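(* Let $dOH$ be the complete extension of $OH$ obtained by complex interpolation of the couple $(R,C)$ at $\theta=\frac12$, i.e. $dOH=\mathcal F(R,C)/(\ker\delta_{1/2}\cap\ker\delta'_{1/2})$. Then $dOH$ is an operator algebra with the multiplication inherited as a quotient of $\mathcal F(R,C)$, where $\mathcal F(R,C)$ carries the pointwise multiplication of functions and $R$, $C$ carry the natural (coordinatewise) multiplication of $\ell_2$.
   Context: $R$ and $C$ are the operator space structures on $\ell_2$ given, for $x_k\in M_n$ and $(e_k)$ the canonical basis, by $\|\sum x_k\otimes e_k\|_{M_n(R)}=\|\sum x_kx_k^*\|^{1/2}$ and $\|\sum x_k\otimes e_k\|_{M_n(C)}=\|\sum x_k^*x_k\|^{1/2}$; they form a compatible couple via the identity of $\ell_2$, and $(R,C)_{1/2}=OH$, Pisier's operator Hilbert space. It is known that $R$ and $C$ are operator algebras with the coordinatewise multiplication. For a compatible couple $(X_0,X_1)$ of operator spaces, $\Sigma=X_0+X_1$ with norm $\inf\{\|x_0\|_{X_0}+\|x_1\|_{X_1}:x=x_0+x_1\}$, $\mathbb S=\{0\le\mathrm{Re}\,z\le1\}$. $\mathcal F(X_0,X_1)$ is the Banach space of functions $f:\mathbb S\to\Sigma$ bounded and continuous on $\mathbb S$, analytic in its interior, with $f(it)\in X_0$, $f(1+it)\in X_1$ and $t\mapsto\|f(it)\|_{X_0}$, $t\mapsto\|f(1+it)\|_{X_1}$ bounded and continuous, with norm $\max\{\sup_t\|f(it)\|_{X_0},\sup_t\|f(1+it)\|_{X_1}\}$ and operator space structure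 $M_n(\mathcal F(X_0,X_1))=\mathcal F(M_n(X_0),M_n(X_1))$. $\delta_\theta(f)=f(\theta)$, $\delta'_\theta(f)=f'(\theta)$. Quotients carry $M_n(X/Y)=M_n(X)/M_n(Y)$. An operator algebra is an operator space $A$ that is also a Banach algebra and such that the inclusion $A\subset B(H)$ giving its operator space structure can be taken to respect the algebraic operations. The paper uses the known characterization: a Banach algebra with an operator space structure is an operator algebra if and only if the maps $m_n:M_n(A)\times M_n(A)\to M_n(A)$, $m_n((x_{ij}),(y_{ij}))=(\sum_k x_{ik}y_{kj})_{ij}$, are uniformly bounded in $n$ (multiplication completely bounded in the Haagerup sense); that is, the representation is understood up to complete isomorphism. *)

theory Defs
  imports "HOL-Analysis.Analysis"
begin

section \<open>Complex vector spaces on a carrier set\<close>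

record 'a cvs =
  vcarrier :: "'a set"
  vzero :: 'a
  vadd :: "'a \<Rightarrow> 'a \<Rightarrow> 'a"
  vscale :: "complex \<Rightarrow> 'a \<Rightarrow> 'a"

definition vsub :: "('a, 'm) cvs_scheme \<Rightarrow> 'a \<Rightarrow> 'a \<Rightarrow> 'a" where
  "vsub V x y = vadd V x (vscale V (-1) y)"

primrec vsum :: "('a, 'm) cvs_scheme \<Rightarrow> (nat \<Rightarrow> 'a) \<Rightarrow> nat \<Rightarrow> 'a" where
  "vsum V f 0 = vzero V"
| "vsum V f (Suc n) = vadd V (vsum V f n) (f n)"

definition cvector_space :: "('a, 'm) cvs_scheme \<Rightarrow> bool" where
  "cvector_space V \<longleftrightarrow>
     vzero V \<in> vcarrier V \<and>
     (\<forall>x\<in>vcarrier V. \<forall>y\<in>vcarrier V. vadd V x y \<in> vcarrier V) \<and>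
     (\<forall>c. \<forall>x\<in>vcarrier V. vscale V c x \<in> vcarrier V) \<and>
     (\<forall>x\<in>vcarrier V. \<forall>y\<in>vcarrier V. \<forall>z\<in>vcarrier V.
        vadd V (vadd V x y) z = vadd V x (vadd V y z)) \<and>
     (\<forall>x\<in>vcarrier V. \<forall>y\<in>vcarrier V. vadd V x y = vadd V y x) \<and>
     (\<forall>x\<in>vcarrier V. vadd V (vzero V) x = x) \<and>
     (\<forall>x\<in>vcarrier V. vadd V x (vscale V (-1) x) = vzero V) \<and>
     (\<forall>c. \<forall>x\<in>vcarrier V. \<forall>y\<in>vcarrier V.
        vscale V c (vadd V x y) = vadd V (vscale V c x) (vscale V c y)) \<and>
     (\<forall>c d. \<forall>x\<in>vcarrier V. vscale V (c + d) x = vadd V (vscale V c x) (vscale V d x)) \<and>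
     (\<forall>c d. \<forall>x\<in>vcarrier V. vscale V (c * d) x = vscale V c (vscale V d x)) \<and>
     (\<forall>x\<in>vcarrier V. vscale V 1 x = x)"

definition clinear_map ::
    "('a, 'm) cvs_scheme \<Rightarrow> ('b, 'k) cvs_scheme \<Rightarrow> ('a \<Rightarrow> 'b) \<Rightarrow> bool" where
  "clinear_map V W T \<longleftrightarrow>
     (\<forall>x\<in>vcarrier V. T x \<in> vcarrier W) \<and>
     (\<forall>x\<in>vcarrier V. \<forall>y\<in>vcarrier V. T (vadd V x y) = vadd W (T x) (T y)) \<and>
     (\<forall>c. \<forall>x\<in>vcarrier V. T (vscale V c x) = vscale W c (T x))"

definition complete_for :: "('a, 'm) cvs_scheme \<Rightarrow> ('a \<Rightarrow> real) \<Rightarrow> bool" where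
  "complete_for V nrm \<longleftrightarrow>
     (\<forall>u :: nat \<Rightarrow> 'a.
        (\<forall>k. u k \<in> vcarrier V) \<and>
        (\<forall>\<epsilon>>0. \<exists>N. \<forall>m\<ge>N. \<forall>k\<ge>N. nrm (vsub V (u m) (u k)) < \<epsilon>)
        \<longrightarrow> (\<exists>l\<in>vcarrier V. (\<lambda>k. nrm (vsub V (u k) l)) \<longlonglongrightarrow> 0))"


section \<open>Operator spaces\<close>

text \<open>A matrix of size \<open>m \<times> n\<close> over \<open>'a\<close> is a function \<open>nat \<Rightarrow> nat \<Rightarrow> 'a\<close> of which only the
  entries with indices \<open>i < m\<close>, \<open>j < n\<close> matter. \<open>mnorm X n\<close> is the norm of \<open>M\<^sub>n(X)\<close>.\<close>

definition cmat_norm :: "nat \<Rightarrow> nat \<Rightarrow> (nat \<Rightarrow> nat \<Rightarrow> complex) \<Rightarrow> real" where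
  "cmat_norm m n a =
     Sup {L2_set (\<lambda>i. cmod (\<Sum>j<n. a i j * v j)) {..<m} | v :: nat \<Rightarrow> complex.
            L2_set (\<lambda>j. cmod (v j)) {..<n} \<le> 1}"

record 'a op_space = "'a cvs" +
  mnorm :: "nat \<Rightarrow> (nat \<Rightarrow> nat \<Rightarrow> 'a) \<Rightarrow> real"

definition vnorm :: "('a, 'm) op_space_scheme \<Rightarrow> 'a \<Rightarrow> real" where
  "vnorm X x = mnorm X 1 (\<lambda>_ _. x)"

definition mats :: "('a, 'm) cvs_scheme \<Rightarrow> nat \<Rightarrow> (nat \<Rightarrow> nat \<Rightarrow> 'a) set" where
  "mats V n = {x. \<forall>i<n. \<forall>j<n. x i j \<in> vcarrier V}"

definition mat_dsum ::
    "('a, 'm) cvs_scheme \<Rightarrow> nat \<Rightarrow> (nat \<Rightarrow> nat \<Rightarrow> 'a) \<Rightarrow> (nat \<Rightarrow> nat \<Rightarrow> 'a) \<Rightarrow> nat \<Rightarrow> nat \<Rightarrow> 'a" where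
  "mat_dsum V m x y =
     (\<lambda>i j. if i < m \<and> j < m then x i j
            else if m \<le> i \<and> m \<le> j then y (i - m) (j - m) else vzero V)"

text \<open>The product \<open>\<alpha> x \<beta>\<close> where \<open>\<alpha>\<close>, \<open>\<beta>\<close> are scalar matrices and \<open>x \<in> M\<^sub>m(V)\<close>.\<close>

definition mat_sandwich ::
    "('a, 'm) cvs_scheme \<Rightarrow> nat \<Rightarrow> (nat \<Rightarrow> nat \<Rightarrow> complex) \<Rightarrow> (nat \<Rightarrow> nat \<Rightarrow> 'a)
       \<Rightarrow> (nat \<Rightarrow> nat \<Rightarrow> complex) \<Rightarrow> nat \<Rightarrow> nat \<Rightarrow> 'a" where
  "mat_sandwich V m \<alpha> x \<beta> =
     (\<lambda>i j. vsum V (\<lambda>k. vsum V (\<lambda>l. vscale V (\<alpha> i k * \<beta> l j) (x k l)) m) m)"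

text \<open>Abstract operator spaces: complete matrix norms satisfying Ruan's two axioms.\<close>

definition operator_space :: "('a, 'm) op_space_scheme \<Rightarrow> bool" where
  "operator_space X \<longleftrightarrow>
     cvector_space X \<and>
     (\<forall>n\<ge>1. \<forall>x\<in>mats X n. 0 \<le> mnorm X n x) \<and>
     (\<forall>n\<ge>1. \<forall>x\<in>mats X n. mnorm X n x = 0 \<longleftrightarrow> (\<forall>i<n. \<forall>j<n. x i j = vzero X)) \<and>
     (\<forall>n\<ge>1. \<forall>c. \<forall>x\<in>mats X n. mnorm X n (\<lambda>i j. vscale X c (x i j)) = cmod c * mnorm X n x) \<and>
     (\<forall>n\<ge>1. \<forall>x\<in>mats X n. \<forall>y\<in>mats X n.
        mnorm X n (\<lambda>i j. vadd X (x i j) (y i j)) \<le> mnorm X n x + mnorm X n y) \<and>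
     (\<forall>m\<ge>1. \<forall>n\<ge>1. \<forall>x\<in>mats X m. \<forall>y\<in>mats X n.
        mnorm X (m + n) (mat_dsum X m x y) = max (mnorm X m x) (mnorm X n y)) \<and>
     (\<forall>m\<ge>1. \<forall>n\<ge>1. \<forall>x\<in>mats X m. \<forall>\<alpha> \<beta>.
        mnorm X n (mat_sandwich X m \<alpha> x \<beta>) \<le> cmat_norm n m \<alpha> * mnorm X m x * cmat_norm m n \<beta>) \<and>
     complete_for X (vnorm X)"

text \<open>Linear maps \<open>\<pi>\<close> that are a complete isomorphism of \<open>X\<close> onto \<open>\<pi>(X) \<subseteq> Y\<close>.\<close>

definition complete_embedding ::
    "('a, 'm) op_space_scheme \<Rightarrow> ('b, 'k) op_space_scheme \<Rightarrow> ('a \<Rightarrow> 'b) \<Rightarrow> bool" where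
  "complete_embedding X Y \<pi> \<longleftrightarrow>
     clinear_map X Y \<pi> \<and>
     (\<exists>c>0. \<exists>K. \<forall>n\<ge>1. \<forall>x\<in>mats X n.
        c * mnorm X n x \<le> mnorm Y n (\<lambda>i j. \<pi> (x i j)) \<and>
        mnorm Y n (\<lambda>i j. \<pi> (x i j)) \<le> K * mnorm X n x)"


section \<open>Hilbert spaces and operator algebras\<close>

record 'h hilbert = "'h cvs" +
  hinner :: "'h \<Rightarrow> 'h \<Rightarrow> complex"

definition hnorm :: "('h, 'm) hilbert_scheme \<Rightarrow> 'h \<Rightarrow> real" where
  "hnorm H v = sqrt (Re (hinner H v v))"

definition hilbert_space :: "('h, 'm) hilbert_scheme \<Rightarrow> bool" where
  "hilbert_space H \<longleftrightarrow>
     cvector_space H \<and>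
     (\<forall>u\<in>vcarrier H. \<forall>v\<in>vcarrier H. \<forall>w\<in>vcarrier H.
        hinner H (vadd H u v) w = hinner H u w + hinner H v w) \<and>
     (\<forall>c. \<forall>u\<in>vcarrier H. \<forall>v\<in>vcarrier H. hinner H (vscale H c u) v = c * hinner H u v) \<and>
     (\<forall>u\<in>vcarrier H. \<forall>v\<in>vcarrier H. hinner H v u = cnj (hinner H u v)) \<and>
     (\<forall>v\<in>vcarrier H. 0 \<le> Re (hinner H v v)) \<and>
     (\<forall>v\<in>vcarrier H. hinner H v v = 0 \<longrightarrow> v = vzero H) \<and>
     complete_for H (hnorm H)"

record 'a op_alg = "'a op_space" +
  vmult :: "'a \<Rightarrow> 'a \<Rightarrow> 'a"

text \<open>\<open>B(H)\<close>, with \<open>M\<^sub>n(B(H)) = B(H\<^sup>n)\<close> isometrically.\<close>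

definition BH :: "('h, 'm) hilbert_scheme \<Rightarrow> ('h \<Rightarrow> 'h) op_alg" where
  "BH H =
     \<lparr> vcarrier = {T \<in> vcarrier H \<rightarrow>\<^sub>E vcarrier H.
                    clinear_map H H T \<and> (\<exists>K. \<forall>v\<in>vcarrier H. hnorm H (T v) \<le> K * hnorm H v)},
       vzero = (\<lambda>v\<in>vcarrier H. vzero H),
       vadd = (\<lambda>S T. \<lambda>v\<in>vcarrier H. vadd H (S v) (T v)),
       vscale = (\<lambda>c T. \<lambda>v\<in>vcarrier H. vscale H c (T v)),
       mnorm = (\<lambda>n T. Sup {L2_set (\<lambda>i. hnorm H (vsum H (\<lambda>j. T i j (v j)) n)) {..<n} | v.
                             (\<forall>j<n. v j \<in> vcarrier H) \<and> L2_set (\<lambda>j. hnorm H (v j)) {..<n} \<le> 1}),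
       vmult = (\<lambda>S T. compose (vcarrier H) S T) \<rparr>"

text \<open>Banach algebras need not be unital.\<close>

definition banach_algebra :: "('a, 'm) op_alg_scheme \<Rightarrow> bool" where
  "banach_algebra A \<longleftrightarrow>
     cvector_space A \<and>
     (\<forall>x\<in>vcarrier A. 0 \<le> vnorm A x) \<and>
     (\<forall>x\<in>vcarrier A. vnorm A x = 0 \<longleftrightarrow> x = vzero A) \<and>
     (\<forall>c. \<forall>x\<in>vcarrier A. vnorm A (vscale A c x) = cmod c * vnorm A x) \<and>
     (\<forall>x\<in>vcarrier A. \<forall>y\<in>vcarrier A. vnorm A (vadd A x y) \<le> vnorm A x + vnorm A y) \<and>
     complete_for A (vnorm A) \<and>
     (\<forall>x\<in>vcarrier A. \<forall>y\<in>vcarrier A. vmult A x y \<in> vcarrier A) \<and>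
     (\<forall>x\<in>vcarrier A. \<forall>y\<in>vcarrier A. \<forall>z\<in>vcarrier A.
        vmult A (vmult A x y) z = vmult A x (vmult A y z)) \<and>
     (\<forall>x\<in>vcarrier A. \<forall>y\<in>vcarrier A. \<forall>z\<in>vcarrier A.
        vmult A (vadd A x y) z = vadd A (vmult A x z) (vmult A y z) \<and>
        vmult A z (vadd A x y) = vadd A (vmult A z x) (vmult A z y)) \<and>
     (\<forall>c. \<forall>x\<in>vcarrier A. \<forall>y\<in>vcarrier A.
        vmult A (vscale A c x) y = vscale A c (vmult A x y) \<and>
        vmult A x (vscale A c y) = vscale A c (vmult A x y)) \<and>
     (\<forall>x\<in>vcarrier A. \<forall>y\<in>vcarrier A. vnorm A (vmult A x y) \<le> vnorm A x * vnorm A y)"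

text \<open>The representation on \<open>H\<close> is understood up to complete isomorphism. HOL has no
  quantification over types inside a formula, so the type \<open>'h\<close> in which the vectors of the Hilbert
  space \<open>H\<close> are found is a parameter. The type \<open>nat \<Rightarrow> complex\<close> contains a copy of every
  separable Hilbert space.\<close>

definition operator_algebra :: "'h itself \<Rightarrow> ('a, 'm) op_alg_scheme \<Rightarrow> bool" where
  "operator_algebra _ A \<longleftrightarrow>
     operator_space A \<and> banach_algebra A \<and>
     (\<exists>(H :: 'h hilbert) \<pi>.
        hilbert_space H \<and> complete_embedding A (BH H) \<pi> \<and>
        (\<forall>x\<in>vcarrier A. \<forall>y\<in>vcarrier A. \<pi> (vmult A x y) = vmult (BH H) (\<pi> x) (\<pi> y)))"


section \<open>Quotients\<close>

definition quot_rel :: "('a, 'm) cvs_scheme \<Rightarrow> 'a set \<Rightarrow> ('a \<times> 'a) set" where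
  "quot_rel X N = {(x, y). x \<in> vcarrier X \<and> y \<in> vcarrier X \<and> vsub X x y \<in> N}"

text \<open>The elements are the cosets, and \<open>M\<^sub>n(X/N)\<close> carries the quotient norm of \<open>M\<^sub>n(X)/M\<^sub>n(N)\<close>.\<close>

definition quot_alg :: "('a, 'm) op_alg_scheme \<Rightarrow> 'a set \<Rightarrow> 'a set op_alg" where
  "quot_alg X N =
     \<lparr> vcarrier = vcarrier X // quot_rel X N,
       vzero = quot_rel X N `` {vzero X},
       vadd = (\<lambda>A B. \<Union>a\<in>A. \<Union>b\<in>B. quot_rel X N `` {vadd X a b}),
       vscale = (\<lambda>c A. \<Union>a\<in>A. quot_rel X N `` {vscale X c a}),
       mnorm = (\<lambda>n A. Inf {mnorm X n x | x. \<forall>i<n. \<forall>j<n. x i j \<in> A i j}),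
       vmult = (\<lambda>A B. \<Union>a\<in>A. \<Union>b\<in>B. quot_rel X N `` {vmult X a b}) \<rparr>"


section \<open>Complex interpolation\<close>

text \<open>A compatible couple consists of two spaces \<open>X\<^sub>0\<close>, \<open>X\<^sub>1\<close> whose carriers lie in the same ambient
  type, with the same ambient operations (here those of \<open>X\<^sub>0\<close> are used throughout).\<close>

definition sum_carrier :: "('a, 'm) cvs_scheme \<Rightarrow> ('a, 'm) cvs_scheme \<Rightarrow> 'a set" where
  "sum_carrier X\<^sub>0 X\<^sub>1 = {vadd X\<^sub>0 x y | x y. x \<in> vcarrier X\<^sub>0 \<and> y \<in> vcarrier X\<^sub>1}"

definition sum_norm :: "('a, 'm) op_space_scheme \<Rightarrow> ('a, 'm) op_space_scheme \<Rightarrow> 'a \<Rightarrow> real" where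
  "sum_norm X\<^sub>0 X\<^sub>1 x =
     Inf {vnorm X\<^sub>0 x\<^sub>0 + vnorm X\<^sub>1 x\<^sub>1 | x\<^sub>0 x\<^sub>1.
            x\<^sub>0 \<in> vcarrier X\<^sub>0 \<and> x\<^sub>1 \<in> vcarrier X\<^sub>1 \<and> x = vadd X\<^sub>0 x\<^sub>0 x\<^sub>1}"

definition strip :: "complex set" where
  "strip = {z. 0 \<le> Re z \<and> Re z \<le> 1}"

text \<open>\<open>f'(z) = d\<close> in the norm of \<open>X\<^sub>0 + X\<^sub>1\<close>, for \<open>z\<close> in the interior of the strip.\<close>

definition has_sum_deriv ::
    "('a, 'm) op_space_scheme \<Rightarrow> ('a, 'm) op_space_scheme \<Rightarrow> (complex \<Rightarrow> 'a) \<Rightarrow> 'a \<Rightarrow> complex \<Rightarrow> bool"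
  where
  "has_sum_deriv X\<^sub>0 X\<^sub>1 f d z \<longleftrightarrow>
     d \<in> sum_carrier X\<^sub>0 X\<^sub>1 \<and>
     ((\<lambda>w. sum_norm X\<^sub>0 X\<^sub>1 (vsub X\<^sub>0 (vscale X\<^sub>0 (inverse (w - z)) (vsub X\<^sub>0 (f w) (f z))) d))
        \<longlongrightarrow> 0) (at z)"

text \<open>Functions on the strip are represented by functions on \<open>complex\<close> with the value
  \<open>undefined\<close> off the strip. \<open>M\<^sub>n(\<F>(X\<^sub>0, X\<^sub>1))\<close> carries the norm of \<open>\<F>(M\<^sub>n(X\<^sub>0), M\<^sub>n(X\<^sub>1))\<close>.\<close>

definition interp_alg ::
    "('a, 'm) op_alg_scheme \<Rightarrow> ('a, 'm) op_alg_scheme \<Rightarrow> (complex \<Rightarrow> 'a) op_alg" where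
  "interp_alg X\<^sub>0 X\<^sub>1 =
     \<lparr> vcarrier = {f \<in> strip \<rightarrow>\<^sub>E sum_carrier X\<^sub>0 X\<^sub>1.
          bounded ((\<lambda>z. sum_norm X\<^sub>0 X\<^sub>1 (f z)) ` strip) \<and>
          (\<forall>z\<in>strip. ((\<lambda>w. sum_norm X\<^sub>0 X\<^sub>1 (vsub X\<^sub>0 (f w) (f z))) \<longlongrightarrow> 0) (at z within strip)) \<and>
          (\<forall>z\<in>interior strip. \<exists>d. has_sum_deriv X\<^sub>0 X\<^sub>1 f d z) \<and>
          (\<forall>t :: real. f (\<i> * t) \<in> vcarrier X\<^sub>0) \<and>
          (\<forall>t :: real. f (1 + \<i> * t) \<in> vcarrier X\<^sub>1) \<and>
          bounded (range (\<lambda>t :: real. vnorm X\<^sub>0 (f (\<i> * t)))) \<and>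
          continuous_on UNIV (\<lambda>t :: real. vnorm X\<^sub>0 (f (\<i> * t))) \<and>
          bounded (range (\<lambda>t :: real. vnorm X\<^sub>1 (f (1 + \<i> * t)))) \<and>
          continuous_on UNIV (\<lambda>t :: real. vnorm X\<^sub>1 (f (1 + \<i> * t)))},
       vzero = (\<lambda>z\<in>strip. vzero X\<^sub>0),
       vadd = (\<lambda>f g. \<lambda>z\<in>strip. vadd X\<^sub>0 (f z) (g z)),
       vscale = (\<lambda>c f. \<lambda>z\<in>strip. vscale X\<^sub>0 c (f z)),
       mnorm = (\<lambda>n f. max (SUP t :: real. mnorm X\<^sub>0 n (\<lambda>i j. f i j (\<i> * t)))
                          (SUP t :: real. mnorm X\<^sub>1 n (\<lambda>i j. f i j (1 + \<i> * t)))),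
       vmult = (\<lambda>f g. \<lambda>z\<in>strip. vmult X\<^sub>0 (f z) (g z)) \<rparr>"

definition eval_at :: "real \<Rightarrow> (complex \<Rightarrow> 'a) \<Rightarrow> 'a" where
  "eval_at \<theta> f = f (complex_of_real \<theta>)"

definition deriv_at ::
    "('a, 'm) op_space_scheme \<Rightarrow> ('a, 'm) op_space_scheme \<Rightarrow> real \<Rightarrow> (complex \<Rightarrow> 'a) \<Rightarrow> 'a" where
  "deriv_at X\<^sub>0 X\<^sub>1 \<theta> f = (THE d. has_sum_deriv X\<^sub>0 X\<^sub>1 f d (complex_of_real \<theta>))"

definition ker_eval :: "('a, 'm) op_alg_scheme \<Rightarrow> ('a, 'm) op_alg_scheme \<Rightarrow> real \<Rightarrow> (complex \<Rightarrow> 'a) set"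
  where
  "ker_eval X\<^sub>0 X\<^sub>1 \<theta> = {f \<in> vcarrier (interp_alg X\<^sub>0 X\<^sub>1). eval_at \<theta> f = vzero X\<^sub>0}"

definition ker_deriv :: "('a, 'm) op_alg_scheme \<Rightarrow> ('a, 'm) op_alg_scheme \<Rightarrow> real \<Rightarrow> (complex \<Rightarrow> 'a) set"
  where
  "ker_deriv X\<^sub>0 X\<^sub>1 \<theta> = {f \<in> vcarrier (interp_alg X\<^sub>0 X\<^sub>1). deriv_at X\<^sub>0 X\<^sub>1 \<theta> f = vzero X\<^sub>0}"

definition deriv_interp ::
    "('a, 'm) op_alg_scheme \<Rightarrow> ('a, 'm) op_alg_scheme \<Rightarrow> real \<Rightarrow> (complex \<Rightarrow> 'a) set op_alg" where
  "deriv_interp X\<^sub>0 X\<^sub>1 \<theta> =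
     quot_alg (interp_alg X\<^sub>0 X\<^sub>1) (ker_eval X\<^sub>0 X\<^sub>1 \<theta> \<inter> ker_deriv X\<^sub>0 X\<^sub>1 \<theta>)"


section \<open>The row and column spaces\<close>

definition ell2 :: "(nat \<Rightarrow> complex) set" where
  "ell2 = {x. summable (\<lambda>k. (cmod (x k))\<^sup>2)}"

text \<open>A matrix \<open>x\<close> over \<open>\<ell>\<^sub>2\<close> stands for \<open>\<Sum>\<^sub>k x\<^sub>k \<otimes> e\<^sub>k\<close> with \<open>x\<^sub>k = (x i j k)\<^sub>i\<^sub>j\<close>; the entries below are
  those of \<open>\<Sum>\<^sub>k x\<^sub>k x\<^sub>k\<^sup>*\<close> and \<open>\<Sum>\<^sub>k x\<^sub>k\<^sup>* x\<^sub>k\<close>.\<close>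

definition row_mnorm :: "nat \<Rightarrow> (nat \<Rightarrow> nat \<Rightarrow> nat \<Rightarrow> complex) \<Rightarrow> real" where
  "row_mnorm n x = sqrt (cmat_norm n n (\<lambda>i j. \<Sum>k. \<Sum>l<n. x i l k * cnj (x j l k)))"

definition col_mnorm :: "nat \<Rightarrow> (nat \<Rightarrow> nat \<Rightarrow> nat \<Rightarrow> complex) \<Rightarrow> real" where
  "col_mnorm n x = sqrt (cmat_norm n n (\<lambda>i j. \<Sum>k. \<Sum>l<n. cnj (x l i k) * x l j k))"

definition row_alg :: "(nat \<Rightarrow> complex) op_alg" where
  "row_alg =
     \<lparr> vcarrier = ell2,
       vzero = (\<lambda>k. 0),
       vadd = (\<lambda>x y k. x k + y k),
       vscale = (\<lambda>c x k. c * x k),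
       mnorm = row_mnorm,
       vmult = (\<lambda>x y k. x k * y k) \<rparr>"

definition col_alg :: "(nat \<Rightarrow> complex) op_alg" where
  "col_alg =
     \<lparr> vcarrier = ell2,
       vzero = (\<lambda>k. 0),
       vadd = (\<lambda>x y k. x k + y k),
       vscale = (\<lambda>c x k. c * x k),
       mnorm = col_mnorm,
       vmult = (\<lambda>x y k. x k * y k) \<rparr>"

definition dOH :: "(complex \<Rightarrow> nat \<Rightarrow> complex) set op_alg" where
  "dOH = deriv_interp row_alg col_alg (1/2)"

end

(*
The couple (R, C) is isometrically (l2, l2) at the first matrix level, so an element of dOH is the
jet (f(1/2), f'(1/2)) of a bounded holomorphic l2-valued function, and all first-level statements
reduce to the three lines theorem and Cauchy's inequality.

The representation follows Cole's theorem on quotients of operator algebras.  The function algebra F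
is represented on the left edge of the strip by diag + row and on the right edge by diag + column.
A vector state of this representation is a quadratic form s on rows over the unitization of F for
which left multiplication by F is completely bounded.  If the jets of a matrix over F truncated to
finitely many coordinates have no lift of norm at most 1, a minimax argument over the compact convex
set of all such forms gives one form s that is large on every lift simultaneously.  The infimum of s
over all lifts still satisfies the parallelogram inequality, hence is a Hilbert form on a finite
dimensional module over the truncated jets, with the same module bound.  Countably many such forms
detect the norm of dOH up to constants, and their Hilbert sum carries the representation.
*)
theory Submission
  imports Defs "HOL-Complex_Analysis.Complex_Analysis"
begin

text \<open>The edge representations see functions, not jets, so none of them factors through the
  quotient; only an infimum over lifts does. Such an infimum keeps the parallelogram inequality when
  it is taken of a single form, whereas a supremum over forms would destroy it; this is why one form
  has to be found before the infimum is taken. The function algebra has no unit, as the constant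
  sequence 1 is not in l2, so the unit rows of the unitization serve as the test vectors on which a
  matrix of jets shows its norm. The diagonal part of diag + row and diag + column is what makes
  these maps multiplicative. The infimum may be degenerate. A small multiple of the Euclidean form
  on truncated jets repairs this, and it obeys a module bound because matrices of jets are bounded
  coordinate by coordinate, with the constant 4 of Cauchy's inequality for derivatives. Since the
  Hilbert space has to consist of sequences, the blocks are indexed by a countable dense set of
  matrices; the approximation is paid for by the gap between the thresholds 2 and 1.\<close>

section \<open>Square-summable sequences\<close>

text \<open>The absolute value gives nonnegativity without summability, since the sum of a divergent
  series is an unspecified real number.\<close>

definition l2 :: "(nat \<Rightarrow> complex) \<Rightarrow> real" where
  "l2 x = sqrt \<bar>\<Sum>k. (cmod (x k))\<^sup>2\<bar>"

lemma l2_nonneg [simp]: "0 \<le> l2 x"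
  by (simp add: l2_def)

lemma ell2_zero [simp]: "(\<lambda>k. 0) \<in> ell2"
  by (simp add: ell2_def)

lemma l2_zero [simp]: "l2 (\<lambda>k. 0) = 0"
  by (simp add: l2_def)

lemma l2_power2: "x \<in> ell2 \<Longrightarrow> (l2 x)\<^sup>2 = (\<Sum>k. (cmod (x k))\<^sup>2)"
  unfolding l2_def ell2_def by (auto intro!: suminf_nonneg abs_of_nonneg)

lemma ell2_partial: "x \<in> ell2 \<Longrightarrow> (\<Sum>k<K. (cmod (x k))\<^sup>2) \<le> (l2 x)\<^sup>2"
  by (simp add: l2_power2) (auto simp: ell2_def intro!: sum_le_suminf)

lemma ell2_I:
  assumes "\<And>K. (\<Sum>k<K. (cmod (x k))\<^sup>2) \<le> c" shows "x \<in> ell2"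
  unfolding ell2_def using assms by (auto intro!: summableI_nonneg_bounded[of _ c])

lemma l2_leI:
  assumes "\<And>K. (\<Sum>k<K. (cmod (x k))\<^sup>2) \<le> c\<^sup>2" "0 \<le> c" shows "l2 x \<le> c"
proof -
  have "x \<in> ell2" using assms(1) by (rule ell2_I)
  then have "(l2 x)\<^sup>2 \<le> c\<^sup>2" unfolding l2_power2[OF \<open>x \<in> ell2\<close>]
    by (auto simp: ell2_def intro!: suminf_le_const assms)
  then show ?thesis using assms(2) by (simp add: power2_le_iff_abs_le)
qed

lemma L2_set_lessThan: "L2_set (\<lambda>k. cmod (x k)) {..<K} \<le> l2 x" if "x \<in> ell2"
  unfolding L2_set_def using ell2_partial[OF that, of K] by (simp add: real_le_lsqrt sum_nonneg)

lemma L2_set_power2: "(L2_set f A)\<^sup>2 = (\<Sum>i\<in>A. (f i)\<^sup>2)"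
  unfolding L2_set_def by (simp add: sum_nonneg)

lemma ell2_add:
  assumes "x \<in> ell2" "y \<in> ell2"
  shows "(\<lambda>k. x k + y k) \<in> ell2" "l2 (\<lambda>k. x k + y k) \<le> l2 x + l2 y"
proof -
  have *: "(\<Sum>k<K. (cmod (x k + y k))\<^sup>2) \<le> (l2 x + l2 y)\<^sup>2" for K
  proof -
    have "L2_set (\<lambda>k. cmod (x k + y k)) {..<K} \<le> L2_set (\<lambda>k. cmod (x k) + cmod (y k)) {..<K}"
      by (intro L2_set_mono norm_triangle_ineq) auto
    also have "\<dots> \<le> L2_set (\<lambda>k. cmod (x k)) {..<K} + L2_set (\<lambda>k. cmod (y k)) {..<K}"
      by (rule L2_set_triangle_ineq)
    also have "\<dots> \<le> l2 x + l2 y"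
      using assms by (intro add_mono L2_set_lessThan)
    finally have "(L2_set (\<lambda>k. cmod (x k + y k)) {..<K})\<^sup>2 \<le> (l2 x + l2 y)\<^sup>2"
      by (rule power_mono) (rule L2_set_nonneg)
    then show ?thesis by (simp add: L2_set_power2)
  qed
  show "(\<lambda>k. x k + y k) \<in> ell2" by (rule ell2_I, rule *)
  show "l2 (\<lambda>k. x k + y k) \<le> l2 x + l2 y" by (rule l2_leI, rule *) simp
qed

lemma ell2_scale:
  assumes "x \<in> ell2"
  shows "(\<lambda>k. c * x k) \<in> ell2" "l2 (\<lambda>k. c * x k) = cmod c * l2 x"
proof -
  have s: "summable (\<lambda>k. (cmod (x k))\<^sup>2)" using assms by (simp add: ell2_def)
  then show "(\<lambda>k. c * x k) \<in> ell2"
    by (simp add: ell2_def norm_mult power_mult_distrib)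
  show "l2 (\<lambda>k. c * x k) = cmod c * l2 x"
    using s by (simp add: l2_def norm_mult power_mult_distrib suminf_mult real_sqrt_mult abs_mult)
qed

lemma ell2_minus [simp]: "x \<in> ell2 \<Longrightarrow> (\<lambda>k. - x k) \<in> ell2"
  using ell2_scale(1)[of x "-1"] by simp

lemma ell2_diff:
  assumes "x \<in> ell2" "y \<in> ell2"
  shows "(\<lambda>k. x k - y k) \<in> ell2" "l2 (\<lambda>k. x k - y k) \<le> l2 x + l2 y"
  using ell2_add[OF assms(1) ell2_minus[OF assms(2)]] by (simp_all add: l2_def)

lemma l2_diff_commute: "l2 (\<lambda>k. x k - y k) = l2 (\<lambda>k. y k - x k)"
  by (simp add: l2_def norm_minus_commute)

lemma ell2_coord: "x \<in> ell2 \<Longrightarrow> cmod (x k) \<le> l2 x"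
proof -
  assume "x \<in> ell2"
  have "(cmod (x k))\<^sup>2 \<le> (\<Sum>j<Suc k. (cmod (x j))\<^sup>2)"
    unfolding sum.lessThan_Suc by (simp add: sum_nonneg)
  also have "\<dots> \<le> (l2 x)\<^sup>2" using \<open>x \<in> ell2\<close> by (rule ell2_partial)
  finally show ?thesis by (simp add: power2_le_iff_abs_le)
qed

text \<open>A coordinate is bounded by the norm, so multiplication by \<open>x\<close> is bounded on
  l2 by the sup norm of \<open>x\<close>, hence by \<open>l2 x\<close>. This makes R and C Banach
  algebras at the first matrix level.\<close>

lemma ell2_mult:
  assumes "x \<in> ell2" "y \<in> ell2"
  shows "(\<lambda>k. x k * y k) \<in> ell2" "l2 (\<lambda>k. x k * y k) \<le> l2 x * l2 y"
proof -
  have *: "(\<Sum>k<K. (cmod (x k * y k))\<^sup>2) \<le> (l2 x * l2 y)\<^sup>2" for K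
  proof -
    have "(\<Sum>k<K. (cmod (x k * y k))\<^sup>2) \<le> (\<Sum>k<K. (l2 x)\<^sup>2 * (cmod (y k))\<^sup>2)"
      by (intro sum_mono) (auto simp: norm_mult power_mult_distrib intro!: mult_right_mono power_mono ell2_coord assms)
    also have "\<dots> = (l2 x)\<^sup>2 * (\<Sum>k<K. (cmod (y k))\<^sup>2)" by (simp add: sum_distrib_left)
    also have "\<dots> \<le> (l2 x)\<^sup>2 * (l2 y)\<^sup>2" by (intro mult_left_mono ell2_partial assms) simp
    finally show ?thesis by (simp add: power_mult_distrib)
  qed
  show "(\<lambda>k. x k * y k) \<in> ell2" by (rule ell2_I, rule *)
  show "l2 (\<lambda>k. x k * y k) \<le> l2 x * l2 y" by (rule l2_leI, rule *) simp
qed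

lemma l2_eq_0: "x \<in> ell2 \<Longrightarrow> l2 x = 0 \<longleftrightarrow> x = (\<lambda>k. 0)"
  using ell2_coord[of x] by (metis l2_zero ext norm_le_zero_iff)

lemma ell2_summable_mult:
  assumes "x \<in> ell2" "y \<in> ell2" shows "summable (\<lambda>k. cnj (x k) * y k)"
proof (rule summable_norm_cancel, rule summable_comparison_test)
  show "summable (\<lambda>k. (cmod (x k))\<^sup>2 + (cmod (y k))\<^sup>2)"
    using assms by (intro summable_add) (auto simp: ell2_def)
  have "cmod (x n) * cmod (y n) \<le> (cmod (x n))\<^sup>2 + (cmod (y n))\<^sup>2" for n
  proof -
    have "0 \<le> cmod (x n) * cmod (y n)" by simp
    then show ?thesis using sum_squares_bound[of "cmod (x n)" "cmod (y n)"] by linarith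
  qed
  then show "\<exists>N. \<forall>n\<ge>N. norm (norm (cnj (x n) * y n)) \<le> (cmod (x n))\<^sup>2 + (cmod (y n))\<^sup>2"
    by (auto simp: norm_mult)
qed

lemma cmod_sum_cs:
  "cmod (\<Sum>i\<in>A. x i * y i) \<le> L2_set (\<lambda>i. cmod (x i)) A * L2_set (\<lambda>i. cmod (y i)) A"
proof -
  have "cmod (\<Sum>i\<in>A. x i * y i) \<le> (\<Sum>i\<in>A. cmod (x i) * cmod (y i))"
    by (rule sum_norm_le) (simp add: norm_mult)
  also have "\<dots> = (\<Sum>i\<in>A. \<bar>cmod (x i)\<bar> * \<bar>cmod (y i)\<bar>)" by simp
  also have "\<dots> \<le> L2_set (\<lambda>i. cmod (x i)) A * L2_set (\<lambda>i. cmod (y i)) A"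
    by (rule L2_set_mult_ineq)
  finally show ?thesis .
qed

lemma cmod_sum_cs2:
  "(cmod (\<Sum>i\<in>A. x i * y i))\<^sup>2 \<le> (\<Sum>i\<in>A. (cmod (x i))\<^sup>2) * (\<Sum>i\<in>A. (cmod (y i))\<^sup>2)"
  using power_mono[OF cmod_sum_cs[of x y A], of 2] by (simp add: power_mult_distrib L2_set_power2)

text \<open>Pairing with its own conjugate computes the square of the norm, so a bound for this
  single functional already bounds the vector. It converts estimates of scalar functionals, the only
  ones complex analysis supplies, into norm estimates with the same constant.\<close>

lemma self_dual_bound:
  fixes w :: "'i \<Rightarrow> complex"
  assumes "cmod (\<Sum>i\<in>A. cnj (w i) * w i) \<le> c * L2_set (\<lambda>i. cmod (w i)) A" "0 \<le> c"
  shows "(\<Sum>i\<in>A. (cmod (w i))\<^sup>2) \<le> c\<^sup>2"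
proof -
  define S where "S = (\<Sum>i\<in>A. (cmod (w i))\<^sup>2)"
  have "(\<Sum>i\<in>A. cnj (w i) * w i) = complex_of_real S"
    by (simp add: S_def complex_norm_square mult.commute del: of_real_power)
  moreover have S0: "0 \<le> S" by (simp add: S_def sum_nonneg)
  ultimately have "S \<le> c * sqrt S" using assms by (simp add: L2_set_def S_def[symmetric] del: of_real_sum)
  then have "sqrt S * sqrt S \<le> c * sqrt S" using S0 by simp
  then have "sqrt S \<le> c" using S0 assms(2) 
    by (metis mult_le_cancel_right not_less order.order_iff_strict real_sqrt_ge_zero)
  then show ?thesis unfolding S_def[symmetric] using S0 by (simp add: sqrt_le_D)
qed

section \<open>Matrix norms\<close>

lemma cmat_set_bound:
  assumes "L2_set (\<lambda>j. cmod (v j)) {..<n} \<le> 1"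
  shows "L2_set (\<lambda>i. cmod (\<Sum>j<n. a i j * v j)) {..<m} \<le> L2_set (\<lambda>i. L2_set (\<lambda>j. cmod (a i j)) {..<n}) {..<m}"
proof (rule L2_set_mono)
  fix i
  have "cmod (\<Sum>j<n. a i j * v j) \<le> L2_set (\<lambda>j. cmod (a i j)) {..<n} * L2_set (\<lambda>j. cmod (v j)) {..<n}"
    by (rule cmod_sum_cs)
  also have "\<dots> \<le> L2_set (\<lambda>j. cmod (a i j)) {..<n} * 1"
    using assms by (intro mult_left_mono) auto
  finally show "cmod (\<Sum>j<n. a i j * v j) \<le> L2_set (\<lambda>j. cmod (a i j)) {..<n}" by simp
qed simp

lemma cmat_bdd:
  "bdd_above {L2_set (\<lambda>i. cmod (\<Sum>j<n. a i j * v j)) {..<m} | v :: nat \<Rightarrow> complex.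
            L2_set (\<lambda>j. cmod (v j)) {..<n} \<le> 1}"
  using cmat_set_bound by (intro bdd_aboveI) blast

lemma cmat_norm_nonneg [simp]: "0 \<le> cmat_norm m n a"
proof -
  have "L2_set (\<lambda>i. cmod (\<Sum>j<n. a i j * 0)) {..<m} \<le> cmat_norm m n a"
    unfolding cmat_norm_def by (rule cSup_upper[OF _ cmat_bdd]) (intro CollectI exI[of _ "\<lambda>_. 0"], simp add: L2_set_def)
  then show ?thesis by (simp add: L2_set_def)
qed

lemma L2_scale: "L2_set (\<lambda>j. cmod (c * v j)) A = cmod c * L2_set (\<lambda>j. cmod (v j)) A"
  by (simp add: norm_mult L2_set_right_distrib)

lemma cmat_norm_bound:
  "L2_set (\<lambda>i. cmod (\<Sum>j<n. a i j * v j)) {..<m} \<le> cmat_norm m n a * L2_set (\<lambda>j. cmod (v j)) {..<n}"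
proof (cases "L2_set (\<lambda>j. cmod (v j)) {..<n} = 0")
  case True
  then have "\<forall>j<n. v j = 0" by (simp add: L2_set_eq_0_iff)
  then have "L2_set (\<lambda>i. cmod (\<Sum>j<n. a i j * v j)) {..<m} = 0" by (simp add: L2_set_eq_0_iff)
  then show ?thesis using True by simp
next
  case False
  define N where "N = L2_set (\<lambda>j. cmod (v j)) {..<n}"
  have N: "N > 0" using False unfolding N_def by (metis L2_set_nonneg less_eq_real_def)
  define w where "w j = complex_of_real (1/N) * v j" for j
  have "L2_set (\<lambda>i. cmod (\<Sum>j<n. a i j * w j)) {..<m} \<le> cmat_norm m n a"
    unfolding cmat_norm_def
  proof (rule cSup_upper[OF _ cmat_bdd], intro CollectI exI[of _ w] conjI refl)
    show "L2_set (\<lambda>j. cmod (w j)) {..<n} \<le> 1"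
      unfolding w_def L2_scale using N by (simp add: N_def[symmetric] norm_divide)
  qed
  moreover have "(\<Sum>j<n. a i j * w j) = complex_of_real (1/N) * (\<Sum>j<n. a i j * v j)" for i
    by (simp add: w_def sum_distrib_left mult_ac)
  ultimately have "L2_set (\<lambda>i. cmod (\<Sum>j<n. a i j * v j)) {..<m} / N \<le> cmat_norm m n a"
    using N by (simp only: L2_scale) (simp add: norm_divide)
  then show ?thesis using N by (simp add: N_def field_simps)
qed

lemma cmat_norm_bound2:
  "(\<Sum>i<m. (cmod (\<Sum>j<n. a i j * v j))\<^sup>2) \<le> (cmat_norm m n a)\<^sup>2 * (\<Sum>j<n. (cmod (v j))\<^sup>2)"
  using power_mono[OF cmat_norm_bound[of a v n m] L2_set_nonneg, of 2]
  by (simp add: L2_set_power2 power_mult_distrib)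

text \<open>A matrix and its transpose have the same operator norm: the image vector is tested
  against itself and the double sum is read in the other order. Row norms use this form.\<close>

lemma cmat_norm_bound2_transpose:
  "(\<Sum>j<n. (cmod (\<Sum>i<m. u i * a i j))\<^sup>2) \<le> (cmat_norm m n a)\<^sup>2 * (\<Sum>i<m. (cmod (u i))\<^sup>2)"
proof -
  define w where "w j = (\<Sum>i<m. u i * a i j)" for j
  have "(\<Sum>j<n. cnj (w j) * w j) = (\<Sum>i<m. u i * (\<Sum>j<n. a i j * cnj (w j)))"
    unfolding w_def sum_distrib_left sum_distrib_right
    by (subst sum.swap) (simp add: mult_ac)
  also have "cmod \<dots> \<le> L2_set (\<lambda>i. cmod (u i)) {..<m} * L2_set (\<lambda>i. cmod (\<Sum>j<n. a i j * cnj (w j))) {..<m}"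
    by (rule cmod_sum_cs)
  also have "\<dots> \<le> L2_set (\<lambda>i. cmod (u i)) {..<m} * (cmat_norm m n a * L2_set (\<lambda>j. cmod (cnj (w j))) {..<n})"
    by (intro mult_left_mono cmat_norm_bound) simp
  finally have "cmod (\<Sum>j<n. cnj (w j) * w j) \<le> (cmat_norm m n a * L2_set (\<lambda>i. cmod (u i)) {..<m}) * L2_set (\<lambda>j. cmod (w j)) {..<n}"
    by (simp add: mult_ac)
  from self_dual_bound[OF this] show ?thesis by (simp add: w_def power_mult_distrib L2_set_power2)
qed

lemma cmat_norm_leI:
  assumes "\<And>v. L2_set (\<lambda>i. cmod (\<Sum>j<n. a i j * v j)) {..<m} \<le> c * L2_set (\<lambda>j. cmod (v j)) {..<n}" "0 \<le> c"
  shows "cmat_norm m n a \<le> c"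
  unfolding cmat_norm_def
proof (rule cSup_least)
  show "{L2_set (\<lambda>i. cmod (\<Sum>j<n. a i j * v j)) {..<m} |v :: nat \<Rightarrow> complex. L2_set (\<lambda>j. cmod (v j)) {..<n} \<le> 1} \<noteq> {}"
    by (auto intro!: exI[of _ "\<lambda>_. 0"] simp: L2_set_def)
  fix x assume "x \<in> {L2_set (\<lambda>i. cmod (\<Sum>j<n. a i j * v j)) {..<m} |v :: nat \<Rightarrow> complex. L2_set (\<lambda>j. cmod (v j)) {..<n} \<le> 1}"
  then obtain v :: "nat \<Rightarrow> complex" where v: "x = L2_set (\<lambda>i. cmod (\<Sum>j<n. a i j * v j)) {..<m}" "L2_set (\<lambda>j. cmod (v j)) {..<n} \<le> 1"
    by blast
  have "x \<le> c * L2_set (\<lambda>j. cmod (v j)) {..<n}" using assms(1) v by simp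
  also have "\<dots> \<le> c * 1" using assms v by (intro mult_left_mono)
  finally show "x \<le> c" by simp
qed

lemma cmat_norm_cnj: "cmat_norm m n (\<lambda>i j. cnj (a i j)) = cmat_norm m n a"
proof -
  have le: "cmat_norm m n (\<lambda>i j. cnj (a i j)) \<le> cmat_norm m n a" for a
  proof (rule cmat_norm_leI)
    fix v :: "nat \<Rightarrow> complex"
    have "(\<Sum>j<n. cnj (a i j) * v j) = cnj (\<Sum>j<n. a i j * cnj (v j))" for i by simp
    then have "L2_set (\<lambda>i. cmod (\<Sum>j<n. cnj (a i j) * v j)) {..<m} = L2_set (\<lambda>i. cmod (\<Sum>j<n. a i j * cnj (v j))) {..<m}"
      by (simp only: complex_mod_cnj)
    also have "\<dots> \<le> cmat_norm m n a * L2_set (\<lambda>j. cmod (cnj (v j))) {..<n}" by (rule cmat_norm_bound)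
    finally show "L2_set (\<lambda>i. cmod (\<Sum>j<n. cnj (a i j) * v j)) {..<m} \<le> cmat_norm m n a * L2_set (\<lambda>j. cmod (v j)) {..<n}" by simp
  qed simp
  from le[of a] le[of "\<lambda>i j. cnj (a i j)"] show ?thesis by simp
qed

section \<open>Row and column bounds\<close>

text \<open>The column operator from \<open>C^n\<close> to l2 with values in \<open>C^n\<close>,
  with blocks \<open>x _ _ k\<close>, has norm at most \<open>c\<close>; quantifying over finite
  \<open>K\<close> avoids any question of convergence. The row condition below uses the transposed
  entries because a row operator and its transpose, a column operator, have the same norm.\<close>

definition col_bdd :: "nat \<Rightarrow> (nat \<Rightarrow> nat \<Rightarrow> nat \<Rightarrow> complex) \<Rightarrow> real \<Rightarrow> bool" where
  "col_bdd n x c \<longleftrightarrow> (\<forall>v K. (\<Sum>k<K. \<Sum>i<n. (cmod (\<Sum>j<n. x i j k * v j))\<^sup>2) \<le> c\<^sup>2 * (\<Sum>j<n. (cmod (v j))\<^sup>2))"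

abbreviation row_bdd :: "nat \<Rightarrow> (nat \<Rightarrow> nat \<Rightarrow> nat \<Rightarrow> complex) \<Rightarrow> real \<Rightarrow> bool" where
  "row_bdd n x c \<equiv> col_bdd n (\<lambda>i j. x j i) c"

lemma col_bdd_mono: "col_bdd n x c \<Longrightarrow> 0 \<le> c \<Longrightarrow> c \<le> d \<Longrightarrow> col_bdd n x d"
  unfolding col_bdd_def by (meson mult_right_mono order_trans power_mono sum_nonneg zero_le_power2)

text \<open>Regrouping the Gram sum exhibits it as an inner product of two vectors indexed by pairs
  of coordinate and row, so that the Cauchy-Schwarz inequality applies.\<close>

lemma gram_form:
  fixes x :: "nat \<Rightarrow> nat \<Rightarrow> nat \<Rightarrow> complex"
  shows "(\<Sum>i<n. cnj (u i) * (\<Sum>j<n. (\<Sum>k<K. \<Sum>l<n. cnj (x l i k) * x l j k) * v j))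
     = (\<Sum>p\<in>{..<K}\<times>{..<n}. cnj (\<Sum>i<n. x (snd p) i (fst p) * u i) * (\<Sum>j<n. x (snd p) j (fst p) * v j))"
proof -
  have "(\<Sum>i<n. cnj (u i) * (\<Sum>j<n. (\<Sum>k<K. \<Sum>l<n. cnj (x l i k) * x l j k) * v j))
     = (\<Sum>i<n. \<Sum>j<n. \<Sum>k<K. \<Sum>l<n. cnj (u i) * cnj (x l i k) * x l j k * v j)"
    by (simp add: sum_distrib_left sum_distrib_right mult_ac)
  also have "\<dots> = (\<Sum>i<n. \<Sum>k<K. \<Sum>j<n. \<Sum>l<n. cnj (u i) * cnj (x l i k) * x l j k * v j)"
    by (intro sum.cong refl sum.swap)
  also have "\<dots> = (\<Sum>k<K. \<Sum>i<n. \<Sum>j<n. \<Sum>l<n. cnj (u i) * cnj (x l i k) * x l j k * v j)"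
    by (rule sum.swap)
  also have "\<dots> = (\<Sum>k<K. \<Sum>i<n. \<Sum>l<n. \<Sum>j<n. cnj (u i) * cnj (x l i k) * x l j k * v j)"
    by (intro sum.cong refl sum.swap)
  also have "\<dots> = (\<Sum>k<K. \<Sum>l<n. \<Sum>i<n. \<Sum>j<n. cnj (u i) * cnj (x l i k) * x l j k * v j)"
    by (intro sum.cong refl sum.swap)
  also have "\<dots> = (\<Sum>k<K. \<Sum>l<n. cnj (\<Sum>i<n. x l i k * u i) * (\<Sum>j<n. x l j k * v j))"
    unfolding cnj_sum sum_product complex_cnj_mult by (simp only: mult_ac)
  finally show ?thesis by (simp add: sum.cartesian_product split_beta)
qed

lemma col_mnorm_nonneg [simp]: "0 \<le> col_mnorm n x"
  by (simp add: col_mnorm_def)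

text \<open>The matrix inside \<open>col_mnorm\<close> is the Gram matrix of the column operator,
  and the norm of a Gram matrix is the square of the operator norm. Both directions are proved for
  the sums cut off at \<open>K\<close> and then passed to the limit.\<close>

lemma col_mnorm_le_iff:
  assumes x: "\<And>i j. i < n \<Longrightarrow> j < n \<Longrightarrow> x i j \<in> ell2" and c: "0 \<le> c"
  shows "col_mnorm n x \<le> c \<longleftrightarrow> col_bdd n x c"
proof -
  define M where "M i j = (\<Sum>k. \<Sum>l<n. cnj (x l i k) * x l j k)" for i j
  define MK where "MK K i j = (\<Sum>k<K. \<Sum>l<n. cnj (x l i k) * x l j k)" for K i j
  have lim: "(\<lambda>K. MK K i j) \<longlonglongrightarrow> M i j" if "i < n" "j < n" for i j
    unfolding M_def MK_def
    by (intro summable_LIMSEQ summable_sum) (auto intro!: ell2_summable_mult x that)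
  have lim2: "(\<lambda>K. \<Sum>i<n. cnj (u i) * (\<Sum>j<n. MK K i j * v j)) \<longlonglongrightarrow> (\<Sum>i<n. cnj (u i) * (\<Sum>j<n. M i j * v j))" for u v
    by (intro tendsto_intros lim) auto
  have gram: "(\<Sum>i<n. cnj (u i) * (\<Sum>j<n. MK K i j * v j))
     = (\<Sum>p\<in>{..<K}\<times>{..<n}. cnj (\<Sum>i<n. x (snd p) i (fst p) * u i) * (\<Sum>j<n. x (snd p) j (fst p) * v j))" for K u v
    unfolding MK_def by (rule gram_form)
  define q where "q K v = (\<Sum>k<K. \<Sum>i<n. (cmod (\<Sum>j<n. x i j k * v j))\<^sup>2)" for K v
  have q: "q K v = (\<Sum>p\<in>{..<K}\<times>{..<n}. (cmod (\<Sum>j<n. x (snd p) j (fst p) * v j))\<^sup>2)" for K v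
    unfolding q_def by (simp add: sum.cartesian_product split_beta)
  have q0: "0 \<le> q K v" for K v by (simp add: q_def sum_nonneg)
  have "cmat_norm n n M \<le> c\<^sup>2 \<longleftrightarrow> (\<forall>v K. q K v \<le> c\<^sup>2 * (\<Sum>j<n. (cmod (v j))\<^sup>2))" (is "?L \<longleftrightarrow> ?R")
  proof
    assume L: ?L
    show ?R
    proof (intro allI)
      fix v K
      have eq: "(\<Sum>i<n. cnj (v i) * (\<Sum>j<n. MK K i j * v j)) = complex_of_real (q K v)" for K
        unfolding gram q by (simp add: complex_norm_square mult.commute del: of_real_power)
      have "(\<lambda>K. q K v) \<longlonglongrightarrow> cmod (\<Sum>i<n. cnj (v i) * (\<Sum>j<n. M i j * v j))"
        using tendsto_norm[OF lim2[of v v]] unfolding eq norm_of_real abs_of_nonneg[OF q0] .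
      \<comment> \<open>Each cut-off form lies below its limit because the forms increase with
        \<open>K\<close>.\<close>
      moreover have "incseq (\<lambda>K. q K v)"
        by (rule incseq_SucI) (simp add: q_def sum_nonneg)
      ultimately have "q K v \<le> cmod (\<Sum>i<n. cnj (v i) * (\<Sum>j<n. M i j * v j))"
        by (intro incseq_le)
      also have "\<dots> \<le> L2_set (\<lambda>i. cmod (cnj (v i))) {..<n} * L2_set (\<lambda>i. cmod (\<Sum>j<n. M i j * v j)) {..<n}"
        by (rule cmod_sum_cs)
      also have "\<dots> \<le> L2_set (\<lambda>i. cmod (cnj (v i))) {..<n} * (c\<^sup>2 * L2_set (\<lambda>i. cmod (v i)) {..<n})"
        using L by (intro mult_left_mono order_trans[OF cmat_norm_bound] mult_right_mono) auto
      also have "\<dots> = c\<^sup>2 * (L2_set (\<lambda>i. cmod (v i)) {..<n})\<^sup>2" by (simp add: power2_eq_square)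
      finally show "q K v \<le> c\<^sup>2 * (\<Sum>j<n. (cmod (v j))\<^sup>2)" by (simp add: L2_set_power2)
    qed
  next
    assume R: ?R
    show ?L
    proof (rule cmat_norm_leI)
      fix v :: "nat \<Rightarrow> complex"
      have b: "sqrt (q K v) \<le> c * L2_set (\<lambda>i. cmod (v i)) {..<n}" for K v
        using R[rule_format, of K v] c by (intro real_le_lsqrt) (auto simp: q_def sum_nonneg power_mult_distrib L2_set_power2)
      \<comment> \<open>Testing the image of \<open>v\<close> under \<open>M\<close> against itself
        reduces the norm of \<open>M\<close> to bounds for its sesquilinear form.\<close>
      define u where "u i = (\<Sum>j<n. M i j * v j)" for i
      have "cmod (\<Sum>i<n. cnj (u i) * (\<Sum>j<n. MK K i j * v j)) \<le> c\<^sup>2 * L2_set (\<lambda>i. cmod (u i)) {..<n} * L2_set (\<lambda>i. cmod (v i)) {..<n}" for K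
      proof -
        have "cmod (\<Sum>i<n. cnj (u i) * (\<Sum>j<n. MK K i j * v j)) \<le> sqrt (q K u) * sqrt (q K v)"
          unfolding gram by (rule order_trans[OF cmod_sum_cs]) (simp only: q L2_set_def complex_mod_cnj order_refl)
        also have "\<dots> \<le> (c * L2_set (\<lambda>i. cmod (u i)) {..<n}) * (c * L2_set (\<lambda>i. cmod (v i)) {..<n})"
          by (intro mult_mono b) (use c in \<open>auto simp: q_def sum_nonneg\<close>)
        finally show ?thesis by (simp add: power2_eq_square mult_ac)
      qed
      then have "cmod (\<Sum>i<n. cnj (u i) * (\<Sum>j<n. M i j * v j)) \<le> c\<^sup>2 * L2_set (\<lambda>i. cmod (u i)) {..<n} * L2_set (\<lambda>i. cmod (v i)) {..<n}"
        by (intro LIMSEQ_le_const2[OF tendsto_norm[OF lim2]]) auto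
      then have "cmod (\<Sum>i<n. cnj (u i) * u i) \<le> (c\<^sup>2 * L2_set (\<lambda>i. cmod (v i)) {..<n}) * L2_set (\<lambda>i. cmod (u i)) {..<n}"
        by (simp add: u_def mult_ac)
      from self_dual_bound[OF this] have "(\<Sum>i<n. (cmod (u i))\<^sup>2) \<le> (c\<^sup>2 * L2_set (\<lambda>i. cmod (v i)) {..<n})\<^sup>2"
        by simp
      then show "L2_set (\<lambda>i. cmod (\<Sum>j<n. M i j * v j)) {..<n} \<le> c\<^sup>2 * L2_set (\<lambda>j. cmod (v j)) {..<n}"
        unfolding L2_set_def[of "\<lambda>i. cmod (\<Sum>j<n. M i j * v j)"] u_def by (intro real_le_lsqrt) (auto simp: sum_nonneg)
    qed simp
  qed
  moreover have "col_mnorm n x \<le> c \<longleftrightarrow> cmat_norm n n M \<le> c\<^sup>2"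
    unfolding col_mnorm_def M_def[abs_def, symmetric] using c
    by (metis cmat_norm_nonneg real_le_lsqrt sqrt_le_D)
  ultimately show ?thesis unfolding col_bdd_def q_def by simp
qed

text \<open>The matrix for rows is the entrywise conjugate of the one for the columns of the
  transpose, and conjugation leaves the operator norm unchanged. Square-summability moves the
  conjugation through the series.\<close>

lemma row_mnorm_eq:
  assumes x: "\<And>i j. i < n \<Longrightarrow> j < n \<Longrightarrow> x i j \<in> ell2"
  shows "row_mnorm n x = col_mnorm n (\<lambda>i j. x j i)"
proof -
  have "cmat_norm n n (\<lambda>i j. \<Sum>k. \<Sum>l<n. x i l k * cnj (x j l k))
      = cmat_norm n n (\<lambda>i j. cnj (\<Sum>k. \<Sum>l<n. x i l k * cnj (x j l k)))"
    by (simp add: cmat_norm_cnj)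
  also have "\<dots> = cmat_norm n n (\<lambda>i j. (\<Sum>k. \<Sum>l<n. cnj (x i l k) * x j l k))"
  proof -
    have eq: "cnj (\<Sum>k. \<Sum>l<n. x i l k * cnj (x j l k)) = (\<Sum>k. \<Sum>l<n. cnj (x i l k) * x j l k)" if "i < n" "j < n" for i j
    proof -
      have "summable (\<lambda>k. \<Sum>l<n. cnj (x j l k) * x i l k)"
        by (intro summable_sum ell2_summable_mult x that) auto
      then have "summable (\<lambda>k. \<Sum>l<n. x i l k * cnj (x j l k))" by (simp add: mult.commute)
      from bounded_linear.suminf[OF bounded_linear_cnj this] show ?thesis by simp
    qed
    show ?thesis unfolding cmat_norm_def by (simp add: eq cong: L2_set_cong_simp)
  qed
  finally show ?thesis by (simp add: row_mnorm_def col_mnorm_def)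
qed

section \<open>Functions on the strip\<close>

lemma strip_eq: "strip = {z. 0 \<le> Re z} \<inter> {z. Re z \<le> 1}"
  by (auto simp: strip_def)

lemma interior_strip: "interior strip = {z. 0 < Re z \<and> Re z < 1}"
  using interior_halfspace_ge[of "1::complex" 0] interior_halfspace_le[of "1::complex" 1]
  unfolding strip_eq interior_Int by (auto simp: inner_complex_def)

lemma half_in_interior [simp]: "1/2 \<in> interior strip"
  by (simp add: interior_strip)

lemma half_in_strip [simp]: "1/2 \<in> strip"
  by (simp add: strip_def)

lemma edges_in_strip [simp]: "\<i> * complex_of_real t \<in> strip" "1 + \<i> * complex_of_real t \<in> strip"
  by (simp_all add: strip_def)

lemma interior_strip_subset: "z \<in> interior strip \<Longrightarrow> z \<in> strip"
  using interior_subset by blast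

text \<open>The damping factor \<open>exp (\<epsilon> (z\<^sup>2 - 1))\<close> reduces the three lines theorem to the maximum
  principle on rectangles.\<close>

lemma three_lines:
  assumes cont: "continuous_on strip g" and hol: "g holomorphic_on interior strip"
    and B: "\<And>z. z \<in> strip \<Longrightarrow> cmod (g z) \<le> B"
    and c0: "\<And>t :: real. cmod (g (\<i> * t)) \<le> c" and c1: "\<And>t :: real. cmod (g (1 + \<i> * t)) \<le> c"
    and z: "z \<in> strip"
  shows "cmod (g z) \<le> c"
proof -
  have c: "0 \<le> c" using c0[of 0] norm_ge_zero order_trans by blast
  have B0: "0 \<le> B" using B[of "1/2"] norm_ge_zero order_trans half_in_strip by blast
  have damp: "cmod (g z) * exp (e * ((Re z)\<^sup>2 - (Im z)\<^sup>2 - 1)) \<le> c" if e: "0 < e" for e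
  proof -
    define h where "h w = g w * exp (of_real e * (w\<^sup>2 - 1))" for w
    have normh: "cmod (h w) = cmod (g w) * exp (e * ((Re w)\<^sup>2 - (Im w)\<^sup>2 - 1))" for w
      by (simp add: h_def norm_mult power2_eq_square)
    have "((\<lambda>T. B * exp (- e * T)) \<longlongrightarrow> B * 0) at_top"
      by (intro tendsto_intros filterlim_compose[OF exp_at_bot] filterlim_tendsto_neg_mult_at_bot[OF tendsto_const])
         (use e in \<open>auto intro: filterlim_ident\<close>)
    \<comment> \<open>for \<open>c = 0\<close> one needs the slack \<open>\<eta>\<close>\<close>
    have lim: "cmod (h z) \<le> c + \<eta>" if \<eta>: "0 < \<eta>" for \<eta>
    proof -
      have "eventually (\<lambda>T. B * exp (- e * T) < \<eta>) at_top"
        using \<open>((\<lambda>T. B * exp (- e * T)) \<longlongrightarrow> B * 0) at_top\<close> \<eta> by (intro order_tendstoD(2)) auto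
      then obtain T0 where T0: "\<And>T. T \<ge> T0 \<Longrightarrow> B * exp (- e * T) < \<eta>"
        unfolding eventually_at_top_linorder by blast
      \<comment> \<open>\<open>T \<ge> 1\<close> yields \<open>T \<le> T^2\<close>: on the
        horizontal sides the exponent is then at most \<open>- e * T\<close>, the \<open>- 1\<close>
        in it absorbing the square of the real part.\<close>
      define T where "T = Max {T0, 1, \<bar>Im z\<bar>}"
      have T: "T \<ge> T0" "T \<ge> 1" "T \<ge> \<bar>Im z\<bar>" unfolding T_def by auto
      define S where "S = cbox (Complex 0 (-T)) (Complex 1 T)"
      have memS: "w \<in> S \<longleftrightarrow> 0 \<le> Re w \<and> Re w \<le> 1 \<and> -T \<le> Im w \<and> Im w \<le> T" for w
        by (auto simp: S_def in_cbox_complex_iff)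
      have intS: "interior S = box (Complex 0 (-T)) (Complex 1 T)" by (simp add: S_def)
      have Ssub: "S \<subseteq> strip" by (auto simp: memS strip_def)
      have "cmod (h z) \<le> c + \<eta>"
      proof (rule maximum_modulus_frontier[of h S])
        show "h holomorphic_on interior S"
          unfolding h_def using holomorphic_on_subset[OF hol interior_mono[OF Ssub]]
          by (intro holomorphic_intros)
        have "closure S = S" by (simp add: S_def)
        then show "continuous_on (closure S) h"
          unfolding h_def using continuous_on_subset[OF cont Ssub] by (auto intro!: continuous_intros)
        show "bounded S" by (simp add: S_def)
        show "z \<in> S" using z T by (auto simp: memS strip_def)
        fix w assume "w \<in> frontier S"
        then have w: "w \<in> S" "w \<notin> interior S"
          by (auto simp: frontier_def \<open>closure S = S\<close>)
        then have "\<not> (0 < Re w \<and> Re w < 1 \<and> -T < Im w \<and> Im w < T)"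
          by (auto simp: intS in_box_complex_iff)
        then consider "Re w = 0" | "Re w = 1" | "\<bar>Im w\<bar> = T" using w(1) T(2) unfolding memS by linarith
        then show "cmod (h w) \<le> c + \<eta>"
        proof cases
          case 1
          then have "w = \<i> * Im w" by (simp add: complex_eq_iff)
          then have "cmod (g w) \<le> c" using c0[of "Im w"] by metis
          moreover have "(Re w)\<^sup>2 - (Im w)\<^sup>2 - 1 \<le> 0"
            using zero_le_power2[of "Im w"] unfolding 1 power_zero_numeral by linarith
          then have "exp (e * ((Re w)\<^sup>2 - (Im w)\<^sup>2 - 1)) \<le> 1" using e by (simp add: mult_nonneg_nonpos)
          ultimately have "cmod (h w) \<le> c * 1" unfolding normh using c by (intro mult_mono) auto
          then show ?thesis using \<eta> by simp
        next
          case 2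
          then have "w = 1 + \<i> * Im w" by (simp add: complex_eq_iff)
          then have "cmod (g w) \<le> c" using c1[of "Im w"] by metis
          moreover have "(Re w)\<^sup>2 - (Im w)\<^sup>2 - 1 \<le> 0"
            using zero_le_power2[of "Im w"] unfolding 2 power_one by linarith
          then have "exp (e * ((Re w)\<^sup>2 - (Im w)\<^sup>2 - 1)) \<le> 1" using e by (simp add: mult_nonneg_nonpos)
          ultimately have "cmod (h w) \<le> c * 1" unfolding normh using c by (intro mult_mono) auto
          then show ?thesis using \<eta> by simp
        next
          case 3
          have "(Re w)\<^sup>2 \<le> 1" using w(1) by (simp add: memS power_le_one)
          moreover have "(Im w)\<^sup>2 \<ge> T" using 3 T(2) power2_abs[of "Im w"] self_le_power[OF T(2), of 2] by simp
          ultimately have "(Re w)\<^sup>2 - (Im w)\<^sup>2 - 1 \<le> - T" by linarith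
          then have "e * ((Re w)\<^sup>2 - (Im w)\<^sup>2 - 1) \<le> e * (- T)" using e by (intro mult_left_mono) auto
          then have "exp (e * ((Re w)\<^sup>2 - (Im w)\<^sup>2 - 1)) \<le> exp (- e * T)" by simp
          moreover have "cmod (g w) \<le> B" using B w(1) Ssub by blast
          ultimately have "cmod (h w) \<le> B * exp (- e * T)" unfolding normh using B0 by (intro mult_mono) auto
          then show ?thesis using T0[OF T(1)] c by linarith
        qed
      qed
      then show ?thesis .
    qed
    then have "cmod (h z) \<le> c" by (rule field_le_epsilon)
    then show ?thesis by (simp add: normh)
  qed
  have "((\<lambda>e. cmod (g z) * exp (e * ((Re z)\<^sup>2 - (Im z)\<^sup>2 - 1))) \<longlongrightarrow> cmod (g z) * exp (0 * ((Re z)\<^sup>2 - (Im z)\<^sup>2 - 1))) (at_right 0)"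
    by (intro tendsto_intros)
  then have "cmod (g z) * exp (0 * ((Re z)\<^sup>2 - (Im z)\<^sup>2 - 1)) \<le> c"
    by (rule tendsto_upperbound) (auto simp: eventually_at_right_less intro!: eventually_mono[OF eventually_at_right_less] damp)
  then show ?thesis by simp
qed

text \<open>Cauchy's inequality on the disc of radius 1/4 about 1/2, which lies inside the strip.
  The 4 reappears in every bound for the derivative part of a jet.\<close>

lemma deriv_half_bound:
  assumes cont: "continuous_on strip g" and hol: "g holomorphic_on interior strip"
    and c: "\<And>z. z \<in> strip \<Longrightarrow> cmod (g z) \<le> c"
  shows "cmod (deriv g (1/2)) \<le> 4 * c"
proof -
  have re: "\<bar>Re z - 1/2\<bar> \<le> cmod (1/2 - z)" for z
    using abs_Re_le_cmod[of "1/2 - z"] by simp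
  have sub: "cball (1/2) (1/4) \<subseteq> interior strip"
  proof
    fix z :: complex assume "z \<in> cball (1/2) (1/4)"
    then have "\<bar>Re z - 1/2\<bar> \<le> 1/4" using re[of z] by (simp add: dist_norm)
    then show "z \<in> interior strip" by (auto simp: interior_strip abs_if split: if_splits)
  qed
  have "norm ((deriv ^^ 1) g (1/2)) \<le> fact 1 * c / (1/4)^1"
  proof (rule Cauchy_inequality)
    show "g holomorphic_on ball (1/2) (1/4)" 
      by (rule holomorphic_on_subset[OF hol]) (use sub ball_subset_cball in blast)
    show "continuous_on (cball (1/2) (1/4)) g"
      by (rule continuous_on_subset[OF cont]) (use sub interior_subset in blast)
    fix z :: complex assume "norm (1/2 - z) = 1/4"
    then have "z \<in> cball (1/2) (1/4)" by (simp add: dist_norm)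
    then show "norm (g z) \<le> c" using c sub interior_subset by blast
  qed simp
  then show ?thesis by simp
qed

text \<open>Taylor's formula with Cauchy's bound for the second derivative; discs of radius
  \<open>r\<close> about points of \<open>cball z r\<close> stay inside
  \<open>cball z (2 * r)\<close>. The remainder depends on \<open>g\<close> only through
  \<open>M\<close>, so it is uniform over linear functionals of a vector-valued function.\<close>

lemma difference_quotient_bound:
  assumes hol: "g holomorphic_on S" and S: "open S" and r: "0 < r" and sub: "cball z (2 * r) \<subseteq> S"
    and M: "\<And>w. w \<in> S \<Longrightarrow> cmod (g w) \<le> M" and w: "cmod (w - z) \<le> r" "w \<noteq> z"
  shows "cmod (inverse (w - z) * (g w - g z) - deriv g z) \<le> 2 * M / r\<^sup>2 * cmod (w - z)"
proof -
  define f where "f i = (deriv ^^ i) g" for i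
  have holi: "f i holomorphic_on S" for i
    unfolding f_def by (rule holomorphic_higher_deriv[OF hol S])
  have in_S: "x \<in> S" if "x \<in> cball z r" for x
    using that sub r by (auto simp: subset_iff)
  have "cmod (f 0 w - (\<Sum>i\<le>1. f i z * (w - z) ^ i / (fact i))) \<le> (2 * M / r\<^sup>2) * cmod (w - z)^(Suc 1) / fact 1"
  proof (rule complex_Taylor[of "cball z r"])
    show "(f i has_field_derivative f (Suc i) x) (at x within cball z r)" if "x \<in> cball z r" for i x
      using holomorphic_derivI[OF holi[of i] S in_S[OF that]] unfolding f_def by (simp add: has_field_derivative_at_within)
    show "cmod (f (Suc 1) x) \<le> 2 * M / r\<^sup>2" if "x \<in> cball z r" for x
    proof -
      have xs: "cball x r \<subseteq> S"
      proof
        fix y assume "y \<in> cball x r"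
        then have "dist z y \<le> 2 * r" using that dist_triangle[of z y x] by simp
        then show "y \<in> S" using sub by auto
      qed
      have "norm ((deriv ^^ 2) g x) \<le> fact 2 * M / r^2"
      proof (rule Cauchy_inequality)
        show "g holomorphic_on ball x r" using hol xs by (meson ball_subset_cball holomorphic_on_subset)
        show "continuous_on (cball x r) g" using hol xs holomorphic_on_imp_continuous_on holomorphic_on_subset by blast
        fix y assume "norm (x - y) = r"
        then have "y \<in> S" using xs by (auto simp: dist_norm)
        then show "norm (g y) \<le> M" by (rule M)
      qed (rule r)
      then show ?thesis by (simp add: f_def numeral_2_eq_2)
    qed
    show "w \<in> cball z r" using w by (simp add: dist_norm norm_minus_commute)
  qed (use r in auto)
  then have *: "cmod (g w - (g z + deriv g z * (w - z))) \<le> (2 * M / r\<^sup>2) * (cmod (w - z))\<^sup>2"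
    by (simp add: f_def numeral_2_eq_2)
  have "inverse (w - z) * (g w - g z) - deriv g z = inverse (w - z) * (g w - (g z + deriv g z * (w - z)))"
    using w(2) by (simp add: field_simps)
  then have "cmod (inverse (w - z) * (g w - g z) - deriv g z) = cmod (g w - (g z + deriv g z * (w - z))) / cmod (w - z)"
    by (simp add: norm_mult norm_inverse divide_inverse mult.commute)
  also have "\<dots> \<le> (2 * M / r\<^sup>2) * (cmod (w - z))\<^sup>2 / cmod (w - z)"
    using * by (intro divide_right_mono) auto
  also have "\<dots> = 2 * M / r\<^sup>2 * cmod (w - z)" using w(2) by (simp add: power2_eq_square)
  finally show ?thesis .
qed

section \<open>Bounded continuous holomorphic functions with values in l2\<close>

text \<open>The carrier of the function algebra up to values off the strip: since R and C agree with
  l2 as normed spaces, the edge conditions follow from boundedness and continuity, and holomorphy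
  may be asked coordinatewise.\<close>

definition strip_fun :: "(complex \<Rightarrow> nat \<Rightarrow> complex) set" where
  "strip_fun = {f. (\<exists>B. \<forall>z\<in>strip. f z \<in> ell2 \<and> l2 (f z) \<le> B) \<and>
     (\<forall>z\<in>strip. ((\<lambda>w. l2 (\<lambda>k. f w k - f z k)) \<longlongrightarrow> 0) (at z within strip)) \<and>
     (\<forall>k. (\<lambda>z. f z k) holomorphic_on interior strip)}"

lemma strip_fun_ell2: "f \<in> strip_fun \<Longrightarrow> z \<in> strip \<Longrightarrow> f z \<in> ell2"
  by (auto simp: strip_fun_def)

lemma strip_fun_bdd:
  assumes "f \<in> strip_fun" obtains B where "0 \<le> B" "\<And>z. z \<in> strip \<Longrightarrow> l2 (f z) \<le> B"
proof -
  obtain B where B: "\<forall>z\<in>strip. f z \<in> ell2 \<and> l2 (f z) \<le> B" using assms by (auto simp: strip_fun_def)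
  moreover have "0 \<le> B" using B[rule_format, of "1/2"] order_trans[OF l2_nonneg[of "f (1/2)"]] by simp
  ultimately show ?thesis using that by blast
qed

lemma strip_fun_tendsto:
  "f \<in> strip_fun \<Longrightarrow> z \<in> strip \<Longrightarrow> ((\<lambda>w. l2 (\<lambda>k. f w k - f z k)) \<longlongrightarrow> 0) (at z within strip)"
  by (auto simp: strip_fun_def)

lemma strip_fun_holomorphic: "f \<in> strip_fun \<Longrightarrow> (\<lambda>z. f z k) holomorphic_on interior strip"
  by (auto simp: strip_fun_def)

lemma tendsto_0_le:
  fixes u v :: "'a \<Rightarrow> real"
  assumes "(u \<longlongrightarrow> 0) F" "\<And>x. 0 \<le> v x" "eventually (\<lambda>x. v x \<le> u x) F"
  shows "(v \<longlongrightarrow> 0) F"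
  by (rule tendsto_sandwich[OF _ assms(3) tendsto_const assms(1)]) (use assms(2) in auto)

lemma eventually_within: "eventually (\<lambda>w. w \<in> S) (at z within S)"
  by (simp add: eventually_at_filter)

lemma strip_fun_continuous: "f \<in> strip_fun \<Longrightarrow> continuous_on strip (\<lambda>z. f z k)"
  unfolding continuous_on_def
proof
  fix z assume f: "f \<in> strip_fun" and z: "z \<in> strip"
  have "((\<lambda>w. cmod (f w k - f z k)) \<longlongrightarrow> 0) (at z within strip)"
    using strip_fun_tendsto[OF f z]
  proof (rule tendsto_0_le)
    show "\<forall>\<^sub>F w in at z within strip. cmod (f w k - f z k) \<le> l2 (\<lambda>k. f w k - f z k)"
      using eventually_within
    proof eventually_elim
      case (elim w)
      show ?case using ell2_coord[OF ell2_diff(1)[OF strip_fun_ell2[OF f elim] strip_fun_ell2[OF f z]], of k] .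
    qed
  qed simp
  then show "((\<lambda>z. f z k) \<longlongrightarrow> f z k) (at z within strip)"
    by (rule LIM_zero_cancel[OF tendsto_norm_zero_cancel])
qed

lemma strip_funI:
  assumes "\<And>z. z \<in> strip \<Longrightarrow> f z \<in> ell2" "\<And>z. z \<in> strip \<Longrightarrow> l2 (f z) \<le> B"
    "\<And>z. z \<in> strip \<Longrightarrow> ((\<lambda>w. l2 (\<lambda>k. f w k - f z k)) \<longlongrightarrow> 0) (at z within strip)"
    "\<And>k. (\<lambda>z. f z k) holomorphic_on interior strip"
  shows "f \<in> strip_fun"
  unfolding strip_fun_def using assms by blast

lemma strip_fun_cong:
  assumes "f \<in> strip_fun" "\<And>z. z \<in> strip \<Longrightarrow> g z = f z" shows "g \<in> strip_fun"
proof -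
  obtain B where B: "\<And>z. z \<in> strip \<Longrightarrow> l2 (f z) \<le> B" using strip_fun_bdd[OF assms(1)] by blast
  show ?thesis
  proof (rule strip_funI[of _ B])
    fix z assume z: "z \<in> strip"
    show "g z \<in> ell2" using assms strip_fun_ell2 z by simp
    show "l2 (g z) \<le> B" using assms B z by simp
    show "((\<lambda>w. l2 (\<lambda>k. g w k - g z k)) \<longlongrightarrow> 0) (at z within strip)"
      using strip_fun_tendsto[OF assms(1) z]
      by (rule Lim_transform_eventually) (rule eventually_mono[OF eventually_within], use assms(2) z in auto)
  next
    fix k
    show "(\<lambda>z. g z k) holomorphic_on interior strip"
      using strip_fun_holomorphic[OF assms(1), of k] interior_subset[of strip] assms(2)
      by (subst holomorphic_cong[OF refl, of _ _ "\<lambda>z. f z k"]) auto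
  qed
qed

lemma strip_fun_add:
  assumes f: "f \<in> strip_fun" and g: "g \<in> strip_fun" shows "(\<lambda>z k. f z k + g z k) \<in> strip_fun"
proof -
  obtain B where B: "\<And>z. z \<in> strip \<Longrightarrow> l2 (f z) \<le> B" using strip_fun_bdd[OF f] by blast
  obtain C where C: "\<And>z. z \<in> strip \<Longrightarrow> l2 (g z) \<le> C" using strip_fun_bdd[OF g] by blast
  note e = strip_fun_ell2[OF f] strip_fun_ell2[OF g]
  show ?thesis
  proof (rule strip_funI[of _ "B + C"])
    fix z assume z: "z \<in> strip"
    show "(\<lambda>k. f z k + g z k) \<in> ell2" by (intro ell2_add e z)
    show "l2 (\<lambda>k. f z k + g z k) \<le> B + C" using ell2_add(2)[OF e(1)[OF z] e(2)[OF z]] B[OF z] C[OF z] by linarith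
    have "((\<lambda>w. l2 (\<lambda>k. f w k - f z k) + l2 (\<lambda>k. g w k - g z k)) \<longlongrightarrow> 0 + 0) (at z within strip)"
      by (intro tendsto_add strip_fun_tendsto f g z)
    then have lim: "((\<lambda>w. l2 (\<lambda>k. f w k - f z k) + l2 (\<lambda>k. g w k - g z k)) \<longlongrightarrow> 0) (at z within strip)" by simp
    show "((\<lambda>w. l2 (\<lambda>k. f w k + g w k - (f z k + g z k))) \<longlongrightarrow> 0) (at z within strip)"
    proof (rule tendsto_0_le[OF lim])
      show "\<forall>\<^sub>F w in at z within strip. l2 (\<lambda>k. f w k + g w k - (f z k + g z k)) \<le> l2 (\<lambda>k. f w k - f z k) + l2 (\<lambda>k. g w k - g z k)"
        using eventually_within
      proof eventually_elim
        case (elim w)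
        have "(\<lambda>k. f w k + g w k - (f z k + g z k)) = (\<lambda>k. (f w k - f z k) + (g w k - g z k))" by auto
        then show ?case using ell2_add(2)[OF ell2_diff(1)[OF e(1)[OF elim] e(1)[OF z]] ell2_diff(1)[OF e(2)[OF elim] e(2)[OF z]]] by simp
      qed
    qed simp
  qed (intro holomorphic_intros strip_fun_holomorphic f g)
qed

lemma strip_fun_mult:
  assumes f: "f \<in> strip_fun" and g: "g \<in> strip_fun" shows "(\<lambda>z k. f z k * g z k) \<in> strip_fun"
proof -
  obtain B where B: "0 \<le> B" "\<And>z. z \<in> strip \<Longrightarrow> l2 (f z) \<le> B" using strip_fun_bdd[OF f] by blast
  obtain C where C: "0 \<le> C" "\<And>z. z \<in> strip \<Longrightarrow> l2 (g z) \<le> C" using strip_fun_bdd[OF g] by blast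
  note e = strip_fun_ell2[OF f] strip_fun_ell2[OF g]
  show ?thesis
  proof (rule strip_funI[of _ "B * C"])
    fix z assume z: "z \<in> strip"
    show "(\<lambda>k. f z k * g z k) \<in> ell2" by (intro ell2_mult e z)
    show "l2 (\<lambda>k. f z k * g z k) \<le> B * C"
      by (rule order_trans[OF ell2_mult(2)[OF e(1)[OF z] e(2)[OF z]]]) (intro mult_mono B C z; simp)
    have "((\<lambda>w. l2 (\<lambda>k. f w k - f z k) * C + B * l2 (\<lambda>k. g w k - g z k)) \<longlongrightarrow> 0 * C + B * 0) (at z within strip)"
      by (intro tendsto_add tendsto_mult tendsto_const strip_fun_tendsto f g z)
    then have lim: "((\<lambda>w. l2 (\<lambda>k. f w k - f z k) * C + B * l2 (\<lambda>k. g w k - g z k)) \<longlongrightarrow> 0) (at z within strip)" by simp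
    show "((\<lambda>w. l2 (\<lambda>k. f w k * g w k - f z k * g z k)) \<longlongrightarrow> 0) (at z within strip)"
    proof (rule tendsto_0_le[OF lim])
      show "\<forall>\<^sub>F w in at z within strip. l2 (\<lambda>k. f w k * g w k - f z k * g z k) \<le> l2 (\<lambda>k. f w k - f z k) * C + B * l2 (\<lambda>k. g w k - g z k)"
        using eventually_within
      proof eventually_elim
        case (elim w)
        note d = ell2_diff(1)[OF e(1)[OF elim] e(1)[OF z]] ell2_diff(1)[OF e(2)[OF elim] e(2)[OF z]]
        have "(\<lambda>k. f w k * g w k - f z k * g z k) = (\<lambda>k. (f w k - f z k) * g w k + f z k * (g w k - g z k))"
          by (auto simp: algebra_simps)
        then have "l2 (\<lambda>k. f w k * g w k - f z k * g z k) \<le> l2 (\<lambda>k. f w k - f z k) * l2 (g w) + l2 (f z) * l2 (\<lambda>k. g w k - g z k)"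
          using ell2_add(2)[OF ell2_mult(1)[OF d(1) e(2)[OF elim]] ell2_mult(1)[OF e(1)[OF z] d(2)]]
            ell2_mult(2)[OF d(1) e(2)[OF elim]] ell2_mult(2)[OF e(1)[OF z] d(2)] by simp
        also have "\<dots> \<le> l2 (\<lambda>k. f w k - f z k) * C + B * l2 (\<lambda>k. g w k - g z k)"
          by (intro add_mono mult_left_mono mult_right_mono B C elim z) auto
        finally show ?case .
      qed
    qed simp
  qed (intro holomorphic_intros strip_fun_holomorphic f g)
qed

lemma strip_fun_scale:
  assumes f: "f \<in> strip_fun" shows "(\<lambda>z k. c * f z k) \<in> strip_fun"
proof -
  obtain B where B: "0 \<le> B" "\<And>z. z \<in> strip \<Longrightarrow> l2 (f z) \<le> B" using strip_fun_bdd[OF f] by blast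
  note e = strip_fun_ell2[OF f]
  show ?thesis
  proof (rule strip_funI[of _ "cmod c * B"])
    fix z assume z: "z \<in> strip"
    show "(\<lambda>k. c * f z k) \<in> ell2" by (intro ell2_scale e z)
    show "l2 (\<lambda>k. c * f z k) \<le> cmod c * B"
      unfolding ell2_scale(2)[OF e[OF z]] by (intro mult_left_mono B z) simp
    have "((\<lambda>w. cmod c * l2 (\<lambda>k. f w k - f z k)) \<longlongrightarrow> cmod c * 0) (at z within strip)"
      by (intro tendsto_mult tendsto_const strip_fun_tendsto f z)
    then have lim: "((\<lambda>w. cmod c * l2 (\<lambda>k. f w k - f z k)) \<longlongrightarrow> 0) (at z within strip)" by simp
    show "((\<lambda>w. l2 (\<lambda>k. c * f w k - c * f z k)) \<longlongrightarrow> 0) (at z within strip)"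
    proof (rule tendsto_0_le[OF lim])
      show "\<forall>\<^sub>F w in at z within strip. l2 (\<lambda>k. c * f w k - c * f z k) \<le> cmod c * l2 (\<lambda>k. f w k - f z k)"
        using eventually_within
      proof eventually_elim
        case (elim w)
        have "(\<lambda>k. c * f w k - c * f z k) = (\<lambda>k. c * (f w k - f z k))" by (auto simp: algebra_simps)
        then show ?case using ell2_scale(2)[OF ell2_diff(1)[OF e[OF elim] e[OF z]], of c] by simp
      qed
    qed simp
  qed (intro holomorphic_intros strip_fun_holomorphic f)
qed

lemma l2_mono:
  assumes "y \<in> ell2" "\<And>k. cmod (x k) \<le> cmod (y k)" shows "x \<in> ell2" "l2 x \<le> l2 y"
proof -
  have *: "(\<Sum>k<K. (cmod (x k))\<^sup>2) \<le> (l2 y)\<^sup>2" for K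
    by (rule order_trans[OF sum_mono ell2_partial[OF assms(1)]]) (simp add: assms(2) power_mono)
  show "x \<in> ell2" by (rule ell2_I, rule *)
  show "l2 x \<le> l2 y" by (rule l2_leI, rule *) simp
qed

lemma strip_fun_trunc:
  assumes f: "f \<in> strip_fun" shows "(\<lambda>z k. if k < N then f z k else 0) \<in> strip_fun"
proof -
  obtain B where B: "0 \<le> B" "\<And>z. z \<in> strip \<Longrightarrow> l2 (f z) \<le> B" using strip_fun_bdd[OF f] by blast
  note e = strip_fun_ell2[OF f]
  show ?thesis
  proof (rule strip_funI[of _ B])
    fix z assume z: "z \<in> strip"
    show "(\<lambda>k. if k < N then f z k else 0) \<in> ell2" by (rule l2_mono(1)[OF e[OF z]]) simp
    show "l2 (\<lambda>k. if k < N then f z k else 0) \<le> B"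
      by (rule order_trans[OF l2_mono(2)[OF e[OF z]] B(2)[OF z]]) simp
    show "((\<lambda>w. l2 (\<lambda>k. (if k < N then f w k else 0) - (if k < N then f z k else 0))) \<longlongrightarrow> 0) (at z within strip)"
    proof (rule tendsto_0_le[OF strip_fun_tendsto[OF f z]])
      show "\<forall>\<^sub>F w in at z within strip. l2 (\<lambda>k. (if k < N then f w k else 0) - (if k < N then f z k else 0)) \<le> l2 (\<lambda>k. f w k - f z k)"
        using eventually_within
      proof eventually_elim
        case (elim w)
        show ?case by (rule l2_mono(2)[OF ell2_diff(1)[OF e[OF elim] e[OF z]]]) simp
      qed
    qed simp
  next
    fix k show "(\<lambda>z. if k < N then f z k else 0) holomorphic_on interior strip"
      using strip_fun_holomorphic[OF f, of k] by (cases "k < N") auto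
  qed
qed

lemma strip_fun_scalar:
  assumes p: "p \<in> ell2" and g: "continuous_on strip g" "g holomorphic_on interior strip"
    and B: "\<And>z. z \<in> strip \<Longrightarrow> cmod (g z) \<le> B"
  shows "(\<lambda>z k. g z * p k) \<in> strip_fun"
proof (rule strip_funI[of _ "B * l2 p"])
  fix z assume z: "z \<in> strip"
  show "(\<lambda>k. g z * p k) \<in> ell2" by (intro ell2_scale p)
  show "l2 (\<lambda>k. g z * p k) \<le> B * l2 p" unfolding ell2_scale(2)[OF p] by (intro mult_right_mono B z) simp
  have eq: "(\<lambda>w. l2 (\<lambda>k. g w * p k - g z * p k)) = (\<lambda>w. cmod (g w - g z) * l2 p)"
    using ell2_scale(2)[OF p] by (simp only: left_diff_distrib[symmetric])
  have "((\<lambda>w. cmod (g w - g z) * l2 p) \<longlongrightarrow> cmod (g z - g z) * l2 p) (at z within strip)"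
    by (intro tendsto_intros) (use g(1) z in \<open>auto simp: continuous_on_def\<close>)
  then show "((\<lambda>w. l2 (\<lambda>k. g w * p k - g z * p k)) \<longlongrightarrow> 0) (at z within strip)" unfolding eq by simp
qed (intro holomorphic_intros g)

lemma strip_fun_zero [simp]: "(\<lambda>z k. 0) \<in> strip_fun"
  using strip_fun_scalar[of "\<lambda>k. 0" "\<lambda>z. 0" 0] by simp

lemma strip_fun_sum:
  assumes "\<And>i. i \<in> A \<Longrightarrow> f i \<in> strip_fun" shows "(\<lambda>z k. \<Sum>i\<in>A. f i z k) \<in> strip_fun"
  using assms by (induction A rule: infinite_finite_induct) (auto intro: strip_fun_add)

section \<open>Jets at one half\<close>

text \<open>An explicit lift of the jet \<open>(p, q)\<close>. The function
  \<open>exp (z - 1/2) - 1\<close> vanishes at 1/2 with derivative 1 and, unlike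
  \<open>z - 1/2\<close>, stays bounded on the strip; its bound 3 comes from
  \<open>exp (1/2) \<le> 2\<close>.\<close>

definition jet_lift :: "(nat \<Rightarrow> complex) \<Rightarrow> (nat \<Rightarrow> complex) \<Rightarrow> complex \<Rightarrow> nat \<Rightarrow> complex" where
  "jet_lift p q z k = p k + (exp (z - 1/2) - 1) * q k"

lemma exp_strip_bound: "z \<in> strip \<Longrightarrow> cmod (exp (z - 1/2) - 1) \<le> 3"
proof -
  assume "z \<in> strip"
  then have "Re z - 1/2 \<le> 1/2" by (simp add: strip_def)
  have "exp (1/2::real) \<le> 2" using exp_half_le2 .
  then have "exp (Re z - 1/2) \<le> 2"
    using order_trans[OF iffD2[OF exp_le_cancel_iff \<open>Re z - 1/2 \<le> 1/2\<close>]] by blast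
  then show ?thesis using norm_triangle_ineq4[of "exp (z - 1/2)" 1] by simp
qed

lemma jet_lift_strip_fun:
  assumes "p \<in> ell2" "q \<in> ell2" shows "jet_lift p q \<in> strip_fun"
proof -
  have "(\<lambda>z k. 1 * p k + (exp (z - 1/2) - 1) * q k) \<in> strip_fun"
    by (intro strip_fun_add strip_fun_scalar assms holomorphic_intros continuous_intros) (auto intro: exp_strip_bound)
  then show ?thesis by (simp add: jet_lift_def[abs_def])
qed

lemma jet_lift_bound:
  assumes "p \<in> ell2" "q \<in> ell2" "z \<in> strip" shows "l2 (jet_lift p q z) \<le> l2 p + 3 * l2 q"
proof -
  have "l2 (jet_lift p q z) \<le> l2 p + l2 (\<lambda>k. (exp (z - 1/2) - 1) * q k)"
    unfolding jet_lift_def[abs_def] using assms by (intro ell2_add ell2_scale)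
  also have "\<dots> \<le> l2 p + 3 * l2 q"
    unfolding ell2_scale(2)[OF assms(2)] using exp_strip_bound[OF assms(3)] by (intro add_left_mono mult_right_mono) auto
  finally show ?thesis .
qed

definition sderiv :: "(complex \<Rightarrow> nat \<Rightarrow> complex) \<Rightarrow> complex \<Rightarrow> nat \<Rightarrow> complex" where
  "sderiv f z k = deriv (\<lambda>z. f z k) z"

definition jet :: "(complex \<Rightarrow> nat \<Rightarrow> complex) \<Rightarrow> (nat \<Rightarrow> complex) \<times> (nat \<Rightarrow> complex)" where
  "jet f = (f (1/2), sderiv f (1/2))"

lemma strip_fun_deriv: "f \<in> strip_fun \<Longrightarrow> z \<in> interior strip \<Longrightarrow> ((\<lambda>z. f z k) has_field_derivative sderiv f z k) (at z)"
  unfolding sderiv_def by (rule holomorphic_derivI[OF strip_fun_holomorphic]) auto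

lemma sderiv_eqI: "((\<lambda>z. f z k) has_field_derivative d) (at z) \<Longrightarrow> sderiv f z k = d"
  unfolding sderiv_def by (rule DERIV_imp_deriv)

lemma sderiv_cong:
  assumes "\<And>w. w \<in> strip \<Longrightarrow> f w = g w" "z \<in> interior strip"
  shows "sderiv f z = sderiv g z"
proof
  fix k
  have "eventually (\<lambda>w. w \<in> interior strip) (nhds z)" using assms(2) by (intro eventually_nhds_in_open) auto
  then have "eventually (\<lambda>w. f w k = g w k) (nhds z)" by eventually_elim (use assms(1) interior_strip_subset in auto)
  then show "sderiv f z k = sderiv g z k" unfolding sderiv_def by (intro deriv_cong_ev) auto
qed

lemma jet_cong: "(\<And>w. w \<in> strip \<Longrightarrow> f w = g w) \<Longrightarrow> jet f = jet g"
  unfolding jet_def using sderiv_cong[of f g "1/2"] by simp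

lemma jet_jet_lift: "jet (jet_lift p q) = (p, q)"
proof -
  have "sderiv (jet_lift p q) (1/2) k = q k" for k
    unfolding jet_lift_def by (rule sderiv_eqI) (auto intro!: derivative_eq_intros)
  then show ?thesis by (auto simp: jet_def jet_lift_def fun_eq_iff)
qed

lemma jet_add: "f \<in> strip_fun \<Longrightarrow> g \<in> strip_fun \<Longrightarrow>
    jet (\<lambda>z k. f z k + g z k) = (\<lambda>k. fst (jet f) k + fst (jet g) k, \<lambda>k. snd (jet f) k + snd (jet g) k)"
  by (auto simp: jet_def fun_eq_iff intro!: sderiv_eqI derivative_intros strip_fun_deriv)

lemma jet_scale: "f \<in> strip_fun \<Longrightarrow>
    jet (\<lambda>z k. c * f z k) = (\<lambda>k. c * fst (jet f) k, \<lambda>k. c * snd (jet f) k)"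
  by (auto simp: jet_def fun_eq_iff intro!: sderiv_eqI DERIV_cmult strip_fun_deriv)

lemma jet_mult: "f \<in> strip_fun \<Longrightarrow> g \<in> strip_fun \<Longrightarrow>
    jet (\<lambda>z k. f z k * g z k) = (\<lambda>k. fst (jet f) k * fst (jet g) k,
       \<lambda>k. fst (jet f) k * snd (jet g) k + snd (jet f) k * fst (jet g) k)"
  by (auto simp: jet_def fun_eq_iff intro!: sderiv_eqI derivative_eq_intros strip_fun_deriv)

lemma jet_zero: "jet (\<lambda>z k. 0) = (\<lambda>k. 0, \<lambda>k. 0)"
  by (auto simp: jet_def fun_eq_iff intro!: sderiv_eqI)

lemma jet_sum:
  assumes "\<And>i. i \<in> A \<Longrightarrow> f i \<in> strip_fun"
  shows "jet (\<lambda>z k. \<Sum>i\<in>A. f i z k) = (\<lambda>k. \<Sum>i\<in>A. fst (jet (f i)) k, \<lambda>k. \<Sum>i\<in>A. snd (jet (f i)) k)"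
  using assms
  by (induction A rule: infinite_finite_induct) (simp_all add: jet_zero jet_add strip_fun_sum)

lemma jet_trunc: "f \<in> strip_fun \<Longrightarrow> jet (\<lambda>z k. if k < N then f z k else 0)
     = (\<lambda>k. if k < N then fst (jet f) k else 0, \<lambda>k. if k < N then snd (jet f) k else 0)"
  by (auto simp: jet_def fun_eq_iff intro!: sderiv_eqI strip_fun_deriv)

text \<open>Holomorphic coordinates and a uniform norm bound give norm differentiability: the
  remainder at \<open>w\<close>, cut off at \<open>K\<close> coordinates, is tested against itself,
  and the resulting scalar function has a Taylor remainder whose constant does not depend on
  \<open>K\<close>.\<close>

lemma strip_fun_l2_deriv:
  assumes f: "f \<in> strip_fun" and z: "z \<in> interior strip"
  shows "sderiv f z \<in> ell2"
    and "((\<lambda>w. l2 (\<lambda>k. inverse (w - z) * (f w k - f z k) - sderiv f z k)) \<longlongrightarrow> 0) (at z)"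
proof -
  obtain B where B: "0 \<le> B" "\<And>z. z \<in> strip \<Longrightarrow> l2 (f z) \<le> B" using strip_fun_bdd[OF f] by blast
  obtain r0 where r0: "0 < r0" "cball z r0 \<subseteq> interior strip"
    using z open_contains_cball[of "interior strip"] by auto
  define r where "r = r0 / 2"
  have r: "0 < r" "cball z (2 * r) \<subseteq> interior strip" using r0 by (auto simp: r_def)
  define C where "C = 2 * B / r\<^sup>2"
  have C: "0 \<le> C" using B r by (simp add: C_def)
  define d where "d w k = inverse (w - z) * (f w k - f z k) - sderiv f z k" for w k
  have main: "(\<Sum>k<K. (cmod (d w k))\<^sup>2) \<le> (C * cmod (w - z))\<^sup>2" if w: "cmod (w - z) \<le> r" "w \<noteq> z" for w K
  proof -
    \<comment> \<open>The functional depends on \<open>w\<close>, but \<open>w\<close> is fixed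
      while Taylor's formula is applied to \<open>G\<close>.\<close>
    define a where "a k = cnj (d w k)" for k
    define G where "G x = (\<Sum>k<K. a k * f x k)" for x
    define A where "A = L2_set (\<lambda>k. cmod (a k)) {..<K}"
    have holG: "G holomorphic_on interior strip"
      unfolding G_def by (intro holomorphic_intros strip_fun_holomorphic f)
    have "deriv G z = (\<Sum>k<K. a k * sderiv f z k)"
      unfolding G_def by (intro DERIV_imp_deriv DERIV_sum DERIV_cmult strip_fun_deriv f z)
    then have eq: "inverse (w - z) * (G w - G z) - deriv G z = (\<Sum>k<K. cnj (d w k) * d w k)"
      by (simp add: G_def d_def[of w] a_def sum_distrib_left algebra_simps sum_subtractf sum.distrib)
    have "cmod (inverse (w - z) * (G w - G z) - deriv G z) \<le> 2 * (A * B) / r\<^sup>2 * cmod (w - z)"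
    proof (rule difference_quotient_bound[OF holG _ r])
      fix x assume "x \<in> interior strip"
      then have x: "x \<in> strip" by (rule interior_strip_subset)
      have "cmod (G x) \<le> A * L2_set (\<lambda>k. cmod (f x k)) {..<K}" unfolding G_def A_def by (rule cmod_sum_cs)
      also have "\<dots> \<le> A * B"
        by (intro mult_left_mono order_trans[OF L2_set_lessThan B(2)] strip_fun_ell2 f x) (simp add: A_def)
      finally show "cmod (G x) \<le> A * B" .
    qed (use w in auto)
    then have "cmod (\<Sum>k<K. cnj (d w k) * d w k) \<le> (C * cmod (w - z)) * L2_set (\<lambda>k. cmod (d w k)) {..<K}"
      unfolding eq by (simp add: A_def a_def C_def mult_ac)
    from self_dual_bound[OF this] show ?thesis using C by simp
  qed
  \<comment> \<open>One point is enough for the derivative to be in l2: at \<open>w0\<close> both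
    the difference quotient and the remainder are.\<close>
  define w0 where "w0 = z + of_real r"
  have w0: "cmod (w0 - z) \<le> r" "w0 \<noteq> z" using r by (auto simp: w0_def)
  have in_strip: "w \<in> strip" if "cmod (w - z) \<le> r" for w
  proof -
    have "w \<in> cball z (2 * r)" using that r(1) by (simp add: dist_norm norm_minus_commute)
    then show ?thesis using r(2) interior_subset by blast
  qed
  have "(\<lambda>k. inverse (w0 - z) * (f w0 k - f z k) - d w0 k) \<in> ell2"
    by (intro ell2_diff ell2_scale strip_fun_ell2 f in_strip w0 ell2_I[OF main]) (use r in auto)
  then show "sderiv f z \<in> ell2" by (simp add: d_def)
  have "((\<lambda>w. C * cmod (w - z)) \<longlongrightarrow> C * cmod (z - z)) (at z)" by (intro tendsto_intros)
  then have lim: "((\<lambda>w. C * cmod (w - z)) \<longlongrightarrow> 0) (at z)" by simp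
  show "((\<lambda>w. l2 (\<lambda>k. inverse (w - z) * (f w k - f z k) - sderiv f z k)) \<longlongrightarrow> 0) (at z)"
    unfolding d_def[symmetric]
  proof (rule tendsto_0_le[OF lim])
    show "\<forall>\<^sub>F w in at z. l2 (\<lambda>k. d w k) \<le> C * cmod (w - z)"
      unfolding eventually_at using r(1) C
      by (intro exI[of _ r]) (auto simp: dist_norm intro!: l2_leI main)
  qed simp
qed

lemma jet_ell2: "f \<in> strip_fun \<Longrightarrow> jet f \<in> ell2 \<times> ell2"
  by (simp add: jet_def strip_fun_l2_deriv strip_fun_ell2)

section \<open>The algebra of functions over the couple \<open>(R, C)\<close>\<close>

abbreviation FRC :: "(complex \<Rightarrow> nat \<Rightarrow> complex) op_alg" where
  "FRC \<equiv> interp_alg row_alg col_alg"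

lemma row_alg_simps [simp]:
  "vcarrier row_alg = ell2" "vzero row_alg = (\<lambda>k. 0)" "vadd row_alg x y = (\<lambda>k. x k + y k)"
  "vscale row_alg c x = (\<lambda>k. c * x k)" "mnorm row_alg = row_mnorm" "vmult row_alg x y = (\<lambda>k. x k * y k)"
  "vsub row_alg x y = (\<lambda>k. x k - y k)"
  by (simp_all add: row_alg_def vsub_def)

lemma col_alg_simps [simp]: "vcarrier col_alg = ell2" "mnorm col_alg = col_mnorm"
  by (simp_all add: col_alg_def)

lemma col_mnorm_1: assumes "x \<in> ell2" shows "col_mnorm 1 (\<lambda>_ _. x) = l2 x"
proof (rule antisym)
  have "(\<Sum>k<K. (cmod (x k) * cmod (v 0))\<^sup>2) \<le> (l2 x)\<^sup>2 * (cmod (v 0))\<^sup>2" for v :: "nat \<Rightarrow> complex" and K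
    using mult_right_mono[OF ell2_partial[OF assms, of K], of "(cmod (v 0))\<^sup>2"]
    by (simp add: power_mult_distrib sum_distrib_right)
  then show "col_mnorm 1 (\<lambda>_ _. x) \<le> l2 x"
    using assms by (subst col_mnorm_le_iff) (auto simp: col_bdd_def norm_mult)
  have "col_bdd 1 (\<lambda>_ _. x) (col_mnorm 1 (\<lambda>_ _. x))"
    using assms by (subst col_mnorm_le_iff[symmetric]) auto
  from this[unfolded col_bdd_def, rule_format, of "\<lambda>_. 1"]
  show "l2 x \<le> col_mnorm 1 (\<lambda>_ _. x)" by (intro l2_leI) simp_all
qed

lemma vnorm_row [simp]: "x \<in> ell2 \<Longrightarrow> vnorm row_alg x = l2 x"
  by (simp add: vnorm_def row_mnorm_eq col_mnorm_1[unfolded One_nat_def])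

lemma vnorm_col [simp]: "x \<in> ell2 \<Longrightarrow> vnorm col_alg x = l2 x"
  by (simp add: vnorm_def col_mnorm_1[unfolded One_nat_def])

lemma sum_carrier_row_col [simp]: "sum_carrier row_alg col_alg = ell2"
proof -
  have "\<exists>a b. x = (\<lambda>k. a k + b k) \<and> a \<in> ell2 \<and> b \<in> ell2" if "x \<in> ell2" for x
    using that by (intro exI[of _ x] exI[of _ "\<lambda>_. 0"]) simp
  then show ?thesis unfolding sum_carrier_def by (auto intro: ell2_add)
qed

text \<open>Both spaces have the norm \<open>l2\<close> at level one, so by the triangle inequality
  no decomposition beats \<open>x + 0\<close>.\<close>

lemma sum_norm_row_col [simp]: assumes "x \<in> ell2" shows "sum_norm row_alg col_alg x = l2 x"
  unfolding sum_norm_def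
proof (rule cInf_eq_minimum)
  show "l2 x \<in> {vnorm row_alg x\<^sub>0 + vnorm col_alg x\<^sub>1 |x\<^sub>0 x\<^sub>1.
          x\<^sub>0 \<in> vcarrier row_alg \<and> x\<^sub>1 \<in> vcarrier col_alg \<and> x = vadd row_alg x\<^sub>0 x\<^sub>1}"
    using assms by (intro CollectI exI[of _ x] exI[of _ "\<lambda>_. 0"]) simp
qed (auto intro: ell2_add)

lemma has_sum_deriv_iff:
  assumes f: "\<And>z. z \<in> strip \<Longrightarrow> f z \<in> ell2" and z: "z \<in> interior strip"
  shows "has_sum_deriv row_alg col_alg f d z \<longleftrightarrow>
    d \<in> ell2 \<and> ((\<lambda>w. l2 (\<lambda>k. inverse (w - z) * (f w k - f z k) - d k)) \<longlongrightarrow> 0) (at z)"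
proof -
  have ev: "eventually (\<lambda>w. w \<in> strip) (at z)"
    using z by (intro eventually_mono[OF eventually_at_in_open'[of "interior strip"]]) (auto intro: interior_strip_subset)
  have "((\<lambda>w. sum_norm row_alg col_alg (vsub row_alg (vscale row_alg (inverse (w - z)) (vsub row_alg (f w) (f z))) d)) \<longlongrightarrow> 0) (at z)
     \<longleftrightarrow> ((\<lambda>w. l2 (\<lambda>k. inverse (w - z) * (f w k - f z k) - d k)) \<longlongrightarrow> 0) (at z)" if d: "d \<in> ell2"
    by (rule tendsto_cong) (rule eventually_mono[OF ev],
        simp add: ell2_diff ell2_scale f interior_strip_subset[OF z] d)
  then show ?thesis unfolding has_sum_deriv_def by auto
qed

lemma l2_deriv_coord:
  assumes f: "\<And>z. z \<in> strip \<Longrightarrow> f z \<in> ell2" and z: "z \<in> interior strip"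
    and d: "has_sum_deriv row_alg col_alg f d z"
  shows "((\<lambda>z. f z k) has_field_derivative d k) (at z)"
proof -
  have de: "d \<in> ell2" and lim: "((\<lambda>w. l2 (\<lambda>k. inverse (w - z) * (f w k - f z k) - d k)) \<longlongrightarrow> 0) (at z)"
    using d has_sum_deriv_iff[OF f z] by auto
  have ev: "eventually (\<lambda>w. w \<in> strip) (at z)"
    using z by (intro eventually_mono[OF eventually_at_in_open'[of "interior strip"]]) (auto intro: interior_strip_subset)
  have "((\<lambda>w. cmod (inverse (w - z) * (f w k - f z k) - d k)) \<longlongrightarrow> 0) (at z)"
    by (rule tendsto_0_le[OF lim]) (auto intro!: eventually_mono[OF ev]
       ell2_coord[of "\<lambda>k. inverse (_ - z) * (f _ k - f z k) - d k"] ell2_diff ell2_scale f interior_strip_subset[OF z] de)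
  then have "((\<lambda>w. inverse (w - z) * (f w k - f z k)) \<longlongrightarrow> d k) (at z)"
    by (rule LIM_zero_cancel[OF tendsto_norm_zero_cancel])
  then show ?thesis unfolding has_field_derivative_iff by (simp add: divide_inverse mult.commute)
qed

lemma strip_fun_has_sum_deriv:
  assumes "f \<in> strip_fun" "z \<in> interior strip"
  shows "has_sum_deriv row_alg col_alg f d z \<longleftrightarrow> d = sderiv f z"
proof
  assume "has_sum_deriv row_alg col_alg f d z"
  from l2_deriv_coord[OF strip_fun_ell2[OF assms(1)] assms(2) this]
  show "d = sderiv f z" by (intro ext sderiv_eqI[symmetric])
next
  assume "d = sderiv f z"
  then show "has_sum_deriv row_alg col_alg f d z"
    using assms by (subst has_sum_deriv_iff) (auto intro: strip_fun_ell2 strip_fun_l2_deriv)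
qed

lemma strip_fun_l2_continuous:
  assumes "f \<in> strip_fun" shows "continuous_on strip (\<lambda>z. l2 (f z))"
  unfolding continuous_on_def
proof
  fix z assume z: "z \<in> strip"
  note e = strip_fun_ell2[OF assms]
  have "((\<lambda>w. \<bar>l2 (f w) - l2 (f z)\<bar>) \<longlongrightarrow> 0) (at z within strip)"
    using strip_fun_tendsto[OF assms z]
  proof (rule tendsto_0_le)
    show "\<forall>\<^sub>F w in at z within strip. \<bar>l2 (f w) - l2 (f z)\<bar> \<le> l2 (\<lambda>k. f w k - f z k)"
      using eventually_within
    proof eventually_elim
      case (elim w)
      have "l2 (f w) \<le> l2 (\<lambda>k. f w k - f z k) + l2 (f z)"
        using ell2_add(2)[OF ell2_diff(1)[OF e[OF elim] e[OF z]] e[OF z]] by simp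
      moreover have "l2 (f z) \<le> l2 (\<lambda>k. f z k - f w k) + l2 (f w)"
        using ell2_add(2)[OF ell2_diff(1)[OF e[OF z] e[OF elim]] e[OF elim]] by simp
      ultimately show ?case using l2_diff_commute[of "f w" "f z"] by linarith
    qed
  qed simp
  then have "((\<lambda>w. l2 (f w) - l2 (f z)) \<longlongrightarrow> 0) (at z within strip)" by (simp add: tendsto_rabs_zero_iff)
  then show "((\<lambda>z. l2 (f z)) \<longlongrightarrow> l2 (f z)) (at z within strip)" by (rule LIM_zero_cancel)
qed

text \<open>Norm differentiability gives holomorphic coordinates because coordinates are continuous,
  and \<open>strip_fun_l2_deriv\<close> gives the converse. The edge conditions hold because the
  norm of the function is bounded and continuous up to the boundary.\<close>

lemma FRC_carrier: "f \<in> vcarrier FRC \<longleftrightarrow> f \<in> strip_fun \<and> f \<in> extensional strip"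
proof
  assume f: "f \<in> vcarrier FRC"
  then have PiE: "f \<in> strip \<rightarrow>\<^sub>E ell2"
    and bdd: "bounded ((\<lambda>z. sum_norm row_alg col_alg (f z)) ` strip)"
    and lim: "\<And>z. z \<in> strip \<Longrightarrow> ((\<lambda>w. sum_norm row_alg col_alg (vsub row_alg (f w) (f z))) \<longlongrightarrow> 0) (at z within strip)"
    and der: "\<And>z. z \<in> interior strip \<Longrightarrow> \<exists>d. has_sum_deriv row_alg col_alg f d z"
    by (auto simp: interp_alg_def)
  have e: "\<And>z. z \<in> strip \<Longrightarrow> f z \<in> ell2" using PiE by auto
  obtain B where B: "\<And>z. z \<in> strip \<Longrightarrow> \<bar>sum_norm row_alg col_alg (f z)\<bar> \<le> B"
    using bdd by (auto simp: bounded_iff)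
  have "f \<in> strip_fun"
  proof (rule strip_funI[of _ B])
    fix z assume z: "z \<in> strip"
    show "f z \<in> ell2" using e z .
    show "l2 (f z) \<le> B" using B[OF z] e[OF z] by simp
    show "((\<lambda>w. l2 (\<lambda>k. f w k - f z k)) \<longlongrightarrow> 0) (at z within strip)"
      using lim[OF z] by (rule Lim_transform_eventually)
        (rule eventually_mono[OF eventually_within], use e z in \<open>simp add: ell2_diff\<close>)
  next
    fix k
    show "(\<lambda>z. f z k) holomorphic_on interior strip"
      unfolding holomorphic_on_open[OF open_interior]
    proof
      fix z assume z: "z \<in> interior strip"
      then obtain d where "has_sum_deriv row_alg col_alg f d z" using der by blast
      from l2_deriv_coord[OF e z this] show "\<exists>f'. ((\<lambda>z. f z k) has_field_derivative f') (at z)" by blast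
    qed
  qed
  then show "f \<in> strip_fun \<and> f \<in> extensional strip" using PiE by (auto simp: PiE_def)
next
  assume f: "f \<in> strip_fun \<and> f \<in> extensional strip"
  then have fs: "f \<in> strip_fun" by simp
  note e = strip_fun_ell2[OF fs]
  obtain B where B: "0 \<le> B" "\<And>z. z \<in> strip \<Longrightarrow> l2 (f z) \<le> B" using strip_fun_bdd[OF fs] by blast
  have cont: "continuous_on UNIV (\<lambda>t :: real. l2 (f (\<i> * t)))" "continuous_on UNIV (\<lambda>t :: real. l2 (f (1 + \<i> * t)))"
    by (rule continuous_on_compose2[OF strip_fun_l2_continuous[OF fs]]; auto intro!: continuous_intros)+
  have lim: "((\<lambda>w. sum_norm row_alg col_alg (vsub row_alg (f w) (f z))) \<longlongrightarrow> 0) (at z within strip)" if z: "z \<in> strip" for z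
    using strip_fun_tendsto[OF fs z] by (rule Lim_transform_eventually)
        (rule eventually_mono[OF eventually_within], use e z in \<open>simp add: ell2_diff\<close>)
  have der: "\<exists>d. has_sum_deriv row_alg col_alg f d z" if "z \<in> interior strip" for z
    using strip_fun_has_sum_deriv[OF fs that] by blast
  show "f \<in> vcarrier FRC"
    unfolding interp_alg_def using f e cont lim der B by (auto simp: bounded_iff PiE_def intro!: exI[of _ B])
qed

lemma FRC_restrict: "f \<in> strip_fun \<Longrightarrow> restrict f strip \<in> vcarrier FRC"
  unfolding FRC_carrier by (auto intro: strip_fun_cong)

lemma jet_restrict [simp]: "jet (restrict f strip) = jet f"
  by (rule jet_cong) simp

lemma FRC_simps:
  "vadd FRC f g = restrict (\<lambda>z k. f z k + g z k) strip"
  "vscale FRC c f = restrict (\<lambda>z k. c * f z k) strip"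
  "vmult FRC f g = restrict (\<lambda>z k. f z k * g z k) strip"
  "vzero FRC = restrict (\<lambda>z k. 0) strip"
  "vsub FRC f g = restrict (\<lambda>z k. f z k - g z k) strip"
  by (simp_all add: interp_alg_def vsub_def fun_eq_iff)

section \<open>The quotient as an algebra of jets\<close>

definition dker :: "(complex \<Rightarrow> nat \<Rightarrow> complex) set" where
  "dker = ker_eval row_alg col_alg (1/2) \<inter> ker_deriv row_alg col_alg (1/2)"

lemma dker_eq: "dker = {f \<in> vcarrier FRC. jet f = (\<lambda>k. 0, \<lambda>k. 0)}"
proof -
  have "deriv_at row_alg col_alg (1/2) f = sderiv f (1/2)" if "f \<in> vcarrier FRC" for f
    using that strip_fun_has_sum_deriv[of f "1/2"] unfolding deriv_at_def FRC_carrier by simp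
  then show ?thesis
    unfolding dker_def ker_eval_def ker_deriv_def jet_def eval_at_def by (auto simp: fun_eq_iff)
qed

abbreviation E2 :: "((nat \<Rightarrow> complex) \<times> (nat \<Rightarrow> complex)) set" where "E2 \<equiv> ell2 \<times> ell2"

definition jcls :: "(nat \<Rightarrow> complex) \<times> (nat \<Rightarrow> complex) \<Rightarrow> (complex \<Rightarrow> nat \<Rightarrow> complex) set" where
  "jcls a = {f \<in> vcarrier FRC. jet f = a}"

definition jadd :: "(nat \<Rightarrow> complex) \<times> (nat \<Rightarrow> complex) \<Rightarrow> (nat \<Rightarrow> complex) \<times> (nat \<Rightarrow> complex) \<Rightarrow> (nat \<Rightarrow> complex) \<times> (nat \<Rightarrow> complex)" where
  "jadd a b = (\<lambda>k. fst a k + fst b k, \<lambda>k. snd a k + snd b k)"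

definition jscale :: "complex \<Rightarrow> (nat \<Rightarrow> complex) \<times> (nat \<Rightarrow> complex) \<Rightarrow> (nat \<Rightarrow> complex) \<times> (nat \<Rightarrow> complex)" where
  "jscale c a = (\<lambda>k. c * fst a k, \<lambda>k. c * snd a k)"

text \<open>Dual numbers \<open>fst a + \<epsilon> * snd a\<close> with
  \<open>\<epsilon>^2 = 0\<close>, multiplied coordinatewise; the second component is Leibniz'
  rule.\<close>

definition jmult :: "(nat \<Rightarrow> complex) \<times> (nat \<Rightarrow> complex) \<Rightarrow> (nat \<Rightarrow> complex) \<times> (nat \<Rightarrow> complex) \<Rightarrow> (nat \<Rightarrow> complex) \<times> (nat \<Rightarrow> complex)" where
  "jmult a b = (\<lambda>k. fst a k * fst b k, \<lambda>k. fst a k * snd b k + snd a k * fst b k)"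

abbreviation jzero :: "(nat \<Rightarrow> complex) \<times> (nat \<Rightarrow> complex)" where "jzero \<equiv> (\<lambda>k. 0, \<lambda>k. 0)"

lemma E2_closed [simp]:
  "a \<in> E2 \<Longrightarrow> b \<in> E2 \<Longrightarrow> jadd a b \<in> E2" "a \<in> E2 \<Longrightarrow> jscale c a \<in> E2"
  "a \<in> E2 \<Longrightarrow> b \<in> E2 \<Longrightarrow> jmult a b \<in> E2" "jzero \<in> E2"
  by (auto simp: jadd_def jscale_def jmult_def mem_Times_iff intro!: ell2_add ell2_scale ell2_mult)

lemma jcls_nonempty: "a \<in> E2 \<Longrightarrow> restrict (jet_lift (fst a) (snd a)) strip \<in> jcls a"
  by (auto simp: jcls_def mem_Times_iff jet_jet_lift intro!: FRC_restrict jet_lift_strip_fun)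

lemma jcls_inj: "a \<in> E2 \<Longrightarrow> jcls a = jcls b \<longleftrightarrow> a = b"
  using jcls_nonempty[of a] by (auto simp: jcls_def)

lemma quot_rel_FRC:
  assumes "f \<in> vcarrier FRC" shows "quot_rel FRC dker `` {f} = jcls (jet f)"
proof -
  have "vsub FRC f g \<in> dker \<longleftrightarrow> jet g = jet f" if g: "g \<in> vcarrier FRC" for g
  proof -
    have fs: "f \<in> strip_fun" "g \<in> strip_fun" using assms g by (auto simp: FRC_carrier)
    have gs: "(\<lambda>z k. (-1) * g z k) \<in> strip_fun" by (rule strip_fun_scale[OF fs(2)])
    have m: "(\<lambda>z k. f z k - g z k) = (\<lambda>z k. f z k + (-1) * g z k)" by simp
    have "(\<lambda>z k. f z k - g z k) \<in> strip_fun" unfolding m by (rule strip_fun_add[OF fs(1) gs])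
    moreover have "jet (\<lambda>z k. f z k - g z k) = (\<lambda>k. fst (jet f) k - fst (jet g) k, \<lambda>k. snd (jet f) k - snd (jet g) k)"
      unfolding m jet_add[OF fs(1) gs] jet_scale[OF fs(2)] by simp
    ultimately show ?thesis unfolding dker_eq FRC_simps
      by (auto simp: FRC_restrict prod_eq_iff fun_eq_iff)
  qed
  then show ?thesis using assms unfolding quot_rel_def jcls_def by auto
qed

lemma dOH_eq: "dOH = quot_alg FRC dker"
  by (simp add: dOH_def deriv_interp_def dker_def)

lemma dOH_carrier: "vcarrier dOH = jcls ` E2"
proof -
  have "vcarrier dOH = (\<lambda>f. jcls (jet f)) ` vcarrier FRC"
    by (auto simp: dOH_eq quot_alg_def quotient_def quot_rel_FRC)
  also have "\<dots> = jcls ` E2"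
  proof
    show "(\<lambda>f. jcls (jet f)) ` vcarrier FRC \<subseteq> jcls ` E2"
      using jet_ell2 by (auto simp: FRC_carrier)
    show "jcls ` E2 \<subseteq> (\<lambda>f. jcls (jet f)) ` vcarrier FRC"
    proof
      fix A assume "A \<in> jcls ` E2"
      then obtain a where a: "a \<in> E2" "A = jcls a" by blast
      from jcls_nonempty[OF a(1)] show "A \<in> (\<lambda>f. jcls (jet f)) ` vcarrier FRC"
        unfolding a(2) by (intro image_eqI[of _ _ "restrict (jet_lift (fst a) (snd a)) strip"]) (auto simp: jcls_def)
    qed
  qed
  finally show ?thesis .
qed

lemma dOH_zero: "vzero dOH = jcls jzero"
  by (simp add: dOH_eq quot_alg_def FRC_simps quot_rel_FRC FRC_restrict jet_zero)

lemma dOH_add: assumes "a \<in> E2" "b \<in> E2" shows "vadd dOH (jcls a) (jcls b) = jcls (jadd a b)"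
proof -
  have "quot_rel FRC dker `` {vadd FRC f g} = jcls (jadd a b)" if "f \<in> jcls a" "g \<in> jcls b" for f g
    by (subst quot_rel_FRC) (use that in \<open>simp_all add: jcls_def FRC_carrier FRC_simps FRC_restrict[unfolded FRC_carrier] strip_fun_add jet_add jadd_def\<close>)
  moreover have "vadd dOH (jcls a) (jcls b) = (\<Union>f\<in>jcls a. \<Union>g\<in>jcls b. quot_rel FRC dker `` {vadd FRC f g})"
    by (simp add: dOH_eq quot_alg_def)
  ultimately show ?thesis using jcls_nonempty[OF assms(1)] jcls_nonempty[OF assms(2)] by auto
qed

lemma dOH_mult: assumes "a \<in> E2" "b \<in> E2" shows "vmult dOH (jcls a) (jcls b) = jcls (jmult a b)"
proof -
  have "quot_rel FRC dker `` {vmult FRC f g} = jcls (jmult a b)" if "f \<in> jcls a" "g \<in> jcls b" for f g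
    by (subst quot_rel_FRC) (use that in \<open>simp_all add: jcls_def FRC_carrier FRC_simps FRC_restrict[unfolded FRC_carrier] strip_fun_mult jet_mult jmult_def\<close>)
  moreover have "vmult dOH (jcls a) (jcls b) = (\<Union>f\<in>jcls a. \<Union>g\<in>jcls b. quot_rel FRC dker `` {vmult FRC f g})"
    by (simp add: dOH_eq quot_alg_def)
  ultimately show ?thesis using jcls_nonempty[OF assms(1)] jcls_nonempty[OF assms(2)] by auto
qed

lemma dOH_scale: assumes "a \<in> E2" shows "vscale dOH c (jcls a) = jcls (jscale c a)"
proof -
  have "quot_rel FRC dker `` {vscale FRC c f} = jcls (jscale c a)" if "f \<in> jcls a" for f
    by (subst quot_rel_FRC) (use that in \<open>simp_all add: jcls_def FRC_carrier FRC_simps FRC_restrict[unfolded FRC_carrier] strip_fun_scale jet_scale jscale_def\<close>)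
  moreover have "vscale dOH c (jcls a) = (\<Union>f\<in>jcls a. quot_rel FRC dker `` {vscale FRC c f})"
    by (simp add: dOH_eq quot_alg_def)
  ultimately show ?thesis using jcls_nonempty[OF assms(1)] by auto
qed

definition jof :: "(complex \<Rightarrow> nat \<Rightarrow> complex) set \<Rightarrow> (nat \<Rightarrow> complex) \<times> (nat \<Rightarrow> complex)" where
  "jof A = (THE a. a \<in> E2 \<and> A = jcls a)"

lemma jof_jcls [simp]: "a \<in> E2 \<Longrightarrow> jof (jcls a) = a"
  unfolding jof_def using jcls_inj by (intro the_equality) auto

lemma jof_carrier: "A \<in> vcarrier dOH \<Longrightarrow> jof A \<in> E2" "A \<in> vcarrier dOH \<Longrightarrow> jcls (jof A) = A"
  unfolding dOH_carrier using jof_jcls by auto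

section \<open>Matrices over the function algebra\<close>

text \<open>In the norm of the function algebra only the edges count, with row norms on the left one
  and column norms on the right one. The predicate avoids the suprema, which are meaningful only
  once boundedness is known.\<close>

definition fun_bdd :: "nat \<Rightarrow> (nat \<Rightarrow> nat \<Rightarrow> complex \<Rightarrow> nat \<Rightarrow> complex) \<Rightarrow> real \<Rightarrow> bool" where
  "fun_bdd n f c \<longleftrightarrow> (\<forall>t :: real. row_bdd n (\<lambda>i j. f i j (\<i> * t)) c) \<and> (\<forall>t :: real. col_bdd n (\<lambda>i j. f i j (1 + \<i> * t)) c)"

lemma fun_bdd_mono: "fun_bdd n f c \<Longrightarrow> 0 \<le> c \<Longrightarrow> c \<le> d \<Longrightarrow> fun_bdd n f d"
  unfolding fun_bdd_def using col_bdd_mono by blast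

lemma col_bdd_cong:
  assumes "\<And>i j. i < n \<Longrightarrow> j < n \<Longrightarrow> x i j = y i j" shows "col_bdd n x c \<longleftrightarrow> col_bdd n y c"
proof -
  have "(\<Sum>j<n. x i j k * v j) = (\<Sum>j<n. y i j k * v j)" if "i < n" for i k and v :: "nat \<Rightarrow> complex"
    by (intro sum.cong) (auto simp: assms that)
  then have "(\<Sum>k<K. \<Sum>i<n. (cmod (\<Sum>j<n. x i j k * v j))\<^sup>2) = (\<Sum>k<K. \<Sum>i<n. (cmod (\<Sum>j<n. y i j k * v j))\<^sup>2)" for v K
    by (intro sum.cong refl) simp
  then show ?thesis unfolding col_bdd_def by simp
qed

lemma fun_bdd_cong:
  assumes "\<And>i j z. i < n \<Longrightarrow> j < n \<Longrightarrow> z \<in> strip \<Longrightarrow> f i j z = g i j z" shows "fun_bdd n f c \<longleftrightarrow> fun_bdd n g c"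
proof -
  have "row_bdd n (\<lambda>i j. f i j (\<i> * t)) c \<longleftrightarrow> row_bdd n (\<lambda>i j. g i j (\<i> * t)) c"
    "col_bdd n (\<lambda>i j. f i j (1 + \<i> * t)) c \<longleftrightarrow> col_bdd n (\<lambda>i j. g i j (1 + \<i> * t)) c" for t :: real
    by (intro col_bdd_cong assms edges_in_strip; assumption)+
  then show ?thesis unfolding fun_bdd_def by simp
qed

lemma col_bdd_L2:
  assumes "0 \<le> c"
  shows "col_bdd n x c \<longleftrightarrow> (\<forall>v K. L2_set (\<lambda>p. cmod (\<Sum>j<n. x (snd p) j (fst p) * v j)) ({..<K} \<times> {..<n}) \<le> c * L2_set (\<lambda>j. cmod (v j)) {..<n})"
proof -
  have "(\<Sum>k<K. \<Sum>i<n. (cmod (\<Sum>j<n. x i j k * v j))\<^sup>2) \<le> c\<^sup>2 * (\<Sum>j<n. (cmod (v j))\<^sup>2) \<longleftrightarrow>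
    L2_set (\<lambda>p. cmod (\<Sum>j<n. x (snd p) j (fst p) * v j)) ({..<K} \<times> {..<n}) \<le> c * L2_set (\<lambda>j. cmod (v j)) {..<n}" for v K
  proof -
    have "(\<Sum>k<K. \<Sum>i<n. (cmod (\<Sum>j<n. x i j k * v j))\<^sup>2) = (L2_set (\<lambda>p. cmod (\<Sum>j<n. x (snd p) j (fst p) * v j)) ({..<K} \<times> {..<n}))\<^sup>2"
      by (simp add: L2_set_power2 sum.cartesian_product split_beta)
    moreover have "c\<^sup>2 * (\<Sum>j<n. (cmod (v j))\<^sup>2) = (c * L2_set (\<lambda>j. cmod (v j)) {..<n})\<^sup>2"
      by (simp add: L2_set_power2 power_mult_distrib)
    moreover have "0 \<le> c * L2_set (\<lambda>j. cmod (v j)) {..<n}" using assms by simp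
    ultimately show ?thesis by (simp only: power_mono_iff[OF L2_set_nonneg _ zero_less_numeral])
  qed
  then show ?thesis unfolding col_bdd_def by simp
qed

lemma col_bdd_add:
  assumes "col_bdd n x c" "col_bdd n y d" "0 \<le> c" "0 \<le> d"
  shows "col_bdd n (\<lambda>i j k. x i j k + y i j k) (c + d)"
proof -
  have "L2_set (\<lambda>p. cmod (\<Sum>j<n. (x (snd p) j (fst p) + y (snd p) j (fst p)) * v j)) ({..<K} \<times> {..<n})
      \<le> (c + d) * L2_set (\<lambda>j. cmod (v j)) {..<n}" (is "?L \<le> _") for v K
  proof -
    have "?L \<le> L2_set (\<lambda>p. cmod (\<Sum>j<n. x (snd p) j (fst p) * v j) + cmod (\<Sum>j<n. y (snd p) j (fst p) * v j)) ({..<K} \<times> {..<n})"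
      by (intro L2_set_mono) (auto simp: distrib_right sum.distrib norm_triangle_ineq)
    also have "\<dots> \<le> L2_set (\<lambda>p. cmod (\<Sum>j<n. x (snd p) j (fst p) * v j)) ({..<K} \<times> {..<n}) + L2_set (\<lambda>p. cmod (\<Sum>j<n. y (snd p) j (fst p) * v j)) ({..<K} \<times> {..<n})"
      by (rule L2_set_triangle_ineq)
    also have "\<dots> \<le> c * L2_set (\<lambda>j. cmod (v j)) {..<n} + d * L2_set (\<lambda>j. cmod (v j)) {..<n}"
      using assms by (intro add_mono) (simp_all add: col_bdd_L2)
    finally show ?thesis by (simp add: distrib_right)
  qed
  then show ?thesis using assms by (simp add: col_bdd_L2)
qed

lemma col_bdd_scale:
  assumes "col_bdd n x c" shows "col_bdd n (\<lambda>i j k. a * x i j k) (cmod a * c)"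
proof -
  have "(\<Sum>k<K. \<Sum>i<n. (cmod (\<Sum>j<n. a * x i j k * v j))\<^sup>2) = (cmod a)\<^sup>2 * (\<Sum>k<K. \<Sum>i<n. (cmod (\<Sum>j<n. x i j k * v j))\<^sup>2)" for v K
    by (simp add: mult.assoc sum_distrib_left[symmetric] norm_mult power_mult_distrib)
  then show ?thesis using assms unfolding col_bdd_def
    by (auto simp: power_mult_distrib mult.assoc intro: mult_left_mono)
qed

text \<open>Cauchy-Schwarz in each row of the matrix, with a factor that grows with
  \<open>n\<close>. This is harmless wherever \<open>n\<close> is fixed and \<open>M\<close> can be
  made small, as for tails and perturbations.\<close>

lemma col_bdd_entries:
  assumes "\<And>i j. i < n \<Longrightarrow> j < n \<Longrightarrow> x i j \<in> ell2 \<and> l2 (x i j) \<le> M" "0 \<le> M"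
  shows "col_bdd n x (real n * M)"
  unfolding col_bdd_def
proof (intro allI)
  fix v :: "nat \<Rightarrow> complex" and K
  define V where "V = (\<Sum>j<n. (cmod (v j))\<^sup>2)"
  have "(\<Sum>k<K. \<Sum>i<n. (cmod (\<Sum>j<n. x i j k * v j))\<^sup>2) \<le> (\<Sum>k<K. \<Sum>i<n. (\<Sum>j<n. (cmod (x i j k))\<^sup>2) * V)"
    unfolding V_def by (intro sum_mono cmod_sum_cs2)
  also have "\<dots> = (\<Sum>i<n. \<Sum>j<n. \<Sum>k<K. (cmod (x i j k))\<^sup>2) * V"
    by (simp add: sum_distrib_right sum.swap[of _ "{..<n}" "{..<K}"])
  also have "\<dots> \<le> (\<Sum>i<n. \<Sum>j<n. M\<^sup>2) * V"
    using assms by (intro mult_right_mono sum_mono order_trans[OF ell2_partial] power_mono) (auto simp: V_def sum_nonneg)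
  finally show "(\<Sum>k<K. \<Sum>i<n. (cmod (\<Sum>j<n. x i j k * v j))\<^sup>2) \<le> (real n * M)\<^sup>2 * (\<Sum>j<n. (cmod (v j))\<^sup>2)"
    by (simp add: V_def power_mult_distrib power2_eq_square mult_ac)
qed

lemma fun_bdd_entries:
  assumes "\<And>i j z. i < n \<Longrightarrow> j < n \<Longrightarrow> z \<in> strip \<Longrightarrow> f i j z \<in> ell2 \<and> l2 (f i j z) \<le> M" "0 \<le> M"
  shows "fun_bdd n f (real n * M)"
  unfolding fun_bdd_def using assms by (auto intro!: col_bdd_entries)

text \<open>The suprema over the edges say nothing until the edge norms are known to be bounded; the
  crude entrywise bound supplies this.\<close>

lemma mnorm_FRC_le_iff:
  assumes f: "\<And>i j. i < n \<Longrightarrow> j < n \<Longrightarrow> f i j \<in> strip_fun" and c: "0 \<le> c"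
  shows "mnorm FRC n f \<le> c \<longleftrightarrow> fun_bdd n f c"
proof -
  have "\<forall>i j. \<exists>B. i < n \<and> j < n \<longrightarrow> (0 \<le> B \<and> (\<forall>z\<in>strip. l2 (f i j z) \<le> B))"
  proof (intro allI)
    fix i j
    show "\<exists>B. i < n \<and> j < n \<longrightarrow> (0 \<le> B \<and> (\<forall>z\<in>strip. l2 (f i j z) \<le> B))"
    proof (cases "i < n \<and> j < n")
      case True
      then obtain B where "0 \<le> B" "\<And>z. z \<in> strip \<Longrightarrow> l2 (f i j z) \<le> B" using strip_fun_bdd[OF f] by blast
      then show ?thesis by blast
    qed auto
  qed
  then obtain B where B: "\<And>i j. i < n \<Longrightarrow> j < n \<Longrightarrow> 0 \<le> B i j \<and> (\<forall>z\<in>strip. l2 (f i j z) \<le> B i j)" by metis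
  define M where "M = (\<Sum>i<n. \<Sum>j<n. B i j)"
  have BM: "B i j \<le> M" if "i < n" "j < n" for i j
  proof -
    have "B i j \<le> (\<Sum>j<n. B i j)" using B that by (intro member_le_sum) auto
    also have "\<dots> \<le> M" unfolding M_def using B that by (intro member_le_sum[of _ _ "\<lambda>i. \<Sum>j<n. B i j"]) (auto intro: sum_nonneg)
    finally show ?thesis .
  qed
  have M0: "0 \<le> M" unfolding M_def using B by (auto intro!: sum_nonneg)
  have "fun_bdd n f (real n * M)"
  proof (rule fun_bdd_entries[OF _ M0])
    fix i j z assume *: "i < n" "j < n" "z \<in> strip"
    then have "l2 (f i j z) \<le> B i j" using B by blast
    then show "f i j z \<in> ell2 \<and> l2 (f i j z) \<le> M" using BM[OF *(1,2)] strip_fun_ell2[OF f[OF *(1,2)] *(3)] by simp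
  qed
  then have bd: "row_mnorm n (\<lambda>i j. f i j (\<i> * t)) \<le> real n * M" "col_mnorm n (\<lambda>i j. f i j (1 + \<i> * t)) \<le> real n * M" for t :: real
    using f M0 by (auto simp: fun_bdd_def row_mnorm_eq col_mnorm_le_iff strip_fun_ell2)
  have r: "(SUP t :: real. row_mnorm n (\<lambda>i j. f i j (\<i> * t))) \<le> c \<longleftrightarrow> (\<forall>t :: real. row_mnorm n (\<lambda>i j. f i j (\<i> * t)) \<le> c)"
    by (subst cSUP_le_iff) (use bd in \<open>auto intro!: bdd_aboveI\<close>)
  have l: "(SUP t :: real. col_mnorm n (\<lambda>i j. f i j (1 + \<i> * t))) \<le> c \<longleftrightarrow> (\<forall>t :: real. col_mnorm n (\<lambda>i j. f i j (1 + \<i> * t)) \<le> c)"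
    by (subst cSUP_le_iff) (use bd in \<open>auto intro!: bdd_aboveI\<close>)
  have "mnorm FRC n f = max (SUP t :: real. row_mnorm n (\<lambda>i j. f i j (\<i> * t))) (SUP t :: real. col_mnorm n (\<lambda>i j. f i j (1 + \<i> * t)))"
    by (simp add: interp_alg_def)
  then show ?thesis unfolding fun_bdd_def using r l f c
    by (simp add: row_mnorm_eq col_mnorm_le_iff strip_fun_ell2)
qed

lemma mnorm_FRC_nonneg:
  assumes f: "\<And>i j. i < n \<Longrightarrow> j < n \<Longrightarrow> f i j \<in> strip_fun"
  shows "0 \<le> mnorm FRC n f"
proof (rule ccontr)
  assume "\<not> 0 \<le> mnorm FRC n f"
  then have neg: "mnorm FRC n f < 0" by simp
  have eq: "mnorm FRC n f = max (SUP t :: real. row_mnorm n (\<lambda>i j. f i j (\<i> * t))) (SUP t :: real. col_mnorm n (\<lambda>i j. f i j (1 + \<i> * t)))"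
    by (simp add: interp_alg_def)
  have "fun_bdd n f 0" using neg mnorm_FRC_le_iff[of n f 0] f by simp
  then have "col_mnorm n (\<lambda>i j. f i j (1 + \<i> * t)) \<le> 0" for t :: real
    using f by (auto simp: fun_bdd_def col_mnorm_le_iff strip_fun_ell2)
  then have "col_mnorm n (\<lambda>i j. f i j (1 + \<i> * t)) = 0" for t :: real
    using col_mnorm_nonneg antisym by blast
  then have "(SUP t :: real. col_mnorm n (\<lambda>i j. f i j (1 + \<i> * t))) = 0" by simp
  then show False using neg eq by simp
qed

section \<open>Lifts and the quotient norm of a matrix of jets\<close>

definition liftable :: "nat \<Rightarrow> (nat \<Rightarrow> nat \<Rightarrow> (nat \<Rightarrow> complex) \<times> (nat \<Rightarrow> complex)) \<Rightarrow> real \<Rightarrow> bool" where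
  "liftable n P c \<longleftrightarrow> (\<exists>f. (\<forall>i<n. \<forall>j<n. f i j \<in> strip_fun \<and> jet (f i j) = P i j) \<and> fun_bdd n f c)"

definition jnorm :: "nat \<Rightarrow> (nat \<Rightarrow> nat \<Rightarrow> (nat \<Rightarrow> complex) \<times> (nat \<Rightarrow> complex)) \<Rightarrow> real" where
  "jnorm n P = Inf {c. 0 \<le> c \<and> liftable n P c}"

lemma liftable_mono: "liftable n P c \<Longrightarrow> 0 \<le> c \<Longrightarrow> c \<le> d \<Longrightarrow> liftable n P d"
  unfolding liftable_def using fun_bdd_mono by blast

lemma liftable_entries:
  assumes "\<And>i j. i < n \<Longrightarrow> j < n \<Longrightarrow> P i j \<in> E2 \<and> l2 (fst (P i j)) + 3 * l2 (snd (P i j)) \<le> M" "0 \<le> M"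
  shows "liftable n P (real n * M)"
  unfolding liftable_def
proof (intro exI[of _ "\<lambda>i j. jet_lift (fst (P i j)) (snd (P i j))"] conjI allI impI)
  show "fun_bdd n (\<lambda>i j. jet_lift (fst (P i j)) (snd (P i j))) (real n * M)"
  proof (rule fun_bdd_entries)
    fix i j z assume *: "i < n" "j < n" "z \<in> strip"
    then have "fst (P i j) \<in> ell2" "snd (P i j) \<in> ell2" using assms(1) by (auto simp: mem_Times_iff)
    then show "jet_lift (fst (P i j)) (snd (P i j)) z \<in> ell2 \<and> l2 (jet_lift (fst (P i j)) (snd (P i j)) z) \<le> M"
      using jet_lift_bound[OF _ _ *(3)] assms(1)[OF *(1,2)] *(3) by (auto intro: strip_fun_ell2 jet_lift_strip_fun order_trans)
  qed (rule assms(2))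
qed (use assms(1) in \<open>auto simp: mem_Times_iff jet_jet_lift intro!: jet_lift_strip_fun\<close>)

lemma liftable_ex:
  assumes "\<And>i j. i < n \<Longrightarrow> j < n \<Longrightarrow> P i j \<in> E2"
  shows "\<exists>c\<ge>0. liftable n P c"
proof -
  define b where "b i j = l2 (fst (P i j)) + 3 * l2 (snd (P i j))" for i j
  define M where "M = (\<Sum>i<n. \<Sum>j<n. b i j)"
  have b: "0 \<le> b i j" for i j by (simp add: b_def)
  have "b i j \<le> M" if "i < n" "j < n" for i j
  proof -
    have "b i j \<le> (\<Sum>j<n. b i j)" using b that by (intro member_le_sum) auto
    also have "\<dots> \<le> M" unfolding M_def using b that by (intro member_le_sum[of _ _ "\<lambda>i. \<Sum>j<n. b i j"]) (auto intro: sum_nonneg)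
    finally show ?thesis .
  qed
  moreover have "0 \<le> M" unfolding M_def using b by (auto intro!: sum_nonneg)
  ultimately show ?thesis using assms by (intro exI[of _ "real n * M"]) (auto intro!: liftable_entries simp: b_def)
qed

lemma jnorm_le: "liftable n P c \<Longrightarrow> 0 \<le> c \<Longrightarrow> jnorm n P \<le> c"
  unfolding jnorm_def by (rule cInf_lower) (auto intro!: bdd_belowI[of _ 0])

lemma jnorm_nonneg:
  assumes "\<And>i j. i < n \<Longrightarrow> j < n \<Longrightarrow> P i j \<in> E2" shows "0 \<le> jnorm n P"
  unfolding jnorm_def using liftable_ex[OF assms] by (intro cInf_greatest) auto

lemma jnorm_less:
  assumes "\<And>i j. i < n \<Longrightarrow> j < n \<Longrightarrow> P i j \<in> E2" "jnorm n P < c" shows "liftable n P c"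
proof -
  have "\<exists>d\<in>{c. 0 \<le> c \<and> liftable n P c}. d < c"
    using assms(2) liftable_ex[OF assms(1)] unfolding jnorm_def by (intro cInf_lessD) auto
  then show ?thesis using liftable_mono by fastforce
qed

lemma liftable_cong:
  assumes "\<And>i j. i < n \<Longrightarrow> j < n \<Longrightarrow> P i j = Q i j" shows "liftable n P c \<longleftrightarrow> liftable n Q c"
  unfolding liftable_def using assms by auto

lemma jnorm_cong:
  assumes "\<And>i j. i < n \<Longrightarrow> j < n \<Longrightarrow> P i j = Q i j" shows "jnorm n P = jnorm n Q"
  unfolding jnorm_def using liftable_cong[OF assms] by simp

lemma nonempty_of_mem: "x \<in> A \<Longrightarrow> A \<noteq> {}" by blast

text \<open>A lift enters the quotient through its restriction to the strip, which changes neither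
  its jet nor its edge bounds.\<close>

lemma mnorm_dOH:
  assumes P: "\<And>i j. i < n \<Longrightarrow> j < n \<Longrightarrow> P i j \<in> E2" and x: "\<And>i j. i < n \<Longrightarrow> j < n \<Longrightarrow> x i j = jcls (P i j)"
  shows "mnorm dOH n x = jnorm n P"
proof -
  have "mnorm dOH n x = Inf {mnorm FRC n f | f. \<forall>i<n. \<forall>j<n. f i j \<in> x i j}"
    by (simp add: dOH_eq quot_alg_def)
  also have "{mnorm FRC n f | f. \<forall>i<n. \<forall>j<n. f i j \<in> x i j} = {mnorm FRC n f | f. \<forall>i<n. \<forall>j<n. f i j \<in> jcls (P i j)}"
    using x by auto
  also have "Inf \<dots> = jnorm n P"
  proof (rule antisym)
    show "Inf {mnorm FRC n f | f. \<forall>i<n. \<forall>j<n. f i j \<in> jcls (P i j)} \<le> jnorm n P"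
      unfolding jnorm_def
    proof (rule cInf_greatest)
      show "{c. 0 \<le> c \<and> liftable n P c} \<noteq> {}" using liftable_ex[OF P] by auto
      fix c assume "c \<in> {c. 0 \<le> c \<and> liftable n P c}"
      then obtain f where c: "0 \<le> c" and f: "\<forall>i<n. \<forall>j<n. f i j \<in> strip_fun \<and> jet (f i j) = P i j" "fun_bdd n f c"
        unfolding liftable_def by blast
      define g where "g i j = restrict (f i j) strip" for i j
      have g: "\<forall>i<n. \<forall>j<n. g i j \<in> jcls (P i j)" using f by (auto simp: g_def jcls_def FRC_restrict)
      have "fun_bdd n g c" using f(2) fun_bdd_cong[of n g f] by (simp add: g_def)
      then have "mnorm FRC n g \<le> c" using g c by (subst mnorm_FRC_le_iff) (auto simp: jcls_def FRC_carrier)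
      moreover have "Inf {mnorm FRC n f | f. \<forall>i<n. \<forall>j<n. f i j \<in> jcls (P i j)} \<le> mnorm FRC n g"
        by (rule cInf_lower) (use g in \<open>auto intro!: bdd_belowI[of _ 0] mnorm_FRC_nonneg simp: jcls_def FRC_carrier\<close>)
      ultimately show "Inf {mnorm FRC n f | f. \<forall>i<n. \<forall>j<n. f i j \<in> jcls (P i j)} \<le> c" by simp
    qed
    show "jnorm n P \<le> Inf {mnorm FRC n f | f. \<forall>i<n. \<forall>j<n. f i j \<in> jcls (P i j)}"
    proof (rule cInf_greatest)
      show "{mnorm FRC n f | f. \<forall>i<n. \<forall>j<n. f i j \<in> jcls (P i j)} \<noteq> {}"
      proof -
        have "\<forall>i<n. \<forall>j<n. restrict (jet_lift (fst (P i j)) (snd (P i j))) strip \<in> jcls (P i j)"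
          using jcls_nonempty P by blast
        then have "mnorm FRC n (\<lambda>i j. restrict (jet_lift (fst (P i j)) (snd (P i j))) strip)
            \<in> {mnorm FRC n f | f. \<forall>i<n. \<forall>j<n. f i j \<in> jcls (P i j)}"
          by (intro CollectI exI[of _ "\<lambda>i j. restrict (jet_lift (fst (P i j)) (snd (P i j))) strip"] conjI refl)
        then show ?thesis by (rule nonempty_of_mem)
      qed
      fix y assume "y \<in> {mnorm FRC n f | f. \<forall>i<n. \<forall>j<n. f i j \<in> jcls (P i j)}"
      then obtain f where y: "y = mnorm FRC n f" and f: "\<forall>i<n. \<forall>j<n. f i j \<in> jcls (P i j)" by blast
      have fs: "f i j \<in> strip_fun" if "i < n" "j < n" for i j using f that by (auto simp: jcls_def FRC_carrier)
      have "0 \<le> y" unfolding y by (rule mnorm_FRC_nonneg) (rule fs)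
      moreover have "fun_bdd n f y" using mnorm_FRC_le_iff[of n f y] fs y \<open>0 \<le> y\<close> by blast
      ultimately show "jnorm n P \<le> y" using fs f unfolding jcls_def
        by (intro jnorm_le) (auto simp: liftable_def intro!: exI[of _ f])
    qed
  qed
  finally show ?thesis .
qed

section \<open>Bounds for the jet at one half\<close>

text \<open>A finite functional turns the functions into one scalar function, to which the three
  lines theorem and Cauchy's inequality apply. Each term reads its own coordinate
  \<open>\<kappa> p\<close>, so the same statement serves vectors, with varying coordinate, and
  matrices at one fixed coordinate.\<close>

lemma edge_functional_bound:
  fixes a :: "'p \<Rightarrow> complex" and f :: "'p \<Rightarrow> complex \<Rightarrow> nat \<Rightarrow> complex"
  assumes I: "finite I" and f: "\<And>p. p \<in> I \<Longrightarrow> f p \<in> strip_fun"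
    and left: "\<And>t :: real. cmod (\<Sum>p\<in>I. a p * f p (\<i> * t) (\<kappa> p)) \<le> c"
    and right: "\<And>t :: real. cmod (\<Sum>p\<in>I. a p * f p (1 + \<i> * t) (\<kappa> p)) \<le> c"
  shows "cmod (\<Sum>p\<in>I. a p * fst (jet (f p)) (\<kappa> p)) \<le> c"
    and "cmod (\<Sum>p\<in>I. a p * snd (jet (f p)) (\<kappa> p)) \<le> 4 * c"
proof -
  define G where "G z = (\<Sum>p\<in>I. a p * f p z (\<kappa> p))" for z
  have "\<forall>p\<in>I. \<exists>B. \<forall>z\<in>strip. l2 (f p z) \<le> B"
    using strip_fun_bdd[OF f] by metis
  then obtain B where B: "\<And>p z. p \<in> I \<Longrightarrow> z \<in> strip \<Longrightarrow> l2 (f p z) \<le> B p" by metis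
  have cont: "continuous_on strip G"
    unfolding G_def by (intro continuous_intros strip_fun_continuous f)
  have hol: "G holomorphic_on interior strip"
    unfolding G_def by (intro holomorphic_intros strip_fun_holomorphic f)
  have bound: "cmod (G z) \<le> c" if z: "z \<in> strip" for z
  proof (rule three_lines[OF cont hol _ _ _ z])
    fix z assume z: "z \<in> strip"
    show "cmod (G z) \<le> (\<Sum>p\<in>I. cmod (a p) * B p)"
      unfolding G_def norm_mult[symmetric]
      by (intro sum_norm_le) (auto simp: norm_mult intro!: mult_left_mono order_trans[OF ell2_coord[OF strip_fun_ell2[OF f z]] B[OF _ z]])
  qed (use left right in \<open>auto simp: G_def\<close>)
  show "cmod (\<Sum>p\<in>I. a p * fst (jet (f p)) (\<kappa> p)) \<le> c"
    using bound[of "1/2"] by (simp add: G_def jet_def)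
  have "deriv G (1/2) = (\<Sum>p\<in>I. a p * sderiv (f p) (1/2) (\<kappa> p))"
    unfolding G_def by (intro DERIV_imp_deriv DERIV_sum DERIV_cmult strip_fun_deriv f) auto
  then show "cmod (\<Sum>p\<in>I. a p * snd (jet (f p)) (\<kappa> p)) \<le> 4 * c"
    using deriv_half_bound[OF cont hol bound] by (simp add: jet_def)
qed

lemma col_bdd_entry:
  assumes "col_bdd n x c" "i < n" "j < n"
  shows "(\<Sum>k<K. (cmod (x i j k))\<^sup>2) \<le> c\<^sup>2"
proof -
  define v :: "nat \<Rightarrow> complex" where "v l = (if l = j then 1 else 0)" for l
  have "(\<Sum>l<n. x i' l k * v l) = x i' j k" for i' k
    using assms(3) by (simp add: v_def if_distrib[of "\<lambda>y. _ * y"] sum.delta' cong: if_cong)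
  moreover have "(\<Sum>l<n. (cmod (v l))\<^sup>2) = 1"
    using assms(3) by (simp add: v_def if_distrib[of cmod] if_distrib[of "\<lambda>y. y\<^sup>2"] cong: if_cong)
  ultimately have "(\<Sum>k<K. \<Sum>i'<n. (cmod (x i' j k))\<^sup>2) \<le> c\<^sup>2"
    using assms(1)[unfolded col_bdd_def, rule_format, of v K] by simp
  moreover have "(\<Sum>k<K. (cmod (x i j k))\<^sup>2) \<le> (\<Sum>k<K. \<Sum>i'<n. (cmod (x i' j k))\<^sup>2)"
    using assms(2) by (intro sum_mono member_le_sum[of i _ "\<lambda>i. (cmod (x i j _))\<^sup>2"]) auto
  ultimately show ?thesis by simp
qed

text \<open>Row and column bounds alike dominate the l2 norm of a single entry, so the functionals
  of that entry are bounded on both edges.\<close>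

lemma fun_bdd_jet:
  assumes "fun_bdd n f c" "0 \<le> c" and f: "f i j \<in> strip_fun" and ij: "i < n" "j < n"
  shows "l2 (fst (jet (f i j))) \<le> c" "l2 (snd (jet (f i j))) \<le> 4 * c"
proof -
  have edge: "cmod (\<Sum>k<K. a k * f i j (\<i> * t) k) \<le> c * L2_set (\<lambda>k. cmod (a k)) {..<K}"
    "cmod (\<Sum>k<K. a k * f i j (1 + \<i> * t) k) \<le> c * L2_set (\<lambda>k. cmod (a k)) {..<K}" for a K and t :: real
  proof -
    have "L2_set (\<lambda>k. cmod (f i j (\<i> * t) k)) {..<K} \<le> c" "L2_set (\<lambda>k. cmod (f i j (1 + \<i> * t) k)) {..<K} \<le> c"
      unfolding L2_set_def using assms(1,2) ij
      by (auto simp: fun_bdd_def intro!: real_le_lsqrt sum_nonneg col_bdd_entry[of n "\<lambda>i j. f i j (1 + \<i> * t)"] col_bdd_entry[of n "\<lambda>i j. f j i (\<i> * t)" c j i])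
    then show "cmod (\<Sum>k<K. a k * f i j (\<i> * t) k) \<le> c * L2_set (\<lambda>k. cmod (a k)) {..<K}"
      "cmod (\<Sum>k<K. a k * f i j (1 + \<i> * t) k) \<le> c * L2_set (\<lambda>k. cmod (a k)) {..<K}"
      by (auto simp: mult.commute[of c] intro!: order_trans[OF cmod_sum_cs] mult_left_mono)
  qed
  have "cmod (\<Sum>k<K. a k * fst (jet (f i j)) k) \<le> c * L2_set (\<lambda>k. cmod (a k)) {..<K}" for a K
    using edge_functional_bound(1)[of "{..<_}" "\<lambda>_. f i j" _ "\<lambda>k. k", OF _ f edge] by simp
  from this[of "\<lambda>k. cnj (_ k)"]
  have "cmod (\<Sum>k<K. cnj (w k) * fst (jet (f i j)) k) \<le> c * L2_set (\<lambda>k. cmod (w k)) {..<K}" for w K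
    unfolding complex_mod_cnj .
  then show "l2 (fst (jet (f i j))) \<le> c"
    using assms(2) by (intro l2_leI self_dual_bound) auto
  have "cmod (\<Sum>k<K. a k * snd (jet (f i j)) k) \<le> 4 * c * L2_set (\<lambda>k. cmod (a k)) {..<K}" for a K
    using edge_functional_bound(2)[of "{..<_}" "\<lambda>_. f i j" _ "\<lambda>k. k", OF _ f edge] by (simp add: mult.assoc)
  from this[of "\<lambda>k. cnj (_ k)"]
  have "cmod (\<Sum>k<K. cnj (w k) * snd (jet (f i j)) k) \<le> 4 * c * L2_set (\<lambda>k. cmod (w k)) {..<K}" for w K
    unfolding complex_mod_cnj .
  then show "l2 (snd (jet (f i j))) \<le> 4 * c"
    using assms(2) by (intro l2_leI self_dual_bound) auto
qed

lemma col_bdd_single: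
  assumes "col_bdd n x c"
  shows "(\<Sum>i<n. (cmod (\<Sum>j<n. x i j k * w j))\<^sup>2) \<le> c\<^sup>2 * (\<Sum>j<n. (cmod (w j))\<^sup>2)"
proof -
  have "(\<Sum>i<n. (cmod (\<Sum>j<n. x i j k * w j))\<^sup>2) \<le> (\<Sum>k<Suc k. \<Sum>i<n. (cmod (\<Sum>j<n. x i j k * w j))\<^sup>2)"
    unfolding sum.lessThan_Suc by (simp add: sum_nonneg)
  also have "\<dots> \<le> c\<^sup>2 * (\<Sum>j<n. (cmod (w j))\<^sup>2)" using assms by (simp add: col_bdd_def del: sum.lessThan_Suc)
  finally show ?thesis .
qed

text \<open>At one coordinate \<open>k\<close> a row bound and a column bound both dominate the
  operator norm of a scalar matrix. The bilinear functionals of the matrix of \<open>k\<close>-th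
  coordinates are therefore bounded on both edges, although the row and column norms themselves
  differ.\<close>

lemma fun_bdd_jet_matrix:
  assumes "fun_bdd n f c" "0 \<le> c" and f: "\<And>i j. i < n \<Longrightarrow> j < n \<Longrightarrow> f i j \<in> strip_fun"
  shows "(\<Sum>i<n. (cmod (\<Sum>j<n. fst (jet (f i j)) k * v j))\<^sup>2) \<le> c\<^sup>2 * (\<Sum>j<n. (cmod (v j))\<^sup>2)"
    and "(\<Sum>i<n. (cmod (\<Sum>j<n. snd (jet (f i j)) k * v j))\<^sup>2) \<le> (4 * c)\<^sup>2 * (\<Sum>j<n. (cmod (v j))\<^sup>2)"
proof -
  define V where "V = L2_set (\<lambda>j. cmod (v j)) {..<n}"
  have V: "0 \<le> V" by (simp add: V_def)
  let ?I = "{..<n} \<times> {..<n}"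
  have single: "L2_set (\<lambda>i. cmod (\<Sum>j<n. x i j k * w j)) {..<n} \<le> c * L2_set (\<lambda>j. cmod (w j)) {..<n}"
    if "col_bdd n x c" for x w
  proof -
    have "(L2_set (\<lambda>i. cmod (\<Sum>j<n. x i j k * w j)) {..<n})\<^sup>2 \<le> (c * L2_set (\<lambda>j. cmod (w j)) {..<n})\<^sup>2"
      using col_bdd_single[OF that, of k w] by (simp add: L2_set_power2 power_mult_distrib)
    then show ?thesis by (rule power2_le_imp_le) (use assms(2) in simp)
  qed
  have edge: "cmod (\<Sum>p\<in>?I. (u (fst p) * v (snd p)) * f (fst p) (snd p) (\<i> * t) k) \<le> c * L2_set (\<lambda>i. cmod (u i)) {..<n} * V"
    "cmod (\<Sum>p\<in>?I. (u (fst p) * v (snd p)) * f (fst p) (snd p) (1 + \<i> * t) k) \<le> c * L2_set (\<lambda>i. cmod (u i)) {..<n} * V" for u and t :: real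
  proof -
    have "(\<Sum>p\<in>?I. (u (fst p) * v (snd p)) * f (fst p) (snd p) (\<i> * t) k) = (\<Sum>j<n. (\<Sum>i<n. f i j (\<i> * t) k * u i) * v j)"
      unfolding sum.cartesian_product' fst_conv snd_conv
      by (subst sum.swap) (simp add: sum_distrib_left sum_distrib_right mult_ac)
    also have "cmod \<dots> \<le> L2_set (\<lambda>j. cmod (\<Sum>i<n. f i j (\<i> * t) k * u i)) {..<n} * V"
      unfolding V_def by (rule cmod_sum_cs)
    also have "\<dots> \<le> c * L2_set (\<lambda>i. cmod (u i)) {..<n} * V"
      using assms(1) V by (intro mult_right_mono single[of "\<lambda>j i. f i j (\<i> * t)"]) (auto simp: fun_bdd_def)
    finally show "cmod (\<Sum>p\<in>?I. (u (fst p) * v (snd p)) * f (fst p) (snd p) (\<i> * t) k) \<le> c * L2_set (\<lambda>i. cmod (u i)) {..<n} * V" .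
    have "(\<Sum>p\<in>?I. (u (fst p) * v (snd p)) * f (fst p) (snd p) (1 + \<i> * t) k) = (\<Sum>i<n. u i * (\<Sum>j<n. f i j (1 + \<i> * t) k * v j))"
      by (simp add: sum.cartesian_product' sum_distrib_left mult_ac)
    also have "cmod \<dots> \<le> L2_set (\<lambda>i. cmod (u i)) {..<n} * L2_set (\<lambda>i. cmod (\<Sum>j<n. f i j (1 + \<i> * t) k * v j)) {..<n}"
      by (rule cmod_sum_cs)
    also have "\<dots> \<le> L2_set (\<lambda>i. cmod (u i)) {..<n} * (c * V)"
      unfolding V_def using assms(1) by (intro mult_left_mono single[of "\<lambda>i j. f i j (1 + \<i> * t)"]) (auto simp: fun_bdd_def)
    finally show "cmod (\<Sum>p\<in>?I. (u (fst p) * v (snd p)) * f (fst p) (snd p) (1 + \<i> * t) k) \<le> c * L2_set (\<lambda>i. cmod (u i)) {..<n} * V"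
      by (simp add: mult_ac)
  qed
  have fin: "finite ?I" by simp
  have f': "\<And>p. p \<in> ?I \<Longrightarrow> f (fst p) (snd p) \<in> strip_fun" using f by auto
  have dual: "(\<Sum>i<n. (cmod (\<Sum>j<n. y i j * v j))\<^sup>2) \<le> d\<^sup>2 * (\<Sum>j<n. (cmod (v j))\<^sup>2)"
    if d: "0 \<le> d" and b: "\<And>u. cmod (\<Sum>p\<in>?I. (u (fst p) * v (snd p)) * y (fst p) (snd p)) \<le> d * L2_set (\<lambda>i. cmod (u i)) {..<n} * V" for d and y :: "nat \<Rightarrow> nat \<Rightarrow> complex"
  proof -
    define w where "w i = (\<Sum>j<n. y i j * v j)" for i
    have "(\<Sum>p\<in>?I. (cnj (w (fst p)) * v (snd p)) * y (fst p) (snd p)) = (\<Sum>i<n. cnj (w i) * w i)"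
    proof -
      have "(\<Sum>j<n. cnj (w i) * v j * y i j) = cnj (w i) * w i" for i
      proof -
        have "(\<Sum>j<n. cnj (w i) * v j * y i j) = cnj (w i) * (\<Sum>j<n. y i j * v j)"
          by (simp add: sum_distrib_left mult_ac)
        then show ?thesis by (simp only: w_def)
      qed
      then show ?thesis by (simp only: sum.cartesian_product' fst_conv snd_conv)
    qed
    then have "cmod (\<Sum>i<n. cnj (w i) * w i) \<le> (d * V) * L2_set (\<lambda>i. cmod (w i)) {..<n}"
      using b[of "\<lambda>i. cnj (w i)"] by (simp add: mult_ac)
    from self_dual_bound[OF this] show ?thesis using d V by (simp add: w_def V_def power_mult_distrib L2_set_power2)
  qed
  show "(\<Sum>i<n. (cmod (\<Sum>j<n. fst (jet (f i j)) k * v j))\<^sup>2) \<le> c\<^sup>2 * (\<Sum>j<n. (cmod (v j))\<^sup>2)"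
    by (rule dual[OF assms(2)], rule edge_functional_bound(1)[OF fin f' edge])
  show "(\<Sum>i<n. (cmod (\<Sum>j<n. snd (jet (f i j)) k * v j))\<^sup>2) \<le> (4 * c)\<^sup>2 * (\<Sum>j<n. (cmod (v j))\<^sup>2)"
  proof (rule dual)
    fix u show "cmod (\<Sum>p\<in>?I. (u (fst p) * v (snd p)) * snd (jet (f (fst p) (snd p))) k) \<le> 4 * c * L2_set (\<lambda>i. cmod (u i)) {..<n} * V"
      using edge_functional_bound(2)[OF fin f' edge(1)[of u] edge(2)[of u]] by (simp add: mult.assoc)
  qed (use assms(2) in simp)
qed

lemma liftable_jet:
  assumes "liftable n P c" "0 \<le> c" "i < n" "j < n"
  shows "l2 (fst (P i j)) \<le> c" "l2 (snd (P i j)) \<le> 4 * c"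
  using assms fun_bdd_jet unfolding liftable_def by metis+

lemma jnorm_jet:
  assumes P: "\<And>i j. i < n \<Longrightarrow> j < n \<Longrightarrow> P i j \<in> E2" and ij: "i < n" "j < n"
  shows "l2 (fst (P i j)) \<le> jnorm n P" "l2 (snd (P i j)) \<le> 4 * jnorm n P"
proof -
  have l: "liftable n P (jnorm n P + e)" "0 \<le> jnorm n P + e" if "0 < e" for e
    using jnorm_less[OF P, where c = "jnorm n P + e"] jnorm_nonneg[OF P] that by auto
  show "l2 (fst (P i j)) \<le> jnorm n P"
    by (rule field_le_epsilon) (rule liftable_jet(1)[OF l ij])
  show "l2 (snd (P i j)) \<le> 4 * jnorm n P"
  proof (rule field_le_epsilon)
    fix e :: real assume "0 < e"
    then show "l2 (snd (P i j)) \<le> 4 * jnorm n P + e"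
      using liftable_jet(2)[OF l[of "e / 4"] ij] by simp
  qed
qed

section \<open>The operator space structure\<close>

lemma liftable_add:
  assumes "liftable n P c" "liftable n Q d" "0 \<le> c" "0 \<le> d"
  shows "liftable n (\<lambda>i j. jadd (P i j) (Q i j)) (c + d)"
proof -
  obtain f g where f: "\<forall>i<n. \<forall>j<n. f i j \<in> strip_fun \<and> jet (f i j) = P i j" "fun_bdd n f c"
    and g: "\<forall>i<n. \<forall>j<n. g i j \<in> strip_fun \<and> jet (g i j) = Q i j" "fun_bdd n g d"
    using assms unfolding liftable_def by blast
  show ?thesis unfolding liftable_def
  proof (intro exI[of _ "\<lambda>i j z k. f i j z k + g i j z k"] conjI allI impI)
    show "fun_bdd n (\<lambda>i j z k. f i j z k + g i j z k) (c + d)"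
      using f(2) g(2) assms(3,4) unfolding fun_bdd_def by (auto intro: col_bdd_add)
  qed (use f(1) g(1) in \<open>auto simp: strip_fun_add jet_add jadd_def\<close>)
qed

lemma liftable_scale:
  assumes "liftable n P c"
  shows "liftable n (\<lambda>i j. jscale a (P i j)) (cmod a * c)"
proof -
  obtain f where f: "\<forall>i<n. \<forall>j<n. f i j \<in> strip_fun \<and> jet (f i j) = P i j" "fun_bdd n f c"
    using assms unfolding liftable_def by blast
  show ?thesis unfolding liftable_def
  proof (intro exI[of _ "\<lambda>i j z k. a * f i j z k"] conjI allI impI)
    show "fun_bdd n (\<lambda>i j z k. a * f i j z k) (cmod a * c)"
      using f(2) unfolding fun_bdd_def by (auto intro: col_bdd_scale)
  qed (use f(1) in \<open>auto simp: strip_fun_scale jet_scale jscale_def\<close>)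
qed

text \<open>At level one both edge norms are the l2 norm, so the product is contractive with
  constant 1, as submultiplicativity in \<open>banach_algebra\<close> requires.\<close>

lemma liftable_mult:
  assumes "liftable 1 P c" "liftable 1 Q d" "0 \<le> c" "0 \<le> d"
  shows "liftable 1 (\<lambda>i j. jmult (P i j) (Q i j)) (c * d)"
proof -
  obtain f g where f: "f 0 0 \<in> strip_fun" "jet (f 0 0) = P 0 0" "fun_bdd 1 f c"
    and g: "g 0 0 \<in> strip_fun" "jet (g 0 0) = Q 0 0" "fun_bdd 1 g d"
    using assms unfolding liftable_def by auto
  have m: "col_bdd 1 (\<lambda>i j k. x i j k * y i j k) (c * d)"
    if x: "col_bdd 1 x c" and y: "col_bdd 1 y d" for x y
  proof -
    have ex: "x 0 0 \<in> ell2" "l2 (x 0 0) \<le> c" using col_bdd_entry[OF x, of 0 0] assms(3)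
      by (auto intro: ell2_I l2_leI)
    have ey: "y 0 0 \<in> ell2" "l2 (y 0 0) \<le> d" using col_bdd_entry[OF y, of 0 0] assms(4)
      by (auto intro: ell2_I l2_leI)
    have "l2 (\<lambda>k. x 0 0 k * y 0 0 k) \<le> c * d"
      by (rule order_trans[OF ell2_mult(2)[OF ex(1) ey(1)]]) (intro mult_mono ex ey assms; simp)
    then have "col_bdd 1 (\<lambda>i j k. x i j k * y i j k) (real 1 * (c * d))"
      using assms by (intro col_bdd_entries) (auto intro: ell2_mult ex ey)
    then show ?thesis by simp
  qed
  show ?thesis unfolding liftable_def
  proof (intro exI[of _ "\<lambda>i j z k. f i j z k * g i j z k"] conjI allI impI)
    show "fun_bdd 1 (\<lambda>i j z k. f i j z k * g i j z k) (c * d)"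
      using f(3) g(3) unfolding fun_bdd_def by (intro conjI allI m) blast+
  qed (use f g in \<open>auto simp: strip_fun_mult jet_mult jmult_def\<close>)
qed

lemma sum_lessThan_add: "(\<Sum>i<m + n. g i) = (\<Sum>i<m. g i) + (\<Sum>i<n. g (m + i :: nat))" for g :: "nat \<Rightarrow> 'a :: comm_monoid_add"
  by (induction n) (simp_all add: add_ac)

lemma col_bdd_dsum:
  assumes x: "col_bdd m x c" and y: "col_bdd n y c"
  shows "col_bdd (m + n) (\<lambda>i j. if i < m \<and> j < m then x i j else if m \<le> i \<and> m \<le> j then y (i - m) (j - m) else (\<lambda>k. 0)) c"
    (is "col_bdd _ ?z _")
  unfolding col_bdd_def
proof (intro allI)
  fix v :: "nat \<Rightarrow> complex" and K
  have 1: "(\<Sum>j<m + n. ?z i j k * v j) = (\<Sum>j<m. x i j k * v j)" if "i < m" for i k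
    using that unfolding sum_lessThan_add by simp
  have 2: "(\<Sum>j<m + n. ?z (m + i) j k * v j) = (\<Sum>j<n. y i j k * v (m + j))" for i k
    unfolding sum_lessThan_add by simp
  have "(\<Sum>k<K. \<Sum>i<m + n. (cmod (\<Sum>j<m + n. ?z i j k * v j))\<^sup>2)
     = (\<Sum>k<K. \<Sum>i<m. (cmod (\<Sum>j<m. x i j k * v j))\<^sup>2) + (\<Sum>k<K. \<Sum>i<n. (cmod (\<Sum>j<n. y i j k * v (m + j)))\<^sup>2)"
    unfolding sum_lessThan_add[of _ m n] sum.distrib[symmetric] 2[unfolded sum_lessThan_add]
    by (intro sum.cong arg_cong2[of _ _ _ _ "(+)"] refl) (simp add: 1[unfolded sum_lessThan_add])
  also have "\<dots> \<le> c\<^sup>2 * (\<Sum>j<m. (cmod (v j))\<^sup>2) + c\<^sup>2 * (\<Sum>j<n. (cmod (v (m + j)))\<^sup>2)"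
    using x y unfolding col_bdd_def by (intro add_mono) auto
  finally show "(\<Sum>k<K. \<Sum>i<m + n. (cmod (\<Sum>j<m + n. ?z i j k * v j))\<^sup>2) \<le> c\<^sup>2 * (\<Sum>j<m + n. (cmod (v j))\<^sup>2)"
    unfolding sum_lessThan_add[of _ m n] by (simp add: distrib_left)
qed

lemma liftable_dsum:
  assumes "liftable m P c" "liftable n Q c"
  shows "liftable (m + n) (\<lambda>i j. if i < m \<and> j < m then P i j else if m \<le> i \<and> m \<le> j then Q (i - m) (j - m) else jzero) c"
proof -
  obtain f g where f: "\<forall>i<m. \<forall>j<m. f i j \<in> strip_fun \<and> jet (f i j) = P i j" "fun_bdd m f c"
    and g: "\<forall>i<n. \<forall>j<n. g i j \<in> strip_fun \<and> jet (g i j) = Q i j" "fun_bdd n g c"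
    using assms unfolding liftable_def by blast
  define h where "h i j = (if i < m \<and> j < m then f i j else if m \<le> i \<and> m \<le> j then g (i - m) (j - m) else (\<lambda>z k. 0))" for i j
  show ?thesis unfolding liftable_def
  proof (intro exI[of _ h] conjI allI impI)
    have "row_bdd (m + n) (\<lambda>i j. h i j (\<i> * t)) c" "col_bdd (m + n) (\<lambda>i j. h i j (1 + \<i> * t)) c" for t :: real
    proof -
      have eq: "h i j z = (if i < m \<and> j < m then f i j z else if m \<le> i \<and> m \<le> j then g (i - m) (j - m) z else (\<lambda>k. 0))" for i j z
        by (simp add: h_def)
      have sw: "h j i z = (if i < m \<and> j < m then f j i z else if m \<le> i \<and> m \<le> j then g (j - m) (i - m) z else (\<lambda>k. 0))" for i j z
        by (auto simp: h_def)
      show "row_bdd (m + n) (\<lambda>i j. h i j (\<i> * t)) c"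
        unfolding sw using f(2) g(2) by (intro col_bdd_dsum) (auto simp: fun_bdd_def)
      show "col_bdd (m + n) (\<lambda>i j. h i j (1 + \<i> * t)) c"
        unfolding eq using f(2) g(2) by (intro col_bdd_dsum) (auto simp: fun_bdd_def)
    qed
    then show "fun_bdd (m + n) h c" by (simp add: fun_bdd_def)
  qed (use f(1) g(1) in \<open>auto simp: h_def jet_zero\<close>)
qed

lemma col_bdd_block:
  assumes x: "col_bdd (m + n) x c"
  shows "col_bdd m x c" "col_bdd n (\<lambda>i j. x (m + i) (m + j)) c"
proof -
  show "col_bdd m x c" unfolding col_bdd_def
  proof (intro allI)
    fix v :: "nat \<Rightarrow> complex" and K
    define w where "w j = (if j < m then v j else 0)" for j
    have s: "(\<Sum>j<m + n. x i j k * w j) = (\<Sum>j<m. x i j k * v j)" for i k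
      unfolding sum_lessThan_add by (simp add: w_def)
    have "(\<Sum>k<K. \<Sum>i<m. (cmod (\<Sum>j<m. x i j k * v j))\<^sup>2) \<le> (\<Sum>k<K. \<Sum>i<m + n. (cmod (\<Sum>j<m + n. x i j k * w j))\<^sup>2)"
      unfolding s sum_lessThan_add[of "\<lambda>i. (cmod (\<Sum>j<m. x i j _ * v j))\<^sup>2" m n] by (intro sum_mono) (simp add: sum_nonneg)
    also have "\<dots> \<le> c\<^sup>2 * (\<Sum>j<m + n. (cmod (w j))\<^sup>2)" using x unfolding col_bdd_def by blast
    also have "(\<Sum>j<m + n. (cmod (w j))\<^sup>2) = (\<Sum>j<m. (cmod (v j))\<^sup>2)" unfolding sum_lessThan_add by (simp add: w_def)
    finally show "(\<Sum>k<K. \<Sum>i<m. (cmod (\<Sum>j<m. x i j k * v j))\<^sup>2) \<le> c\<^sup>2 * (\<Sum>j<m. (cmod (v j))\<^sup>2)" .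
  qed
  show "col_bdd n (\<lambda>i j. x (m + i) (m + j)) c" unfolding col_bdd_def
  proof (intro allI)
    fix v :: "nat \<Rightarrow> complex" and K
    define w where "w j = (if j < m then 0 else v (j - m))" for j
    have s: "(\<Sum>j<m + n. x i j k * w j) = (\<Sum>j<n. x i (m + j) k * v j)" for i k
      unfolding sum_lessThan_add by (simp add: w_def)
    have "(\<Sum>k<K. \<Sum>i<n. (cmod (\<Sum>j<n. x (m + i) (m + j) k * v j))\<^sup>2) \<le> (\<Sum>k<K. \<Sum>i<m + n. (cmod (\<Sum>j<m + n. x i j k * w j))\<^sup>2)"
      unfolding s sum_lessThan_add[of "\<lambda>i. (cmod (\<Sum>j<n. x i (m + j) _ * v j))\<^sup>2" m n] by (intro sum_mono) (simp add: sum_nonneg)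
    also have "\<dots> \<le> c\<^sup>2 * (\<Sum>j<m + n. (cmod (w j))\<^sup>2)" using x unfolding col_bdd_def by blast
    also have "(\<Sum>j<m + n. (cmod (w j))\<^sup>2) = (\<Sum>j<n. (cmod (v j))\<^sup>2)" unfolding sum_lessThan_add by (simp add: w_def)
    finally show "(\<Sum>k<K. \<Sum>i<n. (cmod (\<Sum>j<n. x (m + i) (m + j) k * v j))\<^sup>2) \<le> c\<^sup>2 * (\<Sum>j<n. (cmod (v j))\<^sup>2)" .
  qed
qed

text \<open>Compressing a lift to a diagonal block gives a lift of the block; this is the lower
  bound in the axiom on direct sums.\<close>

lemma liftable_block:
  assumes "liftable (m + n) P c"
  shows "liftable m P c" "liftable n (\<lambda>i j. P (m + i) (m + j)) c"
proof -
  obtain f where f: "\<forall>i<m + n. \<forall>j<m + n. f i j \<in> strip_fun \<and> jet (f i j) = P i j" "fun_bdd (m + n) f c"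
    using assms unfolding liftable_def by blast
  have b: "fun_bdd m f c" "fun_bdd n (\<lambda>i j. f (m + i) (m + j)) c"
    using f(2) unfolding fun_bdd_def by (auto dest: col_bdd_block)
  show "liftable m P c" unfolding liftable_def using f(1) b(1) by (intro exI[of _ f]) auto
  show "liftable n (\<lambda>i j. P (m + i) (m + j)) c" unfolding liftable_def
    using f(1) b(2) by (intro exI[of _ "\<lambda>i j. f (m + i) (m + j)"]) auto
qed

text \<open>The scalar factors enter through their action inequalities rather than through
  \<open>cmat_norm\<close>, so that the row case can be obtained from the transposed
  factors.\<close>

lemma col_bdd_sandwich:
  assumes x: "col_bdd m x c"
    and A: "\<And>u. (\<Sum>i<n. (cmod (\<Sum>k<m. \<alpha> i k * u k))\<^sup>2) \<le> a\<^sup>2 * (\<Sum>k<m. (cmod (u k))\<^sup>2)"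
    and B: "\<And>u. (\<Sum>l<m. (cmod (\<Sum>j<n. \<beta> l j * u j))\<^sup>2) \<le> b\<^sup>2 * (\<Sum>j<n. (cmod (u j))\<^sup>2)"
  shows "col_bdd n (\<lambda>i j r. \<Sum>k<m. \<Sum>l<m. \<alpha> i k * \<beta> l j * x k l r) (a * c * b)"
  unfolding col_bdd_def
proof (intro allI)
  fix v :: "nat \<Rightarrow> complex" and K
  define w where "w l = (\<Sum>j<n. \<beta> l j * v j)" for l
  have s: "(\<Sum>j<n. (\<Sum>k<m. \<Sum>l<m. \<alpha> i k * \<beta> l j * x k l r) * v j) = (\<Sum>k<m. \<alpha> i k * (\<Sum>l<m. x k l r * w l))" for i r
  proof -
    have "(\<Sum>j<n. (\<Sum>k<m. \<Sum>l<m. \<alpha> i k * \<beta> l j * x k l r) * v j) = (\<Sum>j<n. \<Sum>k<m. \<Sum>l<m. \<alpha> i k * (x k l r * (\<beta> l j * v j)))"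
      by (simp add: sum_distrib_left sum_distrib_right mult_ac)
    also have "\<dots> = (\<Sum>k<m. \<Sum>j<n. \<Sum>l<m. \<alpha> i k * (x k l r * (\<beta> l j * v j)))" by (rule sum.swap)
    also have "\<dots> = (\<Sum>k<m. \<Sum>l<m. \<Sum>j<n. \<alpha> i k * (x k l r * (\<beta> l j * v j)))" by (intro sum.cong refl sum.swap)
    finally show ?thesis by (simp add: w_def sum_distrib_left)
  qed
  have "(\<Sum>r<K. \<Sum>i<n. (cmod (\<Sum>j<n. (\<Sum>k<m. \<Sum>l<m. \<alpha> i k * \<beta> l j * x k l r) * v j))\<^sup>2)
      \<le> (\<Sum>r<K. a\<^sup>2 * (\<Sum>k<m. (cmod (\<Sum>l<m. x k l r * w l))\<^sup>2))"
    unfolding s by (intro sum_mono A)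
  also have "\<dots> = a\<^sup>2 * (\<Sum>r<K. \<Sum>k<m. (cmod (\<Sum>l<m. x k l r * w l))\<^sup>2)" by (simp add: sum_distrib_left)
  also have "\<dots> \<le> a\<^sup>2 * (c\<^sup>2 * (\<Sum>l<m. (cmod (w l))\<^sup>2))" using x unfolding col_bdd_def by (intro mult_left_mono) auto
  also have "\<dots> \<le> a\<^sup>2 * (c\<^sup>2 * (b\<^sup>2 * (\<Sum>j<n. (cmod (v j))\<^sup>2)))" unfolding w_def by (intro mult_left_mono B) auto
  finally show "(\<Sum>r<K. \<Sum>i<n. (cmod (\<Sum>j<n. (\<Sum>k<m. \<Sum>l<m. \<alpha> i k * \<beta> l j * x k l r) * v j))\<^sup>2) \<le> (a * c * b)\<^sup>2 * (\<Sum>j<n. (cmod (v j))\<^sup>2)"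
    by (simp add: power_mult_distrib mult_ac)
qed

definition jsandwich where
  "jsandwich m \<alpha> P \<beta> = (\<lambda>i j. (\<lambda>r. \<Sum>k<m. \<Sum>l<m. \<alpha> i k * \<beta> l j * fst (P k l) r, \<lambda>r. \<Sum>k<m. \<Sum>l<m. \<alpha> i k * \<beta> l j * snd (P k l) r))"

lemma liftable_sandwich:
  assumes "liftable m P c"
  shows "liftable n (jsandwich m \<alpha> P \<beta>) (cmat_norm n m \<alpha> * c * cmat_norm m n \<beta>)"
proof -
  obtain f where f: "\<forall>i<m. \<forall>j<m. f i j \<in> strip_fun \<and> jet (f i j) = P i j" "fun_bdd m f c"
    using assms unfolding liftable_def by blast
  define h where "h i j z r = (\<Sum>k<m. \<Sum>l<m. \<alpha> i k * \<beta> l j * f k l z r)" for i j z r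
  have hs: "h i j = (\<lambda>z r. \<Sum>k<m. \<Sum>l<m. \<alpha> i k * \<beta> l j * f k l z r)" for i j by (simp add: h_def fun_eq_iff)
  show ?thesis unfolding liftable_def
  proof (intro exI[of _ h] conjI allI impI)
    fix i j
    show "h i j \<in> strip_fun" unfolding hs using f(1) by (intro strip_fun_sum strip_fun_scale) auto
    show "jet (h i j) = jsandwich m \<alpha> P \<beta> i j"
    proof -
      have inner: "(\<lambda>z r. \<Sum>l<m. \<alpha> i k * \<beta> l j * f k l z r) \<in> strip_fun"
        "jet (\<lambda>z r. \<Sum>l<m. \<alpha> i k * \<beta> l j * f k l z r) = (\<lambda>r. \<Sum>l<m. \<alpha> i k * \<beta> l j * fst (P k l) r, \<lambda>r. \<Sum>l<m. \<alpha> i k * \<beta> l j * snd (P k l) r)"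
        if "k < m" for k
      proof -
        have s: "(\<lambda>z r. \<alpha> i k * \<beta> l j * f k l z r) \<in> strip_fun" if "l < m" for l
          using f(1) that \<open>k < m\<close> by (intro strip_fun_scale) auto
        then show "(\<lambda>z r. \<Sum>l<m. \<alpha> i k * \<beta> l j * f k l z r) \<in> strip_fun" by (intro strip_fun_sum) auto
        show "jet (\<lambda>z r. \<Sum>l<m. \<alpha> i k * \<beta> l j * f k l z r) = (\<lambda>r. \<Sum>l<m. \<alpha> i k * \<beta> l j * fst (P k l) r, \<lambda>r. \<Sum>l<m. \<alpha> i k * \<beta> l j * snd (P k l) r)"
          by (subst jet_sum) (use s f(1) \<open>k < m\<close> in \<open>auto simp: jet_scale intro!: sum.cong ext\<close>)
      qed
      show ?thesis unfolding hs jsandwich_def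
        by (subst jet_sum) (use inner in \<open>auto intro!: sum.cong ext\<close>)
    qed
  next
    have "col_bdd n (\<lambda>i j. h i j (1 + \<i> * t)) (cmat_norm n m \<alpha> * c * cmat_norm m n \<beta>)" for t :: real
      unfolding h_def using f(2)
      by (intro col_bdd_sandwich[of m "\<lambda>i j. f i j (1 + \<i> * t)"] cmat_norm_bound2) (simp add: fun_bdd_def)
    moreover have "row_bdd n (\<lambda>i j. h i j (\<i> * t)) (cmat_norm n m \<alpha> * c * cmat_norm m n \<beta>)" for t :: real
    proof -
      \<comment> \<open>In the row condition \<open>\<alpha>\<close> and \<open>\<beta>\<close> are
        transposed and exchange their roles.\<close>
      have "col_bdd n (\<lambda>i j r. \<Sum>l<m. \<Sum>k<m. \<beta> l i * \<alpha> j k * f k l (\<i> * t) r) (cmat_norm m n \<beta> * c * cmat_norm n m \<alpha>)"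
        using f(2) cmat_norm_bound2_transpose[where m = m and a = \<beta> and n = n] cmat_norm_bound2_transpose[where m = n and a = \<alpha> and n = m]
        by (intro col_bdd_sandwich[where m = m and x = "\<lambda>i j. f j i (\<i> * t)" and c = c and n = n and \<alpha> = "\<lambda>i l. \<beta> l i" and \<beta> = "\<lambda>k j. \<alpha> j k"]) (simp_all add: fun_bdd_def mult.commute)
      moreover have "(\<lambda>i j. h j i (\<i> * t)) = (\<lambda>i j r. \<Sum>l<m. \<Sum>k<m. \<beta> l i * \<alpha> j k * f k l (\<i> * t) r)"
        unfolding h_def by (intro ext) (subst sum.swap, simp add: mult_ac)
      ultimately show ?thesis by (simp add: mult_ac)
    qed
    ultimately show "fun_bdd n h (cmat_norm n m \<alpha> * c * cmat_norm m n \<beta>)" by (simp add: fun_bdd_def)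
  qed
qed

lemma ell2_complete:
  assumes u: "\<And>m. u m \<in> ell2" and C: "\<And>e. 0 < e \<Longrightarrow> \<exists>N. \<forall>m\<ge>N. \<forall>k\<ge>N. l2 (\<lambda>j. u m j - u k j) < e"
  shows "\<exists>l\<in>ell2. (\<lambda>m. l2 (\<lambda>j. u m j - l j)) \<longlonglongrightarrow> 0"
proof -
  have "Cauchy (\<lambda>m. u m j)" for j
  proof (rule metric_CauchyI)
    fix e :: real assume "0 < e"
    from C[OF this] obtain N where N: "\<forall>m\<ge>N. \<forall>k\<ge>N. l2 (\<lambda>j. u m j - u k j) < e" by blast
    have "dist (u m j) (u k j) < e" if "m \<ge> N" "k \<ge> N" for m k
      using ell2_coord[OF ell2_diff(1)[OF u[of m] u[of k]], of j] N that by (fastforce simp: dist_norm)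
    then show "\<exists>N. \<forall>m\<ge>N. \<forall>k\<ge>N. dist (u m j) (u k j) < e" by blast
  qed
  then have "\<forall>j. \<exists>l. (\<lambda>m. u m j) \<longlonglongrightarrow> l" by (auto simp: Cauchy_convergent_iff convergent_def)
  then obtain l where l: "\<And>j. (\<lambda>m. u m j) \<longlonglongrightarrow> l j" by metis
  have main: "\<exists>N. \<forall>m\<ge>N. \<forall>K. (\<Sum>j<K. (cmod (u m j - l j))\<^sup>2) \<le> e\<^sup>2" if e: "0 < e" for e
  proof -
    from C[OF e] obtain N where N: "\<forall>m\<ge>N. \<forall>k\<ge>N. l2 (\<lambda>j. u m j - u k j) < e" by blast
    have "(\<Sum>j<K. (cmod (u m j - l j))\<^sup>2) \<le> e\<^sup>2" if m: "m \<ge> N" for m K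
    proof (rule LIMSEQ_le_const2)
      show "(\<lambda>k. \<Sum>j<K. (cmod (u m j - u k j))\<^sup>2) \<longlonglongrightarrow> (\<Sum>j<K. (cmod (u m j - l j))\<^sup>2)"
        by (intro tendsto_intros l)
      have "(\<Sum>j<K. (cmod (u m j - u k j))\<^sup>2) \<le> e\<^sup>2" if "k \<ge> N" for k
        using N m that by (intro order_trans[OF ell2_partial[OF ell2_diff(1)[OF u[of m] u[of k]]]] power_mono) (auto intro: less_imp_le)
      then show "\<exists>N. \<forall>k\<ge>N. (\<Sum>j<K. (cmod (u m j - u k j))\<^sup>2) \<le> e\<^sup>2" by blast
    qed
    then show ?thesis by blast
  qed
  obtain N where "\<forall>m\<ge>N. \<forall>K. (\<Sum>j<K. (cmod (u m j - l j))\<^sup>2) \<le> 1\<^sup>2" using main[of 1] by auto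
  then have "(\<lambda>j. u N j - l j) \<in> ell2" by (intro ell2_I) auto
  from ell2_diff(1)[OF u[of N] this] have "l \<in> ell2" by simp
  moreover have "(\<lambda>m. l2 (\<lambda>j. u m j - l j)) \<longlonglongrightarrow> 0"
  proof (rule LIMSEQ_I)
    fix r :: real assume "0 < r"
    then obtain N where N: "\<forall>m\<ge>N. \<forall>K. (\<Sum>j<K. (cmod (u m j - l j))\<^sup>2) \<le> (r / 2)\<^sup>2" using main[of "r / 2"] by auto
    have "l2 (\<lambda>j. u m j - l j) \<le> r / 2" if "m \<ge> N" for m
      using N that \<open>0 < r\<close> by (intro l2_leI) auto
    then show "\<exists>N. \<forall>m\<ge>N. norm (l2 (\<lambda>j. u m j - l j) - 0) < r" using \<open>0 < r\<close>
      by (intro exI[of _ N]) fastforce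
  qed
  ultimately show ?thesis by blast
qed

lemma jadd_ring:
  "jadd (jadd a b) e = jadd a (jadd b e)" "jadd a b = jadd b a" "jadd jzero a = a"
  "jadd a (jscale (-1) a) = jzero" "jscale c (jadd a b) = jadd (jscale c a) (jscale c b)"
  "jscale (c + d) a = jadd (jscale c a) (jscale d a)" "jscale (c * d) a = jscale c (jscale d a)"
  "jscale 1 a = a" for c d :: complex
  by (simp_all add: jadd_def jscale_def fun_eq_iff prod_eq_iff algebra_simps)

lemma jmult_ring:
  "jmult (jmult a b) c = jmult a (jmult b c)"
  "jmult (jadd a b) c = jadd (jmult a c) (jmult b c)" "jmult c (jadd a b) = jadd (jmult c a) (jmult c b)"
  "jmult (jscale s a) b = jscale s (jmult a b)" "jmult a (jscale s b) = jscale s (jmult a b)"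
  by (simp_all add: jadd_def jscale_def jmult_def fun_eq_iff prod_eq_iff algebra_simps)

lemma jcls_carrier [simp]: "a \<in> E2 \<Longrightarrow> jcls a \<in> vcarrier dOH"
  by (auto simp: dOH_carrier)

lemma dOH_ball: "(\<forall>A\<in>vcarrier dOH. Q A) \<longleftrightarrow> (\<forall>a\<in>E2. Q (jcls a))"
  by (auto simp: dOH_carrier)

lemma dOH_sub: "a \<in> E2 \<Longrightarrow> b \<in> E2 \<Longrightarrow> vsub dOH (jcls a) (jcls b) = jcls (jadd a (jscale (-1) b))"
  by (simp add: vsub_def dOH_scale dOH_add del: mem_Sigma_iff)

lemma dOH_cvector_space: "cvector_space dOH"
  unfolding cvector_space_def dOH_ball
proof (intro conjI ballI allI)
  fix a b assume "a \<in> E2" "b \<in> E2"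
  then show "vadd dOH (jcls a) (jcls b) = vadd dOH (jcls b) (jcls a)"
    by (simp add: dOH_add jadd_ring(2)[of a b] del: mem_Sigma_iff)
qed (simp_all add: dOH_zero dOH_add dOH_scale jadd_ring(1,3-) del: mem_Sigma_iff)

lemma dOH_mats:
  assumes "x \<in> mats dOH n"
  shows "\<And>i j. i < n \<Longrightarrow> j < n \<Longrightarrow> jof (x i j) \<in> E2" "\<And>i j. i < n \<Longrightarrow> j < n \<Longrightarrow> x i j = jcls (jof (x i j))"
    "mnorm dOH n x = jnorm n (\<lambda>i j. jof (x i j))"
proof -
  show a: "\<And>i j. i < n \<Longrightarrow> j < n \<Longrightarrow> jof (x i j) \<in> E2" "\<And>i j. i < n \<Longrightarrow> j < n \<Longrightarrow> x i j = jcls (jof (x i j))"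
    using assms jof_carrier by (auto simp: mats_def)
  show "mnorm dOH n x = jnorm n (\<lambda>i j. jof (x i j))" by (rule mnorm_dOH[OF a])
qed

lemma vnorm_dOH: "a \<in> E2 \<Longrightarrow> vnorm dOH (jcls a) = jnorm 1 (\<lambda>_ _. a)"
  unfolding vnorm_def by (rule mnorm_dOH) simp_all

lemma jnorm_leI:
  assumes "\<And>e. 0 < e \<Longrightarrow> liftable n P (c + e)" "0 \<le> c" shows "jnorm n P \<le> c"
proof (rule field_le_epsilon)
  fix e :: real assume "0 < e"
  then show "jnorm n P \<le> c + e" using assms by (intro jnorm_le) auto
qed

lemma jnorm_triangle:
  assumes P: "\<And>i j. i < n \<Longrightarrow> j < n \<Longrightarrow> P i j \<in> E2" and Q: "\<And>i j. i < n \<Longrightarrow> j < n \<Longrightarrow> Q i j \<in> E2"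
  shows "jnorm n (\<lambda>i j. jadd (P i j) (Q i j)) \<le> jnorm n P + jnorm n Q"
proof (rule jnorm_leI)
  fix e :: real assume e: "0 < e"
  have "liftable n (\<lambda>i j. jadd (P i j) (Q i j)) ((jnorm n P + e/2) + (jnorm n Q + e/2))"
    using e jnorm_nonneg[OF P] jnorm_nonneg[OF Q] by (intro liftable_add jnorm_less[OF P] jnorm_less[OF Q]) auto
  then show "liftable n (\<lambda>i j. jadd (P i j) (Q i j)) (jnorm n P + jnorm n Q + e)" by (simp add: algebra_simps)
qed (use jnorm_nonneg[OF P] jnorm_nonneg[OF Q] in simp)

lemma jnorm_scale_le:
  assumes P: "\<And>i j. i < n \<Longrightarrow> j < n \<Longrightarrow> P i j \<in> E2"
  shows "jnorm n (\<lambda>i j. jscale a (P i j)) \<le> cmod a * jnorm n P"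
proof (rule jnorm_leI)
  fix e :: real assume e: "0 < e"
  define d where "d = e / (cmod a + 1)"
  have "0 < cmod a + 1" using norm_ge_zero[of a] by linarith
  then have d: "0 < d" "(cmod a + 1) * d = e" using e by (auto simp: d_def)
  then have d: "0 < d" "cmod a * d \<le> e" by (auto simp: distrib_right)
  have "liftable n (\<lambda>i j. jscale a (P i j)) (cmod a * (jnorm n P + d))"
    using d by (intro liftable_scale jnorm_less[OF P]) auto
  then show "liftable n (\<lambda>i j. jscale a (P i j)) (cmod a * jnorm n P + e)"
    using d jnorm_nonneg[OF P] by (rule_tac liftable_mono) (auto simp: distrib_left)
qed (simp add: jnorm_nonneg[OF P])

lemma jnorm_scale:
  assumes P: "\<And>i j. i < n \<Longrightarrow> j < n \<Longrightarrow> P i j \<in> E2"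
  shows "jnorm n (\<lambda>i j. jscale a (P i j)) = cmod a * jnorm n P"
proof (cases "a = 0")
  case True
  then show ?thesis using jnorm_scale_le[of n P a] jnorm_nonneg[of n "\<lambda>i j. jscale a (P i j)"] P by fastforce
next
  case False
  have "jnorm n P = jnorm n (\<lambda>i j. jscale (inverse a) (jscale a (P i j)))"
    using False by (intro jnorm_cong) (simp add: jscale_def prod_eq_iff fun_eq_iff mult.assoc[symmetric])
  also have "\<dots> \<le> cmod (inverse a) * jnorm n (\<lambda>i j. jscale a (P i j))"
    using P by (intro jnorm_scale_le) (simp del: mem_Sigma_iff)
  finally have "cmod a * jnorm n P \<le> jnorm n (\<lambda>i j. jscale a (P i j))"
    using False by (simp add: norm_inverse norm_divide field_simps)
  then show ?thesis using jnorm_scale_le[of n P a, OF P] by (intro antisym) auto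
qed

lemma jnorm_1_le: "a \<in> E2 \<Longrightarrow> jnorm 1 (\<lambda>_ _. a) \<le> l2 (fst a) + 3 * l2 (snd a)"
  using liftable_entries[of 1 "\<lambda>_ _. a" "l2 (fst a) + 3 * l2 (snd a)"] by (intro jnorm_le) auto

text \<open>By \<open>jnorm_jet\<close> and \<open>jnorm_1_le\<close> the norm of a single jet is
  equivalent to the sum of the l2 norms of its two components, so completeness is that of
  l2.\<close>

lemma dOH_complete: "complete_for dOH (vnorm dOH)"
  unfolding complete_for_def
proof (intro allI impI, elim conjE)
  fix U :: "nat \<Rightarrow> (complex \<Rightarrow> nat \<Rightarrow> complex) set"
  assume U: "\<forall>k. U k \<in> vcarrier dOH" and C: "\<forall>\<epsilon>>0. \<exists>N. \<forall>m\<ge>N. \<forall>k\<ge>N. vnorm dOH (vsub dOH (U m) (U k)) < \<epsilon>"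
  define u where "u k = jof (U k)" for k
  have u: "u k \<in> E2" "U k = jcls (u k)" for k using U jof_carrier by (auto simp: u_def)
  have sub: "vnorm dOH (vsub dOH (jcls a) (jcls b)) = jnorm 1 (\<lambda>_ _. jadd a (jscale (-1) b))" if "a \<in> E2" "b \<in> E2" for a b
    using that by (simp add: dOH_sub vnorm_dOH del: mem_Sigma_iff)
  have ue: "fst (u k) \<in> ell2" "snd (u k) \<in> ell2" for k using u(1)[of k] by (auto simp: mem_Times_iff)
  have b: "l2 (\<lambda>j. fst (u m) j - fst (u k) j) \<le> vnorm dOH (vsub dOH (U m) (U k))"
    "l2 (\<lambda>j. snd (u m) j - snd (u k) j) \<le> 4 * vnorm dOH (vsub dOH (U m) (U k))" for m k
    using jnorm_jet[of 1 "\<lambda>_ _. jadd (u m) (jscale (-1) (u k))" 0 0] u sub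
    by (simp_all add: jadd_def jscale_def ell2_diff ue)
  have "\<exists>p\<in>ell2. (\<lambda>m. l2 (\<lambda>j. fst (u m) j - p j)) \<longlonglongrightarrow> 0"
    using C b(1) by (intro ell2_complete ue) (meson le_less_trans)
  moreover have "\<exists>q\<in>ell2. (\<lambda>m. l2 (\<lambda>j. snd (u m) j - q j)) \<longlonglongrightarrow> 0"
  proof (intro ell2_complete ue)
    fix e :: real assume "0 < e"
    then obtain N where N: "\<forall>m\<ge>N. \<forall>k\<ge>N. vnorm dOH (vsub dOH (U m) (U k)) < e / 4" using C[rule_format, of "e / 4"] by auto
    have "l2 (\<lambda>j. snd (u m) j - snd (u k) j) < e" if "m \<ge> N" "k \<ge> N" for m k
      using b(2)[of m k] N[rule_format, OF that] by linarith
    then show "\<exists>N. \<forall>m\<ge>N. \<forall>k\<ge>N. l2 (\<lambda>j. snd (u m) j - snd (u k) j) < e" by blast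
  qed
  ultimately obtain p q where pq: "p \<in> ell2" "q \<in> ell2" "(\<lambda>m. l2 (\<lambda>j. fst (u m) j - p j)) \<longlonglongrightarrow> 0" "(\<lambda>m. l2 (\<lambda>j. snd (u m) j - q j)) \<longlonglongrightarrow> 0"
    by blast
  have E: "(p, q) \<in> E2" using pq by simp
  show "\<exists>l\<in>vcarrier dOH. (\<lambda>k. vnorm dOH (vsub dOH (U k) l)) \<longlonglongrightarrow> 0"
  proof (intro bexI[of _ "jcls (p, q)"])
    have "(\<lambda>m. l2 (\<lambda>j. fst (u m) j - p j) + 3 * l2 (\<lambda>j. snd (u m) j - q j)) \<longlonglongrightarrow> 0 + 3 * 0"
      by (intro tendsto_intros pq)
    then have lim: "(\<lambda>m. l2 (\<lambda>j. fst (u m) j - p j) + 3 * l2 (\<lambda>j. snd (u m) j - q j)) \<longlonglongrightarrow> 0" by simp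
    have d: "jadd (u m) (jscale (-1) (p, q)) \<in> E2" for m by (intro E2_closed u E)
    show "(\<lambda>k. vnorm dOH (vsub dOH (U k) (jcls (p, q)))) \<longlonglongrightarrow> 0"
    proof (rule tendsto_0_le[OF lim])
      show "0 \<le> vnorm dOH (vsub dOH (U m) (jcls (p, q)))" for m
        unfolding u(2) sub[OF u(1) E] by (rule jnorm_nonneg) (rule d)
      have "vnorm dOH (vsub dOH (U m) (jcls (p, q))) \<le> l2 (\<lambda>j. fst (u m) j - p j) + 3 * l2 (\<lambda>j. snd (u m) j - q j)" for m
        unfolding u(2) sub[OF u(1) E] using jnorm_1_le[OF d[of m]] by (simp add: jadd_def jscale_def)
      then show "\<forall>\<^sub>F m in sequentially. vnorm dOH (vsub dOH (U m) (jcls (p, q))) \<le> l2 (\<lambda>j. fst (u m) j - p j) + 3 * l2 (\<lambda>j. snd (u m) j - q j)"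
        by simp
    qed
  qed (use E in simp)
qed

lemma vsum_dOH:
  assumes "\<And>k. k < m \<Longrightarrow> h k \<in> E2 \<and> g k = jcls (h k)"
  shows "(\<lambda>r. \<Sum>k<m. fst (h k) r, \<lambda>r. \<Sum>k<m. snd (h k) r) \<in> E2 \<and>
     vsum dOH g m = jcls (\<lambda>r. \<Sum>k<m. fst (h k) r, \<lambda>r. \<Sum>k<m. snd (h k) r)"
  using assms
proof (induction m)
  case 0 then show ?case by (simp add: dOH_zero)
next
  case (Suc m)
  then have IH: "(\<lambda>r. \<Sum>k<m. fst (h k) r, \<lambda>r. \<Sum>k<m. snd (h k) r) \<in> E2"
     "vsum dOH g m = jcls (\<lambda>r. \<Sum>k<m. fst (h k) r, \<lambda>r. \<Sum>k<m. snd (h k) r)" and h: "h m \<in> E2" "g m = jcls (h m)" by auto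
  have "jadd (\<lambda>r. \<Sum>k<m. fst (h k) r, \<lambda>r. \<Sum>k<m. snd (h k) r) (h m) = (\<lambda>r. \<Sum>k<Suc m. fst (h k) r, \<lambda>r. \<Sum>k<Suc m. snd (h k) r)"
    by (simp add: jadd_def)
  then show ?case using E2_closed(1)[OF IH(1) h(1)] by (simp only: vsum.simps IH(2) h(2) dOH_add[OF IH(1) h(1)])
qed

lemma mat_sandwich_dOH:
  assumes "\<And>k l. k < m \<Longrightarrow> l < m \<Longrightarrow> P k l \<in> E2 \<and> x k l = jcls (P k l)"
  shows "jsandwich m \<alpha> P \<beta> i j \<in> E2 \<and> mat_sandwich dOH m \<alpha> x \<beta> i j = jcls (jsandwich m \<alpha> P \<beta> i j)"
proof -
  have inner: "(\<lambda>r. \<Sum>l<m. \<alpha> i k * \<beta> l j * fst (P k l) r, \<lambda>r. \<Sum>l<m. \<alpha> i k * \<beta> l j * snd (P k l) r) \<in> E2 \<and>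
    vsum dOH (\<lambda>l. vscale dOH (\<alpha> i k * \<beta> l j) (x k l)) m = jcls (\<lambda>r. \<Sum>l<m. \<alpha> i k * \<beta> l j * fst (P k l) r, \<lambda>r. \<Sum>l<m. \<alpha> i k * \<beta> l j * snd (P k l) r)"
    if "k < m" for k
    using vsum_dOH[of m "\<lambda>l. jscale (\<alpha> i k * \<beta> l j) (P k l)" "\<lambda>l. vscale dOH (\<alpha> i k * \<beta> l j) (x k l)"] assms that
    by (simp add: dOH_scale jscale_def ell2_scale mem_Times_iff)
  show ?thesis
    using vsum_dOH[of m "\<lambda>k. (\<lambda>r. \<Sum>l<m. \<alpha> i k * \<beta> l j * fst (P k l) r, \<lambda>r. \<Sum>l<m. \<alpha> i k * \<beta> l j * snd (P k l) r)"
        "\<lambda>k. vsum dOH (\<lambda>l. vscale dOH (\<alpha> i k * \<beta> l j) (x k l)) m", OF inner]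
    by (simp add: mat_sandwich_def jsandwich_def)
qed

text \<open>The infimum in \<open>jnorm\<close> may not be attained, so the upper bounds are proved
  for lifts with an arbitrarily small slack. Definiteness comes from
  \<open>jnorm_jet\<close>.\<close>

lemma dOH_operator_space: "operator_space dOH"
  unfolding operator_space_def
proof (intro conjI allI impI ballI)
  show "cvector_space dOH" by (rule dOH_cvector_space)
  show "complete_for dOH (vnorm dOH)" by (rule dOH_complete)
next
  fix n :: nat and x assume x: "x \<in> mats dOH n"
  note X = dOH_mats[OF x]
  show "0 \<le> mnorm dOH n x" unfolding X(3) by (rule jnorm_nonneg[OF X(1)])
  show "mnorm dOH n x = 0 \<longleftrightarrow> (\<forall>i<n. \<forall>j<n. x i j = vzero dOH)"
  proof
    assume "mnorm dOH n x = 0"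
    then have z: "jnorm n (\<lambda>i j. jof (x i j)) = 0" by (simp add: X(3))
    have "x i j = vzero dOH" if "i < n" "j < n" for i j
    proof -
      have "fst (jof (x i j)) \<in> ell2" "snd (jof (x i j)) \<in> ell2" using X(1)[OF that] by (auto simp: mem_Times_iff)
      moreover have "l2 (fst (jof (x i j))) = 0" "l2 (snd (jof (x i j))) = 0"
        using jnorm_jet[of n "\<lambda>i j. jof (x i j)", OF X(1) that] z by (auto intro: antisym)
      ultimately have "jof (x i j) = jzero" by (simp add: l2_eq_0 prod_eq_iff)
      then show ?thesis using X(2)[OF that] by (simp add: dOH_zero)
    qed
    then show "\<forall>i<n. \<forall>j<n. x i j = vzero dOH" by blast
  next
    assume "\<forall>i<n. \<forall>j<n. x i j = vzero dOH"
    then have "mnorm dOH n x = jnorm n (\<lambda>_ _. jzero)" by (intro mnorm_dOH) (auto simp: dOH_zero)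
    also have "\<dots> = jnorm n (\<lambda>i j. jscale 0 jzero)" by (simp add: jscale_def)
    also have "\<dots> = 0" by (subst jnorm_scale) auto
    finally show "mnorm dOH n x = 0" .
  qed
  fix c
  have "mnorm dOH n (\<lambda>i j. vscale dOH c (x i j)) = jnorm n (\<lambda>i j. jscale c (jof (x i j)))"
  proof (intro mnorm_dOH E2_closed X(1))
    fix i j assume ij: "i < n" "j < n"
    show "vscale dOH c (x i j) = jcls (jscale c (jof (x i j)))"
      using dOH_scale[OF X(1)[OF ij], of c] X(2)[OF ij] by simp
  qed
  then show "mnorm dOH n (\<lambda>i j. vscale dOH c (x i j)) = cmod c * mnorm dOH n x"
    unfolding X(3) by (simp only: jnorm_scale[OF X(1)])
next
  fix n :: nat and x y assume x: "x \<in> mats dOH n" and y: "y \<in> mats dOH n"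
  note X = dOH_mats[OF x] and Y = dOH_mats[OF y]
  have "mnorm dOH n (\<lambda>i j. vadd dOH (x i j) (y i j)) = jnorm n (\<lambda>i j. jadd (jof (x i j)) (jof (y i j)))"
  proof (intro mnorm_dOH E2_closed X(1) Y(1))
    fix i j assume ij: "i < n" "j < n"
    show "vadd dOH (x i j) (y i j) = jcls (jadd (jof (x i j)) (jof (y i j)))"
      using dOH_add[OF X(1)[OF ij] Y(1)[OF ij]] X(2)[OF ij] Y(2)[OF ij] by simp
  qed
  then show "mnorm dOH n (\<lambda>i j. vadd dOH (x i j) (y i j)) \<le> mnorm dOH n x + mnorm dOH n y"
    unfolding X(3) Y(3) by (simp only: jnorm_triangle[OF X(1) Y(1)])
next
  fix m n :: nat and x y assume x: "x \<in> mats dOH m" and y: "y \<in> mats dOH n"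
  note X = dOH_mats[OF x] and Y = dOH_mats[OF y]
  define P where "P i j = jof (x i j)" for i j
  define Q where "Q i j = jof (y i j)" for i j
  define D where "D = (\<lambda>i j. if i < m \<and> j < m then P i j else if m \<le> i \<and> m \<le> j then Q (i - m) (j - m) else jzero)"
  have P: "\<And>i j. i < m \<Longrightarrow> j < m \<Longrightarrow> P i j \<in> E2" and Q: "\<And>i j. i < n \<Longrightarrow> j < n \<Longrightarrow> Q i j \<in> E2"
    using X(1) Y(1) by (auto simp: P_def Q_def)
  have D: "D i j \<in> E2" if "i < m + n" "j < m + n" for i j
  proof -
    consider "i < m \<and> j < m" | "m \<le> i \<and> m \<le> j" | "\<not> (i < m \<and> j < m)" "\<not> (m \<le> i \<and> m \<le> j)" by blast
    then show ?thesis
    proof cases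
      case 1 then show ?thesis using P by (simp add: D_def del: mem_Sigma_iff)
    next
      case 2
      then have "i - m < n" "j - m < n" using that by auto
      then show ?thesis using Q 2 by (simp add: D_def del: mem_Sigma_iff)
    next
      case 3 then show ?thesis by (simp only: D_def if_False E2_closed)
    qed
  qed
  have "mnorm dOH (m + n) (mat_dsum dOH m x y) = jnorm (m + n) D"
  proof (rule mnorm_dOH[OF D])
    fix i j assume ij: "i < m + n" "j < m + n"
    show "mat_dsum dOH m x y i j = jcls (D i j)"
    proof (cases "m \<le> i \<and> m \<le> j")
      case True
      then have "i - m < n" "j - m < n" using ij by auto
      then show ?thesis using True Y(2) by (simp add: mat_dsum_def D_def Q_def)
    next
      case False
      then show ?thesis using X(2) by (auto simp: mat_dsum_def D_def P_def dOH_zero)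
    qed
  qed
  also have "\<dots> = max (jnorm m P) (jnorm n Q)"
  proof (rule antisym)
    show "jnorm (m + n) D \<le> max (jnorm m P) (jnorm n Q)"
    proof (rule jnorm_leI)
      fix e :: real assume e: "0 < e"
      have "liftable m P (max (jnorm m P) (jnorm n Q) + e)" using e by (intro jnorm_less[OF P]) auto
      moreover have "liftable n Q (max (jnorm m P) (jnorm n Q) + e)" using e by (intro jnorm_less[OF Q]) auto
      ultimately show "liftable (m + n) D (max (jnorm m P) (jnorm n Q) + e)" unfolding D_def by (rule liftable_dsum)
    qed (use jnorm_nonneg[OF P] in \<open>simp add: le_max_iff_disj\<close>)
    have "jnorm m P \<le> jnorm (m + n) D" "jnorm n Q \<le> jnorm (m + n) D"
    proof -
      have l: "liftable m P (jnorm (m + n) D + e)" "liftable n Q (jnorm (m + n) D + e)" if "0 < e" for e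
      proof -
        have "liftable (m + n) D (jnorm (m + n) D + e)" using that by (intro jnorm_less[OF D]) auto
        note b = liftable_block[OF this]
        have "liftable m P (jnorm (m + n) D + e) \<longleftrightarrow> liftable m D (jnorm (m + n) D + e)"
          by (intro liftable_cong) (simp add: D_def)
        with b(1) show "liftable m P (jnorm (m + n) D + e)" by blast
        have "liftable n Q (jnorm (m + n) D + e) \<longleftrightarrow> liftable n (\<lambda>i j. D (m + i) (m + j)) (jnorm (m + n) D + e)"
          by (intro liftable_cong) (simp add: D_def)
        with b(2) show "liftable n Q (jnorm (m + n) D + e)" by blast
      qed
      show "jnorm m P \<le> jnorm (m + n) D" "jnorm n Q \<le> jnorm (m + n) D"
        by (intro jnorm_leI l jnorm_nonneg[OF D]; assumption)+
    qed
    then show "max (jnorm m P) (jnorm n Q) \<le> jnorm (m + n) D" by simp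
  qed
  finally show "mnorm dOH (m + n) (mat_dsum dOH m x y) = max (mnorm dOH m x) (mnorm dOH n y)"
    unfolding X(3) Y(3) P_def Q_def .
next
  fix m n :: nat and x \<alpha> \<beta> assume x: "x \<in> mats dOH m"
  note X = dOH_mats[OF x]
  define P where "P i j = jof (x i j)" for i j
  have P: "\<And>i j. i < m \<Longrightarrow> j < m \<Longrightarrow> P i j \<in> E2" using X(1) by (auto simp: P_def)
  have S: "jsandwich m \<alpha> P \<beta> i j \<in> E2 \<and> mat_sandwich dOH m \<alpha> x \<beta> i j = jcls (jsandwich m \<alpha> P \<beta> i j)" for i j
    using X(1,2) by (intro mat_sandwich_dOH) (simp add: P_def)
  have "mnorm dOH n (mat_sandwich dOH m \<alpha> x \<beta>) = jnorm n (jsandwich m \<alpha> P \<beta>)" by (intro mnorm_dOH) (use S in auto)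
  also have "\<dots> \<le> cmat_norm n m \<alpha> * jnorm m P * cmat_norm m n \<beta>"
  proof (rule jnorm_leI)
    fix e :: real assume e: "0 < e"
    define N where "N = cmat_norm n m \<alpha> * cmat_norm m n \<beta>"
    have N: "0 \<le> N" by (simp add: N_def)
    define d where "d = e / (N + 1)"
    have "0 < N + 1" using N by linarith
    then have d: "0 < d" "(N + 1) * d = e" using e by (auto simp: d_def)
    then have d: "0 < d" "N * d \<le> e" by (auto simp: distrib_right)
    have "liftable n (jsandwich m \<alpha> P \<beta>) (cmat_norm n m \<alpha> * (jnorm m P + d) * cmat_norm m n \<beta>)"
      using d by (intro liftable_sandwich jnorm_less[OF P]) auto
    then show "liftable n (jsandwich m \<alpha> P \<beta>) (cmat_norm n m \<alpha> * jnorm m P * cmat_norm m n \<beta> + e)"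
      using d jnorm_nonneg[OF P] by (rule_tac liftable_mono) (auto simp: algebra_simps N_def)
  qed (simp add: jnorm_nonneg[OF P])
  finally show "mnorm dOH n (mat_sandwich dOH m \<alpha> x \<beta>) \<le> cmat_norm n m \<alpha> * mnorm dOH m x * cmat_norm m n \<beta>"
    unfolding X(3) P_def .
qed

lemma dOH_banach_algebra: "banach_algebra dOH"
proof -
  have os: "operator_space dOH" by (rule dOH_operator_space)
  have m: "(\<lambda>_ _. A) \<in> mats dOH 1" if "A \<in> vcarrier dOH" for A using that by (simp add: mats_def)
  have v1: "0 \<le> vnorm dOH A" "vnorm dOH A = 0 \<longleftrightarrow> A = vzero dOH" "vnorm dOH (vscale dOH c A) = cmod c * vnorm dOH A"
    if "A \<in> vcarrier dOH" for A c
    using os m[OF that] unfolding operator_space_def vnorm_def by auto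
  have v2: "vnorm dOH (vadd dOH A B) \<le> vnorm dOH A + vnorm dOH B" if "A \<in> vcarrier dOH" "B \<in> vcarrier dOH" for A B
  proof -
    have "\<forall>n\<ge>1. \<forall>x\<in>mats dOH n. \<forall>y\<in>mats dOH n. mnorm dOH n (\<lambda>i j. vadd dOH (x i j) (y i j)) \<le> mnorm dOH n x + mnorm dOH n y"
      using os unfolding operator_space_def by blast
    from this[rule_format, OF _ m[OF that(1)] m[OF that(2)]] show ?thesis by (simp add: vnorm_def)
  qed
  have v3: "vnorm dOH (vmult dOH (jcls a) (jcls b)) \<le> vnorm dOH (jcls a) * vnorm dOH (jcls b)" if a: "a \<in> E2" and b: "b \<in> E2" for a b
  proof -
    define x where "x = jnorm 1 (\<lambda>_ _. a)"
    define y where "y = jnorm 1 (\<lambda>_ _. b)"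
    have xy: "0 \<le> x" "0 \<le> y" unfolding x_def y_def by (intro jnorm_nonneg a b)+
    have le: "jnorm 1 (\<lambda>_ _. jmult a b) \<le> (x + e) * (y + e)" if "0 < e" for e
      using that xy
      by (intro jnorm_le liftable_mult jnorm_less a b) (auto simp: x_def y_def)
    have "((\<lambda>e. (x + e) * (y + e)) \<longlongrightarrow> (x + 0) * (y + 0)) (at_right 0)" by (intro tendsto_intros)
    then have "jnorm 1 (\<lambda>_ _. jmult a b) \<le> (x + 0) * (y + 0)"
      by (rule tendsto_lowerbound[OF _ eventually_mono[OF eventually_at_right_less le]]) (assumption, rule trivial_limit_at_right_real)
    then show ?thesis using a b by (simp add: dOH_mult vnorm_dOH x_def y_def del: mem_Sigma_iff)
  qed
  show ?thesis
    unfolding banach_algebra_def dOH_ball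
    by (intro conjI ballI allI dOH_cvector_space dOH_complete v1 v2 v3 jcls_carrier)
      (simp_all add: dOH_add dOH_mult dOH_scale jmult_ring del: mem_Sigma_iff)
qed

section \<open>A minimax principle\<close>

text \<open>At a minimiser of \<open>\<Sum>\<^sub>i max(0, 1 - g\<^sub>i)\<^sup>2\<close> the first order condition contradicts \<open>sep\<close>
  for the weights \<open>max(0, 1 - g\<^sub>i)\<close>, unless all of them vanish.\<close>

lemma minimax_finite:
  fixes S :: "'s :: topological_space set" and g :: "'i \<Rightarrow> 's \<Rightarrow> real"
  assumes S: "compact S" "S \<noteq> {}" and I: "finite I" and cont: "\<And>i. i \<in> I \<Longrightarrow> continuous_on S (g i)"
    and conv: "\<And>s s' u. s \<in> S \<Longrightarrow> s' \<in> S \<Longrightarrow> 0 \<le> u \<Longrightarrow> u \<le> 1 \<Longrightarrow> \<exists>r\<in>S. \<forall>i\<in>I. g i r = (1 - u) * g i s + u * g i s'"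
    and sep: "\<And>w. (\<And>i. i \<in> I \<Longrightarrow> 0 \<le> w i) \<Longrightarrow> \<exists>s\<in>S. (\<Sum>i\<in>I. w i) \<le> (\<Sum>i\<in>I. w i * g i s)"
  shows "\<exists>s\<in>S. \<forall>i\<in>I. 1 \<le> g i s"
proof -
  define \<Phi> where "\<Phi> s = (\<Sum>i\<in>I. (max 0 (1 - g i s))\<^sup>2)" for s
  have "continuous_on S \<Phi>" unfolding \<Phi>_def by (intro continuous_intros cont)
  from continuous_attains_inf[OF S this] obtain s where s: "s \<in> S" and min: "\<And>r. r \<in> S \<Longrightarrow> \<Phi> s \<le> \<Phi> r" by blast
  define w where "w = (\<lambda>i. max 0 (1 - g i s))"
  have w: "0 \<le> w i" for i by (simp add: w_def)
  define W where "W = (\<Sum>i\<in>I. (w i)\<^sup>2)"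
  have \<Phi>s: "\<Phi> s = W" unfolding \<Phi>_def W_def w_def ..
  have "W = 0"
  proof (rule ccontr)
    assume "W \<noteq> 0"
    then have W: "0 < W" unfolding W_def by (simp add: less_le sum_nonneg)
    have "\<exists>s\<in>S. (\<Sum>i\<in>I. w i) \<le> (\<Sum>i\<in>I. w i * g i s)" by (rule sep) (rule w)
    then obtain s' where s': "s' \<in> S" and le: "(\<Sum>i\<in>I. w i) \<le> (\<Sum>i\<in>I. w i * g i s')" by blast
    define b where "b i = 1 - g i s'" for i
    define T where "T = (\<Sum>i\<in>I. (b i)\<^sup>2)"
    have T: "0 \<le> T" by (simp add: T_def sum_nonneg)
    have wb: "(\<Sum>i\<in>I. w i * b i) \<le> 0" using le by (simp add: b_def right_diff_distrib sum_subtractf)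
    \<comment> \<open>This \<open>u\<close> minimises \<open>(1 - u)^2 * W + u^2 * T\<close>, the
      bound for \<open>\<Phi> r\<close> once the nonpositive cross term is dropped; the minimum is
      \<open>W - u * W\<close>.\<close>
    define u where "u = W / (W + T)"
    have u: "0 < u" "u \<le> 1" using W T unfolding u_def by (simp_all add: divide_pos_pos add_pos_nonneg)
    obtain r where r: "r \<in> S" "\<forall>i\<in>I. g i r = (1 - u) * g i s + u * g i s'"
      using conv[OF s s'] u by (meson less_imp_le)
    have "(max 0 (1 - g i r))\<^sup>2 \<le> ((1 - u) * w i + u * b i)\<^sup>2" if i: "i \<in> I" for i
    proof -
      have "1 - g i r = (1 - u) * (1 - g i s) + u * b i" using r(2) i by (simp add: b_def algebra_simps)
      also have "\<dots> \<le> (1 - u) * w i + u * b i" using u by (intro add_right_mono mult_left_mono) (auto simp: w_def)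
      finally have "max 0 (1 - g i r) \<le> \<bar>(1 - u) * w i + u * b i\<bar>" by simp
      from power_mono[OF this, of 2] show ?thesis by simp
    qed
    then have "\<Phi> r \<le> (\<Sum>i\<in>I. ((1 - u) * w i + u * b i)\<^sup>2)" unfolding \<Phi>_def by (rule sum_mono)
    also have "\<dots> = (\<Sum>i\<in>I. (1 - u)\<^sup>2 * (w i)\<^sup>2 + 2 * (u * (1 - u)) * (w i * b i) + u\<^sup>2 * (b i)\<^sup>2)"
      by (intro sum.cong refl) (simp add: power2_eq_square algebra_simps)
    also have "\<dots> = (1 - u)\<^sup>2 * W + 2 * (u * (1 - u)) * (\<Sum>i\<in>I. w i * b i) + u\<^sup>2 * T"
      by (simp only: W_def T_def sum.distrib sum_distrib_left)
    also have "\<dots> \<le> (1 - u)\<^sup>2 * W + u\<^sup>2 * T"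
      using wb u by (simp add: mult_nonneg_nonpos)
    also have "\<dots> = W - 2 * u * W + u * (u * (W + T))" by (simp add: power2_eq_square algebra_simps)
    also have "u * (W + T) = W" using W T by (simp add: u_def)
    also have "W - 2 * u * W + u * W = W - u * W" by simp
    also have "\<dots> < W" using W u by simp
    finally show False using min[OF r(1)] \<Phi>s by simp
  qed
  then have "\<forall>i\<in>I. w i = 0" unfolding W_def using I by (simp add: sum_nonneg_eq_0_iff)
  then have "\<forall>i\<in>I. 1 \<le> g i s" by (auto simp: w_def max_def split: if_splits)
  then show ?thesis using s by blast
qed

text \<open>Two-point convexity is iterated with renormalised weights. The set \<open>X\<close>
  carries no linear structure here, so a convex combination is replaced by an element whose values
  lie below it for every \<open>s\<close>.\<close>

lemma finite_convex_combination:
  fixes G :: "'f \<Rightarrow> 's \<Rightarrow> real"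
  assumes conv: "\<And>f f' u. f \<in> X \<Longrightarrow> f' \<in> X \<Longrightarrow> 0 \<le> u \<Longrightarrow> u \<le> 1 \<Longrightarrow> \<exists>h\<in>X. \<forall>s\<in>S. G h s \<le> (1 - u) * G f s + u * G f' s"
  shows "finite I \<Longrightarrow> I \<subseteq> X \<Longrightarrow> (\<And>i. i \<in> I \<Longrightarrow> 0 \<le> w i) \<Longrightarrow> (\<Sum>i\<in>I. w i) = (1 :: real) \<Longrightarrow>
    \<exists>h\<in>X. \<forall>s\<in>S. G h s \<le> (\<Sum>i\<in>I. w i * G i s)"
proof (induction I arbitrary: w rule: finite_induct)
  case empty then show ?case by simp
next
  case (insert i I)
  have s: "w i + (\<Sum>j\<in>I. w j) = 1" using insert by simp
  have wI: "\<And>j. j \<in> I \<Longrightarrow> 0 \<le> w j" using insert by simp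
  then have sn: "0 \<le> (\<Sum>j\<in>I. w j)" by (rule sum_nonneg)
  show ?case
  \<comment> \<open>The weights on \<open>I\<close> are divided by \<open>1 - w i\<close>, so weight
    1 on \<open>i\<close> is treated apart.\<close>
  proof (cases "w i = 1")
    case True
    then have "\<forall>j\<in>I. w j = 0" using s wI insert(1) by (simp add: sum_nonneg_eq_0_iff)
    then have "\<forall>s\<in>S. G i s \<le> (\<Sum>i\<in>insert i I. w i * G i s)" using True insert by simp
    then show ?thesis using insert.prems by blast
  next
    case False
    then have lt: "w i < 1" using s sn by linarith
    have "\<exists>h\<in>X. \<forall>s\<in>S. G h s \<le> (\<Sum>j\<in>I. (w j / (1 - w i)) * G j s)"
    proof (rule insert.IH)
      show "(\<Sum>j\<in>I. w j / (1 - w i)) = 1" using s lt by (simp add: sum_divide_distrib[symmetric] field_simps)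
    qed (use insert.prems lt wI in auto)
    then obtain h where h: "h \<in> X" "\<forall>s\<in>S. G h s \<le> (\<Sum>j\<in>I. (w j / (1 - w i)) * G j s)" by blast
    obtain r where r: "r \<in> X" "\<forall>s\<in>S. G r s \<le> (1 - w i) * G h s + w i * G i s"
      using conv[OF h(1), of i "w i"] insert.prems lt by auto
    have "G r s \<le> (\<Sum>j\<in>insert i I. w j * G j s)" if "s \<in> S" for s
    proof -
      have "(1 - w i) * G h s \<le> (1 - w i) * (\<Sum>j\<in>I. (w j / (1 - w i)) * G j s)"
        using h(2) that lt by (intro mult_left_mono) auto
      also have "\<dots> = (\<Sum>j\<in>I. w j * G j s)" using lt by (simp add: sum_distrib_left)
      finally show ?thesis using r(2) that insert(1,2) by fastforce
    qed
    then show ?thesis using r(1) by blast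
  qed
qed

text \<open>For finitely many functions, convexity in \<open>f\<close> replaces a weighted family by
  one member \<open>h\<close>, and \<open>ge\<close> for \<open>h\<close> yields the separation that
  \<open>minimax_finite\<close> asks for. Compactness of \<open>S\<close> then passes from finite
  subfamilies to all of \<open>X\<close>.\<close>

lemma minimax:
  fixes S :: "'s :: topological_space set" and G :: "'f \<Rightarrow> 's \<Rightarrow> real"
  assumes S: "compact S" "S \<noteq> {}" and cont: "\<And>f. f \<in> X \<Longrightarrow> continuous_on UNIV (G f)"
    and convS: "\<And>s s' u. s \<in> S \<Longrightarrow> s' \<in> S \<Longrightarrow> 0 \<le> u \<Longrightarrow> u \<le> 1 \<Longrightarrow> \<exists>r\<in>S. \<forall>f\<in>X. G f r = (1 - u) * G f s + u * G f s'"
    and convX: "\<And>f f' u. f \<in> X \<Longrightarrow> f' \<in> X \<Longrightarrow> 0 \<le> u \<Longrightarrow> u \<le> 1 \<Longrightarrow> \<exists>h\<in>X. \<forall>s\<in>S. G h s \<le> (1 - u) * G f s + u * G f' s"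
    and ge: "\<And>f. f \<in> X \<Longrightarrow> \<exists>s\<in>S. 1 \<le> G f s"
  shows "\<exists>s\<in>S. \<forall>f\<in>X. 1 \<le> G f s"
proof -
  have fin: "\<exists>s\<in>S. \<forall>i\<in>I. 1 \<le> G i s" if I: "finite I" "I \<subseteq> X" for I
  proof (rule minimax_finite[OF S I(1)])
    show "continuous_on S (G i)" if "i \<in> I" for i using cont I(2) that continuous_on_subset by blast
    show "\<exists>r\<in>S. \<forall>i\<in>I. G i r = (1 - u) * G i s + u * G i s'" if "s \<in> S" "s' \<in> S" "0 \<le> u" "u \<le> 1" for s s' u
      using convS[OF that] I(2) by blast
    fix w assume w: "\<And>i. i \<in> I \<Longrightarrow> (0 :: real) \<le> w i"
    define W where "W = (\<Sum>i\<in>I. w i)"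
    show "\<exists>s\<in>S. (\<Sum>i\<in>I. w i) \<le> (\<Sum>i\<in>I. w i * G i s)"
    proof (cases "W = 0")
      case True
      then have "\<forall>i\<in>I. w i = 0" unfolding W_def using w I(1) by (simp add: sum_nonneg_eq_0_iff)
      then show ?thesis using S(2) by auto
    next
      case False
      then have W: "0 < W" unfolding W_def using w by (simp add: less_le sum_nonneg)
      have "\<exists>h\<in>X. \<forall>s\<in>S. G h s \<le> (\<Sum>i\<in>I. (w i / W) * G i s)"
        using W w by (intro finite_convex_combination[OF convX] I) (auto simp: sum_divide_distrib[symmetric] W_def)
      then obtain h where h: "h \<in> X" "\<forall>s\<in>S. G h s \<le> (\<Sum>i\<in>I. (w i / W) * G i s)" by blast
      obtain s where s: "s \<in> S" "1 \<le> G h s" using ge[OF h(1)] by blast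
      then have "1 \<le> (\<Sum>i\<in>I. (w i / W) * G i s)" using h(2) by fastforce
      also have "\<dots> = (\<Sum>i\<in>I. w i * G i s) / W" by (simp add: sum_divide_distrib)
      finally show ?thesis using W s(1) by (auto simp: W_def field_simps)
    qed
  qed
  have "S \<inter> \<Inter> ((\<lambda>f. {s. 1 \<le> G f s}) ` X) \<noteq> {}"
  proof (rule compact_imp_fip[OF S(1)])
    show "closed T" if "T \<in> (\<lambda>f. {s. 1 \<le> G f s}) ` X" for T
      using that cont by (auto intro!: closed_Collect_le continuous_on_const)
    fix F' assume "finite F'" "F' \<subseteq> (\<lambda>f. {s. 1 \<le> G f s}) ` X"
    then obtain I where "finite I" "I \<subseteq> X" "F' = (\<lambda>f. {s. 1 \<le> G f s}) ` I" by (meson finite_subset_image)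
    then show "S \<inter> \<Inter> F' \<noteq> {}" using fin[of I] by auto
  qed
  then show ?thesis by auto
qed

section \<open>Admissible forms\<close>

text \<open>\<open>(\<lambda>, f)\<close> stands for the row \<open>(\<lambda>\<^sub>l 1 + f\<^sub>l)\<^sub>l\<close> over the unitization of the function algebra.\<close>

type_synonym urow = "(nat \<Rightarrow> complex) \<times> (nat \<Rightarrow> complex \<Rightarrow> nat \<Rightarrow> complex)"

definition urows :: "urow set" where
  "urows = {y. \<forall>l. snd y l \<in> strip_fun}"

definition uadd :: "urow \<Rightarrow> urow \<Rightarrow> urow" where
  "uadd y y' = (\<lambda>l. fst y l + fst y' l, \<lambda>l z k. snd y l z k + snd y' l z k)"

definition uscale :: "complex \<Rightarrow> urow \<Rightarrow> urow" where
  "uscale c y = (\<lambda>l. c * fst y l, \<lambda>l z k. c * snd y l z k)"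

text \<open>Matrix times a column of rows. The functions form an ideal in the unitization, so the
  product has no scalar part.\<close>

definition uact :: "nat \<Rightarrow> (nat \<Rightarrow> nat \<Rightarrow> complex \<Rightarrow> nat \<Rightarrow> complex) \<Rightarrow> (nat \<Rightarrow> urow) \<Rightarrow> nat \<Rightarrow> urow" where
  "uact m a y i = (\<lambda>l. 0, \<lambda>l z k. \<Sum>j<m. a i j z k * (fst (y j) l + snd (y j) l z k))"

definition uunit :: "nat \<Rightarrow> urow" where
  "uunit i = (\<lambda>l. if l = i then 1 else 0, \<lambda>l z k. 0)"

definition urow_of :: "nat \<Rightarrow> (nat \<Rightarrow> nat \<Rightarrow> complex \<Rightarrow> nat \<Rightarrow> complex) \<Rightarrow> nat \<Rightarrow> urow" where
  "urow_of n f i = (\<lambda>l. 0, \<lambda>l z k. if l < n then f i l z k else 0)"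

lemma strip_fun_unit_mult:
  assumes "a \<in> strip_fun" "f \<in> strip_fun" shows "(\<lambda>z k. a z k * (c + f z k)) \<in> strip_fun"
proof -
  have "(\<lambda>z k. c * a z k + a z k * f z k) \<in> strip_fun"
    by (intro strip_fun_add strip_fun_scale strip_fun_mult assms)
  then show ?thesis by (simp add: algebra_simps)
qed

lemma urows_closed:
  "y \<in> urows \<Longrightarrow> y' \<in> urows \<Longrightarrow> uadd y y' \<in> urows" "y \<in> urows \<Longrightarrow> uscale c y \<in> urows" "uunit i \<in> urows"
  "(\<And>i j. i < m \<Longrightarrow> j < m \<Longrightarrow> a i j \<in> strip_fun) \<Longrightarrow> (\<And>j. j < m \<Longrightarrow> v j \<in> urows) \<Longrightarrow> i < m \<Longrightarrow> uact m a v i \<in> urows"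
  "(\<And>j. j < n \<Longrightarrow> f i j \<in> strip_fun) \<Longrightarrow> urow_of n f i \<in> urows"
proof -
  show "y \<in> urows \<Longrightarrow> y' \<in> urows \<Longrightarrow> uadd y y' \<in> urows" by (simp add: urows_def uadd_def strip_fun_add)
  show "y \<in> urows \<Longrightarrow> uscale c y \<in> urows" by (simp add: urows_def uscale_def strip_fun_scale)
  show "uunit i \<in> urows" by (simp add: urows_def uunit_def)
  show "uact m a v i \<in> urows" if "\<And>i j. i < m \<Longrightarrow> j < m \<Longrightarrow> a i j \<in> strip_fun" "\<And>j. j < m \<Longrightarrow> v j \<in> urows" "i < m"
    using that unfolding urows_def uact_def by (auto intro!: strip_fun_sum strip_fun_unit_mult)
  show "urow_of n f i \<in> urows" if f: "\<And>j. j < n \<Longrightarrow> f i j \<in> strip_fun"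
  proof -
    have "(\<lambda>z k. if l < n then f i l z k else 0) \<in> strip_fun" for l
      using f by (cases "l < n") auto
    then show ?thesis by (simp add: urows_def urow_of_def)
  qed
qed

text \<open>What is kept of a vector state: every instance of a clause is an equation or inequality
  linear in \<open>s\<close> that involves finitely many values, so the set is convex and closed
  under pointwise limits. The module clause is uniform in the matrix size \<open>m\<close>, which is
  complete boundedness; its factor 2 is the square of the bound \<open>sqrt 2\<close> for diag + row
  and diag + column. The last clause normalises the vector through the unit rows.\<close>

definition admissible :: "nat \<Rightarrow> (urow \<Rightarrow> real) \<Rightarrow> bool" where
  "admissible n s \<longleftrightarrow>
     (\<forall>y. y \<in> urows \<longrightarrow> 0 \<le> s y) \<and>
     (\<forall>y y'. y \<in> urows \<and> y' \<in> urows \<longrightarrow> s (uadd y y') + s (uadd y (uscale (-1) y')) \<le> 2 * s y + 2 * s y') \<and>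
     (\<forall>y c. y \<in> urows \<longrightarrow> s (uscale c y) = (cmod c)\<^sup>2 * s y) \<and>
     (\<forall>y y' u. y \<in> urows \<and> y' \<in> urows \<and> 0 \<le> u \<and> u \<le> 1 \<longrightarrow>
        s (uadd (uscale (complex_of_real (1 - u)) y) (uscale (complex_of_real u) y')) \<le> (1 - u) * s y + u * s y') \<and>
     (\<forall>m a v c. (\<forall>i<m. \<forall>j<m. a i j \<in> strip_fun) \<and> (\<forall>j<m. v j \<in> urows) \<and> 0 \<le> c \<and> fun_bdd m a c \<longrightarrow>
        (\<Sum>i<m. s (uact m a v i)) \<le> 2 * c\<^sup>2 * (\<Sum>j<m. s (v j))) \<and>
     (\<Sum>i<n. s (uunit i)) \<le> 1"

text \<open>A form may be reset outside \<open>urows\<close>, which is how it is fitted into a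
  compact product of intervals.\<close>

lemma admissible_cong:
  assumes s: "admissible n s" and eq: "\<And>y. y \<in> urows \<Longrightarrow> s' y = s y"
  shows "admissible n s'"
proof -
  have "(\<Sum>i<m. s' (uact m a v i)) = (\<Sum>i<m. s (uact m a v i)) \<and> (\<Sum>j<m. s' (v j)) = (\<Sum>j<m. s (v j))"
    if "\<forall>i<m. \<forall>j<m. a i j \<in> strip_fun" "\<forall>j<m. v j \<in> urows" for m a v
    using that by (intro conjI sum.cong refl eq urows_closed) auto
  moreover have "(\<Sum>i<n. s' (uunit i)) = (\<Sum>i<n. s (uunit i))"
    by (intro sum.cong refl eq urows_closed)
  ultimately show ?thesis using s unfolding admissible_def by (simp add: eq urows_closed)
qed

lemma square_convex: "0 \<le> u \<Longrightarrow> u \<le> 1 \<Longrightarrow> ((1 - u) * x + u * y)\<^sup>2 \<le> (1 - u) * x\<^sup>2 + u * y\<^sup>2" for u x y :: real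
proof -
  assume u: "0 \<le> u" "u \<le> 1"
  have "(1 - u) * x\<^sup>2 + u * y\<^sup>2 - ((1 - u) * x + u * y)\<^sup>2 = u * (1 - u) * (x - y)\<^sup>2"
    by (simp add: power2_eq_square algebra_simps)
  moreover have "0 \<le> u * (1 - u) * (x - y)\<^sup>2" using u by simp
  ultimately show ?thesis by linarith
qed

lemma cmod_parallelogram: "(cmod (a + b))\<^sup>2 + (cmod (a - b))\<^sup>2 = 2 * (cmod a)\<^sup>2 + 2 * (cmod b)\<^sup>2"
  unfolding cmod_power2 by (simp add: power2_eq_square algebra_simps)

text \<open>Squared moduli of linear functionals satisfy the parallelogram, scaling and convexity
  clauses term by term; the module and unit clauses are what a particular representation has to
  provide.\<close>

lemma admissible_sum_squares:
  assumes lin: "\<And>p y y'. p \<in> I \<Longrightarrow> \<phi> p (uadd y y') = \<phi> p y + \<phi> p y'" "\<And>p y c. p \<in> I \<Longrightarrow> \<phi> p (uscale c y) = c * \<phi> p y"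
    and module: "\<And>m a v c. \<forall>i<m. \<forall>j<m. a i j \<in> strip_fun \<Longrightarrow> \<forall>j<m. v j \<in> urows \<Longrightarrow> 0 \<le> c \<Longrightarrow> fun_bdd m a c \<Longrightarrow>
        (\<Sum>i<m. \<Sum>p\<in>I. (cmod (\<phi> p (uact m a v i)))\<^sup>2) \<le> 2 * c\<^sup>2 * (\<Sum>j<m. \<Sum>p\<in>I. (cmod (\<phi> p (v j)))\<^sup>2)"
    and unit: "(\<Sum>i<n. \<Sum>p\<in>I. (cmod (\<phi> p (uunit i)))\<^sup>2) \<le> 1"
  shows "admissible n (\<lambda>y. \<Sum>p\<in>I. (cmod (\<phi> p y))\<^sup>2)"
  unfolding admissible_def
proof (intro conjI allI impI; (elim conjE)?)
  fix y y' :: urow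
  show "(\<Sum>p\<in>I. (cmod (\<phi> p (uadd y y')))\<^sup>2) + (\<Sum>p\<in>I. (cmod (\<phi> p (uadd y (uscale (-1) y'))))\<^sup>2)
      \<le> 2 * (\<Sum>p\<in>I. (cmod (\<phi> p y))\<^sup>2) + 2 * (\<Sum>p\<in>I. (cmod (\<phi> p y'))\<^sup>2)"
    by (simp add: sum_distrib_left sum.distrib[symmetric] lin cmod_parallelogram del: sum.distrib cong: sum.cong)
  fix u :: real assume u: "0 \<le> u" "u \<le> 1"
  show "(\<Sum>p\<in>I. (cmod (\<phi> p (uadd (uscale (complex_of_real (1 - u)) y) (uscale (complex_of_real u) y'))))\<^sup>2)
       \<le> (1 - u) * (\<Sum>p\<in>I. (cmod (\<phi> p y))\<^sup>2) + u * (\<Sum>p\<in>I. (cmod (\<phi> p y'))\<^sup>2)"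
    unfolding sum_distrib_left sum.distrib[symmetric]
  proof (rule sum_mono)
    fix p assume p: "p \<in> I"
    have "cmod (complex_of_real (1 - u) * \<phi> p y + complex_of_real u * \<phi> p y') \<le> (1 - u) * cmod (\<phi> p y) + u * cmod (\<phi> p y')"
      using norm_triangle_ineq[of "complex_of_real (1 - u) * \<phi> p y" "complex_of_real u * \<phi> p y'"] u
      unfolding norm_mult norm_of_real by simp
    from power_mono[OF this norm_ge_zero, of 2]
    show "(cmod (\<phi> p (uadd (uscale (complex_of_real (1 - u)) y) (uscale (complex_of_real u) y'))))\<^sup>2
         \<le> (1 - u) * (cmod (\<phi> p y))\<^sup>2 + u * (cmod (\<phi> p y'))\<^sup>2"
      unfolding lin(1)[OF p] lin(2)[OF p] by (rule order_trans[OF _ square_convex[OF u]])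
  qed
next
  fix y c show "(\<Sum>p\<in>I. (cmod (\<phi> p (uscale c y)))\<^sup>2) = (cmod c)\<^sup>2 * (\<Sum>p\<in>I. (cmod (\<phi> p y))\<^sup>2)"
    by (simp add: lin norm_mult power_mult_distrib sum_distrib_left)
qed (use module unit in \<open>auto intro: sum_nonneg\<close>)

text \<open>The row operator is the transpose of the column operator in the hypothesis, and the
  bound passes by duality.\<close>

lemma row_bdd_dual:
  assumes x: "row_bdd n x c" and c: "0 \<le> c"
  shows "(\<Sum>i<n. (cmod (\<Sum>k<K. \<Sum>j<n. x i j k * h j k))\<^sup>2) \<le> c\<^sup>2 * (\<Sum>k<K. \<Sum>j<n. (cmod (h j k))\<^sup>2)"
proof -
  define w where "w i = (\<Sum>k<K. \<Sum>j<n. x i j k * h j k)" for i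
  let ?I = "{..<K} \<times> {..<n}"
  have "(\<Sum>i<n. cnj (w i) * w i) = (\<Sum>i<n. \<Sum>p\<in>?I. cnj (w i) * (x i (snd p) (fst p) * h (snd p) (fst p)))"
    by (simp only: w_def[of _] sum.cartesian_product' fst_conv snd_conv sum_distrib_left)
  also have "\<dots> = (\<Sum>p\<in>?I. (\<Sum>i<n. x i (snd p) (fst p) * cnj (w i)) * h (snd p) (fst p))"
    by (subst sum.swap) (simp add: sum_distrib_left sum_distrib_right mult_ac)
  also have "cmod \<dots> \<le> L2_set (\<lambda>p. cmod (\<Sum>i<n. x i (snd p) (fst p) * cnj (w i))) ?I * L2_set (\<lambda>p. cmod (h (snd p) (fst p))) ?I"
    by (rule cmod_sum_cs)
  also have "\<dots> \<le> (c * L2_set (\<lambda>i. cmod (cnj (w i))) {..<n}) * L2_set (\<lambda>p. cmod (h (snd p) (fst p))) ?I"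
    using x c by (intro mult_right_mono) (auto simp: col_bdd_L2 simp del: complex_mod_cnj)
  finally have "cmod (\<Sum>i<n. cnj (w i) * w i) \<le> (c * L2_set (\<lambda>p. cmod (h (snd p) (fst p))) ?I) * L2_set (\<lambda>i. cmod (w i)) {..<n}"
    by (simp add: mult_ac)
  from self_dual_bound[OF this] show ?thesis using c
    by (simp add: w_def power_mult_distrib L2_set_power2 sum.cartesian_product')
qed

lemma row_bdd_single:
  assumes x: "row_bdd n x c" and c: "0 \<le> c"
  shows "(\<Sum>i<n. (cmod (\<Sum>j<n. x i j k * w j))\<^sup>2) \<le> c\<^sup>2 * (\<Sum>j<n. (cmod (w j))\<^sup>2)"
proof -
  define h where "h j k' = (if k' = k then w j else 0)" for j k'
  have "(\<Sum>k'<Suc k. \<Sum>j<n. x i j k' * h j k') = (\<Sum>j<n. x i j k * w j)" for i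
    unfolding sum.lessThan_Suc by (simp add: h_def)
  moreover have "(\<Sum>k'<Suc k. \<Sum>j<n. (cmod (h j k'))\<^sup>2) = (\<Sum>j<n. (cmod (w j))\<^sup>2)"
    unfolding sum.lessThan_Suc by (simp add: h_def)
  ultimately show ?thesis using row_bdd_dual[OF x c, where K = "Suc k" and h = h] by (simp only:)
qed

text \<open>The forms \<open>\<parallel>y \<eta>\<parallel>\<^sup>2\<close> for the representations diag + column at \<open>1 + \<i> t\<close>, with \<open>\<eta>\<close> in the extra
  dimension, and diag + row at \<open>\<i> t\<close>, cut off at the first \<open>K\<close> coordinates.  The index \<open>None\<close> is the
  component in the extra dimension.\<close>

definition opt_index :: "nat \<Rightarrow> nat option set" where
  "opt_index K = insert None (Some ` {..<K})"

lemma sum_opt_index: "(\<Sum>p\<in>opt_index K. g p) = g None + (\<Sum>k<K. g (Some k))"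
  by (simp add: opt_index_def sum.reindex image_iff)

definition right_functional :: "nat \<Rightarrow> real \<Rightarrow> (nat \<Rightarrow> complex) \<Rightarrow> nat option \<Rightarrow> urow \<Rightarrow> complex" where
  "right_functional n t \<eta> p y = (case p of None \<Rightarrow> \<Sum>l<n. fst y l * \<eta> l
     | Some k \<Rightarrow> \<Sum>l<n. snd y l (1 + \<i> * t) k * \<eta> l)"

definition left_functional :: "nat \<Rightarrow> nat \<Rightarrow> real \<Rightarrow> (nat \<Rightarrow> nat \<Rightarrow> complex) \<Rightarrow> nat option \<Rightarrow> urow \<Rightarrow> complex" where
  "left_functional n K t \<eta> p y = (case p of None \<Rightarrow> \<Sum>k<K. \<Sum>l<n. snd y l (\<i> * t) k * \<eta> l k
     | Some k \<Rightarrow> \<Sum>l<n. (fst y l + snd y l (\<i> * t) k) * \<eta> l k)"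

definition right_state where
  "right_state n K t \<eta> y = (\<Sum>p\<in>opt_index K. (cmod (right_functional n t \<eta> p y))\<^sup>2)"

definition left_state where
  "left_state n K t \<eta> y = (\<Sum>p\<in>opt_index K. (cmod (left_functional n K t \<eta> p y))\<^sup>2)"

lemma cmod_add_sq: "(cmod (a + b))\<^sup>2 \<le> 2 * (cmod a)\<^sup>2 + 2 * (cmod b)\<^sup>2"
  using cmod_parallelogram[of a b] zero_le_power2[of "cmod (a - b)"] by linarith

text \<open>The vector of a row has a component \<open>P\<close> in the extra dimension and a
  component \<open>R\<close> in l2. Multiplication sends both into l2: \<open>P\<close> through the
  column norm and \<open>R\<close> through the diagonal. The square of this sum of two terms costs
  the factor 2.\<close>

lemma right_state_admissible:
  assumes \<eta>: "(\<Sum>l<n. (cmod (\<eta> l))\<^sup>2) \<le> 1"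
  shows "admissible n (right_state n K t \<eta>)"
  unfolding right_state_def
proof (rule admissible_sum_squares)
  show "(\<Sum>i<n. \<Sum>p\<in>opt_index K. (cmod (right_functional n t \<eta> p (uunit i)))\<^sup>2) \<le> 1"
    using \<eta> by (simp add: sum_opt_index right_functional_def uunit_def if_distrib[of "\<lambda>x. x * _"] cong: if_cong)
  fix m a v c assume "\<forall>i<m. \<forall>j<m. a i j \<in> strip_fun" "\<forall>j<m. v j \<in> urows" and c: "(0::real) \<le> c" and a: "fun_bdd m a c"
  define P where "P j = (\<Sum>l<n. fst (v j) l * \<eta> l)" for j
  define R where "R j k = (\<Sum>l<n. snd (v j) l (1 + \<i> * t) k * \<eta> l)" for j k
  define x where "x i j = a i j (1 + \<i> * t)" for i j
  have x: "col_bdd m x c" using a unfolding fun_bdd_def x_def by blast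
  have act: "right_functional n t \<eta> (Some k) (uact m a v i) = (\<Sum>j<m. x i j k * P j) + (\<Sum>j<m. x i j k * R j k)" for i k
  proof -
    have "right_functional n t \<eta> (Some k) (uact m a v i) = (\<Sum>l<n. \<Sum>j<m. x i j k * (fst (v j) l + snd (v j) l (1 + \<i> * t) k) * \<eta> l)"
      by (simp add: right_functional_def uact_def x_def sum_distrib_right)
    also have "\<dots> = (\<Sum>j<m. \<Sum>l<n. x i j k * (fst (v j) l + snd (v j) l (1 + \<i> * t) k) * \<eta> l)" by (rule sum.swap)
    also have "\<dots> = (\<Sum>j<m. x i j k * P j) + (\<Sum>j<m. x i j k * R j k)"
      by (simp add: P_def R_def sum_distrib_left sum.distrib[symmetric] algebra_simps)
    finally show ?thesis .
  qed
  have none: "right_functional n t \<eta> None (uact m a v i) = 0" for i by (simp add: right_functional_def uact_def)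
  have "(\<Sum>i<m. \<Sum>p\<in>opt_index K. (cmod (right_functional n t \<eta> p (uact m a v i)))\<^sup>2)
     = (\<Sum>i<m. \<Sum>k<K. (cmod ((\<Sum>j<m. x i j k * P j) + (\<Sum>j<m. x i j k * R j k)))\<^sup>2)"
    by (simp add: sum_opt_index none act)
  also have "\<dots> \<le> (\<Sum>i<m. \<Sum>k<K. 2 * (cmod (\<Sum>j<m. x i j k * P j))\<^sup>2 + 2 * (cmod (\<Sum>j<m. x i j k * R j k))\<^sup>2)"
    by (intro sum_mono cmod_add_sq)
  also have "\<dots> = 2 * (\<Sum>k<K. \<Sum>i<m. (cmod (\<Sum>j<m. x i j k * P j))\<^sup>2) + 2 * (\<Sum>k<K. \<Sum>i<m. (cmod (\<Sum>j<m. x i j k * R j k))\<^sup>2)"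
    by (simp add: sum.distrib sum_distrib_left sum.swap[of _ "{..<m}" "{..<K}"])
  also have "\<dots> \<le> 2 * (c\<^sup>2 * (\<Sum>j<m. (cmod (P j))\<^sup>2)) + 2 * (\<Sum>k<K. c\<^sup>2 * (\<Sum>j<m. (cmod (R j k))\<^sup>2))"
    using x by (intro add_mono mult_left_mono sum_mono col_bdd_single) (auto simp: col_bdd_def)
  also have "\<dots> = 2 * c\<^sup>2 * (\<Sum>j<m. (cmod (P j))\<^sup>2 + (\<Sum>k<K. (cmod (R j k))\<^sup>2))"
    by (simp add: sum.distrib sum_distrib_left[symmetric] algebra_simps sum.swap[of _ "{..<K}" "{..<m}"])
  also have "(\<Sum>j<m. (cmod (P j))\<^sup>2 + (\<Sum>k<K. (cmod (R j k))\<^sup>2)) = (\<Sum>j<m. \<Sum>p\<in>opt_index K. (cmod (right_functional n t \<eta> p (v j)))\<^sup>2)"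
    by (simp add: sum_opt_index right_functional_def P_def R_def)
  finally show "(\<Sum>i<m. \<Sum>p\<in>opt_index K. (cmod (right_functional n t \<eta> p (uact m a v i)))\<^sup>2)
      \<le> 2 * c\<^sup>2 * (\<Sum>j<m. \<Sum>p\<in>opt_index K. (cmod (right_functional n t \<eta> p (v j)))\<^sup>2)" .
qed (auto simp: right_functional_def uadd_def uscale_def sum.distrib[symmetric] sum_distrib_left algebra_simps split: option.split)

text \<open>The product depends only on the l2 component \<open>R\<close>, which already contains
  the scalar part. It is used once by the row and once by the diagonal, each bounded by
  \<open>c\<^sup>2\<close>, hence the factor 2.\<close>

lemma left_state_admissible:
  assumes \<eta>: "(\<Sum>l<n. \<Sum>k<K. (cmod (\<eta> l k))\<^sup>2) \<le> 1"
  shows "admissible n (left_state n K t \<eta>)"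
  unfolding left_state_def
proof (rule admissible_sum_squares)
  show "(\<Sum>i<n. \<Sum>p\<in>opt_index K. (cmod (left_functional n K t \<eta> p (uunit i)))\<^sup>2) \<le> 1"
    using \<eta> by (simp add: sum_opt_index left_functional_def uunit_def if_distrib[of "\<lambda>x. x * _"] cong: if_cong)
  fix m a v c assume "\<forall>i<m. \<forall>j<m. a i j \<in> strip_fun" "\<forall>j<m. v j \<in> urows" and c: "(0::real) \<le> c" and a: "fun_bdd m a c"
  define R where "R j k = (\<Sum>l<n. (fst (v j) l + snd (v j) l (\<i> * t) k) * \<eta> l k)" for j k
  define x where "x i j = a i j (\<i> * t)" for i j
  have x: "row_bdd m x c" using a unfolding fun_bdd_def x_def by blast
  have act: "(\<Sum>l<n. snd (uact m a v i) l (\<i> * t) k * \<eta> l k) = (\<Sum>j<m. x i j k * R j k)" for i k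
  proof -
    have "(\<Sum>l<n. snd (uact m a v i) l (\<i> * t) k * \<eta> l k) = (\<Sum>l<n. \<Sum>j<m. x i j k * (fst (v j) l + snd (v j) l (\<i> * t) k) * \<eta> l k)"
      by (simp add: uact_def x_def sum_distrib_right)
    also have "\<dots> = (\<Sum>j<m. \<Sum>l<n. x i j k * (fst (v j) l + snd (v j) l (\<i> * t) k) * \<eta> l k)" by (rule sum.swap)
    also have "\<dots> = (\<Sum>j<m. x i j k * R j k)"
      by (simp add: R_def sum_distrib_left mult.assoc)
    finally show ?thesis .
  qed
  have some: "left_functional n K t \<eta> (Some k) (uact m a v i) = (\<Sum>j<m. x i j k * R j k)" for i k
    using act[of i k] by (simp add: left_functional_def uact_def)
  have none: "left_functional n K t \<eta> None (uact m a v i) = (\<Sum>k<K. \<Sum>j<m. x i j k * R j k)" for i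
    by (simp add: left_functional_def act)
  have "(\<Sum>i<m. \<Sum>p\<in>opt_index K. (cmod (left_functional n K t \<eta> p (uact m a v i)))\<^sup>2)
     = (\<Sum>i<m. (cmod (\<Sum>k<K. \<Sum>j<m. x i j k * R j k))\<^sup>2) + (\<Sum>k<K. \<Sum>i<m. (cmod (\<Sum>j<m. x i j k * R j k))\<^sup>2)"
    by (simp add: sum_opt_index none some sum.distrib sum.swap[of _ "{..<m}" "{..<K}"])
  also have "\<dots> \<le> c\<^sup>2 * (\<Sum>k<K. \<Sum>j<m. (cmod (R j k))\<^sup>2) + (\<Sum>k<K. c\<^sup>2 * (\<Sum>j<m. (cmod (R j k))\<^sup>2))"
    by (intro add_mono sum_mono row_bdd_single row_bdd_dual x c)
  also have "\<dots> = 2 * c\<^sup>2 * (\<Sum>j<m. \<Sum>k<K. (cmod (R j k))\<^sup>2)"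
    by (simp add: sum_distrib_left[symmetric] sum.swap[of _ "{..<K}" "{..<m}"])
  also have "\<dots> \<le> 2 * c\<^sup>2 * (\<Sum>j<m. \<Sum>p\<in>opt_index K. (cmod (left_functional n K t \<eta> p (v j)))\<^sup>2)"
    by (intro mult_left_mono sum_mono) (simp_all add: sum_opt_index left_functional_def R_def)
  finally show "(\<Sum>i<m. \<Sum>p\<in>opt_index K. (cmod (left_functional n K t \<eta> p (uact m a v i)))\<^sup>2)
      \<le> 2 * c\<^sup>2 * (\<Sum>j<m. \<Sum>p\<in>opt_index K. (cmod (left_functional n K t \<eta> p (v j)))\<^sup>2)" .
qed (auto simp: left_functional_def uadd_def uscale_def sum.distrib[symmetric] sum_distrib_left algebra_simps split: option.split)

lemma admissibleD:
  assumes "admissible n s"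
  shows admissible_nonneg: "y \<in> urows \<Longrightarrow> 0 \<le> s y"
    and admissible_parallelogram: "y \<in> urows \<Longrightarrow> y' \<in> urows \<Longrightarrow> s (uadd y y') + s (uadd y (uscale (-1) y')) \<le> 2 * s y + 2 * s y'"
    and admissible_scale: "y \<in> urows \<Longrightarrow> s (uscale c y) = (cmod c)\<^sup>2 * s y"
    and admissible_conv: "y \<in> urows \<Longrightarrow> y' \<in> urows \<Longrightarrow> 0 \<le> u \<Longrightarrow> u \<le> 1 \<Longrightarrow>
        s (uadd (uscale (complex_of_real (1 - u)) y) (uscale (complex_of_real u) y')) \<le> (1 - u) * s y + u * s y'"
    and admissible_module: "(\<And>i j. i < m \<Longrightarrow> j < m \<Longrightarrow> a i j \<in> strip_fun) \<Longrightarrow> (\<And>j. j < m \<Longrightarrow> v j \<in> urows) \<Longrightarrow> 0 \<le> d \<Longrightarrow> fun_bdd m a d \<Longrightarrow>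
        (\<Sum>i<m. s (uact m a v i)) \<le> 2 * d\<^sup>2 * (\<Sum>j<m. s (v j))"
    and admissible_unit: "(\<Sum>i<n. s (uunit i)) \<le> 1"
proof -
  note A = assms[unfolded admissible_def]
  show "y \<in> urows \<Longrightarrow> 0 \<le> s y" by (rule conjunct1[OF A, rule_format])
  show "y \<in> urows \<Longrightarrow> y' \<in> urows \<Longrightarrow> s (uadd y y') + s (uadd y (uscale (-1) y')) \<le> 2 * s y + 2 * s y'"
    by (rule conjunct1[OF conjunct2[OF A], rule_format]) simp
  show "y \<in> urows \<Longrightarrow> s (uscale c y) = (cmod c)\<^sup>2 * s y"
    by (rule conjunct1[OF conjunct2[OF conjunct2[OF A]], rule_format])
  show "y \<in> urows \<Longrightarrow> y' \<in> urows \<Longrightarrow> 0 \<le> u \<Longrightarrow> u \<le> 1 \<Longrightarrow>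
        s (uadd (uscale (complex_of_real (1 - u)) y) (uscale (complex_of_real u) y')) \<le> (1 - u) * s y + u * s y'"
    by (rule conjunct1[OF conjunct2[OF conjunct2[OF conjunct2[OF A]]], rule_format]) simp
  show "(\<And>i j. i < m \<Longrightarrow> j < m \<Longrightarrow> a i j \<in> strip_fun) \<Longrightarrow> (\<And>j. j < m \<Longrightarrow> v j \<in> urows) \<Longrightarrow> 0 \<le> d \<Longrightarrow> fun_bdd m a d \<Longrightarrow>
        (\<Sum>i<m. s (uact m a v i)) \<le> 2 * d\<^sup>2 * (\<Sum>j<m. s (v j))"
    by (rule conjunct1[OF conjunct2[OF conjunct2[OF conjunct2[OF conjunct2[OF A]]]], rule_format]) simp
  show "(\<Sum>i<n. s (uunit i)) \<le> 1" by (rule conjunct2[OF conjunct2[OF conjunct2[OF conjunct2[OF conjunct2[OF A]]]]])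
qed

section \<open>Vector states on the edges\<close>

definition states :: "nat \<Rightarrow> (urow \<Rightarrow> real) set" where
  "states n = {right_state n K t \<eta> | K t \<eta>. (\<Sum>l<n. (cmod (\<eta> l))\<^sup>2) \<le> 1}
     \<union> {left_state n K t \<eta> | K t \<eta>. (\<Sum>l<n. \<Sum>k<K. (cmod (\<eta> l k))\<^sup>2) \<le> 1}"

lemma right_state_in_states: "(\<Sum>l<n. (cmod (\<eta> l))\<^sup>2) \<le> 1 \<Longrightarrow> right_state n K t \<eta> \<in> states n"
  unfolding states_def by (intro UnI1 CollectI exI[of _ K] exI[of _ t] exI[of _ \<eta>] conjI refl)

lemma left_state_in_states: "(\<Sum>l<n. \<Sum>k<K. (cmod (\<eta> l k))\<^sup>2) \<le> 1 \<Longrightarrow> left_state n K t \<eta> \<in> states n"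
  unfolding states_def by (intro UnI2 CollectI exI[of _ K] exI[of _ t] exI[of _ \<eta>] conjI refl)

lemma states_admissible: "s \<in> states n \<Longrightarrow> admissible n s"
  unfolding states_def using right_state_admissible left_state_admissible by blast

text \<open>This is the bound at each row that makes the space of forms compact. It must not depend
  on the cut-off \<open>K\<close> or on \<open>t\<close>, hence the estimates by l2 norms that are
  uniform on the strip.\<close>

lemma states_bounded:
  assumes y: "y \<in> urows"
  shows "\<exists>b. \<forall>s\<in>states n. s y \<le> b"
proof -
  have fs: "snd y l \<in> strip_fun" for l using y by (simp add: urows_def)
  have "\<forall>l. \<exists>B. 0 \<le> B \<and> (\<forall>z\<in>strip. l2 (snd y l z) \<le> B)" using strip_fun_bdd[OF fs] by metis
  then obtain B where B: "\<And>l. 0 \<le> B l" "\<And>l z. z \<in> strip \<Longrightarrow> l2 (snd y l z) \<le> B l" by metis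
  define A where "A = (\<Sum>l<n. (cmod (fst y l) + B l)\<^sup>2)"
  have A0: "0 \<le> A" by (simp add: A_def sum_nonneg)
  have f: "(\<Sum>k<K. \<Sum>l<n. (cmod (snd y l z k))\<^sup>2) \<le> A" if z: "z \<in> strip" for z K
  proof -
    have "(\<Sum>k<K. \<Sum>l<n. (cmod (snd y l z k))\<^sup>2) = (\<Sum>l<n. \<Sum>k<K. (cmod (snd y l z k))\<^sup>2)" by (rule sum.swap)
    also have "\<dots> \<le> A" unfolding A_def
      by (intro sum_mono order_trans[OF ell2_partial[OF strip_fun_ell2[OF fs z]]] power_mono)
        (use B z in \<open>auto intro: order_trans[OF B(2)[OF z]]\<close>)
    finally show ?thesis .
  qed
  have lf: "(\<Sum>l<n. (cmod (fst y l + snd y l z k))\<^sup>2) \<le> A" if z: "z \<in> strip" for z k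
    unfolding A_def
    by (intro sum_mono power_mono order_trans[OF norm_triangle_ineq] add_left_mono
        order_trans[OF ell2_coord[OF strip_fun_ell2[OF fs z]]] B z) auto
  have lam: "(\<Sum>l<n. (cmod (fst y l))\<^sup>2) \<le> A"
    unfolding A_def using B by (intro sum_mono power_mono) auto
  have "right_state n K t \<eta> y \<le> 2 * A" if e: "(\<Sum>l<n. (cmod (\<eta> l))\<^sup>2) \<le> 1" for K t \<eta>
  proof -
    have "(cmod (\<Sum>l<n. fst y l * \<eta> l))\<^sup>2 \<le> A * 1"
      by (rule order_trans[OF cmod_sum_cs2]) (intro mult_mono lam e A0 sum_nonneg; simp)
    moreover have "(\<Sum>k<K. (cmod (\<Sum>l<n. snd y l (1 + \<i> * t) k * \<eta> l))\<^sup>2) \<le> (\<Sum>k<K. (\<Sum>l<n. (cmod (snd y l (1 + \<i> * t) k))\<^sup>2) * 1)"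
      by (intro sum_mono order_trans[OF cmod_sum_cs2] mult_left_mono e sum_nonneg) auto
    moreover have "\<dots> \<le> A" using f[of "1 + \<i> * t" K] by simp
    ultimately show ?thesis by (simp add: right_state_def sum_opt_index right_functional_def)
  qed
  moreover have "left_state n K t \<eta> y \<le> 2 * A" if e: "(\<Sum>l<n. \<Sum>k<K. (cmod (\<eta> l k))\<^sup>2) \<le> 1" for K t \<eta>
  proof -
    have e': "(\<Sum>k<K. \<Sum>l<n. (cmod (\<eta> l k))\<^sup>2) \<le> 1" using e by (subst sum.swap)
    have "(\<Sum>k<K. \<Sum>l<n. snd y l (\<i> * t) k * \<eta> l k) = (\<Sum>p\<in>{..<K} \<times> {..<n}. snd y (snd p) (\<i> * t) (fst p) * \<eta> (snd p) (fst p))"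
      by (simp add: sum.cartesian_product')
    also have "(cmod \<dots>)\<^sup>2 \<le> (\<Sum>p\<in>{..<K} \<times> {..<n}. (cmod (snd y (snd p) (\<i> * t) (fst p)))\<^sup>2) * (\<Sum>p\<in>{..<K} \<times> {..<n}. (cmod (\<eta> (snd p) (fst p)))\<^sup>2)"
      by (rule cmod_sum_cs2)
    also have "\<dots> \<le> A * 1"
      using f[of "\<i> * t" K] e' A0 by (intro mult_mono) (auto simp: sum.cartesian_product' intro!: sum_nonneg)
    finally have 1: "(cmod (\<Sum>k<K. \<Sum>l<n. snd y l (\<i> * t) k * \<eta> l k))\<^sup>2 \<le> A" by simp
    have "(\<Sum>k<K. (cmod (\<Sum>l<n. (fst y l + snd y l (\<i> * t) k) * \<eta> l k))\<^sup>2) \<le> (\<Sum>k<K. A * (\<Sum>l<n. (cmod (\<eta> l k))\<^sup>2))"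
      by (intro sum_mono order_trans[OF cmod_sum_cs2] mult_right_mono lf sum_nonneg) auto
    also have "\<dots> = A * (\<Sum>k<K. \<Sum>l<n. (cmod (\<eta> l k))\<^sup>2)" by (simp add: sum_distrib_left)
    also have "\<dots> \<le> A * 1" using e' A0 by (rule mult_left_mono)
    finally show ?thesis using 1 by (simp add: left_state_def sum_opt_index left_functional_def)
  qed
  ultimately show ?thesis unfolding states_def by blast
qed

text \<open>A violated edge bound comes with a finite witness, which is normalised to a unit vector
  \<open>\<eta>\<close>: on the right the vector \<open>v\<close> itself, on the left the vector in
  l2 on which the row operator, paired with \<open>u\<close>, is largest.\<close>

lemma states_detect:
  assumes f: "\<not> fun_bdd n f 1"
  shows "\<exists>s\<in>states n. 1 \<le> (\<Sum>i<n. s (urow_of n f i))"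
proof -
  consider t :: real where "\<not> col_bdd n (\<lambda>i j. f i j (1 + \<i> * t)) 1"
    | t :: real where "\<not> row_bdd n (\<lambda>i j. f i j (\<i> * t)) 1"
    using f unfolding fun_bdd_def by blast
  then show ?thesis
  proof cases
    case 1
    define x where "x i j = f i j (1 + \<i> * t)" for i j
    obtain v K where vK: "(\<Sum>j<n. (cmod (v j))\<^sup>2) < (\<Sum>k<K. \<Sum>i<n. (cmod (\<Sum>j<n. x i j k * v j))\<^sup>2)"
      using 1 unfolding col_bdd_def x_def by (auto simp: not_le)
    define V where "V = (\<Sum>j<n. (cmod (v j))\<^sup>2)"
    have "V \<noteq> 0"
    proof
      assume "V = 0"
      then have "\<forall>j<n. v j = 0" by (auto simp: V_def sum_nonneg_eq_0_iff)
      then have "(\<Sum>k<K. \<Sum>i<n. (cmod (\<Sum>j<n. x i j k * v j))\<^sup>2) = 0" by simp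
      then show False using vK \<open>V = 0\<close> by (simp add: V_def)
    qed
    then have V: "0 < V" by (simp add: V_def less_le sum_nonneg)
    define r where "r = complex_of_real (1 / sqrt V)"
    have r2: "(cmod r)\<^sup>2 = 1 / V" using V by (simp add: r_def norm_divide power_divide)
    define \<eta> where "\<eta> l = r * v l" for l
    have "(\<Sum>l<n. (cmod (\<eta> l))\<^sup>2) = 1" using V by (simp add: \<eta>_def norm_mult power_mult_distrib r2 sum_divide_distrib[symmetric] V_def)
    then have st: "right_state n K t \<eta> \<in> states n" by (intro right_state_in_states) simp
    have "right_functional n t \<eta> None (urow_of n f i) = 0" for i by (simp add: right_functional_def urow_of_def)
    moreover have "right_functional n t \<eta> (Some k) (urow_of n f i) = r * (\<Sum>j<n. x i j k * v j)" for i k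
      by (simp add: right_functional_def urow_of_def \<eta>_def x_def sum_distrib_left mult_ac)
    ultimately have "(\<Sum>i<n. right_state n K t \<eta> (urow_of n f i)) = (\<Sum>i<n. \<Sum>k<K. (cmod (\<Sum>j<n. x i j k * v j))\<^sup>2) / V"
      by (simp add: right_state_def sum_opt_index norm_mult power_mult_distrib r2 sum_divide_distrib)
    also have "\<dots> \<ge> 1" using vK V by (simp add: V_def sum.swap[of _ "{..<n}" "{..<K}"])
    finally show ?thesis using st by blast
  next
    case 2
    define x where "x i j = f i j (\<i> * t)" for i j
    obtain u K where uK: "(\<Sum>j<n. (cmod (u j))\<^sup>2) < (\<Sum>k<K. \<Sum>j<n. (cmod (\<Sum>i<n. x i j k * u i))\<^sup>2)"
      using 2 unfolding col_bdd_def x_def by (auto simp: not_le)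
    define w where "w l k = (\<Sum>i<n. x i l k * u i)" for l k
    define W where "W = (\<Sum>k<K. \<Sum>l<n. (cmod (w l k))\<^sup>2)"
    define U where "U = (\<Sum>i<n. (cmod (u i))\<^sup>2)"
    have UW: "U < W" using uK by (simp add: U_def W_def w_def)
    have U0: "0 \<le> U" by (simp add: U_def sum_nonneg)
    then have W: "0 < W" using UW by linarith
    define r where "r = complex_of_real (1 / sqrt W)"
    have r2: "(cmod r)\<^sup>2 = 1 / W" using W by (simp add: r_def norm_divide power_divide)
    \<comment> \<open>The conjugate of \<open>w\<close> gives equality in the Cauchy-Schwarz
      inequality, so the squared pairing with \<open>w\<close> equals \<open>W\<close>.\<close>
    define \<eta> where "\<eta> l k = r * cnj (w l k)" for l k
    have "(\<Sum>l<n. \<Sum>k<K. (cmod (\<eta> l k))\<^sup>2) = (\<Sum>k<K. \<Sum>l<n. (cmod (w l k))\<^sup>2) / W"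
      by (subst sum.swap) (simp add: \<eta>_def norm_mult power_mult_distrib r2 sum_divide_distrib)
    then have st: "left_state n K t \<eta> \<in> states n" using W by (intro left_state_in_states) (simp add: W_def)
    define T where "T i = (\<Sum>k<K. \<Sum>l<n. x i l k * \<eta> l k)" for i
    have "(\<Sum>i<n. u i * T i) = (\<Sum>k<K. \<Sum>l<n. w l k * \<eta> l k)"
    proof -
      have "(\<Sum>i<n. u i * T i) = (\<Sum>i<n. \<Sum>k<K. \<Sum>l<n. u i * (x i l k * \<eta> l k))" by (simp add: T_def sum_distrib_left)
      also have "\<dots> = (\<Sum>k<K. \<Sum>i<n. \<Sum>l<n. u i * (x i l k * \<eta> l k))" by (rule sum.swap)
      also have "\<dots> = (\<Sum>k<K. \<Sum>l<n. \<Sum>i<n. u i * (x i l k * \<eta> l k))" by (intro sum.cong refl sum.swap)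
      finally show ?thesis by (simp add: w_def sum_distrib_left sum_distrib_right mult_ac)
    qed
    also have "\<dots> = r * complex_of_real W"
      by (simp add: \<eta>_def W_def sum_distrib_left complex_norm_square mult_ac del: of_real_power)
    finally have "(cmod (\<Sum>i<n. u i * T i))\<^sup>2 = W"
      using W by (simp only: norm_mult power_mult_distrib r2 norm_of_real power2_abs) (simp add: power2_eq_square)
    then have "W \<le> U * (\<Sum>i<n. (cmod (T i))\<^sup>2)"
      using cmod_sum_cs2[of u T "{..<n}"] by (simp add: U_def)
    then have T1: "1 \<le> (\<Sum>i<n. (cmod (T i))\<^sup>2)"
    proof (rule contrapos_pp)
      assume "\<not> 1 \<le> (\<Sum>i<n. (cmod (T i))\<^sup>2)"
      then have "U * (\<Sum>i<n. (cmod (T i))\<^sup>2) \<le> U * 1" using U0 by (intro mult_left_mono) auto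
      then show "\<not> W \<le> U * (\<Sum>i<n. (cmod (T i))\<^sup>2)" using UW by linarith
    qed
    have "left_functional n K t \<eta> None (urow_of n f i) = T i" for i
      by (simp add: left_functional_def urow_of_def T_def x_def)
    then have "(cmod (T i))\<^sup>2 \<le> left_state n K t \<eta> (urow_of n f i)" for i
      by (simp add: left_state_def sum_opt_index sum_nonneg)
    then have "(\<Sum>i<n. (cmod (T i))\<^sup>2) \<le> (\<Sum>i<n. left_state n K t \<eta> (urow_of n f i))" by (intro sum_mono)
    then show ?thesis using st T1 by (intro bexI[OF _ st]) linarith
  qed
qed

text \<open>Jets are prescribed at the first \<open>N\<close> coordinates only. The quotient is then
  finite-dimensional, while the functions themselves remain arbitrary elements of the
  algebra.\<close>

definition lifts :: "nat \<Rightarrow> nat \<Rightarrow> (nat \<Rightarrow> nat \<Rightarrow> (nat \<Rightarrow> complex) \<times> (nat \<Rightarrow> complex)) \<Rightarrow> (nat \<Rightarrow> nat \<Rightarrow> complex \<Rightarrow> nat \<Rightarrow> complex) set" where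
  "lifts n N P = {f. \<forall>i<n. \<forall>j<n. f i j \<in> strip_fun \<and>
     (\<forall>k<N. fst (jet (f i j)) k = fst (P i j) k \<and> snd (jet (f i j)) k = snd (P i j) k)}"

section \<open>One form for all lifts\<close>

text \<open>Tychonoff's theorem, in the product topology on functions.\<close>

lemma compact_fun_box: "compact {s :: 'y \<Rightarrow> real. \<forall>y. a y \<le> s y \<and> s y \<le> b y}"
proof -
  have "compactin (product_topology (\<lambda>_ :: 'y. euclidean :: real topology) UNIV) (PiE UNIV (\<lambda>y. {a y..b y}))"
    by (subst compactin_PiE) simp
  moreover have "PiE UNIV (\<lambda>y. {a y..b y}) = {s. \<forall>y. a y \<le> s y \<and> s y \<le> b y}"
    by (auto simp: PiE_def Pi_def)
  ultimately show ?thesis by (simp add: euclidean_product_topology)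
qed

lemma closed_admissible: "closed {s. admissible n s}"
  unfolding admissible_def
  by (intro closed_Collect_conj closed_Collect_all closed_Collect_imp closed_Collect_le closed_Collect_eq
      open_Collect_const continuous_intros continuous_on_product_coordinates)

lemma admissible_convex:
  assumes s: "admissible n s" and s': "admissible n s'" and u: "0 \<le> u" "u \<le> 1"
  shows "admissible n (\<lambda>y. (1 - u) * s y + u * s' y)"
proof -
  have comb: "(1 - u) * a + u * b \<le> (1 - u) * a' + u * b'" if "a \<le> a'" "b \<le> b'" for a b a' b' :: real
    using u that by (intro add_mono mult_left_mono) auto
  show ?thesis unfolding admissible_def
  proof (intro conjI allI impI; (elim conjE)?)
    fix y assume y: "y \<in> urows"
    show "0 \<le> (1 - u) * s y + u * s' y" using admissible_nonneg[OF s y] admissible_nonneg[OF s' y] u by simp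
    fix c show "(1 - u) * s (uscale c y) + u * s' (uscale c y) = (cmod c)\<^sup>2 * ((1 - u) * s y + u * s' y)"
      using admissible_scale[OF s y] admissible_scale[OF s' y] by (simp add: algebra_simps)
  next
    fix y y' assume y: "y \<in> urows" "y' \<in> urows"
    have "s (uadd y y') + s (uadd y (uscale (-1) y')) \<le> 2 * s y + 2 * s y'"
      "s' (uadd y y') + s' (uadd y (uscale (-1) y')) \<le> 2 * s' y + 2 * s' y'"
      using admissible_parallelogram[OF s y] admissible_parallelogram[OF s' y] .
    from comb[OF this] show "(1 - u) * s (uadd y y') + u * s' (uadd y y') + ((1 - u) * s (uadd y (uscale (-1) y')) + u * s' (uadd y (uscale (-1) y')))
       \<le> 2 * ((1 - u) * s y + u * s' y) + 2 * ((1 - u) * s y' + u * s' y')" by (simp add: algebra_simps)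
    fix r :: real assume r: "0 \<le> r" "r \<le> 1"
    have "s (uadd (uscale (complex_of_real (1 - r)) y) (uscale (complex_of_real r) y')) \<le> (1 - r) * s y + r * s y'"
      "s' (uadd (uscale (complex_of_real (1 - r)) y) (uscale (complex_of_real r) y')) \<le> (1 - r) * s' y + r * s' y'"
      using admissible_conv[OF s y r] admissible_conv[OF s' y r] .
    from comb[OF this] show "(1 - u) * s (uadd (uscale (complex_of_real (1 - r)) y) (uscale (complex_of_real r) y')) +
       u * s' (uadd (uscale (complex_of_real (1 - r)) y) (uscale (complex_of_real r) y'))
       \<le> (1 - r) * ((1 - u) * s y + u * s' y) + r * ((1 - u) * s y' + u * s' y')" by (simp add: algebra_simps)
  next
    fix m a v and c :: real
    assume h: "\<forall>i<m. \<forall>j<m. a i j \<in> strip_fun" "\<forall>j<m. v j \<in> urows" "0 \<le> c" "fun_bdd m a c"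
    have "(\<Sum>i<m. s (uact m a v i)) \<le> 2 * c\<^sup>2 * (\<Sum>j<m. s (v j))" "(\<Sum>i<m. s' (uact m a v i)) \<le> 2 * c\<^sup>2 * (\<Sum>j<m. s' (v j))"
      using h by (auto intro!: admissible_module[OF s] admissible_module[OF s'])
    from comb[OF this] show "(\<Sum>i<m. (1 - u) * s (uact m a v i) + u * s' (uact m a v i)) \<le> 2 * c\<^sup>2 * (\<Sum>j<m. (1 - u) * s (v j) + u * s' (v j))"
      unfolding sum.distrib sum_distrib_left[symmetric] by (simp add: distrib_left mult_ac)
  next
    have "(\<Sum>i<n. s (uunit i)) \<le> 1" "(\<Sum>i<n. s' (uunit i)) \<le> 1" using admissible_unit[OF s] admissible_unit[OF s'] .
    from comb[OF this] show "(\<Sum>i<n. (1 - u) * s (uunit i) + u * s' (uunit i)) \<le> 1"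
      unfolding sum.distrib sum_distrib_left[symmetric] by simp
  qed
qed

text \<open>By \<open>states_detect\<close> each lift has a state of its own. The lifts form a
  convex set, and the pairing is affine in the form and convex in the lift, so the quantifiers may
  be exchanged.\<close>

lemma exists_form:
  assumes nb: "\<And>f. f \<in> lifts n N P \<Longrightarrow> \<not> fun_bdd n f 1"
  shows "\<exists>s. admissible n s \<and> (\<forall>f\<in>lifts n N P. 1 \<le> (\<Sum>i<n. s (urow_of n f i)))"
proof -
  \<comment> \<open>The bound 0 pins the forms off \<open>urows\<close>, where nothing is known
    about states.\<close>
  define b where "b y = (if y \<in> urows then SOME c. \<forall>s\<in>states n. s y \<le> c else 0)" for y
  have b: "s y \<le> b y" if "y \<in> urows" "s \<in> states n" for s y
    using someI_ex[OF states_bounded[OF that(1), of n]] that by (simp add: b_def)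
  define S where "S = {s. \<forall>y. 0 \<le> s y \<and> s y \<le> b y} \<inter> {s. admissible n s}"
  have cS: "compact S" unfolding S_def by (intro compact_Int_closed compact_fun_box closed_admissible)
  define cut where "cut s y = (if y \<in> urows then s y else 0)" for s :: "urow \<Rightarrow> real" and y
  have cut: "cut s \<in> S" if s: "s \<in> states n" for s
  proof -
    have a: "admissible n s" by (rule states_admissible[OF s])
    then have "admissible n (cut s)" by (rule admissible_cong) (simp add: cut_def)
    moreover have "0 \<le> cut s y \<and> cut s y \<le> b y" for y
      using admissible_nonneg[OF a, of y] b[OF _ s, of y] by (simp add: cut_def) (simp add: b_def)
    ultimately show ?thesis by (simp add: S_def)
  qed
  have rows: "urow_of n f i \<in> urows" if "f \<in> lifts n N P" "i < n" for f i
    using that by (intro urows_closed) (auto simp: lifts_def)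
  define G where "G f s = (\<Sum>i<n. s (urow_of n f i))" for f and s :: "urow \<Rightarrow> real"
  have "right_state n 0 0 (\<lambda>_. 0) \<in> states n" by (rule right_state_in_states) simp
  then have ne: "S \<noteq> {}" using cut by blast
  have "\<exists>s\<in>S. \<forall>f\<in>lifts n N P. 1 \<le> G f s"
  proof (rule minimax[OF cS ne])
    fix f assume f: "f \<in> lifts n N P"
    show "continuous_on UNIV (G f)" unfolding G_def
      by (intro continuous_intros continuous_on_product_coordinates)
    obtain s where s: "s \<in> states n" "1 \<le> (\<Sum>i<n. s (urow_of n f i))" using states_detect[OF nb[OF f]] by blast
    have "G f (cut s) = (\<Sum>i<n. s (urow_of n f i))" unfolding G_def cut_def using rows[OF f] by simp
    then show "\<exists>s\<in>S. 1 \<le> G f s" using s cut by (intro bexI[of _ "cut s"]) auto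
  next
    fix s s' u assume s: "s \<in> S" "s' \<in> S" and u: "(0::real) \<le> u" "u \<le> 1"
    define r where "r y = (1 - u) * s y + u * s' y" for y
    have "admissible n r" unfolding r_def using s u by (intro admissible_convex) (auto simp: S_def)
    moreover have "0 \<le> r y \<and> r y \<le> b y" for y
    proof -
      have "0 \<le> s y" "s y \<le> b y" "0 \<le> s' y" "s' y \<le> b y" using s unfolding S_def by blast+
      moreover from this have "(1 - u) * s y + u * s' y \<le> (1 - u) * b y + u * b y" using u by (intro add_mono mult_left_mono) auto
      moreover have "0 \<le> (1 - u) * s y + u * s' y" using u calculation by simp
      moreover have "(1 - u) * b y + u * b y = b y" by (simp add: algebra_simps)
      ultimately show ?thesis unfolding r_def by simp
    qed
    ultimately have "r \<in> S" by (simp add: S_def)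
    moreover have "G f r = (1 - u) * G f s + u * G f s'" for f
      by (simp add: G_def r_def sum.distrib sum_distrib_left)
    ultimately show "\<exists>r\<in>S. \<forall>f\<in>lifts n N P. G f r = (1 - u) * G f s + u * G f s'" by blast
  next
    fix f g u assume f: "f \<in> lifts n N P" and g: "g \<in> lifts n N P" and u: "(0::real) \<le> u" "u \<le> 1"
    define h where "h i j z k = complex_of_real (1 - u) * f i j z k + complex_of_real u * g i j z k" for i j z k
    have hs: "h i j = (\<lambda>z k. complex_of_real (1 - u) * f i j z k + complex_of_real u * g i j z k)" for i j
      by (simp add: h_def fun_eq_iff)
    \<comment> \<open>Taking jets is linear, so a convex combination of two lifts has the same
      prescribed jet.\<close>
    have h: "h \<in> lifts n N P"
      using f g unfolding lifts_def hs mem_Collect_eq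
      by (auto simp: strip_fun_add strip_fun_scale jet_add jet_scale algebra_simps simp del: of_real_diff)
        (simp_all add: algebra_simps)
    have eq: "urow_of n h i = uadd (uscale (complex_of_real (1 - u)) (urow_of n f i)) (uscale (complex_of_real u) (urow_of n g i))" for i
      by (auto simp: urow_of_def uadd_def uscale_def h_def fun_eq_iff)
    have "G h s \<le> (1 - u) * G f s + u * G g s" if "s \<in> S" for s
    proof -
      have "s (urow_of n h i) \<le> (1 - u) * s (urow_of n f i) + u * s (urow_of n g i)" if "i < n" for i
        using \<open>s \<in> S\<close> admissible_conv[OF _ rows[OF f that] rows[OF g that] u] unfolding eq S_def by blast
      then have "G h s \<le> (\<Sum>i<n. (1 - u) * s (urow_of n f i) + u * s (urow_of n g i))" unfolding G_def by (intro sum_mono) simp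
      then show ?thesis by (simp add: G_def sum.distrib sum_distrib_left)
    qed
    then show "\<exists>h\<in>lifts n N P. \<forall>s\<in>S. G h s \<le> (1 - u) * G f s + u * G g s" using h by blast
  qed
  then show ?thesis unfolding S_def G_def by blast
qed

section \<open>Block forms\<close>

text \<open>For each \<open>l < n\<close> a block vector stores at \<open>(l, 0)\<close> the scalar \<open>\<lambda>\<^sub>l\<close>, at \<open>(l, 2 k + 1)\<close> the value at \<open>1/2\<close>
  and at \<open>(l, 2 k + 2)\<close> the derivative at \<open>1/2\<close> of the \<open>k\<close>-th coordinate of \<open>\<lambda>\<^sub>l 1 + f\<^sub>l\<close>.\<close>

definition block_index :: "nat \<Rightarrow> nat \<Rightarrow> (nat \<times> nat) set" where
  "block_index n N = {..<n} \<times> {..2 * N}"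

text \<open>Action on the jet of a row over the unitization: the scalar slot is annihilated because
  the product lies in the function algebra, and a derivative slot \<open>2 * k + 2\<close> follows
  Leibniz' rule, reading also the value slot just below it. There \<open>r div 2 - 1\<close> is
  \<open>k\<close>.\<close>

definition jact :: "(nat \<Rightarrow> complex) \<times> (nat \<Rightarrow> complex) \<Rightarrow> (nat \<times> nat \<Rightarrow> complex) \<Rightarrow> nat \<times> nat \<Rightarrow> complex" where
  "jact a w = (\<lambda>(l, r). if r = 0 then 0 else if odd r then fst a (r div 2) * w (l, r)
     else snd a (r div 2 - 1) * w (l, r - 1) + fst a (r div 2 - 1) * w (l, r))"

lemma jact_simps [simp]:
  "jact a w (l, 0) = 0" "jact a w (l, Suc (2 * k)) = fst a k * w (l, Suc (2 * k))"
  "jact a w (l, Suc (Suc (2 * k))) = snd a k * w (l, Suc (2 * k)) + fst a k * w (l, Suc (Suc (2 * k)))"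
  by (simp_all add: jact_def)

lemma nat_012_cases: obtains "r = 0" | k where "r = Suc (2 * k)" | k where "r = Suc (Suc (2 * k))"
proof (cases "even r")
  case True
  then obtain j where "r = 2 * j" by (elim evenE)
  then show ?thesis using that by (cases j) auto
next
  case False
  then show ?thesis using that by (auto elim!: oddE)
qed

text \<open>The jet of the constant 1 at position \<open>i\<close>: the scalar part and all values
  are 1, all derivatives are 0.\<close>

definition block_unit :: "nat \<Rightarrow> nat \<times> nat \<Rightarrow> complex" where
  "block_unit i = (\<lambda>(l, r). if l = i \<and> (r = 0 \<or> odd r) then 1 else 0)"

definition block_row :: "nat \<Rightarrow> (nat \<Rightarrow> nat \<Rightarrow> (nat \<Rightarrow> complex) \<times> (nat \<Rightarrow> complex)) \<Rightarrow> nat \<Rightarrow> nat \<times> nat \<Rightarrow> complex" where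
  "block_row n P i = (\<lambda>e. \<Sum>j<n. jact (P i j) (block_unit j) e)"

text \<open>Properties of the quotient form after the Euclidean correction. The bound by
  \<open>\<delta>\<close> gives definiteness and continuous coordinates; 34 bounds the module
  constants of both summands, and 2 is the sum of their bounds 1 on the unit vectors.\<close>

definition block_form :: "nat \<Rightarrow> nat \<Rightarrow> ((nat \<times> nat \<Rightarrow> complex) \<Rightarrow> real) \<Rightarrow> bool" where
  "block_form n N Q \<longleftrightarrow>
     (\<forall>w. 0 \<le> Q w) \<and>
     (\<forall>v w. Q (\<lambda>e. v e + w e) + Q (\<lambda>e. v e - w e) \<le> 2 * Q v + 2 * Q w) \<and>
     (\<forall>c w. Q (\<lambda>e. c * w e) = (cmod c)\<^sup>2 * Q w) \<and>
     (\<forall>v w. (\<forall>e\<in>block_index n N. v e = w e) \<longrightarrow> Q v = Q w) \<and>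
     (\<exists>\<delta>>0. \<forall>w. \<forall>e\<in>block_index n N. \<delta> * (cmod (w e))\<^sup>2 \<le> Q w) \<and>
     (\<forall>m A c w. liftable m A c \<and> 0 \<le> c \<longrightarrow>
        (\<Sum>i<m. Q (\<lambda>e. \<Sum>j<m. jact (A i j) (w j) e)) \<le> 34 * c\<^sup>2 * (\<Sum>j<m. Q (w j))) \<and>
     (\<Sum>i<n. Q (block_unit i)) \<le> 2"

text \<open>Positions from \<open>n\<close> on are required to vanish, so that a lift of a row of
  jets has exactly the shape of \<open>urow_of\<close>.\<close>

definition ulifts :: "nat \<Rightarrow> nat \<Rightarrow> (nat \<times> nat \<Rightarrow> complex) \<Rightarrow> urow set" where
  "ulifts n N w = {y \<in> urows. (\<forall>l<n. fst y l = w (l, 0) \<and>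
      (\<forall>k<N. fst y l + fst (jet (snd y l)) k = w (l, Suc (2 * k)) \<and> snd (jet (snd y l)) k = w (l, Suc (Suc (2 * k))))) \<and>
     (\<forall>l\<ge>n. fst y l = 0 \<and> snd y l = (\<lambda>z k. 0))}"

lemma ell2_finite [simp]: "(\<lambda>k. if k < N then g k else 0) \<in> ell2"
  unfolding ell2_def by (auto intro!: summable_finite[of "{..<N}"] split: if_splits)

lemma ulifts_nonempty: "ulifts n N w \<noteq> {}"
proof -
  \<comment> \<open>The value slot stores the value of scalar plus function, hence the subtraction
    of \<open>w (l, 0)\<close>.\<close>
  define y :: urow where "y = (\<lambda>l. if l < n then w (l, 0) else 0,
     \<lambda>l. if l < n then jet_lift (\<lambda>k. if k < N then w (l, Suc (2 * k)) - w (l, 0) else 0) (\<lambda>k. if k < N then w (l, Suc (Suc (2 * k))) else 0)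
         else (\<lambda>z k. 0))"
  have "y \<in> ulifts n N w" unfolding ulifts_def urows_def y_def by (auto simp: jet_jet_lift intro!: jet_lift_strip_fun)
  then show ?thesis by blast
qed

lemma ulifts_urows: "y \<in> ulifts n N w \<Longrightarrow> y \<in> urows"
  by (simp add: ulifts_def)

lemma uliftsD:
  assumes "y \<in> ulifts n N w" "l < n"
  shows "fst y l = w (l, 0)" "k < N \<Longrightarrow> fst y l + fst (jet (snd y l)) k = w (l, Suc (2 * k))"
    "k < N \<Longrightarrow> snd (jet (snd y l)) k = w (l, Suc (Suc (2 * k)))"
  using assms unfolding ulifts_def by blast+

lemma uliftsI:
  assumes "y \<in> urows" "\<And>l. l < n \<Longrightarrow> fst y l = w (l, 0)"
    "\<And>l k. l < n \<Longrightarrow> k < N \<Longrightarrow> fst y l + fst (jet (snd y l)) k = w (l, Suc (2 * k))"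
    "\<And>l k. l < n \<Longrightarrow> k < N \<Longrightarrow> snd (jet (snd y l)) k = w (l, Suc (Suc (2 * k)))"
    "\<And>l. n \<le> l \<Longrightarrow> fst y l = 0" "\<And>l. n \<le> l \<Longrightarrow> snd y l = (\<lambda>z k. 0)"
  shows "y \<in> ulifts n N w"
  using assms unfolding ulifts_def by blast

lemma ulifts_off:
  assumes "y \<in> ulifts n N w" "n \<le> l" shows "fst y l = 0" "snd y l = (\<lambda>z k. 0)"
  using assms unfolding ulifts_def by blast+

lemma ulifts_add:
  assumes "y \<in> ulifts n N v" "y' \<in> ulifts n N w"
  shows "uadd y y' \<in> ulifts n N (\<lambda>e. v e + w e)"
proof -
  have f: "snd y l \<in> strip_fun" "snd y' l \<in> strip_fun" for l using assms by (auto simp: ulifts_def urows_def)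
  have "uadd y y' \<in> urows" using assms by (auto simp: ulifts_def intro: urows_closed)
  then show ?thesis
  proof (rule uliftsI)
    fix l k assume l: "l < n"
    note D = uliftsD[OF assms(1) l] uliftsD[OF assms(2) l]
    show "fst (uadd y y') l = v (l, 0) + w (l, 0)" by (simp add: uadd_def D(1,4))
    assume k: "k < N"
    show "fst (uadd y y') l + fst (jet (snd (uadd y y') l)) k = v (l, Suc (2 * k)) + w (l, Suc (2 * k))"
      unfolding D(2,5)[OF k, symmetric] by (simp add: uadd_def jet_add[OF f])
    show "snd (jet (snd (uadd y y') l)) k = v (l, Suc (Suc (2 * k))) + w (l, Suc (Suc (2 * k)))"
      unfolding D(3,6)[OF k, symmetric] by (simp add: uadd_def jet_add[OF f])
  qed (simp_all add: uadd_def ulifts_off[OF assms(1)] ulifts_off[OF assms(2)])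
qed

lemma ulifts_scale:
  assumes "y \<in> ulifts n N w"
  shows "uscale c y \<in> ulifts n N (\<lambda>e. c * w e)"
proof -
  have f: "snd y l \<in> strip_fun" for l using assms by (auto simp: ulifts_def urows_def)
  have "uscale c y \<in> urows" using assms by (auto simp: ulifts_def intro: urows_closed)
  then show ?thesis
  proof (rule uliftsI)
    fix l k assume l: "l < n"
    note D = uliftsD[OF assms l]
    show "fst (uscale c y) l = c * w (l, 0)" by (simp add: uscale_def D(1))
    assume k: "k < N"
    show "fst (uscale c y) l + fst (jet (snd (uscale c y) l)) k = c * w (l, Suc (2 * k))"
      unfolding D(2)[OF k, symmetric] by (simp add: uscale_def jet_scale[OF f] distrib_left)
    show "snd (jet (snd (uscale c y) l)) k = c * w (l, Suc (Suc (2 * k)))"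
      unfolding D(3)[OF k, symmetric] by (simp add: uscale_def jet_scale[OF f])
  qed (simp_all add: uscale_def ulifts_off[OF assms])
qed

lemma ulifts_cong:
  assumes "\<And>e. e \<in> block_index n N \<Longrightarrow> v e = w e"
  shows "ulifts n N v = ulifts n N w"
proof -
  have "v (l, 0) = w (l, 0)" if "l < n" for l using assms[of "(l, 0)"] that by (simp add: block_index_def)
  moreover have "v (l, Suc (2 * k)) = w (l, Suc (2 * k))" "v (l, Suc (Suc (2 * k))) = w (l, Suc (Suc (2 * k)))" if "l < n" "k < N" for l k
    using assms[of "(l, Suc (2 * k))"] assms[of "(l, Suc (Suc (2 * k)))"] that by (simp_all add: block_index_def)
  ultimately show ?thesis unfolding ulifts_def by auto
qed

lemma jet_unit_mult:
  assumes a: "a \<in> strip_fun" and f: "f \<in> strip_fun"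
  shows "jet (\<lambda>z k. a z k * (c + f z k)) = (\<lambda>k. fst (jet a) k * (c + fst (jet f) k),
     \<lambda>k. snd (jet a) k * (c + fst (jet f) k) + fst (jet a) k * snd (jet f) k)"
proof -
  have "(\<lambda>z k. a z k * (c + f z k)) = (\<lambda>z k. c * a z k + a z k * f z k)" by (simp add: algebra_simps)
  then show ?thesis
    using jet_add[OF strip_fun_scale[OF a] strip_fun_mult[OF a f]] jet_scale[OF a] jet_mult[OF a f]
    by (simp add: algebra_simps)
qed

text \<open>The action commutes with passing to jets: whichever lifts of the matrix and of the
  vectors are taken, their product lifts the product of the jets. This lets the infimum over lifts
  inherit the module bound.\<close>

lemma ulifts_act:
  assumes a: "\<And>i j. i < m \<Longrightarrow> j < m \<Longrightarrow> a i j \<in> strip_fun \<and> jet (a i j) = A i j"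
    and y: "\<And>j. j < m \<Longrightarrow> y j \<in> ulifts n N (w j)" and i: "i < m"
  shows "uact m a y i \<in> ulifts n N (\<lambda>e. \<Sum>j<m. jact (A i j) (w j) e)"
proof -
  have f: "snd (y j) l \<in> strip_fun" if "j < m" for j l using y[OF that] by (auto simp: ulifts_def urows_def)
  have ai: "a i j \<in> strip_fun" "jet (a i j) = A i j" if "j < m" for j using a[OF i that] by auto
  have "uact m a y i \<in> urows" using a y i by (intro urows_closed) (auto simp: ulifts_def)
  moreover have j: "jet (snd (uact m a y i) l) = (\<lambda>k. \<Sum>j<m. fst (A i j) k * (fst (y j) l + fst (jet (snd (y j) l)) k),
     \<lambda>k. \<Sum>j<m. snd (A i j) k * (fst (y j) l + fst (jet (snd (y j) l)) k) + fst (A i j) k * snd (jet (snd (y j) l)) k)" for l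
  proof -
    have "snd (uact m a y i) l = (\<lambda>z k. \<Sum>j<m. a i j z k * (fst (y j) l + snd (y j) l z k))" by (simp add: uact_def)
    then show ?thesis
      by (simp only:) (subst jet_sum, use ai f in \<open>auto simp: jet_unit_mult intro!: strip_fun_unit_mult sum.cong ext\<close>)
  qed
  moreover have "fst (uact m a y i) l = 0" for l by (simp add: uact_def)
  moreover have "snd (uact m a y i) l = (\<lambda>z k. 0)" if "l \<ge> n" for l
    using y that by (simp add: uact_def ulifts_def fun_eq_iff)
  ultimately show ?thesis unfolding ulifts_def[of n N "\<lambda>e. \<Sum>j<m. jact (A i j) (w j) e"] mem_Collect_eq
    by (simp add: uliftsD(2,3)[OF y])
qed

lemma uunit_ulifts:
  assumes "i < n" shows "uunit i \<in> ulifts n N (block_unit i)"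
  unfolding ulifts_def mem_Collect_eq using assms
  by (intro conjI urows_closed) (auto simp: uunit_def block_unit_def jet_zero)

section \<open>The quotient form on block vectors\<close>

definition qform :: "(urow \<Rightarrow> real) \<Rightarrow> nat \<Rightarrow> nat \<Rightarrow> (nat \<times> nat \<Rightarrow> complex) \<Rightarrow> real" where
  "qform s n N w = Inf (s ` ulifts n N w)"

context
  fixes s :: "urow \<Rightarrow> real" and n :: nat
  assumes adm: "admissible n s"
begin

lemma qform_nonneg: "0 \<le> qform s n N w"
  unfolding qform_def using ulifts_nonempty admissible_nonneg[OF adm ulifts_urows]
  by (intro cInf_greatest) auto

lemma qform_le: "y \<in> ulifts n N w \<Longrightarrow> qform s n N w \<le> s y"
  unfolding qform_def using admissible_nonneg[OF adm ulifts_urows]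
  by (intro cInf_lower) (auto intro!: bdd_belowI[of _ 0])

lemma qform_approx: "0 < e \<Longrightarrow> \<exists>y\<in>ulifts n N w. s y < qform s n N w + e"
  using cInf_lessD[of "s ` ulifts n N w" "qform s n N w + e"] ulifts_nonempty[of n N w] by (auto simp: qform_def)

text \<open>One pair of near-optimal lifts yields lifts of both the sum and the difference. It is
  the inequality that survives the infimum, and \<open>quadratic_space\<close> asks for no
  more.\<close>

lemma qform_parallelogram:
  "qform s n N (\<lambda>e. v e + w e) + qform s n N (\<lambda>e. v e - w e) \<le> 2 * qform s n N v + 2 * qform s n N w"
proof (rule field_le_epsilon)
  fix e :: real assume e: "0 < e"
  then have "0 < e / 4" by simp
  obtain y where y: "y \<in> ulifts n N v" "s y < qform s n N v + e / 4" using qform_approx[OF \<open>0 < e / 4\<close>] by blast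
  obtain y' where y': "y' \<in> ulifts n N w" "s y' < qform s n N w + e / 4" using qform_approx[OF \<open>0 < e / 4\<close>] by blast
  have "uadd y y' \<in> ulifts n N (\<lambda>e. v e + w e)" by (rule ulifts_add[OF y(1) y'(1)])
  moreover have "uadd y (uscale (-1) y') \<in> ulifts n N (\<lambda>e. v e - w e)"
    using ulifts_add[OF y(1) ulifts_scale[OF y'(1), of "-1"]] by simp
  ultimately have "qform s n N (\<lambda>e. v e + w e) + qform s n N (\<lambda>e. v e - w e) \<le> s (uadd y y') + s (uadd y (uscale (-1) y'))"
    by (intro add_mono qform_le)
  also have "\<dots> \<le> 2 * s y + 2 * s y'"
    by (intro admissible_parallelogram[OF adm] ulifts_urows[OF y(1)] ulifts_urows[OF y'(1)])
  finally show "qform s n N (\<lambda>e. v e + w e) + qform s n N (\<lambda>e. v e - w e) \<le> 2 * qform s n N v + 2 * qform s n N w + e"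
    using y(2) y'(2) by linarith
qed

lemma qform_scale_le: "qform s n N (\<lambda>e. c * w e) \<le> (cmod c)\<^sup>2 * qform s n N w"
proof -
  have b: "qform s n N (\<lambda>e. c * w e) \<le> (cmod c)\<^sup>2 * (qform s n N w + e)" if e: "0 < e" for e
  proof -
    obtain y where y: "y \<in> ulifts n N w" "s y < qform s n N w + e" using qform_approx[OF e] by blast
    have "qform s n N (\<lambda>e. c * w e) \<le> s (uscale c y)" by (intro qform_le ulifts_scale y)
    also have "\<dots> = (cmod c)\<^sup>2 * s y" by (rule admissible_scale[OF adm ulifts_urows[OF y(1)]])
    also have "\<dots> \<le> (cmod c)\<^sup>2 * (qform s n N w + e)" using y(2) by (intro mult_left_mono) auto
    finally show ?thesis .
  qed
  have "((\<lambda>e. (cmod c)\<^sup>2 * (qform s n N w + e)) \<longlongrightarrow> (cmod c)\<^sup>2 * (qform s n N w + 0)) (at_right 0)"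
    by (intro tendsto_intros)
  from tendsto_lowerbound[OF this eventually_mono[OF eventually_at_right_less b] trivial_limit_at_right_real]
  show ?thesis by simp
qed

lemma qform_scale: "qform s n N (\<lambda>e. c * w e) = (cmod c)\<^sup>2 * qform s n N w"
proof (cases "c = 0")
  case True
  then show ?thesis using qform_scale_le[of N c w] qform_nonneg[of N "\<lambda>e. c * w e"] by simp
next
  case False
  have "qform s n N w \<le> (cmod (inverse c))\<^sup>2 * qform s n N (\<lambda>e. c * w e)"
    using qform_scale_le[of N "inverse c" "\<lambda>e. c * w e"] False by (simp add: mult.assoc[symmetric])
  then have "(cmod c)\<^sup>2 * qform s n N w \<le> qform s n N (\<lambda>e. c * w e)"
    using False by (simp add: norm_inverse norm_divide power_divide field_simps)
  then show ?thesis using qform_scale_le[of N c w] by simp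
qed

text \<open>A lift of the matrix with bound \<open>c\<close> is fixed once, and near-optimal lifts
  of the vectors are chosen independently of it.\<close>

lemma qform_module:
  assumes A: "liftable m A c" and c: "0 \<le> c"
  shows "(\<Sum>i<m. qform s n N (\<lambda>e. \<Sum>j<m. jact (A i j) (w j) e)) \<le> 2 * c\<^sup>2 * (\<Sum>j<m. qform s n N (w j))"
proof -
  obtain a where a: "\<forall>i<m. \<forall>j<m. a i j \<in> strip_fun \<and> jet (a i j) = A i j" "fun_bdd m a c"
    using A unfolding liftable_def by blast
  have b: "(\<Sum>i<m. qform s n N (\<lambda>e. \<Sum>j<m. jact (A i j) (w j) e)) \<le> 2 * c\<^sup>2 * (\<Sum>j<m. qform s n N (w j) + e)"
    if e: "0 < e" for e
  proof -
    have "\<forall>j. \<exists>y\<in>ulifts n N (w j). s y < qform s n N (w j) + e" using qform_approx[OF e] by blast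
    then obtain y where y: "\<And>j. y j \<in> ulifts n N (w j)" "\<And>j. s (y j) < qform s n N (w j) + e" by metis
    have "(\<Sum>i<m. qform s n N (\<lambda>e. \<Sum>j<m. jact (A i j) (w j) e)) \<le> (\<Sum>i<m. s (uact m a y i))"
      using a(1) y(1) by (intro sum_mono qform_le ulifts_act) auto
    also have "\<dots> \<le> 2 * c\<^sup>2 * (\<Sum>j<m. s (y j))"
      by (rule admissible_module[OF adm]) (use a c ulifts_urows[OF y(1)] in auto)
    also have "\<dots> \<le> 2 * c\<^sup>2 * (\<Sum>j<m. qform s n N (w j) + e)"
      using y(2) by (intro mult_left_mono sum_mono) (auto intro: less_imp_le)
    finally show ?thesis .
  qed
  have "((\<lambda>e. 2 * c\<^sup>2 * (\<Sum>j<m. qform s n N (w j) + e)) \<longlongrightarrow> 2 * c\<^sup>2 * (\<Sum>j<m. qform s n N (w j) + 0)) (at_right 0)"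
    by (intro tendsto_intros)
  from tendsto_lowerbound[OF this eventually_mono[OF eventually_at_right_less b] trivial_limit_at_right_real]
  show ?thesis by simp
qed

lemma qform_unit: "(\<Sum>i<n. qform s n N (block_unit i)) \<le> 1"
proof -
  have "(\<Sum>i<n. qform s n N (block_unit i)) \<le> (\<Sum>i<n. s (uunit i))"
    by (intro sum_mono qform_le uunit_ulifts) simp
  then show ?thesis using admissible_unit[OF adm] by linarith
qed

lemma qform_cong: "(\<And>e. e \<in> block_index n N \<Longrightarrow> v e = w e) \<Longrightarrow> qform s n N v = qform s n N w"
  unfolding qform_def using ulifts_cong by metis

end

lemma block_row_simps:
  assumes "l < n"
  shows "block_row n P i (l, 0) = 0" "block_row n P i (l, Suc (2 * k)) = fst (P i l) k"
    "block_row n P i (l, Suc (Suc (2 * k))) = snd (P i l) k"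
  using assms by (simp_all add: block_row_def block_unit_def if_distrib[of "\<lambda>x. _ * x"] cong: if_cong)

text \<open>Near-optimal lifts of the block rows have vanishing scalar parts, so together they make
  up a matrix in \<open>lifts n N P\<close>, to which the lower bound for \<open>s\<close>
  applies.\<close>

lemma qform_row:
  assumes adm: "admissible n s" and s: "\<And>f. f \<in> lifts n N P \<Longrightarrow> 1 \<le> (\<Sum>i<n. s (urow_of n f i))"
  shows "1 \<le> (\<Sum>i<n. qform s n N (block_row n P i))"
proof -
  have b: "1 \<le> (\<Sum>i<n. qform s n N (block_row n P i) + e)" if e: "0 < e" for e
  proof -
    have "\<forall>i. \<exists>y\<in>ulifts n N (block_row n P i). s y < qform s n N (block_row n P i) + e" using qform_approx[OF adm e] by blast
    then obtain y where y: "\<And>i. y i \<in> ulifts n N (block_row n P i)" "\<And>i. s (y i) < qform s n N (block_row n P i) + e" by metis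
    define f where "f i l = snd (y i) l" for i l
    have "f \<in> lifts n N P" unfolding lifts_def mem_Collect_eq
    proof (intro allI impI conjI)
      fix i l k assume "i < n" "l < n"
      show "f i l \<in> strip_fun" using y(1)[of i] by (simp add: f_def ulifts_def urows_def)
      assume "k < N"
      have "fst (y i) l = 0" using y(1)[of i] \<open>l < n\<close> by (simp add: ulifts_def block_row_simps)
      moreover have "fst (y i) l + fst (jet (f i l)) k = fst (P i l) k" "snd (jet (f i l)) k = snd (P i l) k"
        using uliftsD(2,3)[OF y(1)[of i] \<open>l < n\<close> \<open>k < N\<close>] by (simp_all add: f_def block_row_simps[OF \<open>l < n\<close>])
      ultimately show "fst (jet (f i l)) k = fst (P i l) k" "snd (jet (f i l)) k = snd (P i l) k" by simp_all
    qed
    moreover have "urow_of n f i = y i" for i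
    proof -
      have "fst (y i) l = 0" for l using y(1)[of i] by (cases "l < n") (auto simp: ulifts_def block_row_simps)
      moreover have "(\<lambda>z k. if l < n then f i l z k else 0) = snd (y i) l" for l
        using y(1)[of i] by (cases "l < n") (auto simp: ulifts_def f_def)
      ultimately show ?thesis by (simp add: urow_of_def prod_eq_iff fun_eq_iff)
    qed
    ultimately have "1 \<le> (\<Sum>i<n. s (y i))" using s by fastforce
    also have "\<dots> \<le> (\<Sum>i<n. qform s n N (block_row n P i) + e)" using y(2) by (intro sum_mono) (auto intro: less_imp_le)
    finally show ?thesis .
  qed
  have "((\<lambda>e. \<Sum>i<n. qform s n N (block_row n P i) + e) \<longlongrightarrow> (\<Sum>i<n. qform s n N (block_row n P i) + 0)) (at_right 0)"
    by (intro tendsto_intros)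
  from tendsto_lowerbound[OF this eventually_mono[OF eventually_at_right_less b] trivial_limit_at_right_real]
  show ?thesis by simp
qed

text \<open>The Euclidean form; it supplies the definiteness that an infimum over lifts may
  lack.\<close>

definition std_form :: "nat \<Rightarrow> nat \<Rightarrow> (nat \<times> nat \<Rightarrow> complex) \<Rightarrow> real" where
  "std_form n N w = (\<Sum>e\<in>block_index n N. (cmod (w e))\<^sup>2)"

lemma finite_block_index [simp]: "finite (block_index n N)"
  by (simp add: block_index_def)

lemma sum_block_index:
  "(\<Sum>e\<in>block_index n N. g e) = (\<Sum>l<n. g (l, 0) + (\<Sum>k<N. g (l, Suc (2 * k)) + g (l, Suc (Suc (2 * k)))))"
proof -
  have "(\<Sum>r\<le>2 * N. h r) = h 0 + (\<Sum>k<N. h (Suc (2 * k)) + h (Suc (Suc (2 * k))))" for h :: "nat \<Rightarrow> 'a"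
    by (induction N) (simp_all add: add_ac)
  then show ?thesis by (simp add: block_index_def sum.cartesian_product')
qed

text \<open>At each coordinate the matrix of jets acts on pairs of value and derivative. By
  \<open>fun_bdd_jet_matrix\<close> the value slots receive the factor 1 + 2 * 4^2 = 33 and the
  derivative slots the factor 2, both below 34.\<close>

lemma std_form_module:
  assumes A: "liftable m A c" and c: "0 \<le> c"
  shows "(\<Sum>i<m. std_form n N (\<lambda>e. \<Sum>j<m. jact (A i j) (w j) e)) \<le> 34 * c\<^sup>2 * (\<Sum>j<m. std_form n N (w j))"
proof -
  obtain a where a: "\<And>i j. i < m \<Longrightarrow> j < m \<Longrightarrow> a i j \<in> strip_fun" "\<And>i j. i < m \<Longrightarrow> j < m \<Longrightarrow> jet (a i j) = A i j" "fun_bdd m a c"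
    using A unfolding liftable_def by blast
  have b1: "(\<Sum>i<m. (cmod (\<Sum>j<m. fst (A i j) k * v j))\<^sup>2) \<le> c\<^sup>2 * (\<Sum>j<m. (cmod (v j))\<^sup>2)" for k v
    using fun_bdd_jet_matrix(1)[OF a(3) c a(1), of k v] a(2) by simp
  have b2: "(\<Sum>i<m. (cmod (\<Sum>j<m. snd (A i j) k * v j))\<^sup>2) \<le> (4 * c)\<^sup>2 * (\<Sum>j<m. (cmod (v j))\<^sup>2)" for k v
    using fun_bdd_jet_matrix(2)[OF a(3) c a(1), of k v] a(2) by simp
  have cell: "(\<Sum>i<m. (cmod (\<Sum>j<m. fst (A i j) k * p j))\<^sup>2 + (cmod (\<Sum>j<m. snd (A i j) k * p j + fst (A i j) k * q j))\<^sup>2)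
      \<le> 34 * c\<^sup>2 * (\<Sum>j<m. (cmod (p j))\<^sup>2 + (cmod (q j))\<^sup>2)" for k and p q :: "nat \<Rightarrow> complex"
  proof -
    have "(\<Sum>i<m. (cmod (\<Sum>j<m. snd (A i j) k * p j + fst (A i j) k * q j))\<^sup>2)
       \<le> (\<Sum>i<m. 2 * (cmod (\<Sum>j<m. snd (A i j) k * p j))\<^sup>2 + 2 * (cmod (\<Sum>j<m. fst (A i j) k * q j))\<^sup>2)"
      unfolding sum.distrib by (subst sum.distrib[symmetric]) (intro sum_mono cmod_add_sq)
    also have "\<dots> = 2 * (\<Sum>i<m. (cmod (\<Sum>j<m. snd (A i j) k * p j))\<^sup>2) + 2 * (\<Sum>i<m. (cmod (\<Sum>j<m. fst (A i j) k * q j))\<^sup>2)"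
      by (simp add: sum.distrib sum_distrib_left)
    also have "\<dots> \<le> 2 * ((4 * c)\<^sup>2 * (\<Sum>j<m. (cmod (p j))\<^sup>2)) + 2 * (c\<^sup>2 * (\<Sum>j<m. (cmod (q j))\<^sup>2))"
      by (intro add_mono mult_left_mono b1 b2) auto
    finally have 2: "(\<Sum>i<m. (cmod (\<Sum>j<m. snd (A i j) k * p j + fst (A i j) k * q j))\<^sup>2) \<le> 32 * (c\<^sup>2 * (\<Sum>j<m. (cmod (p j))\<^sup>2)) + 2 * (c\<^sup>2 * (\<Sum>j<m. (cmod (q j))\<^sup>2))"
      by (simp add: power_mult_distrib)
    have "0 \<le> c\<^sup>2 * (\<Sum>j<m. (cmod (p j))\<^sup>2)" "0 \<le> c\<^sup>2 * (\<Sum>j<m. (cmod (q j))\<^sup>2)" by (simp_all add: sum_nonneg)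
    then have "(\<Sum>i<m. (cmod (\<Sum>j<m. fst (A i j) k * p j))\<^sup>2) + (\<Sum>i<m. (cmod (\<Sum>j<m. snd (A i j) k * p j + fst (A i j) k * q j))\<^sup>2)
        \<le> 34 * (c\<^sup>2 * (\<Sum>j<m. (cmod (p j))\<^sup>2)) + 34 * (c\<^sup>2 * (\<Sum>j<m. (cmod (q j))\<^sup>2))"
      using 2 b1[of k p] by linarith
    then show ?thesis by (simp add: sum.distrib distrib_left mult.assoc)
  qed
  have "(\<Sum>i<m. std_form n N (\<lambda>e. \<Sum>j<m. jact (A i j) (w j) e))
    = (\<Sum>i<m. \<Sum>l<n. \<Sum>k<N. (cmod (\<Sum>j<m. fst (A i j) k * w j (l, Suc (2 * k))))\<^sup>2 +
        (cmod (\<Sum>j<m. snd (A i j) k * w j (l, Suc (2 * k)) + fst (A i j) k * w j (l, Suc (Suc (2 * k)))))\<^sup>2)"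
    by (simp add: std_form_def sum_block_index)
  also have "\<dots> = (\<Sum>l<n. \<Sum>k<N. \<Sum>i<m. (cmod (\<Sum>j<m. fst (A i j) k * w j (l, Suc (2 * k))))\<^sup>2 +
        (cmod (\<Sum>j<m. snd (A i j) k * w j (l, Suc (2 * k)) + fst (A i j) k * w j (l, Suc (Suc (2 * k)))))\<^sup>2)"
    by (subst sum.swap, rule sum.cong[OF refl], rule sum.swap)
  also have "\<dots> \<le> (\<Sum>l<n. \<Sum>k<N. 34 * c\<^sup>2 * (\<Sum>j<m. (cmod (w j (l, Suc (2 * k))))\<^sup>2 + (cmod (w j (l, Suc (Suc (2 * k)))))\<^sup>2))"
    by (intro sum_mono cell)
  also have "\<dots> = 34 * c\<^sup>2 * (\<Sum>l<n. \<Sum>k<N. \<Sum>j<m. (cmod (w j (l, Suc (2 * k))))\<^sup>2 + (cmod (w j (l, Suc (Suc (2 * k)))))\<^sup>2)"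
    by (simp only: sum_distrib_left)
  also have "(\<Sum>l<n. \<Sum>k<N. \<Sum>j<m. (cmod (w j (l, Suc (2 * k))))\<^sup>2 + (cmod (w j (l, Suc (Suc (2 * k)))))\<^sup>2)
     = (\<Sum>j<m. \<Sum>l<n. \<Sum>k<N. (cmod (w j (l, Suc (2 * k))))\<^sup>2 + (cmod (w j (l, Suc (Suc (2 * k)))))\<^sup>2)"
    by (subst (2) sum.swap, rule sum.cong[OF refl], rule sum.swap)
  also have "34 * c\<^sup>2 * \<dots> \<le> 34 * c\<^sup>2 * (\<Sum>j<m. std_form n N (w j))"
    unfolding std_form_def sum_block_index by (intro mult_left_mono sum_mono) auto
  finally show ?thesis .
qed

lemma block_form_exists:
  "\<exists>Q. block_form n N Q \<and> ((\<forall>f\<in>lifts n N P. \<not> fun_bdd n f 1) \<longrightarrow> 1 \<le> (\<Sum>i<n. Q (block_row n P i)))"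
proof -
  obtain s where adm: "admissible n s" and s: "(\<forall>f\<in>lifts n N P. \<not> fun_bdd n f 1) \<Longrightarrow> (\<forall>f\<in>lifts n N P. 1 \<le> (\<Sum>i<n. s (urow_of n f i)))"
  proof (cases "\<forall>f\<in>lifts n N P. \<not> fun_bdd n f 1")
    case True
    then show ?thesis using exists_form[of n N P] that by blast
  next
    case False
    \<comment> \<open>When a lift of norm at most 1 exists there is nothing to detect, and the zero
      form still yields a block.\<close>
    have "admissible n (\<lambda>_. 0)" by (simp add: admissible_def)
    then show ?thesis using False that by blast
  qed
  \<comment> \<open>\<open>M\<close> is larger than the Euclidean values of all unit vectors
    together, whose entries are 0 or 1, so the correction adds at most 1 to the unit bound; the
    summand 1 keeps \<open>M\<close> positive.\<close>
  define M where "M = real n * real (card (block_index n N)) + 1"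
  have M: "0 < M" by (simp add: M_def add_nonneg_pos)
  define Q where "Q w = qform s n N w + std_form n N w / M" for w
  have std0: "0 \<le> std_form n N w" for w by (simp add: std_form_def sum_nonneg)
  have le: "qform s n N w \<le> Q w" for w using std0[of w] M by (simp add: Q_def)
  have "block_form n N Q" unfolding block_form_def
  proof (intro conjI allI impI)
    fix v w :: "nat \<times> nat \<Rightarrow> complex" and c :: complex
    show "0 \<le> Q w" using std0[of w] M qform_nonneg[OF adm] by (simp add: Q_def)
    have "std_form n N (\<lambda>e. v e + w e) + std_form n N (\<lambda>e. v e - w e) = 2 * std_form n N v + 2 * std_form n N w"
      by (simp add: std_form_def sum.distrib[symmetric] sum_distrib_left cmod_parallelogram del: sum.distrib)
    then have "std_form n N (\<lambda>e. v e + w e) / M + std_form n N (\<lambda>e. v e - w e) / M = 2 * (std_form n N v / M) + 2 * (std_form n N w / M)"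
      by (simp add: add_divide_distrib[symmetric])
    then show "Q (\<lambda>e. v e + w e) + Q (\<lambda>e. v e - w e) \<le> 2 * Q v + 2 * Q w"
      using qform_parallelogram[OF adm, of N v w] unfolding Q_def unfolding divide_inverse by (simp add: algebra_simps)
    show "Q (\<lambda>e. c * w e) = (cmod c)\<^sup>2 * Q w"
      by (simp add: Q_def qform_scale[OF adm] std_form_def norm_mult power_mult_distrib sum_distrib_left[symmetric] distrib_left)
    assume "\<forall>e\<in>block_index n N. v e = w e"
    then show "Q v = Q w" using qform_cong[OF adm, of N v w] by (simp add: Q_def std_form_def)
  next
    show "\<exists>\<delta>>0. \<forall>w. \<forall>e\<in>block_index n N. \<delta> * (cmod (w e))\<^sup>2 \<le> Q w"
    proof (intro exI[of _ "1 / M"] conjI allI ballI)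
      fix w e assume e: "e \<in> block_index n N"
      have "(cmod (w e))\<^sup>2 \<le> std_form n N w" unfolding std_form_def using e by (intro member_le_sum) auto
      then have "1 / M * (cmod (w e))\<^sup>2 \<le> std_form n N w / M" using M by (simp add: divide_right_mono)
      then show "1 / M * (cmod (w e))\<^sup>2 \<le> Q w" using qform_nonneg[OF adm, of N w] by (simp add: Q_def)
    qed (use M in simp)
  next
    fix m A w and c :: real assume A: "liftable m A c \<and> 0 \<le> c"
    have "(\<Sum>i<m. qform s n N (\<lambda>e. \<Sum>j<m. jact (A i j) (w j) e)) \<le> 2 * c\<^sup>2 * (\<Sum>j<m. qform s n N (w j))"
      using A by (intro qform_module[OF adm]) auto
    also have "\<dots> \<le> 34 * c\<^sup>2 * (\<Sum>j<m. qform s n N (w j))"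
      by (intro mult_right_mono sum_nonneg qform_nonneg[OF adm]) auto
    finally have 1: "(\<Sum>i<m. qform s n N (\<lambda>e. \<Sum>j<m. jact (A i j) (w j) e)) \<le> 34 * c\<^sup>2 * (\<Sum>j<m. qform s n N (w j))" .
    have "(\<Sum>i<m. std_form n N (\<lambda>e. \<Sum>j<m. jact (A i j) (w j) e)) / M \<le> 34 * c\<^sup>2 * (\<Sum>j<m. std_form n N (w j)) / M"
      using A M by (intro divide_right_mono std_form_module) auto
    with 1 show "(\<Sum>i<m. Q (\<lambda>e. \<Sum>j<m. jact (A i j) (w j) e)) \<le> 34 * c\<^sup>2 * (\<Sum>j<m. Q (w j))"
      by (simp add: Q_def sum.distrib sum_divide_distrib[symmetric] distrib_left)
  next
    have "(\<Sum>i<n. std_form n N (block_unit i)) \<le> (\<Sum>i<n. \<Sum>e\<in>block_index n N. 1)"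
      unfolding std_form_def by (intro sum_mono) (auto simp: block_unit_def)
    also have "\<dots> \<le> M" by (simp add: M_def)
    finally have "(\<Sum>i<n. std_form n N (block_unit i)) / M \<le> 1" using M by simp
    then show "(\<Sum>i<n. Q (block_unit i)) \<le> 2"
      using qform_unit[OF adm, of N] by (simp add: Q_def sum.distrib sum_divide_distrib[symmetric])
  qed
  moreover have "1 \<le> (\<Sum>i<n. Q (block_row n P i))" if "\<forall>f\<in>lifts n N P. \<not> fun_bdd n f 1"
  proof -
    have "1 \<le> (\<Sum>i<n. qform s n N (block_row n P i))" using s[OF that] by (intro qform_row[OF adm]) auto
    also have "\<dots> \<le> (\<Sum>i<n. Q (block_row n P i))" by (intro sum_mono le)
    finally show ?thesis .
  qed
  ultimately show ?thesis by blast
qed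

section \<open>Hilbert spaces from the parallelogram inequality\<close>

text \<open>After subtraction of the linear part, an additive function vanishes at the integers and
  is therefore bounded by its values on [0,1]. Boundedness of all multiples \<open>n * g t\<close>
  then forces it to be 0.\<close>

lemma additive_bounded_linear:
  fixes h :: "real \<Rightarrow> real"
  assumes add: "\<And>s t. h (s + t) = h s + h t" and bdd: "\<And>t. \<bar>h t\<bar> \<le> A * t\<^sup>2 + B"
  shows "h t = t * h 1"
proof -
  define g where "g t = h t - t * h 1" for t
  have gadd: "g (s + t) = g s + g t" for s t by (simp add: g_def add algebra_simps)
  have g1: "g 1 = 0" by (simp add: g_def)
  have g0: "g 0 = 0" using gadd[of 0 0] by simp
  have gneg: "g (- t) = - g t" for t using gadd[of t "- t"] g0 by simp
  have gn: "g (real n * t) = real n * g t" for n t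
    by (induction n) (simp_all add: g0 gadd algebra_simps)
  have gi: "g (of_int m) = 0" for m
  proof (cases m)
    case (nonneg n) then show ?thesis using gn[of n 1] g1 by simp
  next
    case (neg n)
    then have "of_int m = - (real (Suc n) * 1)" by simp
    then show ?thesis using gneg[of "real (Suc n) * 1"] gn[of "Suc n" 1] g1 by simp
  qed
  define M where "M = \<bar>A\<bar> + B + \<bar>h 1\<bar>"
  have bM: "\<bar>g s\<bar> \<le> M" if s: "0 \<le> s" "s \<le> 1" for s
  proof -
    have "A * s\<^sup>2 \<le> \<bar>A\<bar> * 1" using s by (intro mult_mono) (auto simp: power_le_one)
    moreover have "\<bar>s * h 1\<bar> \<le> 1 * \<bar>h 1\<bar>" unfolding abs_mult using s by (intro mult_right_mono) auto
    ultimately show ?thesis using bdd[of s] unfolding g_def M_def by linarith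
  qed
  have "real n * \<bar>g t\<bar> \<le> M" for n
  proof -
    define s where "s = real n * t - of_int \<lfloor>real n * t\<rfloor>"
    have s: "0 \<le> s" "s \<le> 1" unfolding s_def by linarith+
    have "real n * g t = g s" using gn[of n t] gadd[of s "of_int \<lfloor>real n * t\<rfloor>"] gi by (simp add: s_def)
    then have "\<bar>real n * g t\<bar> \<le> M" using bM[OF s] by simp
    then show ?thesis by (simp add: abs_mult)
  qed
  then have "g t = 0"
    by (metis abs_ge_zero abs_eq_0 antisym_conv3 not_less reals_Archimedean3 less_le_not_le)
  then show ?thesis by (simp add: g_def)
qed

text \<open>The setting of the Jordan-von Neumann theorem on a complex space of functions, with the
  parallelogram law assumed as an inequality.\<close>

locale quadratic_space =
  fixes V :: "('i \<Rightarrow> complex) set" and Q :: "('i \<Rightarrow> complex) \<Rightarrow> real"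
  assumes zero_mem: "(\<lambda>i. 0) \<in> V"
    and add_mem: "u \<in> V \<Longrightarrow> v \<in> V \<Longrightarrow> (\<lambda>i. u i + v i) \<in> V"
    and scale_mem: "u \<in> V \<Longrightarrow> (\<lambda>i. c * u i) \<in> V"
    and nonneg: "u \<in> V \<Longrightarrow> 0 \<le> Q u"
    and hom: "u \<in> V \<Longrightarrow> Q (\<lambda>i. c * u i) = (cmod c)\<^sup>2 * Q u"
    and par: "u \<in> V \<Longrightarrow> v \<in> V \<Longrightarrow> Q (\<lambda>i. u i + v i) + Q (\<lambda>i. u i - v i) \<le> 2 * Q u + 2 * Q v"
begin

lemma minus_mem: "u \<in> V \<Longrightarrow> (\<lambda>i. - u i) \<in> V"
  using scale_mem[of u "-1"] by simp

lemma diff_mem: "u \<in> V \<Longrightarrow> v \<in> V \<Longrightarrow> (\<lambda>i. u i - v i) \<in> V"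
  using add_mem[OF _ minus_mem, of u v] by simp

lemma Q_minus: "u \<in> V \<Longrightarrow> Q (\<lambda>i. - u i) = Q u"
  using hom[of u "-1"] by simp

text \<open>Applied to \<open>u + v\<close> and \<open>u - v\<close>, with doubling multiplying
  \<open>Q\<close> by 4, the inequality turns into its own converse.\<close>

lemma par_eq:
  assumes u: "u \<in> V" and v: "v \<in> V"
  shows "Q (\<lambda>i. u i + v i) + Q (\<lambda>i. u i - v i) = 2 * Q u + 2 * Q v"
proof (rule antisym)
  have "Q (\<lambda>i. (u i + v i) + (u i - v i)) + Q (\<lambda>i. (u i + v i) - (u i - v i)) \<le> 2 * Q (\<lambda>i. u i + v i) + 2 * Q (\<lambda>i. u i - v i)"
    by (rule par[OF add_mem[OF u v] diff_mem[OF u v]])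
  moreover have "(\<lambda>i. (u i + v i) + (u i - v i)) = (\<lambda>i. 2 * u i)" "(\<lambda>i. (u i + v i) - (u i - v i)) = (\<lambda>i. 2 * v i)"
    by (simp_all add: fun_eq_iff)
  ultimately show "2 * Q u + 2 * Q v \<le> Q (\<lambda>i. u i + v i) + Q (\<lambda>i. u i - v i)"
    using hom[OF u, of 2] hom[OF v, of 2] by simp
qed (rule par[OF u v])

definition R :: "('i \<Rightarrow> complex) \<Rightarrow> ('i \<Rightarrow> complex) \<Rightarrow> real" where
  "R u v = (Q (\<lambda>i. u i + v i) - Q (\<lambda>i. u i - v i)) / 4"

lemma R_sym: assumes "u \<in> V" "v \<in> V" shows "R u v = R v u"
  using Q_minus[OF diff_mem[OF assms]] by (simp add: R_def add.commute)

lemma R_zero: "u \<in> V \<Longrightarrow> R (\<lambda>i. 0) u = 0"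
  using Q_minus[of u] by (simp add: R_def)

text \<open>The two parallelogram identities for shifts by \<open>w\<close> and by
  \<open>- w\<close> are subtracted; the term with \<open>u - v\<close> cancels.\<close>

lemma R_half:
  assumes u: "u \<in> V" and v: "v \<in> V" and w: "w \<in> V"
  shows "R u w + R v w = R (\<lambda>i. u i + v i) (\<lambda>i. 2 * w i) / 2"
proof -
  have "Q (\<lambda>i. (u i + w i) + (v i + w i)) + Q (\<lambda>i. (u i + w i) - (v i + w i)) = 2 * Q (\<lambda>i. u i + w i) + 2 * Q (\<lambda>i. v i + w i)"
    by (rule par_eq[OF add_mem[OF u w] add_mem[OF v w]])
  moreover have "Q (\<lambda>i. (u i - w i) + (v i - w i)) + Q (\<lambda>i. (u i - w i) - (v i - w i)) = 2 * Q (\<lambda>i. u i - w i) + 2 * Q (\<lambda>i. v i - w i)"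
    by (rule par_eq[OF diff_mem[OF u w] diff_mem[OF v w]])
  moreover have "(\<lambda>i. (u i + w i) + (v i + w i)) = (\<lambda>i. u i + v i + 2 * w i)" "(\<lambda>i. (u i - w i) + (v i - w i)) = (\<lambda>i. u i + v i - 2 * w i)"
    "(\<lambda>i. (u i + w i) - (v i + w i)) = (\<lambda>i. (u i - w i) - (v i - w i))"
    by (simp_all add: fun_eq_iff algebra_simps)
  ultimately have "Q (\<lambda>i. u i + v i + 2 * w i) + Q (\<lambda>i. u i - v i) = 2 * Q (\<lambda>i. u i + w i) + 2 * Q (\<lambda>i. v i + w i)"
    "Q (\<lambda>i. u i + v i - 2 * w i) + Q (\<lambda>i. u i - v i) = 2 * Q (\<lambda>i. u i - w i) + 2 * Q (\<lambda>i. v i - w i)"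
    by simp_all
  moreover have "a + d = 2 * p + 2 * q \<Longrightarrow> b + d = 2 * r + 2 * s \<Longrightarrow> (p - r) / 4 + (q - s) / 4 = (a - b) / 4 / 2" for a b d p q r s :: real
    by (simp add: field_simps)
  ultimately show ?thesis unfolding R_def by blast
qed

text \<open>\<open>R_half\<close> with second vector 0 shows that the doubled argument and the
  factor 1/2 compensate, so the right-hand side of \<open>R_half\<close> is \<open>R\<close> of the
  sum.\<close>

lemma R_add:
  assumes u: "u \<in> V" and v: "v \<in> V" and w: "w \<in> V"
  shows "R (\<lambda>i. u i + v i) w = R u w + R v w"
  using R_half[OF u v w] R_half[OF add_mem[OF u v] zero_mem w] R_zero[OF w] by simp

lemma R_hom: assumes "u \<in> V" "v \<in> V" shows "R (\<lambda>i. c * u i) (\<lambda>i. c * v i) = (cmod c)\<^sup>2 * R u v"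
  using hom[OF add_mem[OF assms], of c] hom[OF diff_mem[OF assms], of c]
  by (simp add: R_def distrib_left right_diff_distrib diff_divide_distrib)

lemma R_minus_right: "R u (\<lambda>i. - v i) = - R u v"
proof -
  have "R u (\<lambda>i. - v i) = (Q (\<lambda>i. u i - v i) - Q (\<lambda>i. u i + v i)) / 4" by (simp add: R_def)
  then show ?thesis unfolding R_def by (simp only: minus_divide_left minus_diff_eq)
qed

lemma R_i: assumes u: "u \<in> V" and v: "v \<in> V" shows "R (\<lambda>i. \<i> * u i) v = - R u (\<lambda>i. \<i> * v i)"
proof -
  have "R (\<lambda>i. \<i> * u i) (\<lambda>i. \<i> * (\<i> * v i)) = R u (\<lambda>i. \<i> * v i)"
    using R_hom[OF u scale_mem[OF v, of \<i>], of \<i>] by simp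
  moreover have "(\<lambda>i. \<i> * (\<i> * v i)) = (\<lambda>i. - v i)" by (simp add: mult.assoc[symmetric])
  ultimately show ?thesis using R_minus_right[of "\<lambda>i. \<i> * u i" v] by simp
qed

lemma R_bound: assumes u: "u \<in> V" and v: "v \<in> V" shows "\<bar>R u v\<bar> \<le> Q u + Q v"
  using par[OF u v] nonneg[OF add_mem[OF u v]] nonneg[OF diff_mem[OF u v]] nonneg[OF u] nonneg[OF v]
  unfolding R_def by (simp add: abs_le_iff)

text \<open>Homogeneity over the reals comes from additivity together with the growth bound
  \<open>R_bound\<close>, which is quadratic in \<open>t\<close>.\<close>

lemma R_real: assumes u: "u \<in> V" and v: "v \<in> V" shows "R (\<lambda>i. complex_of_real t * u i) v = t * R u v"
proof -
  have "R (\<lambda>i. complex_of_real t * u i) v = t * R (\<lambda>i. complex_of_real 1 * u i) v"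
  proof (rule additive_bounded_linear)
    fix s t
    show "R (\<lambda>i. complex_of_real (s + t) * u i) v = R (\<lambda>i. complex_of_real s * u i) v + R (\<lambda>i. complex_of_real t * u i) v"
      using R_add[OF scale_mem[OF u] scale_mem[OF u] v] by (simp add: distrib_right)
    show "\<bar>R (\<lambda>i. complex_of_real t * u i) v\<bar> \<le> Q u * t\<^sup>2 + Q v"
      using R_bound[OF scale_mem[OF u] v, of "complex_of_real t"] hom[OF u, of "complex_of_real t"] by (simp add: mult.commute)
  qed
  then show ?thesis by simp
qed

text \<open>\<open>R\<close> is the real part. For a form linear in the first argument, the
  imaginary part of the product with \<open>v\<close> is the real part of the product with
  \<open>\<i> * v\<close>.\<close>

definition inner :: "('i \<Rightarrow> complex) \<Rightarrow> ('i \<Rightarrow> complex) \<Rightarrow> complex" where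
  "inner u v = Complex (R u v) (R u (\<lambda>i. \<i> * v i))"

definition space :: "('i \<Rightarrow> complex) hilbert" where
  "space = \<lparr> vcarrier = V, vzero = (\<lambda>i. 0), vadd = (\<lambda>u v i. u i + v i), vscale = (\<lambda>c u i. c * u i), hinner = inner \<rparr>"

lemma space_simps [simp]:
  "vcarrier space = V" "vzero space = (\<lambda>i. 0)" "vadd space u v = (\<lambda>i. u i + v i)"
  "vscale space c u = (\<lambda>i. c * u i)" "hinner space = inner" "vsub space u v = (\<lambda>i. u i - v i)"
  by (simp_all add: space_def vsub_def)

lemma R_scale:
  assumes u: "u \<in> V" and v: "v \<in> V"
  shows "R (\<lambda>i. c * u i) v = Re c * R u v - Im c * R u (\<lambda>i. \<i> * v i)"
proof -
  have "(\<lambda>i. c * u i) = (\<lambda>i. complex_of_real (Re c) * u i + complex_of_real (Im c) * (\<i> * u i))"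
    by (subst complex_eq[of c]) (simp add: algebra_simps)
  then show ?thesis
    using R_add[OF scale_mem[OF u] scale_mem[OF scale_mem[OF u]] v, of "complex_of_real (Re c)" "complex_of_real (Im c)" \<i>]
    by (simp add: R_real[OF u v] R_real[OF scale_mem[OF u] v] R_i[OF u v])
qed

lemma inner_self: assumes u: "u \<in> V" shows "inner u u = complex_of_real (Q u)"
proof -
  have "R u u = Q u" using hom[OF u, of 2] hom[OF u, of 0] by (simp add: R_def mult_2[symmetric])
  \<comment> \<open>This compares the values of \<open>Q\<close> at \<open>(1 + \<i>) u\<close> and
    \<open>(1 - \<i>) u\<close>, which agree because both factors have modulus
    \<open>sqrt 2\<close>.\<close>
  moreover have "R u (\<lambda>i. \<i> * u i) = 0"
    using hom[OF u, of "1 + \<i>"] hom[OF u, of "1 - \<i>"] by (simp add: R_def algebra_simps cmod_def)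
  ultimately show ?thesis by (simp add: inner_def complex_eq_iff)
qed

lemma hnorm_space: "u \<in> V \<Longrightarrow> hnorm space u = sqrt (Q u)"
  by (simp add: hnorm_def inner_self)

lemma hilbert_spaceI:
  assumes definite: "\<And>u. u \<in> V \<Longrightarrow> Q u = 0 \<Longrightarrow> u = (\<lambda>i. 0)"
    and complete: "\<And>u. (\<And>k :: nat. u k \<in> V) \<Longrightarrow> (\<And>e. 0 < e \<Longrightarrow> \<exists>N. \<forall>m\<ge>N. \<forall>k\<ge>N. Q (\<lambda>i. u m i - u k i) < e) \<Longrightarrow>
        \<exists>l\<in>V. (\<lambda>k. Q (\<lambda>i. u k i - l i)) \<longlonglongrightarrow> 0"
  shows "hilbert_space space"
  unfolding hilbert_space_def
proof (intro conjI ballI allI impI)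
  show "cvector_space space"
    unfolding cvector_space_def by (auto simp: zero_mem add_mem scale_mem algebra_simps fun_eq_iff)
  show "complete_for space (hnorm space)"
    unfolding complete_for_def
  proof (intro allI impI, elim conjE)
    fix u :: "nat \<Rightarrow> 'i \<Rightarrow> complex"
    assume "\<forall>k. u k \<in> vcarrier space" and C: "\<forall>\<epsilon>>0. \<exists>N. \<forall>m\<ge>N. \<forall>k\<ge>N. hnorm space (vsub space (u m) (u k)) < \<epsilon>"
    then have u: "u k \<in> V" for k by simp
    have "\<exists>l\<in>V. (\<lambda>k. Q (\<lambda>i. u k i - l i)) \<longlonglongrightarrow> 0"
    proof (rule complete[OF u])
      fix e :: real assume "0 < e"
      then obtain N where N: "\<forall>m\<ge>N. \<forall>k\<ge>N. hnorm space (vsub space (u m) (u k)) < sqrt e" using C[rule_format, of "sqrt e"] by auto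
      have "Q (\<lambda>i. u m i - u k i) < e" if "m \<ge> N" "k \<ge> N" for m k
        using N[rule_format, OF that] hnorm_space[OF diff_mem[OF u[of m] u[of k]]] by simp
      then show "\<exists>N. \<forall>m\<ge>N. \<forall>k\<ge>N. Q (\<lambda>i. u m i - u k i) < e" by blast
    qed
    then obtain l where l: "l \<in> V" "(\<lambda>k. Q (\<lambda>i. u k i - l i)) \<longlonglongrightarrow> 0" by blast
    from tendsto_real_sqrt[OF l(2)] have "(\<lambda>k. hnorm space (vsub space (u k) l)) \<longlonglongrightarrow> 0"
      by (simp add: hnorm_space diff_mem u l(1))
    then show "\<exists>l\<in>vcarrier space. (\<lambda>k. hnorm space (vsub space (u k) l)) \<longlonglongrightarrow> 0" using l(1) by auto
  qed
next
  fix u v w assume "u \<in> vcarrier space" "v \<in> vcarrier space" "w \<in> vcarrier space"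
  then have uv: "u \<in> V" "v \<in> V" "w \<in> V" by simp_all
  show "hinner space (vadd space u v) w = hinner space u w + hinner space v w"
    by (simp add: inner_def R_add uv scale_mem complex_eq_iff)
  show "hinner space v u = cnj (hinner space u v)"
    using R_sym[OF uv(1,2)] R_sym[OF uv(2) scale_mem[OF uv(1)], of \<i>] R_i[OF uv(1,2)]
    by (simp add: inner_def complex_eq_iff)
  fix c
  have "(\<lambda>i. \<i> * (\<i> * v i)) = (\<lambda>i. - v i)" by (simp add: mult.assoc[symmetric])
  then have "R u (\<lambda>i. \<i> * (\<i> * v i)) = - R u v" by (simp add: R_minus_right)
  then show "hinner space (vscale space c u) v = c * hinner space u v"
    by (simp add: inner_def R_scale uv scale_mem complex_eq_iff algebra_simps)
next
  fix v assume "v \<in> vcarrier space"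
  then have v: "v \<in> V" by simp
  show "0 \<le> Re (hinner space v v)" by (simp add: inner_self v nonneg)
  assume "hinner space v v = 0"
  then show "v = vzero space" using definite[OF v] by (simp add: inner_self v)
qed

lemma vsum_space: "vsum space f m = (\<lambda>x. \<Sum>j<m. f j x)"
  by (induction m) simp_all

end

section \<open>The Hilbert sum of a sequence of blocks\<close>

text \<open>All blocks are packed into one sequence by the pairing bijection, block number first and
  position in the block second, so that the vectors of the Hilbert space have the type
  \<open>nat \<Rightarrow> complex\<close> named in the theorem.\<close>

definition blk :: "(nat \<Rightarrow> complex) \<Rightarrow> nat \<Rightarrow> nat \<times> nat \<Rightarrow> complex" where
  "blk h b e = h (prod_encode (b, prod_encode e))"

definition unblk :: "(nat \<Rightarrow> nat \<times> nat \<Rightarrow> complex) \<Rightarrow> nat \<Rightarrow> complex" where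
  "unblk F x = F (fst (prod_decode x)) (prod_decode (snd (prod_decode x)))"

lemma blk_unblk [simp]: "blk (unblk F) b = F b"
  by (simp add: blk_def unblk_def fun_eq_iff)

lemma blk_at: "h x = blk h (fst (prod_decode x)) (prod_decode (snd (prod_decode x)))"
  by (simp add: blk_def)

lemma blk_linear:
  "blk (\<lambda>x. g x + h x) b = (\<lambda>e. blk g b e + blk h b e)" "blk (\<lambda>x. g x - h x) b = (\<lambda>e. blk g b e - blk h b e)"
  "blk (\<lambda>x. c * h x) b = (\<lambda>e. c * blk h b e)" "blk (\<lambda>x. 0) b = (\<lambda>e. 0)"
  "blk (\<lambda>x. \<Sum>j<m. f j x) b = (\<lambda>e. \<Sum>j<m. blk (f j) b e)"
  by (simp_all add: blk_def fun_eq_iff)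

lemma jact_linear:
  "jact (jadd a b) w e = jact a w e + jact b w e" "jact (jscale c a) w e = c * jact a w e"
  "jact (jmult a b) w e = jact a (jact b w) e"
  "jact a (\<lambda>e. v e + w e) e = jact a v e + jact a w e" "jact a (\<lambda>e. c * w e) e = c * jact a w e"
proof -
  obtain l r where e: "e = (l, r)" by (cases e)
  show "jact (jadd a b) w e = jact a w e + jact b w e"
    by (cases r rule: nat_012_cases) (simp_all add: e jadd_def, simp_all add: algebra_simps)
  show "jact (jscale c a) w e = c * jact a w e"
    by (cases r rule: nat_012_cases) (simp_all add: e jscale_def, simp_all add: algebra_simps)
  show "jact (jmult a b) w e = jact a (jact b w) e"
    by (cases r rule: nat_012_cases) (simp_all add: e jmult_def, simp_all add: algebra_simps)
  show "jact a (\<lambda>e. v e + w e) e = jact a v e + jact a w e"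
    by (cases r rule: nat_012_cases) (simp_all add: e, simp_all add: algebra_simps)
  show "jact a (\<lambda>e. c * w e) e = c * jact a w e"
    by (cases r rule: nat_012_cases) (simp_all add: e, simp_all add: algebra_simps)
qed

locale block_family =
  fixes ns Ns :: "nat \<Rightarrow> nat" and Q :: "nat \<Rightarrow> (nat \<times> nat \<Rightarrow> complex) \<Rightarrow> real"
  assumes bf: "block_form (ns b) (Ns b) (Q b)"
begin

abbreviation "E b \<equiv> block_index (ns b) (Ns b)"

lemma Q_nonneg: "0 \<le> Q b w"
  using bf[of b] unfolding block_form_def by blast

lemma Q_par: "Q b (\<lambda>e. v e + w e) + Q b (\<lambda>e. v e - w e) \<le> 2 * Q b v + 2 * Q b w"
  using bf[of b] unfolding block_form_def by blast

lemma Q_hom: "Q b (\<lambda>e. c * w e) = (cmod c)\<^sup>2 * Q b w"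
  using bf[of b] unfolding block_form_def by blast

lemma Q_cong: "(\<And>e. e \<in> E b \<Longrightarrow> v e = w e) \<Longrightarrow> Q b v = Q b w"
  using bf[of b] unfolding block_form_def by blast

lemma Q_coord: "\<exists>\<delta>>0. \<forall>w. \<forall>e\<in>E b. \<delta> * (cmod (w e))\<^sup>2 \<le> Q b w"
  using bf[of b] unfolding block_form_def by blast

lemma Q_module: "liftable m A c \<Longrightarrow> 0 \<le> c \<Longrightarrow>
    (\<Sum>i<m. Q b (\<lambda>e. \<Sum>j<m. jact (A i j) (w j) e)) \<le> 34 * c\<^sup>2 * (\<Sum>j<m. Q b (w j))"
  using bf[of b] unfolding block_form_def by blast

lemma Q_unit: "(\<Sum>i<ns b. Q b (block_unit i)) \<le> 2"
  using bf[of b] unfolding block_form_def by blast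

lemma Q_zero [simp]: "Q b (\<lambda>e. 0) = 0"
  using Q_hom[of b 0 "\<lambda>e. 0"] by simp

lemma Q_add: "Q b (\<lambda>e. v e + w e) \<le> 2 * Q b v + 2 * Q b w" "Q b (\<lambda>e. v e - w e) \<le> 2 * Q b v + 2 * Q b w"
  using Q_par[of b v w] Q_nonneg[of b "\<lambda>e. v e - w e"] Q_nonneg[of b "\<lambda>e. v e + w e"] by linarith+

text \<open>Coordinates are added one at a time by means of \<open>Q_add\<close>. The constant
  depends on the block; it serves to pass coordinatewise limits through \<open>Q b\<close>.\<close>

lemma Q_bounded: "\<exists>C. \<forall>w. Q b w \<le> C * (\<Sum>e\<in>E b. (cmod (w e))\<^sup>2)"
proof -
  have "\<exists>C\<ge>0. \<forall>w. (\<forall>e. e \<notin> F \<longrightarrow> w e = 0) \<longrightarrow> Q b w \<le> C * (\<Sum>e\<in>F. (cmod (w e))\<^sup>2)" if "finite F" for F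
    using that
  proof (induction F rule: finite_induct)
    case empty
    have "Q b w = 0" if "\<forall>e. w e = 0" for w
    proof -
      have "w = (\<lambda>e. 0)" using that by auto
      then show ?thesis by simp
    qed
    then show ?case by (intro exI[of _ 0]) auto
  next
    case (insert f F)
    then obtain C where C: "0 \<le> C" "\<And>w. (\<forall>e. e \<notin> F \<longrightarrow> w e = 0) \<Longrightarrow> Q b w \<le> C * (\<Sum>e\<in>F. (cmod (w e))\<^sup>2)" by blast
    define u :: "nat \<times> nat \<Rightarrow> complex" where "u e = (if e = f then 1 else 0)" for e
    define D where "D = max (2 * C) (2 * Q b u)"
    have "Q b w \<le> D * (\<Sum>e\<in>insert f F. (cmod (w e))\<^sup>2)" if w: "\<forall>e. e \<notin> insert f F \<longrightarrow> w e = 0" for w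
    proof -
      define v where "v e = (if e \<in> F then w e else 0)" for e
      have "w = (\<lambda>e. v e + w f * u e)" using w insert(2) by (auto simp: v_def u_def fun_eq_iff)
      then have "Q b w \<le> 2 * Q b v + 2 * Q b (\<lambda>e. w f * u e)" using Q_add(1)[of b v "\<lambda>e. w f * u e"] by simp
      also have "\<dots> \<le> 2 * (C * (\<Sum>e\<in>F. (cmod (w e))\<^sup>2)) + 2 * ((cmod (w f))\<^sup>2 * Q b u)"
        using C(2)[of v] by (simp add: v_def Q_hom cong: sum.cong)
      also have "\<dots> = (2 * C) * (\<Sum>e\<in>F. (cmod (w e))\<^sup>2) + (2 * Q b u) * (cmod (w f))\<^sup>2" by simp
      also have "\<dots> \<le> D * (\<Sum>e\<in>F. (cmod (w e))\<^sup>2) + D * (cmod (w f))\<^sup>2"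
        by (intro add_mono mult_right_mono sum_nonneg) (auto simp: D_def)
      also have "\<dots> = D * (\<Sum>e\<in>insert f F. (cmod (w e))\<^sup>2)" using insert(1,2) by (simp add: algebra_simps)
      finally show ?thesis .
    qed
    moreover have "0 \<le> D" using C(1) by (simp add: D_def)
    ultimately show ?case by blast
  qed
  from this[of "E b"] obtain C where C: "\<And>w. (\<forall>e. e \<notin> E b \<longrightarrow> w e = 0) \<Longrightarrow> Q b w \<le> C * (\<Sum>e\<in>E b. (cmod (w e))\<^sup>2)" by auto
  have "Q b w \<le> C * (\<Sum>e\<in>E b. (cmod (w e))\<^sup>2)" for w
  proof -
    have "Q b w = Q b (\<lambda>e. if e \<in> E b then w e else 0)" by (intro Q_cong) simp
    also have "\<dots> \<le> C * (\<Sum>e\<in>E b. (cmod (if e \<in> E b then w e else 0))\<^sup>2)" by (rule C) simp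
    finally show ?thesis by (simp cong: sum.cong)
  qed
  then show ?thesis by blast
qed

lemma Q_tendsto_0:
  assumes "\<And>e. (\<lambda>k. w k e) \<longlonglongrightarrow> 0" shows "(\<lambda>k. Q b (w k)) \<longlonglongrightarrow> 0"
proof -
  obtain C where C: "\<And>w. Q b w \<le> C * (\<Sum>e\<in>E b. (cmod (w e))\<^sup>2)" using Q_bounded by blast
  have "(\<lambda>k. C * (\<Sum>e\<in>E b. (cmod (w k e))\<^sup>2)) \<longlonglongrightarrow> C * (\<Sum>e\<in>E b. (cmod 0)\<^sup>2)" by (intro tendsto_intros assms)
  then have "(\<lambda>k. C * (\<Sum>e\<in>E b. (cmod (w k e))\<^sup>2)) \<longlonglongrightarrow> 0" by simp
  then show ?thesis by (rule tendsto_0_le) (use C Q_nonneg in auto)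
qed

text \<open>Entries outside the index sets are fixed to 0 because no form sees them; otherwise the
  sum of the forms would not be definite.\<close>

definition HV :: "(nat \<Rightarrow> complex) set" where
  "HV = {h. (\<forall>b e. e \<notin> E b \<longrightarrow> blk h b e = 0) \<and> summable (\<lambda>b. Q b (blk h b))}"

definition QH :: "(nat \<Rightarrow> complex) \<Rightarrow> real" where
  "QH h = (\<Sum>b. Q b (blk h b))"

lemma HV_summable: "h \<in> HV \<Longrightarrow> summable (\<lambda>b. Q b (blk h b))"
  by (simp add: HV_def)

lemma QH_ge: "h \<in> HV \<Longrightarrow> Q b (blk h b) \<le> QH h"
  unfolding QH_def using sum_le_suminf[OF HV_summable, of h "{b}"] Q_nonneg by simp

lemma summable_le:
  assumes "summable g" "\<And>b. 0 \<le> f b" "\<And>b. f b \<le> g b" shows "summable (f :: nat \<Rightarrow> real)"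
  by (rule summable_comparison_test[OF _ assms(1)]) (use assms in auto)

lemma HV_add:
  assumes "u \<in> HV" "v \<in> HV" shows "(\<lambda>x. u x + v x) \<in> HV" "(\<lambda>x. u x - v x) \<in> HV"
proof -
  have s: "summable (\<lambda>b. 2 * Q b (blk u b) + 2 * Q b (blk v b))"
    using assms by (intro summable_add summable_mult HV_summable)
  have "summable (\<lambda>b. Q b (\<lambda>e. blk u b e + blk v b e))" "summable (\<lambda>b. Q b (\<lambda>e. blk u b e - blk v b e))"
    by (rule summable_le[OF s Q_nonneg Q_add(1)]) (rule summable_le[OF s Q_nonneg Q_add(2)])
  then show "(\<lambda>x. u x + v x) \<in> HV" "(\<lambda>x. u x - v x) \<in> HV" using assms by (auto simp: HV_def blk_linear)
qed

sublocale H: quadratic_space HV QH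
proof
  show "(\<lambda>i. 0) \<in> HV" by (simp add: HV_def blk_linear)
  fix u v c assume u: "u \<in> HV"
  show "0 \<le> QH u" unfolding QH_def using Q_nonneg by (intro suminf_nonneg HV_summable u)
  show "(\<lambda>i. c * u i) \<in> HV" using u by (auto simp: HV_def blk_linear Q_hom)
  show "QH (\<lambda>i. c * u i) = (cmod c)\<^sup>2 * QH u" by (simp add: QH_def blk_linear Q_hom suminf_mult HV_summable u)
  assume v: "v \<in> HV"
  show "(\<lambda>i. u i + v i) \<in> HV" by (rule HV_add[OF u v])
  note s = HV_summable[OF HV_add(1)[OF u v]] HV_summable[OF HV_add(2)[OF u v]]
  have "QH (\<lambda>i. u i + v i) + QH (\<lambda>i. u i - v i) = (\<Sum>b. Q b (blk (\<lambda>i. u i + v i) b) + Q b (blk (\<lambda>i. u i - v i) b))"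
    unfolding QH_def by (rule suminf_add[OF s])
  also have "\<dots> \<le> (\<Sum>b. 2 * Q b (blk u b) + 2 * Q b (blk v b))"
    by (intro suminf_le summable_add s summable_mult HV_summable u v) (simp add: blk_linear Q_par)
  also have "\<dots> = 2 * QH u + 2 * QH v"
    unfolding QH_def using HV_summable[OF u] HV_summable[OF v] by (simp add: suminf_add[symmetric] suminf_mult summable_mult)
  finally show "QH (\<lambda>i. u i + v i) + QH (\<lambda>i. u i - v i) \<le> 2 * QH u + 2 * QH v" .
qed

lemma QH_coord: "\<exists>C\<ge>0. \<forall>h\<in>HV. (cmod (h x))\<^sup>2 \<le> C * QH h"
proof -
  define b where "b = fst (prod_decode x)"
  define e where "e = prod_decode (snd (prod_decode x))"
  have hx: "h x = blk h b e" for h unfolding b_def e_def by (rule blk_at)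
  show ?thesis
  proof (cases "e \<in> E b")
    case False
    then have "\<forall>h\<in>HV. h x = 0" unfolding hx HV_def by blast
    then show ?thesis by (intro exI[of _ 0]) simp
  next
    case True
    obtain \<delta> where \<delta>: "\<delta> > 0" "\<And>w. \<delta> * (cmod (w e))\<^sup>2 \<le> Q b w" using Q_coord[of b] True by blast
    have "(cmod (h x))\<^sup>2 \<le> 1 / \<delta> * QH h" if "h \<in> HV" for h
    proof -
      have "\<delta> * (cmod (h x))\<^sup>2 \<le> QH h" unfolding hx by (rule order_trans[OF \<delta>(2) QH_ge[OF that]])
      then show ?thesis using \<delta>(1) by (simp add: field_simps)
    qed
    then show ?thesis using \<delta>(1) by (intro exI[of _ "1 / \<delta>"]) auto
  qed
qed

text \<open>A Cauchy sequence converges coordinatewise by \<open>QH_coord\<close>; the partial sums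
  over finitely many blocks then carry the Cauchy estimate to the limit.\<close>

lemma hilbert: "hilbert_space H.space"
proof (rule H.hilbert_spaceI)
  fix u assume u: "u \<in> HV" "QH u = 0"
  show "u = (\<lambda>i. 0)"
  proof
    fix x obtain C where "\<forall>h\<in>HV. (cmod (h x))\<^sup>2 \<le> C * QH h" using QH_coord[of x] by blast
    then have "(cmod (u x))\<^sup>2 \<le> 0" using u by fastforce
    then show "u x = 0" by simp
  qed
next
  fix u :: "nat \<Rightarrow> nat \<Rightarrow> complex"
  assume u: "\<And>k. u k \<in> HV" and C: "\<And>e. 0 < e \<Longrightarrow> \<exists>N. \<forall>m\<ge>N. \<forall>k\<ge>N. QH (\<lambda>i. u m i - u k i) < e"
  have d: "(\<lambda>i. u m i - u k i) \<in> HV" for m k by (rule HV_add(2)[OF u u])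
  have "Cauchy (\<lambda>k. u k x)" for x
  proof (rule metric_CauchyI)
    fix e :: real assume e: "0 < e"
    obtain B where B: "0 \<le> B" "\<forall>h\<in>HV. (cmod (h x))\<^sup>2 \<le> B * QH h" using QH_coord[of x] by blast
    have "0 < e\<^sup>2 / (B + 1)" using e B(1) by simp
    from C[OF this] obtain N where N: "\<forall>m\<ge>N. \<forall>k\<ge>N. QH (\<lambda>i. u m i - u k i) < e\<^sup>2 / (B + 1)" by blast
    have "dist (u m x) (u k x) < e" if "m \<ge> N" "k \<ge> N" for m k
    proof -
      have q: "0 \<le> QH (\<lambda>i. u m i - u k i)" by (rule H.nonneg[OF d])
      have "(cmod (u m x - u k x))\<^sup>2 \<le> B * QH (\<lambda>i. u m i - u k i)" using B(2)[rule_format, OF d[of m k]] .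
      also have "\<dots> \<le> (B + 1) * QH (\<lambda>i. u m i - u k i)" using q by (simp add: distrib_right)
      also have "\<dots> < (B + 1) * (e\<^sup>2 / (B + 1))" using N[rule_format, OF that] B(1) by (intro mult_strict_left_mono) auto
      also have "\<dots> = e\<^sup>2" using B(1) by simp
      finally show ?thesis using e by (simp add: dist_norm power2_less_imp_less)
    qed
    then show "\<exists>N. \<forall>m\<ge>N. \<forall>k\<ge>N. dist (u m x) (u k x) < e" by blast
  qed
  then have "\<forall>x. \<exists>l. (\<lambda>k. u k x) \<longlonglongrightarrow> l" by (auto simp: Cauchy_convergent_iff convergent_def)
  then obtain l where l: "\<And>x. (\<lambda>k. u k x) \<longlonglongrightarrow> l x" by metis
  have l0: "blk l b e = 0" if "e \<notin> E b" for b e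
  proof -
    have "u k (prod_encode (b, prod_encode e)) = 0" for k using u[of k] that unfolding HV_def blk_def by blast
    then have "(\<lambda>k. 0) \<longlonglongrightarrow> l (prod_encode (b, prod_encode e))" using l[of "prod_encode (b, prod_encode e)"] by simp
    then show ?thesis by (simp add: blk_def LIMSEQ_const_iff)
  qed
  have main: "\<exists>N. \<forall>m\<ge>N. (\<lambda>i. u m i - l i) \<in> HV \<and> QH (\<lambda>i. u m i - l i) \<le> 2 * e" if e: "0 < e" for e
  proof -
    from C[OF e] obtain N where N: "\<forall>m\<ge>N. \<forall>k\<ge>N. QH (\<lambda>i. u m i - u k i) < e" by blast
    have "(\<lambda>i. u m i - l i) \<in> HV \<and> QH (\<lambda>i. u m i - l i) \<le> 2 * e" if m: "m \<ge> N" for m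
    proof -
      \<comment> \<open>The factor 2 is the price of using \<open>Q_add\<close> for the triangle
        inequality. Over finitely many blocks the terms comparing \<open>u k\<close> with the limit
        vanish as \<open>k\<close> grows.\<close>
      have part: "(\<Sum>b<B. Q b (blk (\<lambda>i. u m i - l i) b)) \<le> 2 * e" for B
      proof (rule LIMSEQ_le_const)
        have "(\<lambda>k. Q b (blk (\<lambda>i. u k i - l i) b)) \<longlonglongrightarrow> 0" for b
        proof (rule Q_tendsto_0)
          fix e
          have "(\<lambda>k. u k (prod_encode (b, prod_encode e)) - l (prod_encode (b, prod_encode e))) \<longlonglongrightarrow> 0"
            by (rule LIM_zero[OF l])
          then show "(\<lambda>k. blk (\<lambda>i. u k i - l i) b e) \<longlonglongrightarrow> 0" by (simp add: blk_def)
        qed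
        then have "(\<lambda>k. 2 * e + (\<Sum>b<B. 2 * Q b (blk (\<lambda>i. u k i - l i) b))) \<longlonglongrightarrow> 2 * e + (\<Sum>b<B. 2 * 0)"
          by (intro tendsto_intros)
        then show "(\<lambda>k. 2 * e + (\<Sum>b<B. 2 * Q b (blk (\<lambda>i. u k i - l i) b))) \<longlonglongrightarrow> 2 * e" by simp
        have "(\<Sum>b<B. Q b (blk (\<lambda>i. u m i - l i) b)) \<le> 2 * e + (\<Sum>b<B. 2 * Q b (blk (\<lambda>i. u k i - l i) b))" if k: "k \<ge> N" for k
        proof -
          have "Q b (blk (\<lambda>i. u m i - l i) b) \<le> 2 * Q b (blk (\<lambda>i. u m i - u k i) b) + 2 * Q b (blk (\<lambda>i. u k i - l i) b)" for b
          proof -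
            have "blk (\<lambda>i. u m i - l i) b = (\<lambda>e. blk (\<lambda>i. u m i - u k i) b e + blk (\<lambda>i. u k i - l i) b e)" by (simp add: blk_linear)
            then show ?thesis using Q_add(1) by simp
          qed
          then have "(\<Sum>b<B. Q b (blk (\<lambda>i. u m i - l i) b)) \<le> (\<Sum>b<B. 2 * Q b (blk (\<lambda>i. u m i - u k i) b) + 2 * Q b (blk (\<lambda>i. u k i - l i) b))"
            by (rule sum_mono)
          also have "\<dots> = 2 * (\<Sum>b<B. Q b (blk (\<lambda>i. u m i - u k i) b)) + (\<Sum>b<B. 2 * Q b (blk (\<lambda>i. u k i - l i) b))"
            by (simp add: sum.distrib sum_distrib_left)
          also have "(\<Sum>b<B. Q b (blk (\<lambda>i. u m i - u k i) b)) \<le> QH (\<lambda>i. u m i - u k i)"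
            unfolding QH_def using Q_nonneg by (intro sum_le_suminf HV_summable d) auto
          finally show ?thesis using N m k by fastforce
        qed
        then show "\<exists>N. \<forall>k\<ge>N. (\<Sum>b<B. Q b (blk (\<lambda>i. u m i - l i) b)) \<le> 2 * e + (\<Sum>b<B. 2 * Q b (blk (\<lambda>i. u k i - l i) b))" by blast
      qed
      have s: "summable (\<lambda>b. Q b (blk (\<lambda>i. u m i - l i) b))"
        by (rule summableI_nonneg_bounded[OF Q_nonneg part])
      moreover have "blk (\<lambda>i. u m i - l i) b e = 0" if "e \<notin> E b" for b e
      proof -
        have "blk (u m) b e = 0" using u[of m] that unfolding HV_def by blast
        then show ?thesis using l0[OF that] by (simp add: blk_linear)
      qed
      ultimately show ?thesis unfolding QH_def using suminf_le_const[OF s part] by (simp add: HV_def)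
    qed
    then show ?thesis by blast
  qed
  obtain N where "(\<lambda>i. u N i - l i) \<in> HV" using main[of 1] by auto
  from HV_add(2)[OF u[of N] this] have lV: "l \<in> HV" by simp
  moreover have "(\<lambda>k. QH (\<lambda>i. u k i - l i)) \<longlonglongrightarrow> 0"
  proof (rule LIMSEQ_I)
    fix r :: real assume r: "0 < r"
    then obtain N where N: "\<forall>m\<ge>N. (\<lambda>i. u m i - l i) \<in> HV \<and> QH (\<lambda>i. u m i - l i) \<le> 2 * (r / 4)" using main[of "r / 4"] by auto
    have "norm (QH (\<lambda>i. u m i - l i) - 0) < r" if "m \<ge> N" for m
      using N that r H.nonneg[of "\<lambda>i. u m i - l i"] by auto
    then show "\<exists>N. \<forall>m\<ge>N. norm (QH (\<lambda>i. u m i - l i) - 0) < r" by blast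
  qed
  ultimately show "\<exists>l\<in>HV. (\<lambda>k. QH (\<lambda>i. u k i - l i)) \<longlonglongrightarrow> 0" by blast
qed

section \<open>The action of jets on the Hilbert sum\<close>

definition act :: "(nat \<Rightarrow> complex) \<times> (nat \<Rightarrow> complex) \<Rightarrow> (nat \<Rightarrow> complex) \<Rightarrow> nat \<Rightarrow> complex" where
  "act a h = unblk (\<lambda>b. jact a (blk h b))"

lemma jact_off:
  assumes "\<And>e. e \<notin> block_index n N \<Longrightarrow> w e = 0" "e \<notin> block_index n N" shows "jact a w e = 0"
proof -
  obtain l r where e: "e = (l, r)" by (cases e)
  show ?thesis
  proof (rule nat_012_cases[of r])
    fix k assume r: "r = Suc (2 * k)"
    then show ?thesis using assms by (simp add: e)
  next
    fix k assume r: "r = Suc (Suc (2 * k))"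
    \<comment> \<open>The value and derivative slots of one coordinate enter and leave the index set
      together, because its last index \<open>2 * N\<close> is even.\<close>
    then have "(l, Suc (2 * k)) \<notin> block_index n N" using assms(2) by (auto simp: e block_index_def) presburger
    then show ?thesis using assms r by (simp add: e)
  qed (simp add: e)
qed

text \<open>The module bound has the same constant for every block, so it can be summed over the
  blocks. As it holds for matrices of any size, it is the complete boundedness of the
  representation.\<close>

lemma act_sum_bound:
  assumes A: "liftable m A c" "0 \<le> c" and v: "\<And>j. j < m \<Longrightarrow> v j \<in> HV"
  shows "\<And>i. i < m \<Longrightarrow> (\<lambda>x. \<Sum>j<m. act (A i j) (v j) x) \<in> HV"
    and "(\<Sum>i<m. QH (\<lambda>x. \<Sum>j<m. act (A i j) (v j) x)) \<le> 34 * c\<^sup>2 * (\<Sum>j<m. QH (v j))"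
proof -
  have b: "blk (\<lambda>x. \<Sum>j<m. act (A i j) (v j) x) b = (\<lambda>e. \<Sum>j<m. jact (A i j) (blk (v j) b) e)" for i b
    by (simp add: blk_linear act_def)
  have sv: "summable (\<lambda>b. 34 * c\<^sup>2 * (\<Sum>j<m. Q b (blk (v j) b)))"
    using v by (intro summable_mult summable_sum HV_summable) auto
  have s: "summable (\<lambda>b. Q b (\<lambda>e. \<Sum>j<m. jact (A i j) (blk (v j) b) e))" if i: "i < m" for i
  proof (rule summable_le[OF sv Q_nonneg])
    fix b
    have "Q b (\<lambda>e. \<Sum>j<m. jact (A i j) (blk (v j) b) e) \<le> (\<Sum>i<m. Q b (\<lambda>e. \<Sum>j<m. jact (A i j) (blk (v j) b) e))"
      using i Q_nonneg by (intro member_le_sum[of i _ "\<lambda>i. Q b (\<lambda>e. \<Sum>j<m. jact (A i j) (blk (v j) b) e)"]) auto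
    also have "\<dots> \<le> 34 * c\<^sup>2 * (\<Sum>j<m. Q b (blk (v j) b))" by (rule Q_module[OF A])
    finally show "Q b (\<lambda>e. \<Sum>j<m. jact (A i j) (blk (v j) b) e) \<le> 34 * c\<^sup>2 * (\<Sum>j<m. Q b (blk (v j) b))" .
  qed
  have off: "(\<Sum>j<m. jact (A i j) (blk (v j) b) e) = 0" if "e \<notin> E b" for i b e
    using v that by (intro sum.neutral ballI jact_off[of "ns b" "Ns b"]) (auto simp: HV_def)
  show "(\<lambda>x. \<Sum>j<m. act (A i j) (v j) x) \<in> HV" if "i < m" for i
    using s[OF that] off by (simp add: HV_def b)
  have "(\<Sum>i<m. QH (\<lambda>x. \<Sum>j<m. act (A i j) (v j) x)) = (\<Sum>b. \<Sum>i<m. Q b (\<lambda>e. \<Sum>j<m. jact (A i j) (blk (v j) b) e))"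
    unfolding QH_def b using s by (subst suminf_sum) auto
  also have "\<dots> \<le> (\<Sum>b. 34 * c\<^sup>2 * (\<Sum>j<m. Q b (blk (v j) b)))"
    using s by (intro suminf_le Q_module[OF A] summable_sum sv) auto
  also have "\<dots> = 34 * c\<^sup>2 * (\<Sum>j<m. QH (v j))"
  proof -
    have "(\<Sum>b. \<Sum>j<m. Q b (blk (v j) b)) = (\<Sum>j<m. \<Sum>b. Q b (blk (v j) b))"
      by (rule suminf_sum) (use v HV_summable in auto)
    then show ?thesis unfolding QH_def using v HV_summable by (subst suminf_mult) (auto intro!: summable_sum)
  qed
  finally show "(\<Sum>i<m. QH (\<lambda>x. \<Sum>j<m. act (A i j) (v j) x)) \<le> 34 * c\<^sup>2 * (\<Sum>j<m. QH (v j))" .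
qed

lemma act_bounded:
  assumes a: "a \<in> E2"
  shows "h \<in> HV \<Longrightarrow> act a h \<in> HV" "\<exists>K. \<forall>h\<in>HV. QH (act a h) \<le> K\<^sup>2 * QH h"
proof -
  obtain c where c: "0 \<le> c" "liftable 1 (\<lambda>_ _. a) c" using liftable_ex[of 1 "\<lambda>_ _. a"] a by auto
  have 1: "act a h \<in> HV \<and> QH (act a h) \<le> 34 * c\<^sup>2 * QH h" if "h \<in> HV" for h
    using act_sum_bound[OF c(2,1), of "\<lambda>_. h"] that by auto
  show "h \<in> HV \<Longrightarrow> act a h \<in> HV" using 1 by blast
  \<comment> \<open>36 is a perfect square above 34, which gives the norm bound in the form
    \<open>6 * c\<close>.\<close>
  have "QH (act a h) \<le> (6 * c)\<^sup>2 * QH h" if "h \<in> HV" for h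
  proof -
    have "QH (act a h) \<le> 34 * c\<^sup>2 * QH h" using 1[OF that] by blast
    also have "\<dots> \<le> (6 * c)\<^sup>2 * QH h" using H.nonneg[OF that] by (intro mult_right_mono) (auto simp: power_mult_distrib)
    finally show ?thesis .
  qed
  then show "\<exists>K. \<forall>h\<in>HV. QH (act a h) \<le> K\<^sup>2 * QH h" by blast
qed

lemma act_linear:
  "act (jadd a b) h = (\<lambda>x. act a h x + act b h x)" "act (jscale c a) h = (\<lambda>x. c * act a h x)"
  "act (jmult a b) h = act a (act b h)"
  "act a (\<lambda>x. g x + h x) = (\<lambda>x. act a g x + act a h x)" "act a (\<lambda>x. c * h x) = (\<lambda>x. c * act a h x)"
  by (simp_all add: act_def fun_eq_iff unblk_def jact_linear blk_linear)

end

section \<open>Detecting the norm by a block\<close>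

lemma l2_finite_le_sum: "l2 (\<lambda>k. if k < N then g k else 0) \<le> (\<Sum>k<N. cmod (g k))"
proof (rule l2_leI)
  fix K
  have "(\<Sum>k<K. (cmod (if k < N then g k else 0))\<^sup>2) \<le> (\<Sum>k<N. (cmod (g k))\<^sup>2)"
  proof -
    have "(\<Sum>k<K. (cmod (if k < N then g k else 0))\<^sup>2) = (\<Sum>k\<in>{..<K} \<inter> {..<N}. (cmod (g k))\<^sup>2)"
      by (intro sum.mono_neutral_cong_right) auto
    also have "\<dots> \<le> (\<Sum>k<N. (cmod (g k))\<^sup>2)" by (intro sum_mono2) auto
    finally show ?thesis .
  qed
  also have "\<dots> = (L2_set (\<lambda>k. cmod (g k)) {..<N})\<^sup>2" by (simp add: L2_set_power2)
  also have "\<dots> \<le> (\<Sum>k<N. cmod (g k))\<^sup>2" by (intro power_mono L2_set_le_sum) auto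
  finally show "(\<Sum>k<K. (cmod (if k < N then g k else 0))\<^sup>2) \<le> (\<Sum>k<N. cmod (g k))\<^sup>2" .
qed (simp add: sum_nonneg)

lemma ell2_tail:
  assumes x: "x \<in> ell2"
  shows "(\<lambda>k. if k < N then 0 else x k) \<in> ell2" "(\<lambda>N. l2 (\<lambda>k. if k < N then 0 else x k)) \<longlonglongrightarrow> 0"
proof -
  show "(\<lambda>k. if k < N then 0 else x k) \<in> ell2" for N by (rule l2_mono(1)[OF x]) simp
  have s: "summable (\<lambda>k. (cmod (x k))\<^sup>2)" using x by (simp add: ell2_def)
  have part: "(\<Sum>k<K. (cmod (if k < N then 0 else x k))\<^sup>2) \<le> (l2 x)\<^sup>2 - (\<Sum>k<N. (cmod (x k))\<^sup>2)" for K N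
  proof -
    have "(\<Sum>k<K. (cmod (if k < N then 0 else x k))\<^sup>2) + (\<Sum>k<N. (cmod (x k))\<^sup>2) \<le> (\<Sum>k<max K N. (cmod (x k))\<^sup>2)"
    proof -
      have "(\<Sum>k<K. (cmod (if k < N then 0 else x k))\<^sup>2) \<le> (\<Sum>k<max K N. (cmod (if k < N then 0 else x k))\<^sup>2)"
        by (intro sum_mono2) auto
      moreover have "(\<Sum>k<N. (cmod (x k))\<^sup>2) = (\<Sum>k<max K N. (cmod (if k < N then x k else 0))\<^sup>2)"
        by (intro sum.mono_neutral_cong_left) auto
      moreover have "(\<Sum>k<max K N. (cmod (if k < N then 0 else x k))\<^sup>2) + (\<Sum>k<max K N. (cmod (if k < N then x k else 0))\<^sup>2) = (\<Sum>k<max K N. (cmod (x k))\<^sup>2)"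
        unfolding sum.distrib[symmetric] by (intro sum.cong) auto
      ultimately show ?thesis by linarith
    qed
    also have "\<dots> \<le> (l2 x)\<^sup>2" by (rule ell2_partial[OF x])
    finally show ?thesis by linarith
  qed
  have nn: "0 \<le> (l2 x)\<^sup>2 - (\<Sum>k<N. (cmod (x k))\<^sup>2)" for N using ell2_partial[OF x, of N] by simp
  have le: "l2 (\<lambda>k. if k < N then 0 else x k) \<le> sqrt ((l2 x)\<^sup>2 - (\<Sum>k<N. (cmod (x k))\<^sup>2))" for N
    using part[where N = N] nn[of N] by (intro l2_leI) simp_all
  have "(\<lambda>N. sqrt ((l2 x)\<^sup>2 - (\<Sum>k<N. (cmod (x k))\<^sup>2))) \<longlonglongrightarrow> sqrt ((l2 x)\<^sup>2 - (l2 x)\<^sup>2)"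
    using summable_LIMSEQ[OF s] by (intro tendsto_intros) (simp add: l2_power2[OF x])
  then have "(\<lambda>N. sqrt ((l2 x)\<^sup>2 - (\<Sum>k<N. (cmod (x k))\<^sup>2))) \<longlonglongrightarrow> 0" by simp
  then show "(\<lambda>N. l2 (\<lambda>k. if k < N then 0 else x k)) \<longlonglongrightarrow> 0"
    by (rule tendsto_0_le) (use le in auto)
qed

lemma col_bdd_trunc:
  assumes "col_bdd n x c" shows "col_bdd n (\<lambda>i j k. if k < N then x i j k else 0) c"
  unfolding col_bdd_def
proof (intro allI)
  fix v :: "nat \<Rightarrow> complex" and K
  have "(\<Sum>k<K. \<Sum>i<n. (cmod (\<Sum>j<n. (if k < N then x i j k else 0) * v j))\<^sup>2) \<le> (\<Sum>k<K. \<Sum>i<n. (cmod (\<Sum>j<n. x i j k * v j))\<^sup>2)"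
  proof (rule sum_mono)
    fix k
    show "(\<Sum>i<n. (cmod (\<Sum>j<n. (if k < N then x i j k else 0) * v j))\<^sup>2) \<le> (\<Sum>i<n. (cmod (\<Sum>j<n. x i j k * v j))\<^sup>2)"
      by (cases "k < N") (simp_all add: sum_nonneg)
  qed
  also have "\<dots> \<le> c\<^sup>2 * (\<Sum>j<n. (cmod (v j))\<^sup>2)" using assms unfolding col_bdd_def by blast
  finally show "(\<Sum>k<K. \<Sum>i<n. (cmod (\<Sum>j<n. (if k < N then x i j k else 0) * v j))\<^sup>2) \<le> c\<^sup>2 * (\<Sum>j<n. (cmod (v j))\<^sup>2)" .
qed

lemma fun_bdd_trunc: "fun_bdd n f c \<Longrightarrow> fun_bdd n (\<lambda>i j z k. if k < N then f i j z k else 0) c"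
  unfolding fun_bdd_def using col_bdd_trunc by blast

text \<open>A lift that is correct at the first \<open>N\<close> coordinates may be cut off there
  without increasing its row and column bounds. The remaining tails of the jets have small l2 norms
  for large \<open>N\<close>, so their explicit lift costs at most \<open>e\<close>.\<close>

lemma liftable_of_truncations:
  assumes P: "\<And>i j. i < n \<Longrightarrow> j < n \<Longrightarrow> P i j \<in> E2" and c: "0 \<le> c"
    and ex: "\<And>N. \<exists>f\<in>lifts n N P. fun_bdd n f c" and e: "0 < e"
  shows "liftable n P (c + e)"
proof -
  define T where "T N i j = (\<lambda>k. if k < N then 0 else fst (P i j) k, \<lambda>k. if k < N then 0 else snd (P i j) k)" for N i j
  define M where "M = e / (real n + 1)"
  have M: "0 < M" "real n * M \<le> e" using e by (auto simp: M_def field_simps)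
  have "eventually (\<lambda>N. \<forall>i<n. \<forall>j<n. l2 (fst (T N i j)) + 3 * l2 (snd (T N i j)) < M) sequentially"
  proof -
    have "eventually (\<lambda>N. l2 (fst (T N i j)) + 3 * l2 (snd (T N i j)) < M) sequentially" if "i < n" "j < n" for i j
    proof -
      have p: "fst (P i j) \<in> ell2" "snd (P i j) \<in> ell2" using P[OF that] by (auto simp: mem_Times_iff)
      have "(\<lambda>N. l2 (fst (T N i j)) + 3 * l2 (snd (T N i j))) \<longlonglongrightarrow> 0 + 3 * 0"
        unfolding T_def fst_conv snd_conv by (intro tendsto_intros ell2_tail p)
      then show ?thesis using M(1) by (intro order_tendstoD(2)) auto
    qed
    then have "eventually (\<lambda>N. \<forall>i\<in>{..<n}. \<forall>j\<in>{..<n}. l2 (fst (T N i j)) + 3 * l2 (snd (T N i j)) < M) sequentially"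
      by (intro eventually_ball_finite ballI) auto
    then show ?thesis by (simp add: Ball_def)
  qed
  then obtain N where N: "\<forall>i<n. \<forall>j<n. l2 (fst (T N i j)) + 3 * l2 (snd (T N i j)) < M"
    by (auto simp: eventually_sequentially)
  have TE: "T N i j \<in> E2" if "i < n" "j < n" for i j
    using P[OF that] by (auto simp: T_def mem_Times_iff intro: ell2_tail)
  have lT: "liftable n (T N) (real n * M)"
    using N TE M(1) by (intro liftable_entries) (auto intro: less_imp_le)
  obtain f where f: "f \<in> lifts n N P" "fun_bdd n f c" using ex by blast
  have lf: "liftable n (\<lambda>i j. (\<lambda>k. if k < N then fst (P i j) k else 0, \<lambda>k. if k < N then snd (P i j) k else 0)) c"
    unfolding liftable_def
  proof (intro exI[of _ "\<lambda>i j z k. if k < N then f i j z k else 0"] conjI allI impI fun_bdd_trunc f(2))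
    fix i j assume "i < n" "j < n"
    then have fs: "f i j \<in> strip_fun" and fj: "\<And>k. k < N \<Longrightarrow> fst (jet (f i j)) k = fst (P i j) k" "\<And>k. k < N \<Longrightarrow> snd (jet (f i j)) k = snd (P i j) k"
      using f(1) unfolding lifts_def by blast+
    show "(\<lambda>z k. if k < N then f i j z k else 0) \<in> strip_fun" by (rule strip_fun_trunc[OF fs])
    show "jet (\<lambda>z k. if k < N then f i j z k else 0) = (\<lambda>k. if k < N then fst (P i j) k else 0, \<lambda>k. if k < N then snd (P i j) k else 0)"
      unfolding jet_trunc[OF fs] by (auto simp: fj fun_eq_iff)
  qed
  have "liftable n (\<lambda>i j. jadd (\<lambda>k. if k < N then fst (P i j) k else 0, \<lambda>k. if k < N then snd (P i j) k else 0) (T N i j)) (c + real n * M)"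
    using lf lT c M(1) by (intro liftable_add) auto
  moreover have "jadd (\<lambda>k. if k < N then fst (P i j) k else 0, \<lambda>k. if k < N then snd (P i j) k else 0) (T N i j) = P i j" for i j
    by (auto simp: jadd_def T_def fun_eq_iff prod_eq_iff)
  ultimately have "liftable n P (c + real n * M)" by simp
  then show ?thesis by (rule liftable_mono) (use M c in auto)
qed

text \<open>Only finitely many coordinates enter, so the set is open in the product topology and a
  dense set meets it as soon as it is nonempty.\<close>

lemma open_jet_nbhd:
  fixes P :: "nat \<Rightarrow> nat \<Rightarrow> (nat \<Rightarrow> complex) \<times> (nat \<Rightarrow> complex)"
  shows "open {P'. (\<Sum>i<n. \<Sum>j<n. \<Sum>k<N. cmod (fst (P i j) k - fst (P' i j) k) + cmod (snd (P i j) k - snd (P' i j) k)) < \<eta>}"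
proof -
  have c: "continuous_on UNIV (\<lambda>P' :: nat \<Rightarrow> nat \<Rightarrow> (nat \<Rightarrow> complex) \<times> (nat \<Rightarrow> complex). P' i j)" for i j
    by (rule continuous_on_product_then_coordinatewise[OF continuous_on_product_then_coordinatewise[OF continuous_on_id]])
  have "continuous_on UNIV (\<lambda>P' :: nat \<Rightarrow> nat \<Rightarrow> (nat \<Rightarrow> complex) \<times> (nat \<Rightarrow> complex). fst (P' i j) k)"
    "continuous_on UNIV (\<lambda>P' :: nat \<Rightarrow> nat \<Rightarrow> (nat \<Rightarrow> complex) \<times> (nat \<Rightarrow> complex). snd (P' i j) k)" for i j k
    by (intro continuous_on_product_then_coordinatewise[OF continuous_on_fst[OF c]])
       (intro continuous_on_product_then_coordinatewise[OF continuous_on_snd[OF c]])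
  then show ?thesis by (intro open_Collect_less continuous_intros)
qed

context block_family
begin

text \<open>A block built for a nearby matrix still works: the difference lifts with norm at most
  1/20, so its rows contribute at most 34 * (1/20)^2 * 2 = 17/100. With x for the sum to be bounded,
  1 \<le> 2 * x + 2 * 17/100 gives x \<ge> 1/4.\<close>

lemma block_detects:
  assumes P: "\<And>i j. i < n \<Longrightarrow> j < n \<Longrightarrow> P i j \<in> E2"
    and b: "ns b = n" "1 \<le> (\<Sum>i<n. Q b (block_row n P' i))"
    and M: "0 \<le> M" "20 * (real n * M) \<le> 1"
    and close: "\<And>i j. i < n \<Longrightarrow> j < n \<Longrightarrow>
       (\<Sum>k<Ns b. cmod (fst (P i j) k - fst (P' i j) k)) + 3 * (\<Sum>k<Ns b. cmod (snd (P i j) k - snd (P' i j) k)) \<le> M"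
  shows "1 / 4 \<le> (\<Sum>i<n. Q b (block_row n P i))"
proof -
  define N where "N = Ns b"
  define D where "D i j = (\<lambda>k. if k < N then fst (P i j) k - fst (P' i j) k else 0, \<lambda>k. if k < N then snd (P i j) k - snd (P' i j) k else 0)" for i j
  have "liftable n D (real n * M)"
  proof (rule liftable_entries[OF _ M(1)])
    fix i j assume ij: "i < n" "j < n"
    have "l2 (fst (D i j)) + 3 * l2 (snd (D i j)) \<le> M"
      using close[OF ij] l2_finite_le_sum[of N "\<lambda>k. fst (P i j) k - fst (P' i j) k"] l2_finite_le_sum[of N "\<lambda>k. snd (P i j) k - snd (P' i j) k"]
      unfolding D_def N_def fst_conv snd_conv by linarith
    then show "D i j \<in> E2 \<and> l2 (fst (D i j)) + 3 * l2 (snd (D i j)) \<le> M" by (simp add: D_def)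
  qed
  then have "(\<Sum>i<n. Q b (block_row n D i)) \<le> 34 * (real n * M)\<^sup>2 * (\<Sum>j<n. Q b (block_unit j))"
    unfolding block_row_def using M by (intro Q_module) auto
  also have "\<dots> \<le> 34 * (real n * M)\<^sup>2 * 2"
    using Q_unit[of b] b(1) by (intro mult_left_mono) auto
  also have "\<dots> \<le> 34 * (1 / 20)\<^sup>2 * 2"
    using M by (intro mult_right_mono mult_left_mono power_mono) auto
  finally have D: "(\<Sum>i<n. Q b (block_row n D i)) \<le> 17 / 100" by (simp add: power2_eq_square)
  have "Q b (block_row n P' i) \<le> 2 * Q b (block_row n P i) + 2 * Q b (block_row n D i)" for i
  proof -
    have "Q b (block_row n P' i) = Q b (\<lambda>e. block_row n P i e - block_row n D i e)"
    proof (rule Q_cong)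
      fix e assume "e \<in> E b"
      then obtain l r where e: "e = (l, r)" "l < n" "r \<le> 2 * N" by (auto simp: block_index_def b(1) N_def)
      show "block_row n P' i e = block_row n P i e - block_row n D i e"
        by (cases r rule: nat_012_cases) (use e in \<open>simp_all add: block_row_simps D_def\<close>)
    qed
    then show ?thesis using Q_add(2) by simp
  qed
  then have "(\<Sum>i<n. Q b (block_row n P' i)) \<le> (\<Sum>i<n. 2 * Q b (block_row n P i) + 2 * Q b (block_row n D i))" by (intro sum_mono)
  also have "\<dots> = 2 * (\<Sum>i<n. Q b (block_row n P i)) + 2 * (\<Sum>i<n. Q b (block_row n D i))" by (simp add: sum.distrib sum_distrib_left)
  finally show ?thesis using D b(2) by linarith
qed

text \<open>The unit vectors of the block, placed in the Hilbert sum and divided by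
  \<open>sqrt 2\<close> to absorb the bound 2 of \<open>Q_unit\<close>, are the test vectors; the
  division turns 1/4 into 1/8.\<close>

lemma block_vectors:
  assumes b: "ns b = n"
    and g: "1 / 4 \<le> (\<Sum>i<n. Q b (block_row n P i))" and P: "\<And>i j. i < n \<Longrightarrow> j < n \<Longrightarrow> P i j \<in> E2"
  shows "\<exists>v. (\<forall>j<n. v j \<in> HV) \<and> (\<Sum>j<n. QH (v j)) \<le> 1 \<and> 1 / 8 \<le> (\<Sum>i<n. QH (\<lambda>x. \<Sum>j<n. act (P i j) (v j) x))"
proof -
  define r where "r = complex_of_real (1 / sqrt 2)"
  have r2: "(cmod r)\<^sup>2 = 1 / 2" by (simp add: r_def norm_divide power_divide)
  \<comment> \<open>Cutting to the index set puts the vector into \<open>HV\<close> without changing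
    the value of the form.\<close>
  define w where "w j e = (if e \<in> E b then r * block_unit j e else 0)" for j e
  define v where "v j = unblk (\<lambda>b'. if b' = b then w j else (\<lambda>e. 0))" for j
  have bv: "blk (v j) b' = (if b' = b then w j else (\<lambda>e. 0))" for j b' by (simp add: v_def)
  have Qw: "Q b (w j) = 1 / 2 * Q b (block_unit j)" for j
  proof -
    have "Q b (w j) = Q b (\<lambda>e. r * block_unit j e)" by (rule Q_cong) (simp add: w_def)
    then show ?thesis by (simp add: Q_hom r2)
  qed
  have Qv: "Q b' (blk (v j) b') = (if b' = b then Q b (w j) else 0)" for j b' by (simp add: bv)
  have sums: "(\<lambda>b'. Q b' (blk (v j) b')) sums Q b (w j)" for j
    unfolding Qv using sums_single[of b "\<lambda>_. Q b (w j)"] by simp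
  have vH: "v j \<in> HV" for j using sums[of j] by (auto simp: HV_def bv w_def sums_iff)
  have "QH (v j) = 1 / 2 * Q b (block_unit j)" for j using sums[of j] by (simp add: QH_def sums_iff Qw)
  then have "(\<Sum>j<n. QH (v j)) = 1 / 2 * (\<Sum>j<n. Q b (block_unit j))" by (simp only: sum_distrib_left)
  also have "\<dots> \<le> 1" using Q_unit[of b] b by simp
  finally have 1: "(\<Sum>j<n. QH (v j)) \<le> 1" .
  obtain c where c: "0 \<le> c" "liftable n P c" using liftable_ex[of n P] P by blast
  have "1 / 2 * Q b (block_row n P i) \<le> QH (\<lambda>x. \<Sum>j<n. act (P i j) (v j) x)" if i: "i < n" for i
  proof -
    have "Q b (blk (\<lambda>x. \<Sum>j<n. act (P i j) (v j) x) b) \<le> QH (\<lambda>x. \<Sum>j<n. act (P i j) (v j) x)"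
      by (rule QH_ge[OF act_sum_bound(1)[OF c(2,1) vH i]])
    moreover have "Q b (blk (\<lambda>x. \<Sum>j<n. act (P i j) (v j) x) b) = Q b (\<lambda>e. r * block_row n P i e)"
    proof (rule Q_cong)
      fix e assume e: "e \<in> E b"
      obtain l s where lr: "e = (l, s)" by (cases e)
      \<comment> \<open>A derivative slot also reads the value slot below it, which lies in the
        index set again, so the cut is not felt.\<close>
      have "jact (P i j) (w j) e = jact (P i j) (\<lambda>e. r * block_unit j e) e" for j
      proof (cases s rule: nat_012_cases)
        fix k assume s: "s = Suc (Suc (2 * k))"
        then have "(l, Suc (2 * k)) \<in> E b" using e lr by (auto simp: block_index_def)
        then show ?thesis using e lr s by (simp add: w_def)
      qed (use e lr in \<open>simp_all add: w_def\<close>)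
      then show "blk (\<lambda>x. \<Sum>j<n. act (P i j) (v j) x) b e = r * block_row n P i e"
        by (simp add: blk_linear act_def bv block_row_def jact_linear sum_distrib_left)
    qed
    ultimately show ?thesis by (simp add: Q_hom r2)
  qed
  then have "(\<Sum>i<n. 1 / 2 * Q b (block_row n P i)) \<le> (\<Sum>i<n. QH (\<lambda>x. \<Sum>j<n. act (P i j) (v j) x))" by (intro sum_mono) auto
  then have "1 / 8 \<le> (\<Sum>i<n. QH (\<lambda>x. \<Sum>j<n. act (P i j) (v j) x))" using g unfolding sum_distrib_left[symmetric] by simp
  then show ?thesis using 1 vH by blast
qed

end

section \<open>The representation\<close>

text \<open>If every truncation had a lift of norm at most 2, so would the whole matrix up to an
  arbitrarily small slack. A norm above 2 is therefore visible at finitely many coordinates, where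
  the matrix can be replaced by a member of a countable dense set.\<close>

lemma separating_block_family:
  obtains ns Ns Q where "block_family ns Ns Q"
    and "\<And>n P. (\<And>i j. i < n \<Longrightarrow> j < n \<Longrightarrow> P i j \<in> E2) \<Longrightarrow> 2 < jnorm n P \<Longrightarrow>
        \<exists>b. ns b = n \<and> 1 / 4 \<le> (\<Sum>i<n. Q b (block_row n P i))"
proof -
  obtain D :: "(nat \<Rightarrow> nat \<Rightarrow> (nat \<Rightarrow> complex) \<times> (nat \<Rightarrow> complex)) set"
    where D: "countable D" "\<And>X. open X \<Longrightarrow> X \<noteq> {} \<Longrightarrow> \<exists>d\<in>D. d \<in> X"
    using countable_dense_exists by blast
  define T where "T = (UNIV :: nat set) \<times> (UNIV :: nat set) \<times> D"
  have T: "countable T" unfolding T_def using D(1) by auto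
  define ns where "ns b = fst (from_nat_into T b)" for b
  define Ns where "Ns b = fst (snd (from_nat_into T b))" for b
  define Ps where "Ps b = snd (snd (from_nat_into T b))" for b
  define good where "good b Q \<longleftrightarrow> block_form (ns b) (Ns b) Q \<and>
     ((\<forall>f\<in>lifts (ns b) (Ns b) (Ps b). \<not> fun_bdd (ns b) f 1) \<longrightarrow> 1 \<le> (\<Sum>i<ns b. Q (block_row (ns b) (Ps b) i)))" for b Q
  have "\<exists>Q. good b Q" for b unfolding good_def by (rule block_form_exists)
  then obtain Q where Q: "\<And>b. good b (Q b)" by metis
  have fam: "block_family ns Ns Q" by unfold_locales (use Q in \<open>auto simp: good_def\<close>)
  interpret block_family ns Ns Q by (rule fam)
  have "\<exists>b. ns b = n \<and> 1 / 4 \<le> (\<Sum>i<n. Q b (block_row n P i))"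
    if P: "\<And>i j. i < n \<Longrightarrow> j < n \<Longrightarrow> P i j \<in> E2" and big: "2 < jnorm n P" for n P
  proof -
    have "\<exists>N. \<forall>f\<in>lifts n N P. \<not> fun_bdd n f 2"
    proof (rule ccontr)
      assume "\<not> (\<exists>N. \<forall>f\<in>lifts n N P. \<not> fun_bdd n f 2)"
      then have "\<And>N. \<exists>f\<in>lifts n N P. fun_bdd n f 2" by blast
      from liftable_of_truncations[OF P _ this] have "jnorm n P \<le> 2" by (intro jnorm_leI) auto
      then show False using big by simp
    qed
    then obtain N where N: "\<And>f. f \<in> lifts n N P \<Longrightarrow> \<not> fun_bdd n f 2" by blast
    \<comment> \<open>The perturbation \<open>n * M\<close> stays below 1/20, as
      \<open>block_detects\<close> demands, and in particular below the gap between the thresholds 2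
      and 1.\<close>
    define M where "M = 1 / (20 * (real n + 1))"
    have M: "0 < M" "20 * (real n * M) \<le> 1" by (auto simp: M_def field_simps)
    define dst where "dst P' = (\<Sum>i<n. \<Sum>j<n. \<Sum>k<N. cmod (fst (P i j) k - fst (P' i j) k) + cmod (snd (P i j) k - snd (P' i j) k))" for P'
    \<comment> \<open>Division by 3 compensates for the weight 3 of the derivative part in the bound
      for \<open>jet_lift\<close>.\<close>
    have "open {P'. dst P' < M / 3}" unfolding dst_def by (rule open_jet_nbhd)
    moreover have "P \<in> {P'. dst P' < M / 3}" using M by (simp add: dst_def)
    ultimately obtain P' where P': "P' \<in> D" "dst P' < M / 3" using D(2)[of "{P'. dst P' < M / 3}"] by blast
    have close: "(\<Sum>k<N. cmod (fst (P i j) k - fst (P' i j) k)) + 3 * (\<Sum>k<N. cmod (snd (P i j) k - snd (P' i j) k)) \<le> M"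
      if ij: "i < n" "j < n" for i j
    proof -
      define A where "A i j = (\<Sum>k<N. cmod (fst (P i j) k - fst (P' i j) k) + cmod (snd (P i j) k - snd (P' i j) k))" for i j
      have A: "0 \<le> A i j" for i j by (simp add: A_def sum_nonneg)
      have "A i j \<le> (\<Sum>j<n. A i j)" using A ij by (intro member_le_sum) auto
      also have "\<dots> \<le> (\<Sum>i<n. \<Sum>j<n. A i j)" using A ij by (intro member_le_sum[of _ _ "\<lambda>i. \<Sum>j<n. A i j"]) (auto intro: sum_nonneg)
      also have "\<dots> = dst P'" by (simp add: A_def dst_def)
      finally have "3 * A i j \<le> M" using P'(2) by simp
      moreover have "A i j = (\<Sum>k<N. cmod (fst (P i j) k - fst (P' i j) k)) + (\<Sum>k<N. cmod (snd (P i j) k - snd (P' i j) k))"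
        by (simp add: A_def sum.distrib)
      moreover have "0 \<le> (\<Sum>k<N. cmod (fst (P i j) k - fst (P' i j) k))" by (simp add: sum_nonneg)
      ultimately show ?thesis by linarith
    qed
    \<comment> \<open>Adding the explicit lift of the difference would turn a lift of
      \<open>P'\<close> with bound 1 into a lift of \<open>P\<close> with bound at most 2.\<close>
    have nb: "\<not> fun_bdd n f 1" if f: "f \<in> lifts n N P'" for f
    proof
      assume fb: "fun_bdd n f 1"
      define d where "d i j = jet_lift (\<lambda>k. if k < N then fst (P i j) k - fst (P' i j) k else 0) (\<lambda>k. if k < N then snd (P i j) k - snd (P' i j) k else 0)" for i j
      have ds: "d i j \<in> strip_fun" for i j unfolding d_def by (intro jet_lift_strip_fun) auto
      define h where "h i j = (\<lambda>z k. f i j z k + d i j z k)" for i j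
      have fs: "f i j \<in> strip_fun" if "i < n" "j < n" for i j using f that unfolding lifts_def by blast
      have "h \<in> lifts n N P"
        using f unfolding lifts_def h_def by (auto simp: strip_fun_add ds fs jet_add) (simp_all add: d_def jet_jet_lift)
      moreover have "fun_bdd n d (real n * M)"
      proof (rule fun_bdd_entries)
        fix i j z assume ij: "i < n" "j < n" and z: "z \<in> strip"
        have "l2 (d i j z) \<le> M"
          unfolding d_def
          using jet_lift_bound[OF ell2_finite ell2_finite z, of N "\<lambda>k. fst (P i j) k - fst (P' i j) k" N "\<lambda>k. snd (P i j) k - snd (P' i j) k"]
            close[OF ij] l2_finite_le_sum[of N "\<lambda>k. fst (P i j) k - fst (P' i j) k"] l2_finite_le_sum[of N "\<lambda>k. snd (P i j) k - snd (P' i j) k"] by linarith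
        then show "d i j z \<in> ell2 \<and> l2 (d i j z) \<le> M" using strip_fun_ell2[OF ds z] by simp
      qed (use M in simp)
      then have "fun_bdd n h (1 + real n * M)"
        using fb M unfolding fun_bdd_def h_def by (auto intro!: col_bdd_add)
      then have "fun_bdd n h 2" by (rule fun_bdd_mono) (use M in auto)
      ultimately show False using N by blast
    qed
    have "(n, N, P') \<in> T" using P'(1) by (simp add: T_def)
    then obtain b where b: "from_nat_into T b = (n, N, P')" using from_nat_into_surj[OF T] by blast
    then have nsb: "ns b = n" "Ns b = N" "Ps b = P'" by (simp_all add: ns_def Ns_def Ps_def)
    have "1 \<le> (\<Sum>i<n. Q b (block_row n P' i))" using Q[of b] nb unfolding good_def nsb by blast
    then have "1 / 4 \<le> (\<Sum>i<n. Q b (block_row n P i))"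
      using M close by (intro block_detects[OF P nsb(1)]) (auto simp: nsb)
    then show ?thesis using nsb(1) by blast
  qed
  then show ?thesis using that[OF fam] by blast
qed

context block_family
begin

definition rep :: "(complex \<Rightarrow> nat \<Rightarrow> complex) set \<Rightarrow> (nat \<Rightarrow> complex) \<Rightarrow> nat \<Rightarrow> complex" where
  "rep A = restrict (act (jof A)) HV"

lemma BH_simps:
  "vadd (BH H.space) S T = (\<lambda>h\<in>HV. \<lambda>x. S h x + T h x)" "vscale (BH H.space) c T = (\<lambda>h\<in>HV. \<lambda>x. c * T h x)"
  "vmult (BH H.space) S T = compose HV S T"
  by (simp_all add: BH_def)

lemma BH_carrier:
  "T \<in> vcarrier (BH H.space) \<longleftrightarrow> T \<in> HV \<rightarrow>\<^sub>E HV \<and> clinear_map H.space H.space T \<and>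
     (\<exists>K. \<forall>h\<in>HV. hnorm H.space (T h) \<le> K * hnorm H.space h)"
  by (simp add: BH_def)

lemma rep_carrier:
  assumes "A \<in> vcarrier dOH" shows "rep A \<in> vcarrier (BH H.space)"
proof -
  have a: "jof A \<in> E2" by (rule jof_carrier[OF assms])
  obtain K where K: "\<And>h. h \<in> HV \<Longrightarrow> QH (act (jof A) h) \<le> K\<^sup>2 * QH h" using act_bounded(2)[OF a] by blast
  have "hnorm H.space (rep A h) \<le> \<bar>K\<bar> * hnorm H.space h" if h: "h \<in> HV" for h
    using real_sqrt_le_mono[OF K[OF h]] h act_bounded(1)[OF a h]
    by (simp add: rep_def H.hnorm_space real_sqrt_mult)
  moreover have "rep A \<in> HV \<rightarrow>\<^sub>E HV" using act_bounded(1)[OF a] by (auto simp: rep_def)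
  moreover have "clinear_map H.space H.space (rep A)"
    unfolding clinear_map_def using act_bounded(1)[OF a] by (simp add: rep_def act_linear H.add_mem H.scale_mem)
  ultimately show ?thesis unfolding BH_carrier by blast
qed

lemma rep_linear: "clinear_map dOH (BH H.space) rep"
  unfolding clinear_map_def
proof (intro conjI ballI allI)
  fix A assume A: "A \<in> vcarrier dOH"
  show "rep A \<in> vcarrier (BH H.space)" by (rule rep_carrier[OF A])
  obtain a where a: "a \<in> E2" "A = jcls a" using A by (auto simp: dOH_carrier)
  show "rep (vscale dOH c A) = vscale (BH H.space) c (rep A)" for c
    using a(1) by (auto simp: a(2) dOH_scale rep_def BH_simps act_linear fun_eq_iff simp del: mem_Sigma_iff)
  fix B assume "B \<in> vcarrier dOH"
  then obtain b where b: "b \<in> E2" "B = jcls b" by (auto simp: dOH_carrier)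
  show "rep (vadd dOH A B) = vadd (BH H.space) (rep A) (rep B)"
    using a(1) b(1) by (auto simp: a(2) b(2) dOH_add rep_def BH_simps act_linear fun_eq_iff simp del: mem_Sigma_iff)
qed

lemma rep_mult:
  assumes "A \<in> vcarrier dOH" "B \<in> vcarrier dOH"
  shows "rep (vmult dOH A B) = vmult (BH H.space) (rep A) (rep B)"
proof -
  obtain a where a: "a \<in> E2" "A = jcls a" using assms by (auto simp: dOH_carrier)
  obtain b where b: "b \<in> E2" "B = jcls b" using assms by (auto simp: dOH_carrier)
  show ?thesis
    using a(1) b(1) act_bounded(1)[OF b(1)]
    by (auto simp: a(2) b(2) dOH_mult rep_def BH_simps act_linear compose_def fun_eq_iff simp del: mem_Sigma_iff)
qed

definition ampl :: "nat \<Rightarrow> (nat \<Rightarrow> nat \<Rightarrow> (nat \<Rightarrow> complex) \<times> (nat \<Rightarrow> complex)) \<Rightarrow> (nat \<Rightarrow> nat \<Rightarrow> complex) \<Rightarrow> real" where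
  "ampl n P v = sqrt (\<Sum>i<n. QH (\<lambda>x. \<Sum>j<n. act (P i j) (v j) x))"

lemma mnorm_BH_rep:
  assumes x: "x \<in> mats dOH n"
  shows "mnorm (BH H.space) n (\<lambda>i j. rep (x i j)) =
     Sup {ampl n (\<lambda>i j. jof (x i j)) v | v. (\<forall>j<n. v j \<in> HV) \<and> (\<Sum>j<n. QH (v j)) \<le> 1}"
proof -
  note X = dOH_mats[OF x]
  obtain c where c: "0 \<le> c" "liftable n (\<lambda>i j. jof (x i j)) c" using liftable_ex[of n "\<lambda>i j. jof (x i j)"] X(1) by blast
  have norm: "L2_set (\<lambda>j. hnorm H.space (v j)) {..<n} \<le> 1 \<longleftrightarrow> (\<Sum>j<n. QH (v j)) \<le> 1" if "\<forall>j<n. v j \<in> HV" for v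
  proof -
    have "L2_set (\<lambda>j. hnorm H.space (v j)) {..<n} = sqrt (\<Sum>j<n. QH (v j))"
      unfolding L2_set_def using that by (intro arg_cong[of _ _ sqrt] sum.cong) (auto simp: H.hnorm_space H.nonneg)
    then show ?thesis by simp
  qed
  have img: "L2_set (\<lambda>i. hnorm H.space (vsum H.space (\<lambda>j. rep (x i j) (v j)) n)) {..<n} = ampl n (\<lambda>i j. jof (x i j)) v"
    if v: "\<forall>j<n. v j \<in> HV" for v
  proof -
    have s: "vsum H.space (\<lambda>j. rep (x i j) (v j)) n = (\<lambda>x'. \<Sum>j<n. act (jof (x i j)) (v j) x')" for i
      unfolding H.vsum_space using v by (intro ext sum.cong) (auto simp: rep_def)
    have m: "(\<lambda>x'. \<Sum>j<n. act (jof (x i j)) (v j) x') \<in> HV" if "i < n" for i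
      using act_sum_bound(1)[OF c(2,1) _ that] v by blast
    show ?thesis unfolding ampl_def L2_set_def s
      by (intro arg_cong[of _ _ sqrt] sum.cong refl) (simp add: H.hnorm_space m H.nonneg)
  qed
  have "{L2_set (\<lambda>i. hnorm H.space (vsum H.space (\<lambda>j. rep (x i j) (v j)) n)) {..<n} |v.
      (\<forall>j<n. v j \<in> HV) \<and> L2_set (\<lambda>j. hnorm H.space (v j)) {..<n} \<le> 1}
    = {ampl n (\<lambda>i j. jof (x i j)) v | v. (\<forall>j<n. v j \<in> HV) \<and> (\<Sum>j<n. QH (v j)) \<le> 1}"
  proof (intro Collect_cong ex_cong1)
    fix y v
    show "y = L2_set (\<lambda>i. hnorm H.space (vsum H.space (\<lambda>j. rep (x i j) (v j)) n)) {..<n} \<and>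
        (\<forall>j<n. v j \<in> HV) \<and> L2_set (\<lambda>j. hnorm H.space (v j)) {..<n} \<le> 1 \<longleftrightarrow>
      y = ampl n (\<lambda>i j. jof (x i j)) v \<and> (\<forall>j<n. v j \<in> HV) \<and> (\<Sum>j<n. QH (v j)) \<le> 1"
    proof (cases "\<forall>j<n. v j \<in> HV")
      case True
      show ?thesis unfolding norm[OF True] img[OF True] ..
    qed blast
  qed
  then show ?thesis by (simp add: BH_def)
qed

text \<open>The module bound applied to a near-optimal lift; the factor 6 arises from 34 \<le>
  6^2.\<close>

lemma ampl_le:
  assumes P: "\<And>i j. i < n \<Longrightarrow> j < n \<Longrightarrow> P i j \<in> E2" and v: "\<And>j. j < n \<Longrightarrow> v j \<in> HV" "(\<Sum>j<n. QH (v j)) \<le> 1"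
  shows "ampl n P v \<le> 6 * jnorm n P"
proof (rule field_le_epsilon)
  fix e :: real assume e: "0 < e"
  define c where "c = jnorm n P + e / 6"
  have c: "0 \<le> c" "liftable n P c" using e jnorm_nonneg[OF P] jnorm_less[OF P, where c = c] by (auto simp: c_def)
  have "(\<Sum>i<n. QH (\<lambda>x. \<Sum>j<n. act (P i j) (v j) x)) \<le> 34 * c\<^sup>2 * (\<Sum>j<n. QH (v j))"
    by (rule act_sum_bound(2)[OF c(2,1) v(1)])
  also have "\<dots> \<le> 34 * c\<^sup>2 * 1" using v(2) by (intro mult_left_mono) auto
  also have "\<dots> \<le> (6 * c)\<^sup>2" by (simp add: power_mult_distrib)
  finally have "ampl n P v \<le> 6 * c" unfolding ampl_def using c(1) by (intro real_le_lsqrt) auto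
  then show "ampl n P v \<le> 6 * jnorm n P + e" by (simp add: c_def)
qed

lemma ampl_nonneg:
  assumes P: "\<And>i j. i < n \<Longrightarrow> j < n \<Longrightarrow> P i j \<in> E2" and v: "\<And>j. j < n \<Longrightarrow> v j \<in> HV"
  shows "0 \<le> ampl n P v"
proof -
  from liftable_ex[of n P, OF P] obtain d where d: "0 \<le> d" "liftable n P d" by blast
  have "0 \<le> QH (\<lambda>x. \<Sum>j<n. act (P i j) (v j) x)" if "i < n" for i
    by (rule H.nonneg[OF act_sum_bound(1)[OF d(2,1) v that]])
  then show ?thesis unfolding ampl_def by (intro real_sqrt_ge_zero sum_nonneg) simp
qed

lemma ampl_scale:
  assumes P: "\<And>i j. i < n \<Longrightarrow> j < n \<Longrightarrow> P i j \<in> E2" and v: "\<And>j. j < n \<Longrightarrow> v j \<in> HV"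
  shows "ampl n (\<lambda>i j. jscale c (P i j)) v = cmod c * ampl n P v"
proof -
  from liftable_ex[of n P, OF P] obtain d where d: "0 \<le> d" "liftable n P d" by blast
  have "QH (\<lambda>x. \<Sum>j<n. act (jscale c (P i j)) (v j) x) = (cmod c)\<^sup>2 * QH (\<lambda>x. \<Sum>j<n. act (P i j) (v j) x)" if i: "i < n" for i
    using H.hom[OF act_sum_bound(1)[OF d(2,1) v i], where c = c]
    by (simp add: act_linear sum_distrib_left)
  then show ?thesis by (simp add: ampl_def sum_distrib_left[symmetric] real_sqrt_mult)
qed

end

theorem mainTheorem7:
  shows "operator_algebra TYPE(nat \<Rightarrow> complex) dOH"
proof -
  obtain ns Ns Q where bf: "block_family ns Ns Q"
    and sep: "\<And>n P. (\<And>i j. i < n \<Longrightarrow> j < n \<Longrightarrow> P i j \<in> E2) \<Longrightarrow> 2 < jnorm n P \<Longrightarrow>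
        \<exists>b. ns b = n \<and> 1 / 4 \<le> (\<Sum>i<n. Q b (block_row n P i))"
    using separating_block_family by blast
  interpret block_family ns Ns Q by (rule bf)
  have bounds: "1 / 9 * mnorm dOH n x \<le> mnorm (BH H.space) n (\<lambda>i j. rep (x i j)) \<and>
      mnorm (BH H.space) n (\<lambda>i j. rep (x i j)) \<le> 6 * mnorm dOH n x" if x: "x \<in> mats dOH n" for n x
  proof -
    note X = dOH_mats[OF x]
    define P where "P i j = jof (x i j)" for i j
    have P: "\<And>i j. i < n \<Longrightarrow> j < n \<Longrightarrow> P i j \<in> E2" using X(1) by (simp add: P_def)
    define J where "J = jnorm n P"
    have J: "0 \<le> J" unfolding J_def by (rule jnorm_nonneg[OF P])
    have nx: "mnorm dOH n x = J" using X(3) by (simp add: J_def P_def[abs_def])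
    define S where "S = {ampl n P v | v. (\<forall>j<n. v j \<in> HV) \<and> (\<Sum>j<n. QH (v j)) \<le> 1}"
    have nr: "mnorm (BH H.space) n (\<lambda>i j. rep (x i j)) = Sup S"
      unfolding mnorm_BH_rep[OF x] S_def P_def ..
    have le: "a \<le> 6 * J" if "a \<in> S" for a using that ampl_le[of n P, OF P] unfolding S_def J_def by blast
    have Q0: "QH (\<lambda>x. 0) = 0" using H.hom[OF H.zero_mem, of 0] by simp
    have z: "ampl n P (\<lambda>j x. 0) \<in> S" unfolding S_def using H.zero_mem Q0 by (intro CollectI exI[of _ "\<lambda>j x. 0"]) simp
    have up: "Sup S \<le> 6 * J" using z le by (intro cSup_least) auto
    have bdd: "bdd_above S" using le by (intro bdd_aboveI)
    have "1 / 9 * J \<le> Sup S"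
    \<comment> \<open>The matrix is rescaled by \<open>3 / J\<close>, so norm 0 is treated
      apart.\<close>
    proof (cases "J = 0")
      case True
      have "0 \<le> ampl n P (\<lambda>j x. 0)" by (rule ampl_nonneg[OF P H.zero_mem])
      then show ?thesis using True cSup_upper[OF z bdd] by simp
    next
      case False
      then have J0: "0 < J" using J by simp
      \<comment> \<open>The rescaled matrix has norm 3, above the threshold 2 at which blocks
        detect.\<close>
      define c where "c = complex_of_real (3 / J)"
      have cm: "cmod c = 3 / J" using J0 by (simp add: c_def norm_divide)
      have cP: "\<And>i j. i < n \<Longrightarrow> j < n \<Longrightarrow> jscale c (P i j) \<in> E2" using P by (simp only: E2_closed)
      have "jnorm n (\<lambda>i j. jscale c (P i j)) = 3" using J0 by (simp add: jnorm_scale[OF P] cm J_def[symmetric])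
      then obtain b where b: "ns b = n" "1 / 4 \<le> (\<Sum>i<n. Q b (block_row n (\<lambda>i j. jscale c (P i j)) i))"
        using sep[of n "\<lambda>i j. jscale c (P i j)", OF cP] by auto
      obtain v where v: "\<forall>j<n. v j \<in> HV" "(\<Sum>j<n. QH (v j)) \<le> 1"
        "1 / 8 \<le> (\<Sum>i<n. QH (\<lambda>x. \<Sum>j<n. act (jscale c (P i j)) (v j) x))"
        using block_vectors[of b n "\<lambda>i j. jscale c (P i j)", OF b cP] by blast
      \<comment> \<open>Detection gives 1/8, which is weakened to 1/9 for the sake of a rational
        root; undoing the scaling by \<open>3 / J\<close> leaves \<open>J / 9\<close>.\<close>
      have "1 / 3 = sqrt ((1 / 3)\<^sup>2)" by simp
      also have "\<dots> \<le> ampl n (\<lambda>i j. jscale c (P i j)) v"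
        unfolding ampl_def using v(3) by (intro real_sqrt_le_mono) (simp add: power2_eq_square)
      also have "\<dots> = 3 / J * ampl n P v" using v(1) by (simp add: ampl_scale[OF P] cm)
      finally have "1 / 9 * J \<le> ampl n P v" using J0 by (simp add: field_simps)
      also have "\<dots> \<le> Sup S" using v by (intro cSup_upper[OF _ bdd]) (auto simp: S_def)
      finally show ?thesis .
    qed
    then show ?thesis using up unfolding nx nr by simp
  qed
  have "complete_embedding dOH (BH H.space) rep"
    unfolding complete_embedding_def using bounds rep_linear
    by (intro conjI exI[of _ "1 / 9"] exI[of _ 6]) auto
  then have "\<exists>(H :: (nat \<Rightarrow> complex) hilbert) \<pi>. hilbert_space H \<and> complete_embedding dOH (BH H) \<pi> \<and>
        (\<forall>x\<in>vcarrier dOH. \<forall>y\<in>vcarrier dOH. \<pi> (vmult dOH x y) = vmult (BH H) (\<pi> x) (\<pi> y))"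
    using hilbert rep_mult by (intro exI[of _ H.space] exI[of _ rep]) auto
  then show ?thesis unfolding operator_algebra_def using dOH_operator_space dOH_banach_algebra by blast
qed

end
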